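(* Let $e\ge 2$, $i\ge 1$, and let $\mathbb{V}^{(e+1)}_i$ be a metabelian vertex of nilpotency class $i+2$ of the BCF coclass tree $\mathcal{T}^{e+1}(\mathbb{M}^{(e+1)}_1)$ which is either the mainline vertex $\mathbb{M}^{(e+1)}_i$ or (for $i\ge2$) an offside immediate descendant (depth $1$) of $\mathbb{M}^{(e+1)}_{i-1}$. Then: (1) if $e\ge 3$ and $1\le i\le e-2$ (i.e. $\mathrm{cl}(\mathbb{V}^{(e+1)}_i)<e+1$), then $\mathbb{V}^{(e+1)}_i=V^{(e)}_i-\#1;k$ for some positive integer $k$, where $V^{(e)}_i$ is a vertex of class $i+2$ and depth at most $1$ of the CF coclass tree $\mathcal{T}^e(M^{(e)}_1)$, and the types $\mathrm{d}.10$, $\mathrm{B}.2$, $\mathrm{D}.10$, $\mathrm{C}.4$, $\mathrm{D}.5$ of $\mathbb{V}^{(e+1)}_i$ correspond respectively to the types $\mathrm{a}.1$, $\mathrm{a}.1$, $\mathrm{b}.16$, $\mathrm{a}.1$, $\mathrm{a}.1$ of $V^{(e)}_i$; (2) if $e\ge 3$ and $i=e-1$ (i.e. $\mathrm{cl}(\mathbb{V}^{(e+1)}_i)=e+1$), then $\mathbb{V}^{(e+1)}_i=M^{(e)}_{i-1}-\#2;\ell$ for some positive integer $\ell$; (3) if $i\ge e$ (i.e. $\mathrm{cl}(\mathbb{V}^{(e+1)}_i)>e+1$), then $\mathbb{V}^{(e+1)}_i=\mathbb{M}^{(e+1)}_{i-1}-\#1;m$ for some positive integer $m$.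
   Context: All groups are finite $3$-groups. For $G$ with $G/G'\simeq C_{3^e}\times C_3$ ($e\ge 2$), $G=\langle x,y\rangle$ with $w=x^{3^{e-1}}$, $w^3,y^3\in G'$; maximal subgroups $H_1,H_2,H_3$ (cyclic $H_i/G'$), $H_4$ ($H_4/G'\simeq C_{3^{e-1}}\times C_3$). Rank distribution $\varrho(G)=(r_1,r_2,r_3;r_4)$, $r_i$ the $3$-rank of $H_i/H_i'$. Transfer kernel type $\varkappa(G)=(\varkappa_1,\varkappa_2,\varkappa_3;\varkappa_4)$, $\varkappa_i=0,\ j,\ 4$ according as the kernel of the Artin transfer $G/G'\to H_i/H_i'$ equals $\langle w,y\rangle G'/G'$, $\langle w^{j-1}y\rangle G'/G'$ ($1\le j\le 3$), $\langle w\rangle G'/G'$; $\sim$ means up to permuting the first three components. Types: $\mathrm{a}.1$: $(0,0,0;0)$; $\mathrm{b}.16$: $\sim(0,0,4;0)$; $\mathrm{d}.10$: $\sim(1,1,0;2)$; $\mathrm{B}.2$: $\sim(1,1,1;2)$; $\mathrm{C}.4$: $\sim(1,1,2;2)$; $\mathrm{D}.5$: $\sim(1,1,3;2)$; $\mathrm{D}.10$: $\sim(1,1,4;2)$. Lower central series $\gamma_i$, class $\mathrm{cl}$, coclass $\mathrm{cc}=\log_3|G|-\mathrm{cl}$; CF-group: all nontrivial $\gamma_i/\gamma_{i+1}$ ($i\ge2$) cyclic; BCF-group: all cyclic or bicyclic. Parent $\pi(D)=D/\gamma_{\mathrm{cl}(D)}(D)$; coclass trees are pruned descendant trees w.r.t.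 $\pi$ with a unique infinite mainline and all vertices of one coclass; depth = distance from the mainline. For $e\ge 2$: $\mathcal{T}^e(M^{(e)}_1)$ is the unique coclass tree of CF-groups $V$ with $\mathrm{cc}(V)=e$, $V/V'\simeq C_{3^e}\times C_3$, $\varrho(V)\sim(2,2,3;3)$, rooted at $M^{(e)}_1$ of class $3$, with mainline $M^{(e)}_1,M^{(e)}_2,\dots$ ($\mathrm{cl}(M^{(e)}_i)=i+2$); $\mathcal{T}^{e+1}(\mathbb{M}^{(e+1)}_1)$ is the unique coclass tree of BCF-groups $\mathbb{V}$ with $\mathrm{cc}(\mathbb{V})=e+1$, $\mathbb{V}/\mathbb{V}'\simeq C_{3^e}\times C_3$, $\varrho(\mathbb{V})\sim(2,2,3;3)$, mainline of type $\mathrm{d}.10$, rooted at $\mathbb{M}^{(e+1)}_1$ of class $3$, with mainline $\mathbb{M}^{(e+1)}_1,\mathbb{M}^{(e+1)}_2,\dots$ ($\mathrm{cl}(\mathbb{M}^{(e+1)}_i)=i+2$). Lower exponent-$p$ central series $P_0(G)=G$, $P_i(G)=P_{i-1}(G)^3[P_{i-1}(G),G]$, $p$-class $c_p$; $p$-parent $D/P_{c_p-1}(D)$, step size $s$ with $|P_{c_p-1}(D)|=3^s$. $P-\#s;j$ denotes the $j$-th immediate step size-$s$ $p$-descendant of $P$ produced by the Newman–O'Brien $p$-group generation algorithm (Magma's \texttt{Descendants(P:StepSizes:=[s])}). *)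

theory Defs
  imports "HOL-Algebra.Algebra"
begin

definition is_3group :: "('a,'b) monoid_scheme \<Rightarrow> bool" where
  "is_3group G \<longleftrightarrow> group G \<and> finite (carrier G) \<and> (\<exists>n::nat. order G = 3 ^ n)"

definition log3_order :: "('a,'b) monoid_scheme \<Rightarrow> nat" where
  "log3_order G = (THE n. order G = 3 ^ n)"

definition comm_set :: "('a,'b) monoid_scheme \<Rightarrow> 'a set \<Rightarrow> 'a set \<Rightarrow> 'a set" where
  "comm_set G A B = {a \<otimes>\<^bsub>G\<^esub> b \<otimes>\<^bsub>G\<^esub> inv\<^bsub>G\<^esub> a \<otimes>\<^bsub>G\<^esub> inv\<^bsub>G\<^esub> b | a b. a \<in> A \<and> b \<in> B}"

text \<open>Lower central series: gam G i is gamma_i(G) for i >= 1 (gam G 0 = G as well).\<close>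
fun gam :: "('a,'b) monoid_scheme \<Rightarrow> nat \<Rightarrow> 'a set" where
  "gam G 0 = carrier G"
| "gam G (Suc 0) = carrier G"
| "gam G (Suc (Suc n)) = generate G (comm_set G (gam G (Suc n)) (carrier G))"

definition nil_class :: "('a,'b) monoid_scheme \<Rightarrow> nat" where
  "nil_class G = (LEAST c. gam G (Suc c) = {\<one>\<^bsub>G\<^esub>})"

definition coclass :: "('a,'b) monoid_scheme \<Rightarrow> nat" where
  "coclass G = log3_order G - nil_class G"

definition metabelian :: "('a,'b) monoid_scheme \<Rightarrow> bool" where
  "metabelian G \<longleftrightarrow> derived G (derived G (carrier G)) = {\<one>\<^bsub>G\<^esub>}"

text \<open>A is cyclic, resp. cyclic or bicyclic, modulo B (B a normal subgroup inside A).\<close>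
definition cyc_mod :: "('a,'b) monoid_scheme \<Rightarrow> 'a set \<Rightarrow> 'a set \<Rightarrow> bool" where
  "cyc_mod G A B \<longleftrightarrow> (\<exists>a\<in>A. A = generate G (insert a B))"

definition bicyc_mod :: "('a,'b) monoid_scheme \<Rightarrow> 'a set \<Rightarrow> 'a set \<Rightarrow> bool" where
  "bicyc_mod G A B \<longleftrightarrow> (\<exists>a\<in>A. \<exists>b\<in>A. A = generate G ({a, b} \<union> B))"

definition is_CF :: "('a,'b) monoid_scheme \<Rightarrow> bool" where
  "is_CF G \<longleftrightarrow> (\<forall>i\<ge>2. cyc_mod G (gam G i) (gam G (Suc i)))"

definition is_BCF :: "('a,'b) monoid_scheme \<Rightarrow> bool" where
  "is_BCF G \<longleftrightarrow> (\<forall>i\<ge>2. bicyc_mod G (gam G i) (gam G (Suc i)))"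

definition abel_type :: "nat \<Rightarrow> ('a,'b) monoid_scheme \<Rightarrow> bool" where
  "abel_type e G \<longleftrightarrow>
     G Mod derived G (carrier G) \<cong> DirProd (integer_mod_group (3 ^ e)) (integer_mod_group 3)"

definition max_sub :: "('a,'b) monoid_scheme \<Rightarrow> 'a set \<Rightarrow> bool" where
  "max_sub G H \<longleftrightarrow> subgroup H G \<and> H \<noteq> carrier G \<and>
     (\<forall>K. subgroup K G \<and> H \<subseteq> K \<longrightarrow> K = H \<or> K = carrier G)"

definition cyc_quot :: "('a,'b) monoid_scheme \<Rightarrow> 'a set \<Rightarrow> bool" where
  "cyc_quot G H \<longleftrightarrow> cyc_mod G H (derived G (carrier G))"

definition rank3 :: "('a,'b) monoid_scheme \<Rightarrow> nat" where
  "rank3 K = (THE d. card (carrier K) =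
      3 ^ d * card (generate K ({x [^]\<^bsub>K\<^esub> (3::nat) | x. x \<in> carrier K} \<union> derived K (carrier K))))"

definition rank_dist_2233 :: "('a,'b) monoid_scheme \<Rightarrow> bool" where
  "rank_dist_2233 G \<longleftrightarrow> (\<exists>H1 H2 H3 H4. distinct [H1, H2, H3] \<and>
      (\<forall>H\<in>{H1, H2, H3}. max_sub G H \<and> cyc_quot G H) \<and> max_sub G H4 \<and> \<not> cyc_quot G H4 \<and>
      rank3 (G\<lparr>carrier := H1\<rparr>) = 2 \<and> rank3 (G\<lparr>carrier := H2\<rparr>) = 2 \<and>
      rank3 (G\<lparr>carrier := H3\<rparr>) = 3 \<and> rank3 (G\<lparr>carrier := H4\<rparr>) = 3)"

definition transversal :: "('a,'b) monoid_scheme \<Rightarrow> 'a set \<Rightarrow> 'a set \<Rightarrow> bool" where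
  "transversal G H T \<longleftrightarrow> T \<subseteq> carrier G \<and>
     (\<forall>g\<in>carrier G. \<exists>!t. t \<in> T \<and> H #>\<^bsub>G\<^esub> g = H #>\<^bsub>G\<^esub> t)"

definition coset_rep :: "('a,'b) monoid_scheme \<Rightarrow> 'a set \<Rightarrow> 'a set \<Rightarrow> 'a \<Rightarrow> 'a" where
  "coset_rep G H T u = (THE t. t \<in> T \<and> H #>\<^bsub>G\<^esub> u = H #>\<^bsub>G\<^esub> t)"

definition transfer :: "('a,'b) monoid_scheme \<Rightarrow> 'a set \<Rightarrow> 'a \<Rightarrow> 'a set" where
  "transfer G H g =
     (let T = (SOME T. transversal G H T); K = G\<lparr>carrier := H\<rparr> in
      finprod (K Mod derived K H)
        (\<lambda>t. derived K H #>\<^bsub>K\<^esub> (t \<otimes>\<^bsub>G\<^esub> g \<otimes>\<^bsub>G\<^esub> inv\<^bsub>G\<^esub> (coset_rep G H T (t \<otimes>\<^bsub>G\<^esub> g)))) T)"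

definition transfer_kernel :: "('a,'b) monoid_scheme \<Rightarrow> 'a set \<Rightarrow> 'a set" where
  "transfer_kernel G H =
     {g \<in> carrier G. transfer G H g = derived (G\<lparr>carrier := H\<rparr>) H}"

definition gens_ok :: "nat \<Rightarrow> ('a,'b) monoid_scheme \<Rightarrow> 'a \<Rightarrow> 'a \<Rightarrow> bool" where
  "gens_ok e G x y \<longleftrightarrow> x \<in> carrier G \<and> y \<in> carrier G \<and> generate G {x, y} = carrier G \<and>
     (x [^]\<^bsub>G\<^esub> ((3::nat) ^ (e - 1))) [^]\<^bsub>G\<^esub> (3::nat) \<in> derived G (carrier G) \<and>
     y [^]\<^bsub>G\<^esub> (3::nat) \<in> derived G (carrier G)"

definition kval :: "nat \<Rightarrow> ('a,'b) monoid_scheme \<Rightarrow> 'a \<Rightarrow> 'a \<Rightarrow> 'a set \<Rightarrow> nat" where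
  "kval e G x y H =
     (let D = derived G (carrier G); w = x [^]\<^bsub>G\<^esub> ((3::nat) ^ (e - 1));
          S = (\<lambda>A. generate G (A \<union> D)); K = transfer_kernel G H in
      if K = S {w, y} then 0
      else if K = S {y} then 1
      else if K = S {w \<otimes>\<^bsub>G\<^esub> y} then 2
      else if K = S {w \<otimes>\<^bsub>G\<^esub> w \<otimes>\<^bsub>G\<^esub> y} then 3
      else if K = S {w} then 4
      else 5)"

definition has_tkt :: "nat \<Rightarrow> ('a,'b) monoid_scheme \<Rightarrow> nat \<Rightarrow> nat \<Rightarrow> nat \<Rightarrow> nat \<Rightarrow> bool" where
  "has_tkt e G a b c d \<longleftrightarrow> (\<exists>x y. gens_ok e G x y \<and> (\<exists>H1 H2 H3 H4. distinct [H1, H2, H3] \<and>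
      (\<forall>H\<in>{H1, H2, H3}. max_sub G H \<and> cyc_quot G H) \<and> max_sub G H4 \<and> \<not> cyc_quot G H4 \<and>
      kval e G x y H1 = a \<and> kval e G x y H2 = b \<and> kval e G x y H3 = c \<and> kval e G x y H4 = d))"

text \<open>fam False e: vertex conditions of T^e(M^(e)_1) (CF);
      fam True e: vertex conditions of T^(e+1)(MM^(e+1)_1) (BCF).\<close>
definition fam :: "bool \<Rightarrow> nat \<Rightarrow> ('a,'b) monoid_scheme \<Rightarrow> bool" where
  "fam bcf e V \<longleftrightarrow> is_3group V \<and> abel_type e V \<and> rank_dist_2233 V \<and>
     (if bcf then is_BCF V \<and> coclass V = e + 1 else is_CF V \<and> coclass V = e)"

text \<open>Tree membership: V and all its ancestors V/gamma_k(V) of class >= 3 satisfy the conditions.\<close>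
definition in_tree :: "bool \<Rightarrow> nat \<Rightarrow> ('a,'b) monoid_scheme \<Rightarrow> bool" where
  "in_tree bcf e V \<longleftrightarrow> fam bcf e V \<and> nil_class V \<ge> 3 \<and>
     (\<forall>k. 4 \<le> k \<and> k \<le> nil_class V \<longrightarrow> fam bcf e (V Mod gam V k))"

text \<open>G has descendants in the tree of every class >= cl(G) (i.e. G lies on the infinite mainline).
  Descendants are represented by groups with carrier in nat (every finite group has such a copy).\<close>
definition has_desc_all :: "bool \<Rightarrow> nat \<Rightarrow> ('a,'b) monoid_scheme \<Rightarrow> bool" where
  "has_desc_all bcf e G \<longleftrightarrow> (\<forall>c \<ge> nil_class G. \<exists>D :: nat monoid.
      in_tree bcf e D \<and> nil_class D = c \<and> G \<cong> D Mod gam D (Suc (nil_class G)))"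

definition CF_mainline :: "nat \<Rightarrow> ('a,'b) monoid_scheme \<Rightarrow> bool" where
  "CF_mainline e G \<longleftrightarrow> in_tree False e G \<and> has_desc_all False e G"

text \<open>Mainline of the BCF tree: its mainline is of type d.10 ~ (1,1,0;2).\<close>
definition BCF_mainline :: "nat \<Rightarrow> ('a,'b) monoid_scheme \<Rightarrow> bool" where
  "BCF_mainline e G \<longleftrightarrow> in_tree True e G \<and> has_desc_all True e G \<and> has_tkt e G 1 1 0 2"

definition CF_depth_le1 :: "nat \<Rightarrow> ('a,'b) monoid_scheme \<Rightarrow> bool" where
  "CF_depth_le1 e G \<longleftrightarrow> in_tree False e G \<and>
     (CF_mainline e G \<or> CF_mainline e (G Mod gam G (nil_class G)))"

fun pser :: "('a,'b) monoid_scheme \<Rightarrow> nat \<Rightarrow> 'a set" where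
  "pser G 0 = carrier G"
| "pser G (Suc n) = generate G ({x [^]\<^bsub>G\<^esub> (3::nat) | x. x \<in> pser G n} \<union> comm_set G (pser G n) (carrier G))"

definition pclass :: "('a,'b) monoid_scheme \<Rightarrow> nat" where
  "pclass G = (LEAST c. pser G c = {\<one>\<^bsub>G\<^esub>})"

definition pparent :: "('a,'b) monoid_scheme \<Rightarrow> 'a set monoid" where
  "pparent G = G Mod pser G (pclass G - 1)"

definition step_size :: "('a,'b) monoid_scheme \<Rightarrow> nat \<Rightarrow> bool" where
  "step_size G s \<longleftrightarrow> pclass G \<ge> 1 \<and> card (pser G (pclass G - 1)) = 3 ^ s"

end

theory Submission
  imports Defs
begin

text \<open>Generators \<open>x, y\<close> of \<open>V\<close> can be chosen such that \<open>\<langle>x\<rangle>\<gamma>\<^sub>2\<close> is the maximal subgroup of rank three among those with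
  cyclic quotient. Then \<open>u = x\<^bsup>3\<^sup>e\<^esup>\<close> lies in \<open>\<gamma>\<^sub>3\<close>, is independent of \<open>\<lbrakk>y, \<lbrakk>x, y\<rbrakk>\<rbrakk>\<close> modulo \<open>\<gamma>\<^sub>4\<close>, and is central
  modulo \<open>\<gamma>\<^sub>e\<^sub>+\<^sub>3\<close>. Since \<open>P\<^sub>k(V) = \<gamma>\<^sub>k\<^sub>+\<^sub>1\<langle>x\<^bsup>3\<^sup>k\<^esup>\<rangle>\<close>, the last nontrivial term of the lower exponent-\<open>3\<close> central
  series is \<open>\<langle>u\<rangle>\<close> for \<open>c \<le> e\<close>, \<open>\<gamma>\<^sub>c\<langle>u\<rangle>\<close> for \<open>c = e + 1\<close> and \<open>\<gamma>\<^sub>c\<close> for \<open>c \<ge> e + 2\<close>, where \<open>c\<close> is the class. Factoring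
  out \<open>u\<close> makes \<open>\<gamma>\<^sub>3/\<gamma>\<^sub>4\<close> cyclic and leaves the ranks unchanged, which gives a vertex of the CF tree.
  It is a mainline vertex if \<open>V\<close> is one: in a BCF descendant of large class, \<open>u\<close> is
  first corrected by an element of \<open>\<gamma>\<^sub>e\<^sub>+\<^sub>2\<close> to become central, and then factored out.\<close>

text \<open>The obstacle is that a mainline vertex is recognised by its descendants of every class,
  and these are not assumed metabelian, even when the vertex is. The remedy is to start from a
  descendant whose class is larger by two: \<open>gam2_comm_c\<close> puts its second derived
  subgroup into the last term of the lower central series, so that its parent is metabelian, and one
  more class is spent on making the corrected \<open>u\<close> central. The rank condition enters by
  counting. The derived subgroup of the maximal subgroup generated by h over the Frattini subgroup
  lies in \<open>R h\<close>, which has order at most 3 over gamma_4. A maximal subgroup <h>gamma_2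
  has rank at least three if h^(3^e) lies in \<open>R h\<close>, and at most two otherwise. That
  high powers of x vanish as early as required does not follow from commutator estimates alone; it
  comes from a norm argument in gamma_2, viewed as a cyclic module over a commutative ring.\<close>

definition cm :: "('a,'b) monoid_scheme \<Rightarrow> 'a \<Rightarrow> 'a \<Rightarrow> 'a" where
  "cm G a b = a \<otimes>\<^bsub>G\<^esub> b \<otimes>\<^bsub>G\<^esub> inv\<^bsub>G\<^esub> a \<otimes>\<^bsub>G\<^esub> inv\<^bsub>G\<^esub> b"

section \<open>Commutators and subgroups of central type\<close>

context group
begin

abbreviation comm (\<open>\<lbrakk>_,/ _\<rbrakk>\<close>) where "comm a b \<equiv> cm G a b"

lemma inv_cancel_left: "a \<in> carrier G \<Longrightarrow> b \<in> carrier G \<Longrightarrow> a \<otimes> (inv a \<otimes> b) = b"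
  "a \<in> carrier G \<Longrightarrow> b \<in> carrier G \<Longrightarrow> inv a \<otimes> (a \<otimes> b) = b"
  by (simp_all add: m_assoc[symmetric])

lemma pow3: "a \<in> carrier G \<Longrightarrow> a [^] (3::nat) = a \<otimes> a \<otimes> a"
  by (simp add: numeral_3_eq_3)

text \<open>Together with the default rules for inverses these amount to the usual completion of the
  group axioms, so that identities of group words are settled by simplification.\<close>

lemmas word = m_assoc inv_mult_group inv_cancel_left

lemma cm_closed [simp, intro]: "a \<in> carrier G \<Longrightarrow> b \<in> carrier G \<Longrightarrow> \<lbrakk>a, b\<rbrakk> \<in> carrier G"
  by (simp add: cm_def)

lemma cm_inv: "a \<in> carrier G \<Longrightarrow> b \<in> carrier G \<Longrightarrow> inv \<lbrakk>a, b\<rbrakk> = \<lbrakk>b, a\<rbrakk>"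
  by (simp add: cm_def word)

lemma cm_self [simp]: "a \<in> carrier G \<Longrightarrow> \<lbrakk>a, a\<rbrakk> = \<one>"
  by (simp add: cm_def word)

lemma cm_one [simp]: "a \<in> carrier G \<Longrightarrow> \<lbrakk>a, \<one>\<rbrakk> = \<one>" "a \<in> carrier G \<Longrightarrow> \<lbrakk>\<one>, a\<rbrakk> = \<one>"
  by (simp_all add: cm_def word)

lemma cm_eq_one_iff: 
  assumes "a \<in> carrier G" "b \<in> carrier G" 
  shows "\<lbrakk>a, b\<rbrakk> = \<one> \<longleftrightarrow> a \<otimes> b = b \<otimes> a"
proof
  assume "\<lbrakk>a, b\<rbrakk> = \<one>"
  then have "\<lbrakk>a, b\<rbrakk> \<otimes> (b \<otimes> a) = b \<otimes> a" using assms by simp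
  then show "a \<otimes> b = b \<otimes> a" using assms by (simp add: cm_def word)
next
  assume h: "a \<otimes> b = b \<otimes> a"
  show "\<lbrakk>a, b\<rbrakk> = \<one>" unfolding cm_def h using assms by (simp add: word)
qed

lemma conj_cm: "a \<in> carrier G \<Longrightarrow> g \<in> carrier G \<Longrightarrow> g \<otimes> a \<otimes> inv g = \<lbrakk>g, a\<rbrakk> \<otimes> a"
  by (simp add: cm_def word)

lemma cm_mult_right: "a \<in> carrier G \<Longrightarrow> g \<in> carrier G \<Longrightarrow> h \<in> carrier G \<Longrightarrow>
   \<lbrakk>a, g \<otimes> h\<rbrakk> = \<lbrakk>a, g\<rbrakk> \<otimes> (g \<otimes> \<lbrakk>a, h\<rbrakk> \<otimes> inv g)"
  by (simp add: cm_def word)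

lemma cm_mult_left: "a \<in> carrier G \<Longrightarrow> b \<in> carrier G \<Longrightarrow> g \<in> carrier G \<Longrightarrow>
   \<lbrakk>a \<otimes> b, g\<rbrakk> = (a \<otimes> \<lbrakk>b, g\<rbrakk> \<otimes> inv a) \<otimes> \<lbrakk>a, g\<rbrakk>"
  by (simp add: cm_def word)

lemma cm_inv_right: "a \<in> carrier G \<Longrightarrow> g \<in> carrier G \<Longrightarrow> \<lbrakk>a, inv g\<rbrakk> = inv g \<otimes> inv \<lbrakk>a, g\<rbrakk> \<otimes> g"
  by (simp add: cm_def word)

text \<open>Most inclusions below are obtained by exhibiting generators of a group inside such a centralizer.\<close>

definition Cent where "Cent M a = {g \<in> carrier G. \<lbrakk>a, g\<rbrakk> \<in> M}"

lemma Cent_subgroup: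
  assumes M: "M \<lhd> G" and a: "a \<in> carrier G"
  shows "subgroup (Cent M a) G"
proof -
  interpret M: normal M G by (rule M)
  show ?thesis
  proof (rule subgroupI)
    show "Cent M a \<subseteq> carrier G" by (auto simp: Cent_def)
    show "Cent M a \<noteq> {}" using a by (auto simp: Cent_def intro!: exI[of _ \<one>])
    show "inv g \<in> Cent M a" if "g \<in> Cent M a" for g
      using that a by (auto simp: Cent_def cm_inv_right intro!: M.inv_op_closed1)
    show "g \<otimes> h \<in> Cent M a" if "g \<in> Cent M a" "h \<in> Cent M a" for g h
      using that a by (auto simp: Cent_def cm_mult_right intro!: M.m_closed M.inv_op_closed2)
  qed
qed

lemma Cent_iff: "g \<in> Cent M a \<longleftrightarrow> g \<in> carrier G \<and> \<lbrakk>a, g\<rbrakk> \<in> M"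
  by (simp add: Cent_def)

lemma cm_swap:
  assumes "subgroup M G" "\<lbrakk>a, g\<rbrakk> \<in> M" "a \<in> carrier G" "g \<in> carrier G"
  shows "\<lbrakk>g, a\<rbrakk> \<in> M"
  using subgroup.m_inv_closed[OF assms(1,2)] assms by (simp add: cm_inv)

lemma Cent_swap: "subgroup M G \<Longrightarrow> a \<in> carrier G \<Longrightarrow> g \<in> Cent M a \<Longrightarrow> a \<in> Cent M g"
  by (auto simp: Cent_iff intro: cm_swap)

lemma Cent_self: "subgroup M G \<Longrightarrow> a \<in> carrier G \<Longrightarrow> a \<in> Cent M a"
  by (auto simp: Cent_iff subgroup.one_closed)

lemma Cent_cm_right: "M \<lhd> G \<Longrightarrow> b \<in> M \<Longrightarrow> a \<in> carrier G \<Longrightarrow> \<lbrakk>a, b\<rbrakk> \<in> M"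
  using normal.inv_op_closed2[of M G a b] subgroup.m_inv_closed[of M G b] subgroup.m_closed[of M G]
    normal_imp_subgroup[of M G]
  unfolding cm_def by blast

lemma sub_Cent: "M \<lhd> G \<Longrightarrow> a \<in> carrier G \<Longrightarrow> M \<subseteq> Cent M a"
  using Cent_cm_right normal_imp_subgroup subgroup.mem_carrier by (fastforce simp: Cent_iff)

lemma sub_CentI:
  assumes "\<And>b. b \<in> A \<Longrightarrow> \<lbrakk>a, b\<rbrakk> \<in> M'" "M' \<subseteq> M" "A \<subseteq> carrier G"
  shows "A \<subseteq> Cent M a"
  unfolding Cent_def using assms by blast

lemma coset_drop:
  assumes "M \<lhd> G" "m \<in> M" "a \<in> carrier G"
  shows "M #> (m \<otimes> a) = M #> a"
proof -
  interpret M: normal M G by fact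
  have "M #> (m \<otimes> a) = M #> m #> a" using assms by (simp add: coset_mult_assoc M.subset)
  then show ?thesis using assms by (simp add: M.rcos_const)
qed

section \<open>The lower central series\<close>

lemma gam_Suc: "n \<ge> 1 \<Longrightarrow> gam G (Suc n) = generate G (comm_set G (gam G n) (carrier G))"
  by (cases n) auto

declare gam.simps(3) [simp del]

lemma gam_normal: "gam G n \<lhd> G"
proof (induct n)
  case 0 show ?case by (simp add: normal_self)
next
  case (Suc n)
  show ?case
  proof (cases "n = 0")
    case True then show ?thesis by (simp add: normal_self)
  next
    case False
    interpret M: normal "gam G n" G by (rule Suc)
    have "comm_set G (gam G n) (carrier G) \<subseteq> carrier G"
      by (auto simp: comm_set_def)
    moreover have "g \<otimes> h \<otimes> inv g \<in> comm_set G (gam G n) (carrier G)"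
      if h: "h \<in> comm_set G (gam G n) (carrier G)" and g: "g \<in> carrier G" for h g
    proof -
      obtain a b where ab: "h = a \<otimes> b \<otimes> inv a \<otimes> inv b" "a \<in> gam G n" "b \<in> carrier G"
        using h by (auto simp: comm_set_def)
      let ?a = "g \<otimes> a \<otimes> inv g" and ?b = "g \<otimes> b \<otimes> inv g"
      have "g \<otimes> h \<otimes> inv g = ?a \<otimes> ?b \<otimes> inv ?a \<otimes> inv ?b"
        using ab g by (simp add: word)
      moreover have "?a \<in> gam G n" using ab g by (intro M.inv_op_closed2)
      moreover have "?b \<in> carrier G" using ab g by auto
      ultimately show ?thesis unfolding comm_set_def by blast
    qed
    ultimately show ?thesis using False by (simp add: gam_Suc normal_generateI)
  qed
qed

lemma gam_subgroup: "subgroup (gam G n) G"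
  by (rule normal_imp_subgroup[OF gam_normal])

lemma gam_carrier: "a \<in> gam G n \<Longrightarrow> a \<in> carrier G"
  by (rule subgroup.mem_carrier[OF gam_subgroup])

lemma gam_sub: "gam G n \<subseteq> carrier G"
  using gam_carrier by blast

lemma cm_gam: "a \<in> gam G n \<Longrightarrow> g \<in> carrier G \<Longrightarrow> \<lbrakk>a, g\<rbrakk> \<in> gam G (Suc n)"
proof (cases "n = 0")
  case False
  assume "a \<in> gam G n" "g \<in> carrier G"
  then have "\<lbrakk>a, g\<rbrakk> \<in> comm_set G (gam G n) (carrier G)" by (auto simp: comm_set_def cm_def)
  then show ?thesis using False by (simp add: gam_Suc generate.incl)
qed auto

lemma cm_gam': "a \<in> gam G n \<Longrightarrow> g \<in> carrier G \<Longrightarrow> \<lbrakk>g, a\<rbrakk> \<in> gam G (Suc n)"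
  by (rule cm_swap[OF gam_subgroup cm_gam]) (auto intro: gam_carrier)

lemma gam_least:
  assumes "n \<ge> 1" "subgroup M G" "\<And>a g. a \<in> gam G n \<Longrightarrow> g \<in> carrier G \<Longrightarrow> \<lbrakk>a, g\<rbrakk> \<in> M"
  shows "gam G (Suc n) \<subseteq> M"
  unfolding gam_Suc[OF assms(1)]
  by (rule generate_subgroup_incl[OF _ assms(2)]) (use assms(3) in \<open>auto simp: comm_set_def cm_def\<close>)

lemma gam_Suc_sub: "gam G (Suc n) \<subseteq> gam G n"
proof (cases "n = 0")
  case False
  have "\<lbrakk>a, g\<rbrakk> \<in> gam G n" if "a \<in> gam G n" "g \<in> carrier G" for a g
    using cm_swap[OF gam_subgroup Cent_cm_right[OF gam_normal that]] that gam_carrier by blast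
  then show ?thesis using False by (intro gam_least gam_subgroup) auto
qed (use gam_sub in auto)

lemma gam_antimono: "m \<le> n \<Longrightarrow> gam G n \<subseteq> gam G m"
  using gam_Suc_sub by (rule lift_Suc_antimono_le)

lemma gam2: "gam G 2 = derived G (carrier G)"
proof -
  have "comm_set G (carrier G) (carrier G) = derived_set G (carrier G)"
    by (auto simp: comm_set_def)
  then show ?thesis by (simp add: numeral_2_eq_2 derived_def gam.simps(3))
qed

text \<open>Once two neighbouring terms agree, taking commutators with \<open>G\<close> reproduces
  the agreement at every later place.\<close>

lemma gam_stab:
  assumes "n \<ge> 1" "gam G n \<subseteq> gam G (Suc n)" "m \<ge> n"
  shows "gam G n \<subseteq> gam G m"
  using assms(3)
proof (induct m rule: dec_induct)
  case (step m)
  have "gam G (Suc n) \<subseteq> gam G (Suc m)"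
    by (rule gam_least[OF assms(1) gam_subgroup]) (use step cm_gam in blast)
  then show ?case using assms(2) by blast
qed simp

lemma normal_between:
  assumes "subgroup M G" "gam G (Suc k) \<subseteq> M" "M \<subseteq> gam G k"
  shows "M \<lhd> G"
proof (rule normal_invI[OF assms(1)])
  fix g h assume g: "g \<in> carrier G" and h: "h \<in> M"
  have "\<lbrakk>g, h\<rbrakk> \<in> M" using cm_gam'[of h k g] assms h g by blast
  then show "g \<otimes> h \<otimes> inv g \<in> M"
    using conj_cm[of h g] g h assms(1) subgroup.mem_carrier[OF assms(1)] subgroup.m_closed by metis
qed

lemma normal_above_derived:
  assumes "subgroup M G" "gam G 2 \<subseteq> M"
  shows "M \<lhd> G"
  using normal_between[of M 1] assms subgroup.subset[OF assms(1)] by (simp add: numeral_2_eq_2)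

text \<open>Commutation is bimultiplicative on \<open>\<gamma>\<^sub>n \<times> G\<close> modulo \<open>\<gamma>\<^sub>n\<^sub>+\<^sub>2\<close>.\<close>
lemma cm_gam_gam2:
  assumes a: "a \<in> gam G n" and b: "b \<in> gam G 2"
  shows "\<lbrakk>a, b\<rbrakk> \<in> gam G (Suc (Suc n))"
proof -
  let ?M = "gam G (Suc (Suc n))"
  have aG: "a \<in> carrier G" using a gam_carrier by blast
  have C: "subgroup (Cent ?M a) G" by (rule Cent_subgroup[OF gam_normal aG])
  \<comment> \<open>Centralizing \<open>a\<close> modulo gamma_(n+2) is a subgroup condition, so a
    single commutator [g,h] is enough. It is reached by comparing both sides of gh =
    [g,h]hg.\<close>
  have "gam G (Suc 1) \<subseteq> Cent ?M a"
  proof (rule gam_least[OF _ C])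
    fix g h assume "g \<in> gam G 1" and h: "h \<in> carrier G"
    then have g: "g \<in> carrier G" by simp
    interpret M: normal ?M G by (rule gam_normal)
    define A where "A = \<lbrakk>a, g\<rbrakk>"
    define B where "B = \<lbrakk>a, h\<rbrakk>"
    have A: "A \<in> gam G (Suc n)" "A \<in> carrier G" and B: "B \<in> gam G (Suc n)" "B \<in> carrier G"
      using cm_gam[OF a] aG g h unfolding A_def B_def by auto
    have "g \<otimes> B \<otimes> inv g = \<lbrakk>g, B\<rbrakk> \<otimes> B" "h \<otimes> A \<otimes> inv h = \<lbrakk>h, A\<rbrakk> \<otimes> A"
      using A B g h by (auto intro!: conj_cm)
    then have e1: "\<lbrakk>a, g \<otimes> h\<rbrakk> = A \<otimes> (\<lbrakk>g, B\<rbrakk> \<otimes> B)" and e2: "\<lbrakk>a, h \<otimes> g\<rbrakk> = B \<otimes> (\<lbrakk>h, A\<rbrakk> \<otimes> A)"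
      using cm_mult_right[OF aG g h] cm_mult_right[OF aG h g] unfolding A_def B_def by auto
    have gB: "\<lbrakk>g, B\<rbrakk> \<in> ?M" and hA: "\<lbrakk>h, A\<rbrakk> \<in> ?M" and AB: "\<lbrakk>A, B\<rbrakk> \<in> ?M"
      using cm_gam'[OF B(1) g] cm_gam'[OF A(1) h] cm_gam[OF A(1) B(2)] by auto
    \<comment> \<open>Conjugation by g or h moves A and B only within gamma_(n+2), and A and B
      commute modulo it. Hence [a,gh] and [a,hg] have the same coset.\<close>
    have "?M #> \<lbrakk>a, g \<otimes> h\<rbrakk> = ?M #> (A \<otimes> B)"
    proof -
      have "A \<otimes> (\<lbrakk>g, B\<rbrakk> \<otimes> B) = (A \<otimes> \<lbrakk>g, B\<rbrakk> \<otimes> inv A) \<otimes> (A \<otimes> B)"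
        using A B g by (simp add: word)
      moreover have "A \<otimes> \<lbrakk>g, B\<rbrakk> \<otimes> inv A \<in> ?M" using gB A by (intro M.inv_op_closed2)
      ultimately show ?thesis unfolding e1
        by (simp add: coset_drop[OF gam_normal] A B)
    qed
    moreover have "?M #> \<lbrakk>a, h \<otimes> g\<rbrakk> = ?M #> (B \<otimes> A)"
    proof -
      have "B \<otimes> (\<lbrakk>h, A\<rbrakk> \<otimes> A) = (B \<otimes> \<lbrakk>h, A\<rbrakk> \<otimes> inv B) \<otimes> (B \<otimes> A)"
        using A B h by (simp add: word)
      moreover have "B \<otimes> \<lbrakk>h, A\<rbrakk> \<otimes> inv B \<in> ?M" using hA B by (intro M.inv_op_closed2)
      ultimately show ?thesis unfolding e2
        by (simp add: coset_drop[OF gam_normal] A B)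
    qed
    moreover have "?M #> (A \<otimes> B) = ?M #> (B \<otimes> A)"
    proof -
      have "A \<otimes> B = \<lbrakk>A, B\<rbrakk> \<otimes> (B \<otimes> A)" using A B by (simp add: cm_def word)
      then show ?thesis using AB
        by (simp add: coset_drop[OF gam_normal] A B)
    qed
    ultimately have eq: "?M #> \<lbrakk>a, g \<otimes> h\<rbrakk> = ?M #> \<lbrakk>a, h \<otimes> g\<rbrakk>" by simp
    have "\<lbrakk>g, h\<rbrakk> \<otimes> (h \<otimes> g) = g \<otimes> h" using g h by (simp add: cm_def word)
    then have e3: "\<lbrakk>a, \<lbrakk>g, h\<rbrakk> \<otimes> (h \<otimes> g)\<rbrakk> = \<lbrakk>a, g \<otimes> h\<rbrakk>" by simp
    let ?c = "\<lbrakk>g, h\<rbrakk>"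
    have cG: "?c \<in> carrier G" using g h by auto
    have e4: "\<lbrakk>a, g \<otimes> h\<rbrakk> = \<lbrakk>a, ?c\<rbrakk> \<otimes> (\<lbrakk>?c, \<lbrakk>a, h \<otimes> g\<rbrakk>\<rbrakk> \<otimes> \<lbrakk>a, h \<otimes> g\<rbrakk>)"
      using cm_mult_right[OF aG cG, of "h \<otimes> g"] conj_cm[of "\<lbrakk>a, h \<otimes> g\<rbrakk>" ?c] g h aG cG e3 by auto
    have m: "\<lbrakk>?c, \<lbrakk>a, h \<otimes> g\<rbrakk>\<rbrakk> \<in> ?M" using cm_gam'[OF cm_gam[OF a]] g h cG by blast
    let ?m = "\<lbrakk>?c, \<lbrakk>a, h \<otimes> g\<rbrakk>\<rbrakk>" and ?u = "\<lbrakk>a, h \<otimes> g\<rbrakk>" and ?v = "\<lbrakk>a, g \<otimes> h\<rbrakk>"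
    have uv: "?v \<otimes> inv ?u \<in> ?M"
      using eq aG g h M.rcos_module_imp[OF group_axioms] rcos_self[OF _ gam_subgroup]
      by (metis cm_closed m_closed)
    have "\<lbrakk>a, ?c\<rbrakk> = (?v \<otimes> inv ?u) \<otimes> inv ?m"
      unfolding e4 using aG g h cG by (simp add: word)
    also have "\<dots> \<in> ?M" using uv m by blast
    finally show "?c \<in> Cent ?M a" using cG by (simp add: Cent_iff)
  qed simp
  then show ?thesis using b by (auto simp: Cent_iff numeral_2_eq_2)
qed

end

section \<open>Two generators, products of normal subgroups, and a nilpotent analogue of Nakayama's
  lemma\<close>

context group
begin

lemma gen2_eq:
  assumes "generate G {x, y} = carrier G" "subgroup S G" "x \<in> S" "y \<in> S"
  shows "S = carrier G"
  using generate_subgroup_incl[of "{x, y}" S] subgroup.subset[OF assms(2)] assms by auto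

lemma gen2_Cent:
  assumes "generate G {x, y} = carrier G" "M \<lhd> G" "a \<in> carrier G" "g \<in> carrier G"
    "\<lbrakk>a, x\<rbrakk> \<in> M" "\<lbrakk>a, y\<rbrakk> \<in> M" "x \<in> carrier G" "y \<in> carrier G"
  shows "\<lbrakk>a, g\<rbrakk> \<in> M"
  using gen2_eq[OF assms(1) Cent_subgroup[OF assms(2,3)]] assms by (auto simp: Cent_iff)

text \<open>The images of the generators commute modulo \<open>M\<close>, so the quotient is
  abelian.\<close>

lemma gen2_gam2:
  assumes g: "generate G {x, y} = carrier G" and M: "M \<lhd> G"
    and xy: "x \<in> carrier G" "y \<in> carrier G" "\<lbrakk>x, y\<rbrakk> \<in> M"
  shows "gam G 2 \<subseteq> M"
proof -
  note sM = normal_imp_subgroup[OF M]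
  have one: "\<one> \<in> M" by (rule subgroup.one_closed[OF sM])
  have 1: "\<lbrakk>h, x\<rbrakk> \<in> M" if "h \<in> carrier G" for h
    using cm_swap[OF sM gen2_Cent[OF g M xy(1) that]] xy one that by auto
  have 2: "\<lbrakk>h, y\<rbrakk> \<in> M" if "h \<in> carrier G" for h
    using cm_swap[OF sM gen2_Cent[OF g M xy(2) that]] xy one that cm_swap[OF sM xy(3) xy(1,2)] by auto
  have "gam G (Suc 1) \<subseteq> M"
    by (rule gam_least[OF _ sM]) (use gen2_Cent[OF g M] 1 2 xy in auto)
  then show ?thesis by (simp add: numeral_2_eq_2)
qed

text \<open>For fixed \<open>g\<close>, the elements commuting with \<open>g\<close> modulo
  \<open>M\<close> form a subgroup; it contains \<open>B\<close> and gamma_(k+1), hence gamma_k. So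
  only commutators of generators of gamma_k modulo gamma_(k+1) have to be tested.\<close>

lemma gam_step:
  assumes k: "k \<ge> 1" and B: "gam G k \<subseteq> generate G (B \<union> gam G (Suc k))" "B \<subseteq> carrier G"
    and M: "M \<lhd> G" "gam G (Suc (Suc k)) \<subseteq> M"
    and b: "\<And>b g. b \<in> B \<Longrightarrow> g \<in> carrier G \<Longrightarrow> \<lbrakk>b, g\<rbrakk> \<in> M"
  shows "gam G (Suc k) \<subseteq> M"
proof (rule gam_least[OF k normal_imp_subgroup[OF M(1)]])
  fix a g assume a: "a \<in> gam G k" and g: "g \<in> carrier G"
  note sM = normal_imp_subgroup[OF M(1)]
  have "generate G (B \<union> gam G (Suc k)) \<subseteq> Cent M g"
  proof (rule generate_subgroup_incl[OF _ Cent_subgroup[OF M(1) g]])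
    have "c \<in> Cent M g" if c: "c \<in> B" for c
      using cm_swap[OF sM b[OF c g] _ g] B(2) c by (auto simp: Cent_iff)
    moreover have "c \<in> Cent M g" if c: "c \<in> gam G (Suc k)" for c
      using cm_gam'[OF c g] M(2) gam_carrier[OF c] by (auto simp: Cent_iff)
    ultimately show "B \<union> gam G (Suc k) \<subseteq> Cent M g" by blast
  qed
  then have "\<lbrakk>g, a\<rbrakk> \<in> M" using a B by (auto simp: Cent_iff)
  then show "\<lbrakk>a, g\<rbrakk> \<in> M" using cm_swap[OF sM] g gam_carrier[OF a] by blast
qed

lemma gam_step2:
  assumes "generate G {x, y} = carrier G" "x \<in> carrier G" "y \<in> carrier G"
    and k: "k \<ge> 1" and B: "gam G k \<subseteq> generate G (B \<union> gam G (Suc k))" "B \<subseteq> carrier G"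
    and M: "M \<lhd> G" "gam G (Suc (Suc k)) \<subseteq> M"
    and b: "\<And>b. b \<in> B \<Longrightarrow> \<lbrakk>b, x\<rbrakk> \<in> M" "\<And>b. b \<in> B \<Longrightarrow> \<lbrakk>b, y\<rbrakk> \<in> M"
  shows "gam G (Suc k) \<subseteq> M"
  by (rule gam_step[OF k B M]) (use gen2_Cent[OF assms(1) M(1)] b B assms(2,3) in blast)

lemma mult_mem_cancel:
  assumes "subgroup N G" "a \<in> carrier G" "n \<in> N"
  shows "a \<otimes> n \<in> N \<longleftrightarrow> a \<in> N"
proof
  interpret N: subgroup N G by fact
  assume "a \<otimes> n \<in> N"
  then have "a \<otimes> n \<otimes> inv n \<in> N" using assms(3) by blast
  then show "a \<in> N" using assms by (simp add: m_assoc)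
qed (use assms subgroup.m_closed[OF assms(1)] in auto)

lemma set_mult_normal:
  assumes M: "M \<lhd> G" and N: "N \<lhd> G"
  shows "M <#> N \<lhd> G" "M \<subseteq> M <#> N" "N \<subseteq> M <#> N"
proof -
  interpret M: normal M G by fact
  interpret N: normal N G by fact
  have s: "subgroup (M <#> N) G"
    using mult_norm_subgroup[OF M] N.subgroup_axioms commut_normal[OF _ M] by metis
  show "M <#> N \<lhd> G"
  proof (rule normal_invI[OF s])
    fix g h assume g: "g \<in> carrier G" and "h \<in> M <#> N"
    then obtain m n where mn: "m \<in> M" "n \<in> N" "h = m \<otimes> n" by (auto simp: set_mult_def)
    have "g \<otimes> h \<otimes> inv g = (g \<otimes> m \<otimes> inv g) \<otimes> (g \<otimes> n \<otimes> inv g)"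
      using mn g by (simp add: word)
    then show "g \<otimes> h \<otimes> inv g \<in> M <#> N"
      using M.inv_op_closed2[OF g mn(1)] N.inv_op_closed2[OF g mn(2)] by (auto simp: set_mult_def)
  qed
  show "M \<subseteq> M <#> N"
  proof
    fix m assume m: "m \<in> M" 
    then have "m = m \<otimes> \<one>" by simp
    then show "m \<in> M <#> N" using m N.one_closed unfolding set_mult_def by blast
  qed
  show "N \<subseteq> M <#> N"
  proof
    fix m assume m: "m \<in> N" 
    then have "m = \<one> \<otimes> m" by simp
    then show "m \<in> M <#> N" using m M.one_closed unfolding set_mult_def by blast
  qed
qed

lemma set_mult_least: "subgroup K G \<Longrightarrow> M \<subseteq> K \<Longrightarrow> N \<subseteq> K \<Longrightarrow> M <#> N \<subseteq> K"
  by (auto simp: set_mult_def intro: subgroup.m_closed)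

text \<open>If \<open>M\<close> covers gamma_k modulo gamma_(k+1), commutation with \<open>G\<close>
  shows that it covers every later section too. The series ends in 1, so climbing back from there
  puts gamma_k itself into \<open>M\<close>.\<close>

lemma nakayama:
  assumes M: "M \<lhd> G" and k: "k \<ge> 1" and sub: "gam G k \<subseteq> M <#> gam G (Suc k)"
    and nil: "gam G (Suc c) = {\<one>}"
  shows "gam G k \<subseteq> M"
proof -
  note sM = normal_imp_subgroup[OF M]
  have step: "gam G j \<subseteq> M <#> gam G (Suc j)" if "j \<ge> k" for j
    using that
  proof (induct j rule: dec_induct)
    case (step j)
    let ?K = "M <#> gam G (Suc (Suc j))"
    note K = set_mult_normal[OF M gam_normal[of "Suc (Suc j)"]]
    note sK = normal_imp_subgroup[OF K(1)]
    show ?case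
    proof (rule gam_least[OF _ sK])
      fix a g assume a: "a \<in> gam G j" and g: "g \<in> carrier G"
      have "M <#> gam G (Suc j) \<subseteq> Cent ?K g"
      proof (rule set_mult_least[OF Cent_subgroup[OF K(1) g]])
        show "M \<subseteq> Cent ?K g" 
          using Cent_cm_right[OF M _ g] K(2) subgroup.mem_carrier[OF sM] unfolding Cent_def by blast
        show "gam G (Suc j) \<subseteq> Cent ?K g"
          using cm_gam'[OF _ g, of _ "Suc j"] K(3) gam_carrier unfolding Cent_def by blast
      qed
      then have "\<lbrakk>g, a\<rbrakk> \<in> ?K" using a step by (auto simp: Cent_iff)
      then show "\<lbrakk>a, g\<rbrakk> \<in> ?K" using cm_swap[OF sK] g gam_carrier[OF a] by blast
    qed (use step k in auto)
  qed (use sub in simp)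
  \<comment> \<open>The bound \<open>max k (Suc c)\<close> makes the descent start at a trivial term
    even if \<open>k\<close> exceeds \<open>Suc c\<close>.\<close>
  have down: "gam G j \<subseteq> M" if "k \<le> j" "j \<le> max k (Suc c)" for j
    using that(2,1)
  proof (induct j rule: inc_induct)
    case base
    have "gam G (max k (Suc c)) \<subseteq> {\<one>}" using gam_antimono[of "Suc c" "max k (Suc c)"] nil by auto
    then show ?case using subgroup.one_closed[OF sM] by blast
  next
    case (step j)
    then show ?case using \<open>\<And>j. k \<le> j \<Longrightarrow> gam G j \<subseteq> M <#> gam G (Suc j)\<close>[of j]
        set_mult_least[OF sM order_refl, of "gam G (Suc j)"] by auto
  qed
  show ?thesis using down[of k] by simp
qed

section \<open>Adjoining one element to a normal subgroup\<close>

abbreviation adj where "adj N a \<equiv> generate G (insert a N)"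

lemma adj_subgroup: "subgroup N G \<Longrightarrow> a \<in> carrier G \<Longrightarrow> subgroup (adj N a) G"
  using subgroup.subset by (intro generate_is_subgroup) fastforce

lemma adj_sub: "N \<subseteq> adj N a" "a \<in> adj N a"
  by (auto intro: generate.incl)

lemma adj_least: "subgroup K G \<Longrightarrow> N \<subseteq> K \<Longrightarrow> a \<in> K \<Longrightarrow> adj N a \<subseteq> K"
  by (rule generate_subgroup_incl) auto

lemma adj_mem_int:
  assumes N: "N \<lhd> G" and a: "a \<in> carrier G" and b: "b \<in> adj N a"
  shows "\<exists>k::int. \<exists>n\<in>N. b = n \<otimes> a [^] k"
  using b
proof (induct b rule: generate.induct)
  interpret N: normal N G by fact
  case one then show ?case by (intro exI[of _ 0] bexI[of _ \<one>]) auto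
next
  interpret N: normal N G by fact
  case (incl h) then show ?case
    using a by (cases "h = a") (auto intro: exI[of _ "1::int"] bexI[of _ \<one>] exI[of _ "0::int"] bexI[of _ h])
next
  interpret N: normal N G by fact
  case (inv h)
  show ?case
  proof (cases "h = a")
    case True then show ?thesis
      using a by (intro exI[of _ "-1"] bexI[of _ \<one>]) (auto simp: int_pow_neg)
  next
    case False then show ?thesis
      using inv by (intro exI[of _ "0::int"] bexI[of _ "inv h"]) auto
  qed
next
  interpret N: normal N G by fact
  case (eng b c)
  then obtain k l m n where h: "m \<in> N" "n \<in> N" "b = m \<otimes> a [^] (k::int)" "c = n \<otimes> a [^] (l::int)" by blast
  have "b \<otimes> c = (m \<otimes> (a [^] k \<otimes> n \<otimes> inv (a [^] k))) \<otimes> a [^] (k + l)"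
    using h a by (simp add: int_pow_mult word)
  moreover have "m \<otimes> (a [^] k \<otimes> n \<otimes> inv (a [^] k)) \<in> N"
    using h a N.inv_op_closed2[of "a [^] k" n] by auto
  ultimately show ?case by blast
qed

lemma adj_mem:
  assumes N: "N \<lhd> G" and a: "a \<in> carrier G" "a [^] (m::nat) \<in> N" "m > 0" and b: "b \<in> adj N a"
  shows "\<exists>k<m. b \<in> N #> a [^] k"
proof -
  interpret N: normal N G by fact
  obtain k :: int and n where n: "n \<in> N" "b = n \<otimes> a [^] k" using adj_mem_int[OF N a(1) b] by blast
  let ?q = "k div int m" and ?r = "k mod int m"
  define l where "l = nat ?r"
  have l: "?r = int l" using a(3) by (simp add: l_def)
  have r: "a [^] ?r = a [^] l" unfolding l by (rule int_pow_int)
  have "a [^] k = a [^] (int m * ?q + ?r)" by simp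
  also have "\<dots> = a [^] (int m * ?q) \<otimes> a [^] ?r" by (rule int_pow_mult[OF a(1)])
  also have "a [^] (int m * ?q) = (a [^] m) [^] ?q" 
    using int_pow_pow[OF a(1), of "int m" ?q] by (simp add: int_pow_int)
  also note r
  finally have "b = (n \<otimes> (a [^] m) [^] ?q) \<otimes> a [^] l" using n a by (simp add: m_assoc)
  moreover have "n \<otimes> (a [^] m) [^] ?q \<in> N"
    using n subgroup_int_pow_closed[OF N.subgroup_axioms a(2)] by auto
  moreover have "l < m" using a(3) by (simp add: l_def nat_less_iff)
  ultimately show ?thesis by (auto simp: r_coset_def)
qed

lemma card_r_coset: "subgroup N G \<Longrightarrow> a \<in> carrier G \<Longrightarrow> card (N #> a) = card N"
  using card_rcosets_equal[of "N #> a" N] subgroup.subset[of N G]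
  unfolding RCOSETS_def by fastforce

lemma card_adj_le:
  assumes N: "N \<lhd> G" "finite N" and a: "a \<in> carrier G" "a [^] (m::nat) \<in> N" "m > 0"
  shows "finite (adj N a)" "card (adj N a) \<le> m * card N"
proof -
  note sN = normal_imp_subgroup[OF N(1)]
  have sub: "adj N a \<subseteq> (\<Union>k<m. N #> a [^] k)" using adj_mem[OF N(1) a] by blast
  have fin: "finite (N #> a [^] k)" for k :: nat using N(2) by (simp add: r_coset_def)
  then show "finite (adj N a)" using sub finite_subset by blast
  have "card (adj N a) \<le> card (\<Union>k<m. N #> a [^] k)" using sub fin by (intro card_mono) auto
  also have "\<dots> \<le> (\<Sum>k<m. card (N #> a [^] k))" by (rule card_UN_le) simp
  also have "\<dots> = m * card N" using card_r_coset[OF sN] a(1) by simp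
  finally show "card (adj N a) \<le> m * card N" .
qed

text \<open>Modulo \<open>N\<close> the element \<open>a\<close> generates a group of order dividing
  3, and any nontrivial element of such a group generates it.\<close>

lemma adj_exchange:
  assumes N: "N \<lhd> G" and a: "a \<in> carrier G" "a [^] (3::nat) \<in> N"
    and b: "b \<in> adj N a" "b \<notin> N" and K: "subgroup K G" "N \<subseteq> K" "b \<in> K"
  shows "a \<in> K"
proof -
  interpret K: subgroup K G by fact
  note sN = normal_imp_subgroup[OF N]
  obtain k n where k: "k < 3" and n: "n \<in> N" "b = n \<otimes> a [^] (k::nat)"
    using adj_mem[OF N a _ b(1)] by (auto simp: r_coset_def)
  have nG: "n \<in> carrier G" by (rule subgroup.mem_carrier[OF sN n(1)])
  have "inv n \<otimes> b \<in> K" using n K(2,3) by (intro K.m_closed K.m_inv_closed) auto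
  then have ak: "a [^] k \<in> K" using n nG a by (simp add: word)
  have a3: "a [^] (3::nat) \<in> K" using a K(2) by auto
  have "k \<noteq> 0" using b n nG a by (cases "k = 0") auto
  then consider "k = 1" | "k = 2" using k by linarith
  then show ?thesis
  proof cases
    case 1 then show ?thesis using ak a by simp
  next
    case 2
    have "a [^] (3::nat) = a [^] (2::nat) \<otimes> a" using a by (simp add: numeral_3_eq_3 numeral_2_eq_2)
    then have "inv (a [^] k) \<otimes> a [^] (3::nat) = a" using a 2 by (simp add: word)
    then show ?thesis using ak a3 K.m_closed K.m_inv_closed by metis
  qed
qed

lemma adj_normal_gam:
  assumes "a \<in> gam G k"
  shows "adj (gam G (Suc k)) a \<lhd> G" "adj (gam G (Suc k)) a \<subseteq> gam G k"
proof -
  have s: "adj (gam G (Suc k)) a \<subseteq> gam G k"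
    using assms gam_Suc_sub by (intro adj_least gam_subgroup)
  show "adj (gam G (Suc k)) a \<subseteq> gam G k" by (rule s)
  show "adj (gam G (Suc k)) a \<lhd> G"
    using adj_sub s by (intro normal_between[where k=k] adj_subgroup gam_subgroup gam_carrier[OF assms])
qed

end

section \<open>Computing modulo a normal subgroup\<close>

lemma (in group_hom) hom_cm: "a \<in> carrier G \<Longrightarrow> b \<in> carrier G \<Longrightarrow> h (cm G a b) = cm H (h a) (h b)"
  by (simp add: cm_def)

context normal
begin

lemma mod_hom: "group_hom G (G Mod H) (\<lambda>a. H #> a)"
  by (intro group_hom.intro group_hom_axioms.intro r_coset_hom_Mod factorgroup_is_group is_group)

lemma mod_one_iff: "a \<in> carrier G \<Longrightarrow> H #> a = \<one>\<^bsub>G Mod H\<^esub> \<longleftrightarrow> a \<in> H"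
  using rcos_const[of a] rcos_self[OF _ is_subgroup, of a] by (auto simp: is_group)

end

context group
begin

text \<open>[x,y^3] is the product of the conjugates of s = [x,y] by 1, y, y^2. With t = [y,s] and p
  = [y,t] these conjugates are s, ts and pt times ts.\<close>

lemma cm_cube_word:
  assumes "x \<in> carrier G" "y \<in> carrier G"
  shows "\<lbrakk>x, y [^] (3::nat)\<rbrakk> = \<lbrakk>x, y\<rbrakk> \<otimes> \<lbrakk>y, \<lbrakk>x, y\<rbrakk>\<rbrakk> \<otimes> \<lbrakk>x, y\<rbrakk> \<otimes> \<lbrakk>y, \<lbrakk>y, \<lbrakk>x, y\<rbrakk>\<rbrakk>\<rbrakk> \<otimes>
     \<lbrakk>y, \<lbrakk>x, y\<rbrakk>\<rbrakk> \<otimes> \<lbrakk>y, \<lbrakk>x, y\<rbrakk>\<rbrakk> \<otimes> \<lbrakk>x, y\<rbrakk>"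
  using assms by (simp add: cm_def word pow3)

lemma commute_word:
  assumes c: "s \<in> carrier G" "t \<in> carrier G" "p \<in> carrier G"
    and "\<lbrakk>s, t\<rbrakk> = \<one>" "\<lbrakk>s, p\<rbrakk> = \<one>" "\<lbrakk>t, p\<rbrakk> = \<one>"
  shows "s \<otimes> t \<otimes> s \<otimes> p \<otimes> t \<otimes> t \<otimes> s = s [^] (3::nat) \<otimes> t [^] (3::nat) \<otimes> p"
proof -
  have st: "t \<otimes> s = s \<otimes> t" and sp: "p \<otimes> s = s \<otimes> p" and tp: "p \<otimes> t = t \<otimes> p"
    using assms by (simp_all add: cm_eq_one_iff)
  have l: "t \<otimes> (s \<otimes> u) = s \<otimes> (t \<otimes> u)" "p \<otimes> (s \<otimes> u) = s \<otimes> (p \<otimes> u)" "p \<otimes> (t \<otimes> u) = t \<otimes> (p \<otimes> u)"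
    if "u \<in> carrier G" for u
    using that c st sp tp by (simp_all add: m_assoc[symmetric])
  show ?thesis using c by (simp add: pow3 m_assoc st sp tp l)
qed

text \<open>The word for [x,y^3] can be reordered as soon as s, t, p commute modulo
  \<open>N\<close>. This trades information on the cube of a generator for information on the cube
  of a commutator, and is the source of all estimates of cubes below.\<close>

lemma cm_cube_mod:
  assumes N: "N \<lhd> G" and x: "x \<in> carrier G" and y: "y \<in> carrier G"
    and s: "s = \<lbrakk>x, y\<rbrakk>" and t: "t = \<lbrakk>y, s\<rbrakk>" and p: "p = \<lbrakk>y, t\<rbrakk>"
    and c: "\<lbrakk>s, t\<rbrakk> \<in> N" "\<lbrakk>s, p\<rbrakk> \<in> N" "\<lbrakk>t, p\<rbrakk> \<in> N"
  shows "\<lbrakk>x, y [^] (3::nat)\<rbrakk> \<in> N \<longleftrightarrow> s [^] (3::nat) \<otimes> t [^] (3::nat) \<otimes> p \<in> N"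
proof -
  interpret N: normal N G by fact
  interpret Q: group_hom G "G Mod N" "\<lambda>a. N #> a" by (rule N.mod_hom)
  have car: "s \<in> carrier G" "t \<in> carrier G" "p \<in> carrier G" using x y s t p by auto
  note tr = Q.hom_cm[symmetric] N.mod_one_iff
  have "N #> \<lbrakk>x, y [^] (3::nat)\<rbrakk> = N #> (s \<otimes> t \<otimes> s \<otimes> p \<otimes> t \<otimes> t \<otimes> s)"
    using cm_cube_word[OF x y] by (simp add: s t p)
  also have "\<dots> = N #> (s [^] (3::nat) \<otimes> t [^] (3::nat) \<otimes> p)"
    using Q.H.commute_word[of "N #> s" "N #> t" "N #> p"] car c
    by (simp add: tr Q.hom_mult[symmetric] Q.hom_nat_pow[symmetric] del: Q.hom_mult Q.hom_nat_pow mult_FactGroup one_FactGroup)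
  finally show ?thesis using N.mod_one_iff car x y by (metis cm_closed m_closed nat_pow_closed)
qed

lemma cm_cube_mod':
  assumes N: "N \<lhd> G" and x: "x \<in> carrier G" and y: "y \<in> carrier G"
    and t: "\<lbrakk>y, \<lbrakk>x, y\<rbrakk>\<rbrakk> \<in> N"
  shows "\<lbrakk>x, y [^] (3::nat)\<rbrakk> \<in> N \<longleftrightarrow> \<lbrakk>x, y\<rbrakk> [^] (3::nat) \<in> N"
proof -
  interpret N: normal N G by fact
  let ?t = "\<lbrakk>y, \<lbrakk>x, y\<rbrakk>\<rbrakk>"
  have p: "\<lbrakk>y, ?t\<rbrakk> \<in> N" "\<lbrakk>\<lbrakk>x, y\<rbrakk>, ?t\<rbrakk> \<in> N"  using Cent_cm_right[OF N t] x y by auto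
  have p': "\<lbrakk>\<lbrakk>x, y\<rbrakk>, \<lbrakk>y, ?t\<rbrakk>\<rbrakk> \<in> N" "\<lbrakk>?t, \<lbrakk>y, ?t\<rbrakk>\<rbrakk> \<in> N"
    using Cent_cm_right[OF N p(1)] x y by auto
  have n: "?t [^] (3::nat) \<otimes> \<lbrakk>y, ?t\<rbrakk> \<in> N" using t p x y by (auto simp: pow3)
  have "\<lbrakk>x, y\<rbrakk> [^] (3::nat) \<otimes> (?t [^] (3::nat) \<otimes> \<lbrakk>y, ?t\<rbrakk>) \<in> N \<longleftrightarrow> \<lbrakk>x, y\<rbrakk> [^] (3::nat) \<in> N"
    by (rule mult_mem_cancel[OF N.is_subgroup _ n]) (use x y in auto)
  then show ?thesis using cm_cube_mod[OF N x y refl refl refl p(2) p'] x y by (simp add: m_assoc)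
qed

text \<open>The action of \<open>G\<close> by conjugation on an abelian normal section centralized by \<open>\<lbrakk>x, y\<rbrakk>\<close> factors
  through an abelian group.\<close>
lemma cm_cm_commute:
  assumes N: "N \<lhd> G" and x: "x \<in> carrier G" and y: "y \<in> carrier G" and a: "a \<in> carrier G"
    and c: "\<lbrakk>\<lbrakk>x, a\<rbrakk>, \<lbrakk>y, a\<rbrakk>\<rbrakk> \<in> N" "\<lbrakk>\<lbrakk>x, y\<rbrakk>, y \<otimes> x \<otimes> a \<otimes> inv (y \<otimes> x)\<rbrakk> \<in> N"
  shows "N #> \<lbrakk>x, \<lbrakk>y, a\<rbrakk>\<rbrakk> = N #> \<lbrakk>y, \<lbrakk>x, a\<rbrakk>\<rbrakk>"
proof -
  interpret N: normal N G by fact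
  interpret Q: group_hom G "G Mod N" "\<lambda>a. N #> a" by (rule N.mod_hom)
  let ?z = "\<lbrakk>x, a\<rbrakk>" and ?t = "\<lbrakk>y, a\<rbrakk>" and ?s = "\<lbrakk>x, y\<rbrakk>" and ?w = "y \<otimes> x \<otimes> a \<otimes> inv (y \<otimes> x)"
  have car: "?z \<in> carrier G" "?t \<in> carrier G" "?s \<in> carrier G" "?w \<in> carrier G" using x y a by auto
  \<comment> \<open>Since \<open>?s\<close> times yx is xy, the left side is the conjugate of
    \<open>a\<close> by xy, whereas \<open>?w\<close> is the conjugate by yx. Both are expanded one
    generator at a time.\<close>
  have e1: "?s \<otimes> ?w \<otimes> inv ?s = \<lbrakk>x, ?t\<rbrakk> \<otimes> (?t \<otimes> ?z \<otimes> a)" and e2: "?w = \<lbrakk>y, ?z\<rbrakk> \<otimes> (?z \<otimes> ?t \<otimes> a)"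
    using x y a by (simp_all add: cm_def word)
  have e3: "?s \<otimes> ?w \<otimes> inv ?s = \<lbrakk>?s, ?w\<rbrakk> \<otimes> ?w" using car by (simp add: conj_cm)
  have e4: "?z \<otimes> ?t \<otimes> a = \<lbrakk>?z, ?t\<rbrakk> \<otimes> (?t \<otimes> ?z \<otimes> a)" using x y a by (simp add: cm_def word)
  have A0: "N #> (?z \<otimes> ?t \<otimes> a) = N #> (?t \<otimes> ?z \<otimes> a)"
    unfolding e4 using coset_drop[OF N c(1), of "?t \<otimes> ?z \<otimes> a"] x y a by simp
  define A where "A = \<lbrakk>x, ?t\<rbrakk>"
  define B where "B = \<lbrakk>y, ?z\<rbrakk>"
  define C where "C = ?t \<otimes> ?z \<otimes> a"
  have ABC: "A \<in> carrier G" "B \<in> carrier G" "C \<in> carrier G" "?z \<otimes> ?t \<otimes> a \<in> carrier G"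
    using x y a by (auto simp: A_def B_def C_def)
  have "N #> (A \<otimes> C) = N #> ?w"
    unfolding A_def C_def e1[symmetric] e3 using coset_drop[OF N c(2) car(4)] .
  also have "\<dots> = (N #> B) <#> (N #> (?z \<otimes> ?t \<otimes> a))"
    unfolding e2 B_def[symmetric] by (rule N.rcos_sum[symmetric]) (use ABC in auto)
  finally have "(N #> A) <#> (N #> C) = (N #> B) <#> (N #> C)"
    unfolding A0[folded C_def] N.rcos_sum[OF ABC(1,3)] .
  then show ?thesis unfolding A_def[symmetric] B_def[symmetric]
    using Q.H.right_cancel[of "N #> C" "N #> A" "N #> B"] Q.hom_closed[OF ABC(1)] Q.hom_closed[OF ABC(2)]
      Q.hom_closed[OF ABC(3)] unfolding mult_FactGroup by blast
qed

lemma coset_eq_mem: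
  assumes "N \<lhd> G" "a \<in> carrier G" "b \<in> carrier G" "N #> a = N #> b" "N \<subseteq> M" "subgroup M G" "a \<in> M"
  shows "b \<in> M"
proof -
  interpret N: normal N G by fact
  have "b \<in> N #> a" using assms(4) rcos_self[OF assms(3) N.is_subgroup] by simp
  then show ?thesis using assms(5-7) subgroup.m_closed[OF assms(6)] by (auto simp: r_coset_def)
qed

end

section \<open>The cube map modulo a normal subgroup\<close>

context group
begin

lemma mod_commute_iff:
  assumes N: "N \<lhd> G" and a: "a \<in> carrier G" and b: "b \<in> carrier G"
  shows "\<lbrakk>a, b\<rbrakk> \<in> N \<longleftrightarrow> (N #> a) \<otimes>\<^bsub>G Mod N\<^esub> (N #> b) = (N #> b) \<otimes>\<^bsub>G Mod N\<^esub> (N #> a)"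
proof -
  interpret N: normal N G by fact
  interpret Q: group_hom G "G Mod N" "\<lambda>a. N #> a" by (rule N.mod_hom)
  have "\<lbrakk>a, b\<rbrakk> \<in> N \<longleftrightarrow> cm (G Mod N) (N #> a) (N #> b) = \<one>\<^bsub>G Mod N\<^esub>"
    using N.mod_one_iff[of "\<lbrakk>a, b\<rbrakk>"] Q.hom_cm[OF a b] a b by simp
  then show ?thesis using Q.H.cm_eq_one_iff[OF Q.hom_closed[OF a] Q.hom_closed[OF b]] by blast
qed

lemma pow_mult_mod:
  assumes N: "N \<lhd> G" and a: "a \<in> carrier G" and b: "b \<in> carrier G" and c: "\<lbrakk>a, b\<rbrakk> \<in> N"
  shows "N #> ((a \<otimes> b) [^] (n::nat)) = N #> (a [^] n \<otimes> b [^] n)"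
proof -
  interpret N: normal N G by fact
  interpret Q: group_hom G "G Mod N" "\<lambda>a. N #> a" by (rule N.mod_hom)
  have "N #> ((a \<otimes> b) [^] n) = ((N #> a) \<otimes>\<^bsub>G Mod N\<^esub> (N #> b)) [^]\<^bsub>G Mod N\<^esub> n"
    using a b Q.hom_mult[OF a b] Q.hom_nat_pow[of "a \<otimes> b" n] by simp
  also have "\<dots> = (N #> a) [^]\<^bsub>G Mod N\<^esub> n \<otimes>\<^bsub>G Mod N\<^esub> (N #> b) [^]\<^bsub>G Mod N\<^esub> n"
    using c unfolding mod_commute_iff[OF N a b]
    by (rule Q.H.pow_mult_distrib) (use a b Q.hom_closed in auto)
  also have "\<dots> = N #> (a [^] n \<otimes> b [^] n)"
    using a b Q.hom_mult[of "a [^] n" "b [^] n"] Q.hom_nat_pow by simp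
  finally show ?thesis .
qed

lemma coset_mem_iff:
  assumes "N \<lhd> G" "a \<in> carrier G" "b \<in> carrier G" "N #> a = N #> b" "N \<subseteq> M" "subgroup M G"
  shows "a \<in> M \<longleftrightarrow> b \<in> M"
  using coset_eq_mem[OF assms(1-6)] coset_eq_mem[OF assms(1,3,2) assms(4)[symmetric] assms(5,6)] by blast

text \<open>\<open>A\<close> is abelian modulo \<open>N\<close>, so cubing induces a homomorphism
  there and the set is its kernel.\<close>

lemma cube_subgroup:
  assumes N: "N \<lhd> G" and A: "subgroup A G" and c: "\<And>a b. a \<in> A \<Longrightarrow> b \<in> A \<Longrightarrow> \<lbrakk>a, b\<rbrakk> \<in> N"
  shows "subgroup {a \<in> A. a [^] (3::nat) \<in> N} G"
proof (rule subgroupI)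
  interpret N: normal N G by fact
  interpret A: subgroup A G by fact
  show "{a \<in> A. a [^] (3::nat) \<in> N} \<subseteq> carrier G" by auto
  show "{a \<in> A. a [^] (3::nat) \<in> N} \<noteq> {}" by (auto intro!: exI[of _ \<one>])
  show "inv a \<in> {a \<in> A. a [^] (3::nat) \<in> N}" if "a \<in> {a \<in> A. a [^] (3::nat) \<in> N}" for a
    using that nat_pow_inv[of a 3] by (auto simp: A.m_inv_closed)
  show "a \<otimes> b \<in> {a \<in> A. a [^] (3::nat) \<in> N}"
    if "a \<in> {a \<in> A. a [^] (3::nat) \<in> N}" "b \<in> {a \<in> A. a [^] (3::nat) \<in> N}" for a b
    using that pow_mult_mod[OF N _ _ c[of a b], where n=3] coset_mem_iff[OF N, of "(a \<otimes> b) [^] (3::nat)" "a [^] (3::nat) \<otimes> b [^] (3::nat)" N]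
    by (auto simp: A.m_closed N.is_subgroup)
qed

text \<open>For a in gamma_k the cube [g,a]^3 agrees with [g,a^3] modulo the target term, because
  the correction [a,[g,a]] lies in gamma_(k+3); the bound d <= 2 makes that deep enough.\<close>

lemma cube_gam_Suc:
  assumes k: "k \<ge> 2" and d: "d \<le> 2" and h: "\<And>a. a \<in> gam G k \<Longrightarrow> a [^] (3::nat) \<in> gam G (k + d)"
    and a: "a \<in> gam G (Suc k)"
  shows "a [^] (3::nat) \<in> gam G (Suc (k + d))"
proof -
  let ?N = "gam G (Suc (k + d))"
  have sub: "gam G (Suc (Suc (Suc k))) \<subseteq> ?N" using d by (intro gam_antimono) auto
  have k2: "gam G (Suc k) \<subseteq> gam G 2" "gam G k \<subseteq> gam G 2" using k by (auto intro!: gam_antimono)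
  have S: "subgroup {a \<in> gam G (Suc k). a [^] (3::nat) \<in> ?N} G"
    using cm_gam_gam2[of _ "Suc k"] sub k2 by (intro cube_subgroup gam_normal gam_subgroup) blast
  have "gam G (Suc k) \<subseteq> {a \<in> gam G (Suc k). a [^] (3::nat) \<in> ?N}"
  proof (rule gam_least[OF _ S])
    fix a g assume a: "a \<in> gam G k" and g: "g \<in> carrier G"
    have aG: "a \<in> carrier G" by (rule gam_carrier[OF a])
    have m: "\<lbrakk>g, a\<rbrakk> \<in> gam G (Suc k)" by (rule cm_gam'[OF a g])
    have "\<lbrakk>\<lbrakk>g, a\<rbrakk>, a\<rbrakk> \<in> ?N" using cm_gam_gam2[OF m] a k2 sub by blast
    then have "\<lbrakk>a, \<lbrakk>g, a\<rbrakk>\<rbrakk> \<in> ?N" using cm_swap[OF gam_subgroup] aG g by blast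
    moreover have "\<lbrakk>g, a [^] (3::nat)\<rbrakk> \<in> ?N" using cm_gam'[OF h[OF a] g] .
    ultimately have "\<lbrakk>g, a\<rbrakk> [^] (3::nat) \<in> ?N" using cm_cube_mod'[OF gam_normal g aG] by blast
    then have "\<lbrakk>g, a\<rbrakk> \<in> {a \<in> gam G (Suc k). a [^] (3::nat) \<in> ?N}" using m by blast
    then show "\<lbrakk>a, g\<rbrakk> \<in> {a \<in> gam G (Suc k). a [^] (3::nat) \<in> ?N}" by (rule cm_swap[OF S _ g aG])
  qed (use k in simp)
  then show ?thesis using a by blast
qed

section \<open>Maximal subgroups\<close>

text \<open>Take the last term gamma_k not contained in \<open>H\<close>. By maximality gamma_k H =
  G. Commutators with gamma_k fall into gamma_(k+1), which is inside \<open>H\<close>; so gamma_k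
  normalizes \<open>H\<close> and is central modulo \<open>H\<close>, which makes the quotient
  abelian.\<close>

lemma max_sub_gam2:
  assumes nil: "gam G (Suc c) = {\<one>}" and H: "max_sub G H"
  shows "H \<lhd> G" "gam G 2 \<subseteq> H"
proof -
  have sH: "subgroup H G" and HG: "H \<noteq> carrier G"
    and mx: "\<And>K. subgroup K G \<Longrightarrow> H \<subseteq> K \<Longrightarrow> K = H \<or> K = carrier G" using H by (auto simp: max_sub_def)
  interpret H: subgroup H G by (rule sH)
  have "\<exists>k\<ge>1. \<not> gam G k \<subseteq> H \<and> gam G (Suc k) \<subseteq> H"
  proof (rule ccontr)
    assume a: "\<not> ?thesis"
    have "\<not> gam G (Suc k) \<subseteq> H" for k
    proof (induct k)
      case 0 show ?case using HG H.subset by auto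
    next
      case (Suc k) then show ?case using a by auto
    qed
    from this[of c] show False using nil by auto
  qed
  then obtain k where k: "k \<ge> 1" "\<not> gam G k \<subseteq> H" "gam G (Suc k) \<subseteq> H" by blast
  interpret N: normal "gam G k" G by (rule gam_normal)
  have sK: "subgroup (gam G k <#> H) G" by (rule mult_norm_subgroup[OF gam_normal sH])
  have "H \<subseteq> gam G k <#> H"
  proof
    fix h assume h: "h \<in> H"
    then have "h = \<one> \<otimes> h" by simp
    then show "h \<in> gam G k <#> H" using h N.one_closed unfolding set_mult_def by blast
  qed
  moreover have "gam G k \<subseteq> gam G k <#> H"
  proof
    fix h assume h: "h \<in> gam G k"
    then have "h = h \<otimes> \<one>" by simp
    then show "h \<in> gam G k <#> H" using h H.one_closed unfolding set_mult_def by blast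
  qed
  ultimately have KG: "gam G k <#> H = carrier G" using mx[OF sK] k(2) by blast
  have conj: "a \<otimes> h \<otimes> inv a \<in> H" if "a \<in> gam G k" "h \<in> H" for a h
  proof -
    have "\<lbrakk>a, h\<rbrakk> \<in> H" using cm_gam[OF that(1) H.mem_carrier[OF that(2)]] k(3) by blast
    then show ?thesis using conj_cm[OF H.mem_carrier[OF that(2)] gam_carrier[OF that(1)]] that(2) by simp
  qed
  show nH: "H \<lhd> G"
  proof (rule normal_invI[OF sH])
    fix g h assume "g \<in> carrier G" and h: "h \<in> H"
    then obtain a h0 where g: "g = a \<otimes> h0" "a \<in> gam G k" "h0 \<in> H" unfolding KG[symmetric] set_mult_def by blast
    have "g \<otimes> h \<otimes> inv g = a \<otimes> (h0 \<otimes> h \<otimes> inv h0) \<otimes> inv a"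
      using g h gam_carrier[OF g(2)] by (simp add: word)
    then show "g \<otimes> h \<otimes> inv g \<in> H" using conj[OF g(2)] g h by simp
  qed
  show "gam G 2 \<subseteq> H"
  proof -
    have all: "S = carrier G" if "subgroup S G" "H \<subseteq> S" "gam G k \<subseteq> S" for S
      using set_mult_least[OF that(1,3,2)] KG subgroup.subset[OF that(1)] by blast
    have 1: "Cent H a = carrier G" if "a \<in> gam G k" for a
    proof (rule all[OF Cent_subgroup[OF nH] sub_Cent[OF nH]])
      show "gam G k \<subseteq> Cent H a"
      proof
        fix b assume "b \<in> gam G k"
        then have b: "b \<in> carrier G" by (rule gam_carrier)
        then show "b \<in> Cent H a" using subsetD[OF k(3) cm_gam[OF that b]] by (simp add: Cent_iff)
      qed
    qed (use gam_carrier[OF that] in auto)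
    have 2: "Cent H g = carrier G" if g: "g \<in> carrier G" for g
    proof (rule all[OF Cent_subgroup[OF nH g] sub_Cent[OF nH g]])
      show "gam G k \<subseteq> Cent H g"
      proof
        fix a assume a: "a \<in> gam G k"
        show "a \<in> Cent H g"
          by (rule Cent_swap[OF sH gam_carrier[OF a]]) (use 1[OF a] g in simp)
      qed
    qed
    have "gam G (Suc 1) \<subseteq> H"
      by (rule gam_least[OF _ sH]) (use 2 in \<open>auto simp: Cent_def set_eq_iff\<close>)
    then show ?thesis by (simp add: numeral_2_eq_2)
  qed
qed

lemma max_sub_adj:
  assumes "max_sub G H" "r \<in> carrier G" "r \<notin> H"
  shows "adj H r = carrier G"
  using assms adj_subgroup[of H r] adj_sub unfolding max_sub_def by blast

lemma max_sub_index:
  assumes fin: "finite (carrier G)" and o: "order G = 3 ^ n" and nil: "gam G (Suc c) = {\<one>}" and H: "max_sub G H"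
  shows "g \<in> carrier G \<Longrightarrow> g [^] (3::nat) \<in> H" "card (carrier G) = 3 * card H"
proof -
  have nH: "H \<lhd> G" by (rule max_sub_gam2[OF nil H])
  interpret H: normal H G by (rule nH)
  interpret Q: group_hom G "G Mod H" "\<lambda>a. H #> a" by (rule H.mod_hom)
  show cube: "g [^] (3::nat) \<in> H" if g: "g \<in> carrier G" for g
  proof (rule ccontr)
    assume n: "g [^] (3::nat) \<notin> H"
    \<comment> \<open>If g^3 were outside \<open>H\<close>, it would generate \<open>G\<close> over
      \<open>H\<close>, so that g would be congruent to g^(3k). Iterating n times turns the right
      side into a power of g^(3^n) = 1.\<close>
    have "g \<in> adj H (g [^] (3::nat))" using max_sub_adj[OF H _ n] g by simp
    then obtain k :: int and h where h: "h \<in> H" "g = h \<otimes> (g [^] (3::nat)) [^] k"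
      using adj_mem_int[OF nH, of "g [^] (3::nat)" g] g by auto
    let ?q = "H #> g"
    have qc: "?q \<in> carrier (G Mod H)" using g by (rule Q.hom_closed)
    have "(g [^] (3::nat)) [^] k = g [^] (3 * k)" using int_pow_pow[OF g, of 3 k] int_pow_int[of G g 3] by simp
    then have "?q = H #> (g [^] (3 * k))" using coset_drop[OF nH h(1), of "g [^] (3*k)"] h(2) g by simp
    also have "\<dots> = ?q [^]\<^bsub>G Mod H\<^esub> (3 * k)" using g H.FactGroup_int_pow by simp
    finally have q: "?q [^]\<^bsub>G Mod H\<^esub> (3 * k) = ?q" by simp
    have pw: "?q [^]\<^bsub>G Mod H\<^esub> ((3 * k) ^ m) = ?q" for m :: nat
    proof (induct m)
      case 0 then show ?case using Q.H.int_pow_1[OF qc] by simp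
    next
      case (Suc m) then show ?case using Q.H.int_pow_pow[OF qc, of "3 * k" "(3*k)^m"] q by simp
    qed
    have "(3 * k) ^ n = int (3 ^ n) * k ^ n" by (simp add: power_mult_distrib)
    then have "?q = (?q [^]\<^bsub>G Mod H\<^esub> (3 ^ n :: nat)) [^]\<^bsub>G Mod H\<^esub> (k ^ n)"
      using pw[of n] Q.H.int_pow_pow[OF qc, of "int (3 ^ n)" "k ^ n"] int_pow_int[of "G Mod H" ?q "3 ^ n"] by simp
    moreover have "?q [^]\<^bsub>G Mod H\<^esub> (3 ^ n :: nat) = \<one>\<^bsub>G Mod H\<^esub>"
      using pow_order_eq_1[OF g] o Q.hom_nat_pow[OF g, of "3 ^ n"] Q.hom_one by simp
    ultimately have "?q = \<one>\<^bsub>G Mod H\<^esub>" by (simp only: Q.H.int_pow_one)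
    then have "g \<in> H" using H.mod_one_iff[OF g] by simp
    then show False using n by (simp add: pow3)
  qed
  obtain r where r: "r \<in> carrier G" "r \<notin> H" using H H.subset by (auto simp: max_sub_def)
  have finH: "finite H" using fin H.subset finite_subset by blast
  have le: "card (carrier G) \<le> 3 * card H"
    using card_adj_le[OF nH finH r(1) cube[OF r(1)]] max_sub_adj[OF H r] by simp
  have lt: "card H < card (carrier G)" using r H.subset fin by (intro psubset_card_mono) auto
  have L: "card (carrier G) = card (rcosets H) * card H"
    using lagrange[OF H.is_subgroup] by (simp add: order_def)
  have c0: "card H > 0" using H.one_closed finH card_gt_0_iff by blast
  let ?m = "card (rcosets H)"
  have "?m \<le> 3" "?m > 1" using le lt c0 unfolding L by auto
  moreover have "?m dvd 3 ^ n" using L o unfolding order_def by (metis dvd_triv_left)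
  then have "?m \<noteq> 2" using even_power[of "3::nat" n] by (metis odd_numeral dvd_refl even_numeral dvd_trans)
  ultimately have "?m = 3" by linarith
  then show "card (carrier G) = 3 * card H" using L by simp
qed

lemma max_sub_exists:
  assumes "finite (carrier G)" "subgroup K G" "K \<noteq> carrier G"
  shows "\<exists>H. max_sub G H \<and> K \<subseteq> H"
  using assms(2,3)
proof (induct "card (carrier G) - card K" arbitrary: K rule: less_induct)
  case less
  show ?case
  proof (cases "max_sub G K")
    case False
    then obtain L where L: "subgroup L G" "K \<subseteq> L" "L \<noteq> K" "L \<noteq> carrier G" using less unfolding max_sub_def by blast
    have "card K < card L" using L assms(1) finite_subset[OF subgroup.subset[OF L(1)]] by (intro psubset_card_mono) auto
    moreover have "card L \<le> card (carrier G)" by (intro card_mono assms(1) subgroup.subset L(1))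
    ultimately show ?thesis using less(1)[OF _ L(1,4)] L(2) by fastforce
  qed blast
qed

text \<open>A proper subgroup lies in a maximal one, and maximal subgroups contain gamma_2. So
  gamma_2 consists of non-generators.\<close>

lemma frattini:
  assumes "finite (carrier G)" "gam G (Suc c) = {\<one>}" "subgroup K G"
    and all: "\<And>S. subgroup S G \<Longrightarrow> K \<subseteq> S \<Longrightarrow> gam G 2 \<subseteq> S \<Longrightarrow> S = carrier G"
  shows "K = carrier G"
proof (rule ccontr)
  assume "K \<noteq> carrier G"
  then obtain H where H: "max_sub G H" "K \<subseteq> H" using max_sub_exists assms(1,3) by blast
  then have "H = carrier G" using all[of H] max_sub_gam2[OF assms(2)] by (auto simp: max_sub_def)
  then show False using H by (simp add: max_sub_def)
qed

end

section \<open>Two-generator groups with abelianization of type \<open>(3\<^sup>e, 3)\<close> and bicyclic \<open>\<gamma>\<^sub>3/\<gamma>\<^sub>4\<close>\<close>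

text \<open>The lower central sections are prescribed by their orders, which do not mention
  \<open>x\<close> and \<open>y\<close>. Therefore the assumptions survive a change of generators,
  see \<open>change_generator\<close> and \<open>gens_ok_bicyc\<close>. The finer shape of
  gamma_2/gamma_4 is deduced in \<open>card23\<close> and \<open>card34\<close>.\<close>

locale bicyc = group G for G (structure) +
  fixes e c :: nat and x y
  assumes fin: "finite (carrier G)" and e2: "e \<ge> 2" and c3: "c \<ge> 3"
    and x [simp]: "x \<in> carrier G" and y [simp]: "y \<in> carrier G"
    and gen: "generate G {x, y} = carrier G"
    and x_pow2: "x [^] ((3::nat) ^ e) \<in> gam G 2" and y_pow2: "y [^] (3::nat) \<in> gam G 2"
    and nil: "gam G (Suc c) = {\<one>}"
    and card_carrier: "card (carrier G) = 3 ^ (e + 1) * card (gam G 2)"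
    and card24: "card (gam G 2) = 27 * card (gam G 4)"
    and card_step: "4 \<le> k \<Longrightarrow> k \<le> c \<Longrightarrow> card (gam G k) = 3 * card (gam G (Suc k))"
begin

abbreviation s where "s \<equiv> \<lbrakk>x, y\<rbrakk>"
abbreviation z where "z \<equiv> \<lbrakk>x, s\<rbrakk>"
abbreviation t where "t \<equiv> \<lbrakk>y, s\<rbrakk>"
abbreviation p where "p \<equiv> \<lbrakk>y, t\<rbrakk>"
abbreviation u where "u \<equiv> x [^] ((3::nat) ^ e)"

lemma gam_fin: "finite (gam G k)"
  using fin gam_sub finite_subset by blast

lemma gam_card_pos: "card (gam G k) > 0"
  using gam_fin subgroup.one_closed[OF gam_subgroup] card_gt_0_iff by blast

lemma Suc2: "Suc (Suc 0) = 2" "Suc 2 = 3" "Suc 3 = 4" "Suc 4 = 5" "Suc 5 = 6" by auto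

lemma s_gam: "s \<in> gam G 2" 
  using cm_gam[of x 1 y] by (simp add: numeral_2_eq_2)

lemma cm3: "g \<in> carrier G \<Longrightarrow> \<lbrakk>g, s\<rbrakk> \<in> gam G 3"
  using cm_gam'[OF s_gam] by (simp add: Suc2)

lemma t_gam: "t \<in> gam G 3" and z_gam: "z \<in> gam G 3"
  using cm3 by auto

lemma p_gam: "p \<in> gam G 4"
  using cm_gam'[OF t_gam y] by (simp add: Suc2)

lemma stzp [simp]: "s \<in> carrier G" "z \<in> carrier G" "t \<in> carrier G" "p \<in> carrier G" "u \<in> carrier G"
  by auto

lemma gam2_adj: "gam G 2 \<subseteq> adj (gam G 3) s"
  using adj_normal_gam(1)[OF s_gam] adj_sub(2) by (intro gen2_gam2[OF gen]) (auto simp: Suc2)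

text \<open>As y^3 lies in gamma_2, the commutator [x,y^3] lies in gamma_3, and modulo gamma_3 it
  equals s^3.\<close>

lemma s3_gam3: "s [^] (3::nat) \<in> gam G 3"
  using cm_cube_mod'[OF gam_normal x y, of 3] cm3[OF y] cm_gam'[OF y_pow2 x] by (simp add: Suc2)

lemma gam2_comm: "a \<in> gam G 2 \<Longrightarrow> b \<in> gam G 2 \<Longrightarrow> \<lbrakk>a, b\<rbrakk> \<in> gam G 4"
  using cm_gam_gam2[of a 2 b] by (simp add: Suc2)

lemma gam43: "gam G 4 \<subseteq> gam G 3" and gam32: "gam G 3 \<subseteq> gam G 2" and gam42: "gam G 4 \<subseteq> gam G 2"
  by (auto intro!: gam_antimono)

lemma cube1: "k \<ge> 2 \<Longrightarrow> a \<in> gam G k \<Longrightarrow> a [^] (3::nat) \<in> gam G (Suc k)"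
proof (induct k arbitrary: a rule: nat_induct_at_least)
  case base
  have S: "subgroup {a \<in> gam G 2. a [^] (3::nat) \<in> gam G 3} G"
    using gam2_comm gam43 by (intro cube_subgroup gam_normal gam_subgroup) blast
  have "gam G 3 \<subseteq> {a \<in> gam G 2. a [^] (3::nat) \<in> gam G 3}"
    using gam32 subgroup.m_closed[OF gam_subgroup[of 3]] gam_carrier by (auto simp: pow3)
  then have "adj (gam G 3) s \<subseteq> {a \<in> gam G 2. a [^] (3::nat) \<in> gam G 3}"
    using s3_gam3 s_gam by (intro adj_least S) auto
  then show ?case using base gam2_adj by (auto simp: Suc2)
next
  case (Suc k)
  show ?case using cube_gam_Suc[of k 1 a] Suc by simp
qed

lemma gam3_least:
  assumes M: "M \<lhd> G" "gam G 4 \<subseteq> M" and h: "\<lbrakk>x, s\<rbrakk> \<in> M" "\<lbrakk>y, s\<rbrakk> \<in> M"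
  shows "gam G 3 \<subseteq> M"
proof -
  note sM = normal_imp_subgroup[OF M(1)]
  have "gam G (Suc 2) \<subseteq> M"
    by (rule gam_step2[OF gen x y, where B = "{s}"])
      (use M gam2_adj cm_swap[OF sM h(1)] cm_swap[OF sM h(2)] in \<open>auto simp: Suc2\<close>)
  then show ?thesis by (simp add: Suc2)
qed

lemma gam3_least':
  assumes M: "M \<lhd> G" "gam G 4 \<subseteq> M" and h: "\<And>g. g \<in> carrier G \<Longrightarrow> \<lbrakk>g, s\<rbrakk> \<in> M"
  shows "gam G 3 \<subseteq> M"
  by (intro gam3_least M h x y)

text \<open>The subgroup bounding the derived subgroup of the maximal subgroup through
  \<open>g\<close>, see \<open>derived_max_sub'\<close>; it has order at most 3 over
  gamma_4.\<close>

definition R where "R g = adj (gam G 4) \<lbrakk>g, s\<rbrakk>"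

lemma R_normal: "g \<in> carrier G \<Longrightarrow> R g \<lhd> G" and R_sub: "g \<in> carrier G \<Longrightarrow> R g \<subseteq> gam G 3"
  using adj_normal_gam[of "\<lbrakk>g, s\<rbrakk>" 3] cm3[of g] by (auto simp: R_def Suc2)

lemma R_mem: "gam G 4 \<subseteq> R g" "\<lbrakk>g, s\<rbrakk> \<in> R g"
  unfolding R_def by (rule adj_sub)+

lemma R_fin: "g \<in> carrier G \<Longrightarrow> finite (R g)"
  using R_sub gam_fin finite_subset by metis

lemma cube3: "a \<in> gam G 3 \<Longrightarrow> a [^] (3::nat) \<in> gam G 4"
  using cube1[of 3 a] by (simp add: Suc2)

lemma card_R_le: "g \<in> carrier G \<Longrightarrow> card (R g) \<le> 3 * card (gam G 4)"
  unfolding R_def using card_adj_le[OF gam_normal gam_fin _ cube3[OF cm3]] by simp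

lemma gam3_adj_R:
  assumes h: "\<And>M. M \<lhd> G \<Longrightarrow> R g \<subseteq> M \<Longrightarrow> b \<in> M \<Longrightarrow> gam G 3 \<subseteq> M" and b: "b \<in> gam G 3" and g: "g \<in> carrier G"
  shows "gam G 3 \<subseteq> adj (R g) b"
proof (rule h)
  show "adj (R g) b \<lhd> G"
  proof (rule normal_between[where k = 3])
    show "subgroup (adj (R g) b) G"
      using b g R_normal normal_imp_subgroup gam_carrier by (intro adj_subgroup) auto
    show "gam G (Suc 3) \<subseteq> adj (R g) b" using R_mem adj_sub(1) by (fastforce simp: Suc2)
    show "adj (R g) b \<subseteq> gam G 3" using b R_sub[OF g] by (intro adj_least gam_subgroup)
  qed
qed (auto intro: adj_sub subsetD[OF adj_sub(1)])

lemma card_adj_R: "g \<in> carrier G \<Longrightarrow> b \<in> gam G 3 \<Longrightarrow> card (adj (R g) b) \<le> 9 * card (gam G 4)"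
  using card_adj_le(2)[OF R_normal R_fin gam_carrier, of g b 3 3] cube3[of b] R_mem card_R_le[of g] by force

text \<open>One commutator generates gamma_2 over gamma_3 and two generate gamma_3 over gamma_4, all
  with cubes one step deeper. The resulting bounds 3 and 9 multiply to the prescribed index 27, so
  both are attained.\<close>

lemma card23: "card (gam G 2) = 3 * card (gam G 3)" and card34: "card (gam G 3) = 9 * card (gam G 4)"
proof -
  have 1: "card (gam G 2) \<le> 3 * card (gam G 3)"
    using card_adj_le[OF gam_normal gam_fin, of s 3 3] s3_gam3 card_mono[OF _ gam2_adj] by simp
  have "gam G 3 \<subseteq> adj (R x) t"
    by (rule gam3_adj_R) (use R_mem gam3_least t_gam x in \<open>blast+\<close>)
  then have "card (gam G 3) \<le> card (adj (R x) t)"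
    using card_adj_le(1)[OF R_normal R_fin, of x t 3] cube3[OF t_gam] R_mem by (intro card_mono) auto
  also have "\<dots> \<le> 9 * card (gam G 4)" using card_adj_R t_gam x by blast
  finally show "card (gam G 2) = 3 * card (gam G 3)" "card (gam G 3) = 9 * card (gam G 4)"
    using 1 card24 by auto
qed

lemma gam3_not_sub_R: "g \<in> carrier G \<Longrightarrow> \<not> gam G 3 \<subseteq> R g"
  using card_mono[OF R_fin, of g "gam G 3"] card_R_le[of g] card34 gam_card_pos[of 4] by fastforce

lemma x_y_indep: 
  shows "t \<notin> R x" "z \<notin> R y" "z \<notin> gam G 4" "t \<notin> gam G 4" "s \<notin> gam G 3"
proof -
  show 1: "t \<notin> R x" using gam3_least[OF R_normal[OF x] R_mem(1)] R_mem(2)[of x] gam3_not_sub_R[OF x] by blast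
  show 2: "z \<notin> R y" using gam3_least[OF R_normal[OF y] R_mem(1)] R_mem(2)[of y] gam3_not_sub_R[OF y] by blast
  show "z \<notin> gam G 4" "t \<notin> gam G 4" using 1 2 R_mem(1) by blast+
  show "s \<notin> gam G 3"
  proof
    assume "s \<in> gam G 3"
    then have "gam G 2 \<subseteq> gam G 3" using gam2_adj adj_least[OF gam_subgroup order_refl] by blast
    then show False using card_mono[OF gam_fin, of "gam G 2" 3] card23 gam_card_pos[of 3] by simp
  qed
qed

text \<open>Outside gamma_3 the element \<open>h\<close> would generate gamma_2 modulo gamma_3, and
  then \<open>s\<close> would commute with \<open>g\<close> modulo gamma_4 as well.\<close>

lemma mem_gam3:
  assumes "h \<in> gam G 2" "g \<in> carrier G" "\<lbrakk>g, h\<rbrakk> \<in> gam G 4" "\<lbrakk>g, s\<rbrakk> \<notin> gam G 4"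
  shows "h \<in> gam G 3"
proof (rule ccontr)
  assume n: "h \<notin> gam G 3"
  have "gam G 3 \<subseteq> Cent (gam G 4) g"
    using cm_gam'[OF _ assms(2), of _ 3] gam_carrier by (auto simp: Cent_iff Suc2)
  then have "s \<in> Cent (gam G 4) g"
    using adj_exchange[OF gam_normal _ s3_gam3 _ n Cent_subgroup[OF gam_normal assms(2)]] assms gam2_adj gam_carrier
    by (auto simp: Cent_iff)
  then show False using assms by (simp add: Cent_iff)
qed

lemma cm_pow_self: "g \<in> carrier G \<Longrightarrow> \<lbrakk>g, g [^] (n::nat)\<rbrakk> = \<one>"
  using cm_eq_one_iff[of g "g [^] n"] nat_pow_Suc2[of g n] by simp

text \<open>\<open>u\<close> commutes with \<open>x\<close> and y^3 commutes with \<open>y\<close>,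
  but \<open>z\<close> and \<open>t\<close> are outside gamma_4; so neither power can generate
  gamma_2 modulo gamma_3.\<close>

lemma u_gam3: "u \<in> gam G 3" and y3_gam3: "y [^] (3::nat) \<in> gam G 3"
proof -
  have "\<one> \<in> gam G 4" by (rule subgroup.one_closed[OF gam_subgroup])
  then show "u \<in> gam G 3" "y [^] (3::nat) \<in> gam G 3"
    using mem_gam3[OF x_pow2 x] mem_gam3[OF y_pow2 y] cm_pow_self[OF x] cm_pow_self[OF y] x_y_indep by auto
qed

lemma s3t3p: 
  assumes "gam G 5 \<subseteq> N" "N \<lhd> G" 
  shows "\<lbrakk>x, y [^] (3::nat)\<rbrakk> \<in> N \<longleftrightarrow> s [^] (3::nat) \<otimes> t [^] (3::nat) \<otimes> p \<in> N"
proof (rule cm_cube_mod[OF assms(2) x y refl refl refl])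
  note gam32 gam43
  then have "\<lbrakk>t, s\<rbrakk> \<in> gam G 5" "\<lbrakk>p, s\<rbrakk> \<in> gam G 6" "\<lbrakk>p, t\<rbrakk> \<in> gam G 6"
    using cm_gam_gam2[OF t_gam s_gam] cm_gam_gam2[OF p_gam s_gam] cm_gam_gam2[OF p_gam, of t] t_gam gam32 by (auto simp: Suc2)
  then show "\<lbrakk>s, t\<rbrakk> \<in> N" "\<lbrakk>s, p\<rbrakk> \<in> N" "\<lbrakk>t, p\<rbrakk> \<in> N"
    using assms gam_Suc_sub[of 5] cm_swap[OF normal_imp_subgroup[OF assms(2)]] by (auto simp: Suc2)
qed

text \<open>Second pass of the argument for \<open>s3_gam3\<close>, now with y^3 in gamma_3: [x,y^3]
  falls into gamma_4, and so do t^3 and \<open>p\<close>.\<close>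

lemma s3_gam4: "s [^] (3::nat) \<in> gam G 4"
proof -
  have "\<lbrakk>x, y [^] (3::nat)\<rbrakk> \<in> gam G 4" using cm_gam'[OF y3_gam3 x] by (simp add: Suc2)
  then have "s [^] (3::nat) \<otimes> t [^] (3::nat) \<otimes> p \<in> gam G 4"
    using s3t3p[OF _ gam_normal, of 4] gam_Suc_sub[of 4] by (simp add: Suc2)
  then show ?thesis
    using mult_mem_cancel[OF gam_subgroup _ p_gam, of "s [^] (3::nat) \<otimes> t [^] (3::nat)"] 
     mult_mem_cancel[OF gam_subgroup _ cube3[OF t_gam], of "s [^] (3::nat)"] by simp
qed

lemma cube2: "k \<ge> 2 \<Longrightarrow> a \<in> gam G k \<Longrightarrow> a [^] (3::nat) \<in> gam G (k + 2)"
proof (induct k arbitrary: a rule: nat_induct_at_least)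
  case base
  have S: "subgroup {a \<in> gam G 2. a [^] (3::nat) \<in> gam G 4} G"
    using gam2_comm by (intro cube_subgroup gam_normal gam_subgroup)
  have "gam G 3 \<subseteq> {a \<in> gam G 2. a [^] (3::nat) \<in> gam G 4}"
    using gam32 cube3 by auto
  then have "adj (gam G 3) s \<subseteq> {a \<in> gam G 2. a [^] (3::nat) \<in> gam G 4}"
    using s3_gam4 s_gam by (intro adj_least S) auto
  then show ?case using base gam2_adj by auto
next
  case (Suc k)
  show ?case using cube_gam_Suc[of k 2 a] Suc by simp
qed

lemma cm_cube_gam4:
  assumes g: "g \<in> carrier G" and h: "h \<in> carrier G"
  shows "\<lbrakk>h, g [^] (3::nat)\<rbrakk> \<in> gam G 4"
proof -
  let ?s = "\<lbrakk>h, g\<rbrakk>" and ?t = "\<lbrakk>g, \<lbrakk>h, g\<rbrakk>\<rbrakk>"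
  have s: "?s \<in> gam G 2" using cm_gam[of h 1 g] g h by (simp add: numeral_2_eq_2)
  have t: "?t \<in> gam G 3" using cm_gam'[OF s g] by (simp add: Suc2)
  have p: "\<lbrakk>g, ?t\<rbrakk> \<in> gam G 4" using cm_gam'[OF t g] by (simp add: Suc2)
  have cube: "?s [^] (3::nat) \<in> gam G 4" "?t [^] (3::nat) \<in> gam G 4" using cube2[of 2] cube3 s t by auto
  have "\<lbrakk>?s, ?t\<rbrakk> \<in> gam G 4" "\<lbrakk>?s, \<lbrakk>g, ?t\<rbrakk>\<rbrakk> \<in> gam G 4" "\<lbrakk>?t, \<lbrakk>g, ?t\<rbrakk>\<rbrakk> \<in> gam G 4"
    using gam2_comm s t p gam32 gam42 by blast+
  moreover have "?s [^] (3::nat) \<otimes> ?t [^] (3::nat) \<otimes> \<lbrakk>g, ?t\<rbrakk> \<in> gam G 4"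
    using cube p subgroup.m_closed[OF gam_subgroup] by blast
  ultimately show ?thesis using cm_cube_mod[OF gam_normal h g refl refl refl] by blast
qed

text \<open>The first cube reaches gamma_4 by \<open>cm_cube_gam4\<close>. Every further cube gains
  a step, since the cube of the previous commutator and the correction term are both one step
  deeper.\<close>

lemma cm_pow_gam:
  assumes g: "g \<in> carrier G" and h: "h \<in> carrier G" 
  shows "k \<ge> 1 \<Longrightarrow> \<lbrakk>h, g [^] ((3::nat) ^ k)\<rbrakk> \<in> gam G (k + 3)"
proof (induct k rule: nat_induct_at_least)
  case base show ?case using cm_cube_gam4[OF g h] by (simp add: Suc2)
next
  case (Suc k)
  let ?y = "g [^] ((3::nat) ^ k)"
  have yG: "?y \<in> carrier G" using g by simp
  have "\<lbrakk>?y, \<lbrakk>h, ?y\<rbrakk>\<rbrakk> \<in> gam G (Suc (k + 3))" by (rule cm_gam'[OF Suc(2) yG])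
  then have "\<lbrakk>h, ?y [^] (3::nat)\<rbrakk> \<in> gam G (Suc (k + 3))"
    using cm_cube_mod'[OF gam_normal h yG] cube1[OF _ Suc(2)] by simp
  moreover have "?y [^] (3::nat) = g [^] ((3::nat) ^ Suc k)" using nat_pow_pow[OF g] by (simp add: mult.commute)
  ultimately show ?case by simp
qed

lemma cube_gam2_mod:
  assumes g: "g \<in> carrier G" and h: "h \<in> carrier G" and m: "g [^] (3::nat) \<otimes> inv (h [^] (3::nat)) \<in> gam G 2"
  shows "gam G 4 #> g [^] (9::nat) = gam G 4 #> h [^] (9::nat)"
proof -
  let ?b = "h [^] (3::nat)" and ?m = "g [^] (3::nat) \<otimes> inv (h [^] (3::nat))"
  have e: "g [^] (3::nat) = ?m \<otimes> ?b" using g h by (simp add: m_assoc)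
  have "gam G 4 #> (?m \<otimes> ?b) [^] (3::nat) = gam G 4 #> (?m [^] (3::nat) \<otimes> ?b [^] (3::nat))"
    by (rule pow_mult_mod[OF gam_normal]) (use g h cm_cube_gam4[of h ?m] in auto)
  also have "\<dots> = gam G 4 #> ?b [^] (3::nat)"
    by (rule coset_drop[OF gam_normal]) (use cube2[OF _ m] h in auto)
  finally show ?thesis unfolding e[symmetric] using g h by (simp add: nat_pow_pow)
qed

lemma carrier_adj: "carrier G = adj (adj (gam G 2) y) x" "adj (gam G 2) y \<lhd> G"
proof -
  have s: "subgroup (adj (gam G 2) y) G" by (rule adj_subgroup[OF gam_subgroup y])
  show "adj (gam G 2) y \<lhd> G" using adj_sub(1) by (rule normal_above_derived[OF s])
  show "carrier G = adj (adj (gam G 2) y) x"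
    by (rule gen2_eq[OF gen adj_subgroup[OF s x], symmetric]) (auto intro: adj_sub subsetD[OF adj_sub(1)])
qed

lemma gam2_all: "a \<in> carrier G \<Longrightarrow> b \<in> carrier G \<Longrightarrow> \<lbrakk>a, b\<rbrakk> \<in> gam G 2"
  using cm_gam[of a 1 b] by (simp add: numeral_2_eq_2)

lemma adj_y_cube: "n \<in> adj (gam G 2) y \<Longrightarrow> n \<in> carrier G \<and> n [^] (3::nat) \<in> gam G 2"
proof -
  have S: "subgroup {a \<in> carrier G. a [^] (3::nat) \<in> gam G 2} G"
    by (intro cube_subgroup gam_normal subgroup_self gam2_all)
  have "adj (gam G 2) y \<subseteq> {a \<in> carrier G. a [^] (3::nat) \<in> gam G 2}"
    using y_pow2 subgroup.m_closed[OF gam_subgroup[of 2]] gam_carrier by (intro adj_least S) (auto simp: pow3)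
  then show "n \<in> adj (gam G 2) y \<Longrightarrow> n \<in> carrier G \<and> n [^] (3::nat) \<in> gam G 2" by blast
qed

text \<open>Modulo gamma_2 the cube of \<open>g\<close> is the cube of a power of \<open>x\<close>.
  Cubes are central modulo gamma_4 and cubes of gamma_2 lie in gamma_4, so the error disappears at
  the ninth power; this is where \<open>e \<ge> 2\<close> enters.\<close>

lemma pow_e_mod:
  assumes g: "g \<in> carrier G"
  shows "\<exists>i::int. gam G 4 #> g [^] ((3::nat) ^ e) = gam G 4 #> u [^] i"
proof -
  interpret N: normal "gam G 4" G by (rule gam_normal)
  obtain i :: int and n where n: "n \<in> adj (gam G 2) y" "g = n \<otimes> x [^] i"
    using adj_mem_int[OF carrier_adj(2) x, of g] g carrier_adj(1) by blast
  let ?h = "x [^] i"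
  have h: "?h \<in> carrier G" by simp
  have nG: "n \<in> carrier G" "n [^] (3::nat) \<in> gam G 2" using adj_y_cube[OF n(1)] by auto
  have "gam G 2 #> g [^] (3::nat) = gam G 2 #> (n [^] (3::nat) \<otimes> ?h [^] (3::nat))"
    unfolding n(2) by (rule pow_mult_mod[OF gam_normal nG(1) h gam2_all[OF nG(1) h]])
  also have "\<dots> = gam G 2 #> ?h [^] (3::nat)"
    by (rule coset_drop[OF gam_normal nG(2)]) simp
  finally have "g [^] (3::nat) \<otimes> inv (?h [^] (3::nat)) \<in> gam G 2"
    using subgroup.rcos_module_imp[OF gam_subgroup group_axioms, of "?h [^] (3::nat)"]
      rcos_self[OF _ gam_subgroup, of "g [^] (3::nat)"] g h by auto
  from cube_gam2_mod[OF g h this]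
  have "gam G 4 #> (g [^] (9::nat)) [^] ((3::nat) ^ (e - 2)) = gam G 4 #> (?h [^] (9::nat)) [^] ((3::nat) ^ (e - 2))"
    using N.FactGroup_pow[of "g [^] (9::nat)" "3 ^ (e - 2)"] N.FactGroup_pow[of "?h [^] (9::nat)" "3 ^ (e - 2)"] g h by simp
  moreover have "(3::nat) ^ (2 + (e - 2)) = 3 ^ e" using le_add_diff_inverse[OF e2] by (rule arg_cong)
  then have "9 * (3::nat) ^ (e - 2) = 3 ^ e" unfolding power_add by simp
  ultimately have "gam G 4 #> g [^] ((3::nat) ^ e) = gam G 4 #> ?h [^] ((3::nat) ^ e)"
    using g h by (simp add: nat_pow_pow)
  moreover have "?h [^] ((3::nat) ^ e) = u [^] i"
    using int_pow_pow[OF x, of i "int (3 ^ e)"] int_pow_pow[OF x, of "int (3 ^ e)" i]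
      int_pow_int[of G ?h "3 ^ e"] int_pow_int[of G x "3 ^ e"] by (simp add: mult.commute)
  ultimately show ?thesis by auto
qed

end

context group
begin

text \<open>The index divides a power of 3, hence is neither one nor two.\<close>

lemma card_proper_subgroup:
  assumes fin: "finite (carrier G)" and o: "order G = 3 ^ n" and A: "subgroup A G" and B: "subgroup B G" "A \<subset> B"
  shows "3 * card A \<le> card B"
proof -
  interpret B: group "G\<lparr>carrier := B\<rparr>" by (rule subgroup_imp_group[OF B(1)])
  have sA: "subgroup A (G\<lparr>carrier := B\<rparr>)" using B(2) by (intro subgroup_incl A B(1)) auto
  define m where "m = card (rcosets\<^bsub>G\<lparr>carrier := B\<rparr>\<^esub> A)"
  have m: "card B = m * card A" using B.lagrange[OF sA] by (simp add: order_def m_def)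
  have "3 ^ n = card (rcosets B) * card B" using lagrange[OF B(1)] o by simp
  then have "m dvd 3 ^ n" using m by simp
  then have "m \<noteq> 2" using even_power[of "3::nat" n] by auto
  moreover have finB: "finite B" using fin subgroup.subset[OF B(1)] finite_subset by blast
  then have "card A < card B" using B(2) by (rule psubset_card_mono)
  then have "m > 1" unfolding m by (cases m) auto
  ultimately show ?thesis using m by simp
qed

end

section \<open>The Frattini subgroup and the derived subgroups of the maximal subgroups\<close>

context bicyc
begin

text \<open>This is the Frattini subgroup of \<open>G\<close>, of index 9 and contained in every
  maximal subgroup, see \<open>max_sub_gen\<close>.\<close>

definition Phi where "Phi = adj (gam G 2) (x [^] (3::nat))"

lemma Phi_normal: "Phi \<lhd> G" and gam2_Phi: "gam G 2 \<subseteq> Phi" and x3_Phi: "x [^] (3::nat) \<in> Phi"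
proof -
  have s: "subgroup Phi G" unfolding Phi_def by (rule adj_subgroup[OF gam_subgroup]) simp
  show g: "gam G 2 \<subseteq> Phi" unfolding Phi_def by (rule adj_sub)
  show "x [^] (3::nat) \<in> Phi" unfolding Phi_def by (rule adj_sub)
  show "Phi \<lhd> G" by (rule normal_above_derived[OF s g])
qed

lemma Phi_least: "subgroup K G \<Longrightarrow> gam G 2 \<subseteq> K \<Longrightarrow> x [^] (3::nat) \<in> K \<Longrightarrow> Phi \<subseteq> K"
  unfolding Phi_def by (rule adj_least)

lemma Phi_fin: "finite Phi"
  using fin subgroup.subset[OF normal_imp_subgroup[OF Phi_normal]] finite_subset by blast

lemma card_Phi: "card Phi \<le> 3 ^ (e - 1) * card (gam G 2)"
proof -
  have "3 * (3::nat) ^ (e - 1) = 3 ^ e" using e2 by (cases e) auto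
  then have "(x [^] (3::nat)) [^] ((3::nat) ^ (e - 1)) = u" by (simp add: nat_pow_pow)
  then show ?thesis unfolding Phi_def
    using card_adj_le(2)[OF gam_normal gam_fin, of "x [^] (3::nat)" "3 ^ (e - 1)" 2] x_pow2 by simp
qed

lemma card_carrier_Phi: "card (carrier G) \<ge> 9 * card Phi"
proof -
  have "2 + (e - 1) = e + 1" using e2 by simp
  then have "(3::nat) ^ (2 + (e - 1)) = 3 ^ (e + 1)" by (rule arg_cong)
  then have "(3::nat) ^ (e + 1) = 9 * 3 ^ (e - 1)" unfolding power_add by simp
  then show ?thesis using card_Phi unfolding card_carrier by simp
qed

lemma cube_Phi: "g \<in> carrier G \<Longrightarrow> g [^] (3::nat) \<in> Phi"
proof -
  have S: "subgroup {a \<in> carrier G. a [^] (3::nat) \<in> Phi} G"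
    using gam2_all gam2_Phi by (intro cube_subgroup Phi_normal subgroup_self) blast
  have "{a \<in> carrier G. a [^] (3::nat) \<in> Phi} = carrier G"
    by (rule gen2_eq[OF gen S]) (use x3_Phi y_pow2 gam2_Phi in auto)
  then show "g \<in> carrier G \<Longrightarrow> g [^] (3::nat) \<in> Phi" by blast
qed

lemma card_adj_Phi: "h \<in> carrier G \<Longrightarrow> card (adj Phi h) \<le> 3 * card Phi" "h \<in> carrier G \<Longrightarrow> finite (adj Phi h)"
  using card_adj_le[OF Phi_normal Phi_fin _ cube_Phi] by auto

text \<open>Two generators with cubes in \<open>Phi\<close> give index at most 9, and the orders
  give at least 9. A maximal subgroup has index 3, so it is generated over \<open>Phi\<close> by any
  of its elements outside \<open>Phi\<close>.\<close>

lemma max_sub_gen: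
  assumes o: "order G = 3 ^ n" and H: "max_sub G H"
  shows "Phi \<subseteq> H" "H \<lhd> G" "\<exists>h\<in>H. h \<notin> Phi" "h \<in> H \<Longrightarrow> h \<notin> Phi \<Longrightarrow> H = adj Phi h"
proof -
  have sH: "subgroup H G" and nH: "H \<lhd> G" using H max_sub_gam2[OF nil H] by (auto simp: max_sub_def)
  show "H \<lhd> G" by (rule nH)
  have finH: "finite H" using fin subgroup.subset[OF sH] finite_subset by blast
  show PH: "Phi \<subseteq> H"
    using max_sub_gam2[OF nil H] max_sub_index(1)[OF fin o nil H x] by (intro Phi_least sH)
  have cH: "card (carrier G) = 3 * card H" by (rule max_sub_index[OF fin o nil H])
  have P0: "card Phi > 0" using Phi_fin subgroup.one_closed[OF normal_imp_subgroup[OF Phi_normal]] card_gt_0_iff by blast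
  show "\<exists>h\<in>H. h \<notin> Phi"
  proof (rule ccontr)
    assume "\<not> ?thesis"
    then have "card H \<le> card Phi" using Phi_fin by (intro card_mono) auto
    then show False using card_carrier_Phi cH P0 by simp
  qed
  show "H = adj Phi h" if h: "h \<in> H" "h \<notin> Phi"
  proof -
    have hG: "h \<in> carrier G" by (rule subgroup.mem_carrier[OF sH h(1)])
    let ?K = "adj Phi h"
    have KH: "?K \<subseteq> H" by (rule adj_least[OF sH PH h(1)])
    have sK: "subgroup ?K G" by (rule adj_subgroup[OF normal_imp_subgroup[OF Phi_normal] hG])
    have "card (carrier G) \<le> 9 * card Phi"
    proof -
      have n: "adj Phi y \<lhd> G"
        using gam2_Phi adj_sub(1) by (intro normal_above_derived adj_subgroup normal_imp_subgroup[OF Phi_normal]) auto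
      have "adj (adj Phi y) x = carrier G"
        by (rule gen2_eq[OF gen adj_subgroup[OF normal_imp_subgroup[OF n] x]])
          (auto intro: adj_sub subsetD[OF adj_sub(1)])
      moreover have "x [^] (3::nat) \<in> adj Phi y" using x3_Phi adj_sub(1) by blast
      ultimately have "card (carrier G) \<le> 3 * card (adj Phi y)"
        using card_adj_le(2)[OF n card_adj_Phi(2)[OF y] x, of 3] by simp
      then show ?thesis using card_adj_Phi(1)[OF y] by simp
    qed
    moreover have "3 * card Phi \<le> card ?K"
      using card_proper_subgroup[OF fin o normal_imp_subgroup[OF Phi_normal] sK] adj_sub[where N=Phi and a=h] h(2) by blast
    ultimately have "card H \<le> card ?K" using cH by simp
    then show ?thesis using card_seteq[OF finH KH] by simp
  qed
qed

text \<open>Modulo gamma_4, x^3 is central and gamma_2 is abelian. The only commutators left are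
  those of \<open>h\<close> with gamma_2, and they are powers of [h,s] modulo gamma_4.\<close>

lemma derived_max_sub:
  assumes h: "h \<in> carrier G" and a: "a \<in> adj Phi h" and b: "b \<in> adj Phi h"
  shows "\<lbrakk>a, b\<rbrakk> \<in> R h"
proof -
  let ?M = "R h" and ?H = "adj Phi h"
  note nM = R_normal[OF h]
  note sM = normal_imp_subgroup[OF nM]
  note C = Cent_subgroup[OF nM]
  have M4: "gam G 4 \<subseteq> ?M" by (rule R_mem)
  have PhiG: "f \<in> carrier G" if "f \<in> Phi" for f
    using that subgroup.mem_carrier[OF normal_imp_subgroup[OF Phi_normal]] by blast
  have HG: "f \<in> carrier G" if "f \<in> ?H" for f
    using that subgroup.mem_carrier[OF adj_subgroup[OF normal_imp_subgroup[OF Phi_normal] h]] by blast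
  have x3: "x [^] (3::nat) \<in> Cent ?M f" if "f \<in> carrier G" for f
    using cm_cube_gam4[OF x that] M4 by (auto simp: Cent_iff)
  have "adj (gam G 3) s \<subseteq> Cent ?M h"
  proof (rule adj_least[OF C[OF h]])
    show "gam G 3 \<subseteq> Cent ?M h"
    proof
      fix f assume f: "f \<in> gam G 3"
      show "f \<in> Cent ?M h" using cm_gam'[OF f h] M4 gam_carrier[OF f] by (auto simp: Cent_iff Suc2)
    qed
    show "s \<in> Cent ?M h" using R_mem(2) by (simp add: Cent_iff)
  qed
  then have hPhi: "Phi \<subseteq> Cent ?M h" using gam2_adj x3[OF h] by (intro Phi_least C h) auto
  have A: "Phi \<subseteq> Cent ?M f" if f: "f \<in> gam G 2" for f
  proof (rule Phi_least[OF C[OF gam_carrier[OF f]]])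
    show "gam G 2 \<subseteq> Cent ?M f" using gam2_comm[OF f] M4 gam_sub by (rule sub_CentI)
    show "x [^] (3::nat) \<in> Cent ?M f" by (rule x3[OF gam_carrier[OF f]])
  qed
  have B: "?H \<subseteq> Cent ?M f" if f: "f \<in> Phi" for f
  proof (rule adj_least[OF C[OF PhiG[OF f]]])
    show "Phi \<subseteq> Cent ?M f"
    proof (rule Phi_least[OF C[OF PhiG[OF f]]])
      show "gam G 2 \<subseteq> Cent ?M f"
      proof
        fix k assume k: "k \<in> gam G 2"
        show "k \<in> Cent ?M f" by (rule Cent_swap[OF sM gam_carrier[OF k]]) (use A[OF k] f in blast)
      qed
      show "x [^] (3::nat) \<in> Cent ?M f" by (rule x3[OF PhiG[OF f]])
    qed
    show "h \<in> Cent ?M f" by (rule Cent_swap[OF sM h]) (use hPhi f in blast)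
  qed
  have "?H \<subseteq> Cent ?M a"
  proof (rule adj_least[OF C[OF HG[OF a]]])
    show "Phi \<subseteq> Cent ?M a"
    proof
      fix k assume k: "k \<in> Phi"
      show "k \<in> Cent ?M a" by (rule Cent_swap[OF sM PhiG[OF k]]) (use B[OF k] a in blast)
    qed
    have "?H \<subseteq> Cent ?M h" using hPhi Cent_self[OF sM h] by (intro adj_least C h)
    then show "h \<in> Cent ?M a" using a by (intro Cent_swap[OF sM h]) blast
  qed
  then show ?thesis using b by (auto simp: Cent_iff)
qed

lemma derived_max_sub':
  assumes h: "h \<in> carrier G" shows "derived G (adj Phi h) \<subseteq> R h"
  unfolding derived_def
proof (rule generate_subgroup_incl[OF _ normal_imp_subgroup[OF R_normal[OF h]]])
  show "derived_set G (adj Phi h) \<subseteq> R h"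
    using derived_max_sub[OF h] unfolding cm_def by blast
qed

text \<open>If [h,s] were in gamma_4, then \<open>H\<close> and any further element r would
  centralize \<open>s\<close> modulo \<open>R r\<close>. This would force gamma_3 into
  \<open>R r\<close>, which is too small.\<close>

lemma cm_max_sub_gam4:
  assumes H: "max_sub G H" and h: "h \<in> carrier G" "H = adj Phi h"
  shows "\<lbrakk>h, s\<rbrakk> \<notin> gam G 4"
proof
  assume a: "\<lbrakk>h, s\<rbrakk> \<in> gam G 4"
  have sH: "subgroup H G" using H by (simp add: max_sub_def)
  obtain r where r: "r \<in> carrier G" "r \<notin> H" using H subgroup.subset[OF sH] by (auto simp: max_sub_def)
  note C = Cent_subgroup[OF R_normal[OF r(1)], of s]
  note sM = normal_imp_subgroup[OF R_normal[OF r(1)]]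
  have M4: "gam G 4 \<subseteq> R r" by (rule R_mem)
  have "Phi \<subseteq> Cent (R r) s"
  proof (rule Phi_least[OF C])
    show "gam G 2 \<subseteq> Cent (R r) s" using gam2_comm[OF s_gam] M4 gam_sub by (rule sub_CentI)
    show "x [^] (3::nat) \<in> Cent (R r) s" using cm_cube_gam4[OF x, of s] M4 by (auto simp: Cent_iff)
  qed simp
  moreover have "h \<in> Cent (R r) s" "r \<in> Cent (R r) s"
    using cm_swap[OF sM _ h(1), of s] cm_swap[OF sM R_mem(2) r(1)] a M4 h(1) r(1) by (auto simp: Cent_iff)
  ultimately have "adj H r \<subseteq> Cent (R r) s"
    using C unfolding h(2) by (intro adj_least) auto
  then have "carrier G \<subseteq> Cent (R r) s" using max_sub_adj[OF H r] by simp
  then have "gam G 3 \<subseteq> R r"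
    using cm_swap[OF sM, of s] by (intro gam3_least' R_normal r M4) (auto simp: Cent_def)
  then show False using gam3_not_sub_R[OF r(1)] by simp
qed

lemma pow_e_gam3: "g \<in> carrier G \<Longrightarrow> g [^] ((3::nat) ^ e) \<in> gam G 3"
proof -
  assume g: "g \<in> carrier G"
  obtain i :: int where i: "gam G 4 #> g [^] ((3::nat) ^ e) = gam G 4 #> u [^] i" using pow_e_mod[OF g] by blast
  have "u [^] i \<in> gam G 3" by (rule subgroup_int_pow_closed[OF gam_subgroup u_gam3])
  then show ?thesis using coset_mem_iff[OF gam_normal _ _ i gam43 gam_subgroup] g by simp
qed

end

section \<open>Ranks of the maximal subgroups\<close>

context group
begin

text \<open>The Frattini subgroup of a 3-group \<open>H\<close>, formed with the operations of
  \<open>G\<close>; \<open>Frat_consistent\<close> identifies it with the expression inside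
  \<open>rank3\<close>.\<close>

definition Frat where "Frat H = generate G ({a [^] (3::nat) | a. a \<in> H} \<union> derived G H)"

lemma Frat_gen_sub: "subgroup H G \<Longrightarrow> {a [^] (3::nat) | a. a \<in> H} \<union> derived G H \<subseteq> H"
proof -
  assume H: "subgroup H G"
  have "derived G H \<subseteq> H" by (rule derived_incl[OF order_refl H])
  moreover have "a [^] (3::nat) \<in> H" if "a \<in> H" for a
    using that subgroup.m_closed[OF H] subgroup.mem_carrier[OF H] by (simp add: pow3)
  ultimately show ?thesis by blast
qed

lemma Frat_subgroup: "subgroup H G \<Longrightarrow> subgroup (Frat H) G"
  and Frat_sub: "subgroup H G \<Longrightarrow> Frat H \<subseteq> H"
  unfolding Frat_def
  using Frat_gen_sub[of H] subgroup.subset[of H G] generate_subgroup_incl[OF Frat_gen_sub]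
  by (auto intro!: generate_is_subgroup)

lemma Frat_normal:
  assumes H: "H \<lhd> G"
  shows "Frat H \<lhd> G"
  unfolding Frat_def
proof (rule normal_generateI)
  interpret H: normal H G by (rule H)
  interpret D: normal "derived G H" G by (rule derived_is_normal[OF H])
  show "{a [^] (3::nat) | a. a \<in> H} \<union> derived G H \<subseteq> carrier G"
    using Frat_gen_sub[OF H.is_subgroup] H.subset by blast
  fix h g assume h: "h \<in> {a [^] (3::nat) | a. a \<in> H} \<union> derived G H" and g: "g \<in> carrier G"
  show "g \<otimes> h \<otimes> inv g \<in> {a [^] (3::nat) | a. a \<in> H} \<union> derived G H"
  proof (cases "h \<in> derived G H")
    case False
    then obtain a where a: "a \<in> H" "h = a [^] (3::nat)" using h by blast
    then have "g \<otimes> h \<otimes> inv g = (g \<otimes> a \<otimes> inv g) [^] (3::nat)" using g by (simp add: pow3 word)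
    then show ?thesis using H.inv_op_closed2[OF g a(1)] by blast
  qed (use D.inv_op_closed2[OF g] in blast)
qed

lemma Frat_cube: "a \<in> H \<Longrightarrow> a [^] (3::nat) \<in> Frat H"
  unfolding Frat_def by (rule generate.incl) blast

lemma Frat_cm: "a \<in> H \<Longrightarrow> b \<in> H \<Longrightarrow> \<lbrakk>a, b\<rbrakk> \<in> Frat H"
  unfolding Frat_def derived_def cm_def by (intro generate.incl UnI2) blast

lemma Frat_consistent:
  assumes "subgroup H G"
  shows "generate (G\<lparr>carrier := H\<rparr>) ({x [^]\<^bsub>G\<lparr>carrier := H\<rparr>\<^esub> (3::nat) | x. x \<in> H} \<union> derived (G\<lparr>carrier := H\<rparr>) H) = Frat H"
  using generate_consistent[OF Frat_gen_sub[OF assms] assms] derived_consistent[OF order_refl assms]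
  unfolding Frat_def by (simp add: nat_pow_consistent[symmetric])

lemma card_subgroup_pow3:
  assumes "finite (carrier G)" "order G = 3 ^ n" "subgroup H G"
  shows "\<exists>k. card H = 3 ^ k"
proof -
  have "card H dvd 3 ^ n" using lagrange[OF assms(3)] assms(2) by (metis dvd_triv_right)
  then show ?thesis using divides_primepow_nat[of 3 "card H" n] by auto
qed

lemma rank3_eq:
  assumes fin: "finite (carrier G)" and o: "order G = 3 ^ n" and H: "subgroup H G"
  shows "rank3 (G\<lparr>carrier := H\<rparr>) = d \<longleftrightarrow> card H = 3 ^ d * card (Frat H)"
proof -
  obtain k l where k: "card H = 3 ^ k" and l: "card (Frat H) = 3 ^ l"
    using card_subgroup_pow3[OF fin o] H Frat_subgroup[OF H] by metis
  have "card (Frat H) \<le> card H"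
    using Frat_sub[OF H] finite_subset[OF subgroup.subset[OF H] fin] by (intro card_mono)
  then have "l \<le> k" unfolding k l by simp
  then have iff: "card H = 3 ^ d * card (Frat H) \<longleftrightarrow> d = k - l" for d
    unfolding k l power_add[symmetric] by auto
  have "rank3 (G\<lparr>carrier := H\<rparr>) = (THE d. card H = 3 ^ d * card (Frat H))"
    unfolding rank3_def using Frat_consistent[OF H] by simp
  then show ?thesis unfolding iff by auto
qed

end

context bicyc
begin

text \<open>\<open>H\<close> is abelian modulo \<open>R h\<close>, so its Frattini subgroup lies in
  <h^3>R h. By hypothesis this has order at most 3^(e-1) times 3 |gamma_4|, whereas |H| is 3^e times
  27 |gamma_4|.\<close>

lemma rank_ge3:
  assumes h: "h \<in> carrier G" and H: "H = adj (gam G 2) h" and HP: "H \<subseteq> adj Phi h"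
    and cH: "card (carrier G) = 3 * card H" and sH: "subgroup H G"
    and uR: "h [^] ((3::nat) ^ e) \<in> R h"
  shows "27 * card (Frat H) \<le> card H"
proof -
  let ?P = "adj (R h) (h [^] (3::nat))"
  have h3: "h [^] (3::nat) \<in> carrier G" using h by simp
  have sP: "subgroup ?P G" by (intro adj_subgroup normal_imp_subgroup R_normal h h3)
  have R_P: "R h \<subseteq> ?P" by (rule adj_sub)
  have e1: "3 * (3::nat) ^ (e - 1) = 3 ^ e" using e2 by (cases e) auto
  then have "(h [^] (3::nat)) [^] ((3::nat) ^ (e - 1)) \<in> R h" using uR h by (simp add: nat_pow_pow)
  then have cP: "finite ?P" "card ?P \<le> 3 ^ (e - 1) * card (R h)"
    using card_adj_le[OF R_normal[OF h] R_fin[OF h] h3, of "3 ^ (e - 1)"] by auto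
  have "derived G H \<subseteq> ?P" using derived_max_sub'[OF h] mono_derived[OF HP] R_P by blast
  moreover have "a [^] (3::nat) \<in> ?P" if a: "a \<in> H" for a
  proof -
    obtain k :: int and n where n: "n \<in> gam G 2" "a = n \<otimes> h [^] k"
      using adj_mem_int[OF gam_normal h] a H by blast
    have nG: "n \<in> carrier G" by (rule gam_carrier[OF n(1)])
    have nP: "n \<in> adj Phi h" "h [^] k \<in> adj Phi h"
      using gam2_Phi adj_sub(1) n(1)
      by (auto intro!: subgroup_int_pow_closed adj_subgroup normal_imp_subgroup[OF Phi_normal] h adj_sub)
    have "R h #> a [^] (3::nat) = R h #> (n [^] (3::nat) \<otimes> (h [^] k) [^] (3::nat))"
      unfolding n(2) by (rule pow_mult_mod[OF R_normal[OF h] nG _ derived_max_sub[OF h nP]]) (use h in simp)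
    moreover have "(h [^] k) [^] (3::nat) = (h [^] (3::nat)) [^] k"
      using int_pow_pow[OF h, of k 3] int_pow_pow[OF h, of 3 k] int_pow_int[of G "h [^] k" 3] int_pow_int[of G h 3]
      by (simp add: mult.commute)
    moreover have "(h [^] (3::nat)) [^] k \<in> ?P" by (rule subgroup_int_pow_closed[OF sP adj_sub(2)])
    moreover have "n [^] (3::nat) \<in> ?P" using cube2[OF _ n(1)] R_mem(1)[of h] R_P by auto
    ultimately show ?thesis
      using coset_mem_iff[OF R_normal[OF h], of "a [^] (3::nat)" "n [^] (3::nat) \<otimes> (h [^] k) [^] (3::nat)" ?P] sP R_P
        subgroup.m_closed[OF sP] nG h n(2) by simp
  qed
  ultimately have "Frat H \<subseteq> ?P" unfolding Frat_def by (intro generate_subgroup_incl sP) blast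
  then have "card (Frat H) \<le> card ?P" by (intro card_mono cP)
  also have "\<dots> \<le> 3 ^ (e - 1) * (3 * card (gam G 4))" using cP card_R_le[OF h] mult_le_mono2 le_trans by blast
  finally have "27 * card (Frat H) \<le> 27 * (3 ^ (e - 1) * (3 * card (gam G 4)))" by (rule mult_le_mono2)
  also have "\<dots> = 3 * 3 ^ (e - 1) * (27 * card (gam G 4))" by simp
  also have "\<dots> = card H" using cH unfolding card_carrier e1 card24 by simp
  finally show ?thesis .
qed

lemma gam3_eq_adj_R:
  assumes o: "order G = 3 ^ n" and h: "h \<in> carrier G" "\<lbrakk>h, s\<rbrakk> \<notin> gam G 4" and b: "b \<in> gam G 3" "b \<notin> R h"
  shows "gam G 3 = adj (R h) b"
proof -
  note sR = normal_imp_subgroup[OF R_normal[OF h(1)]]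
  have sA: "subgroup (adj (R h) b) G" by (rule adj_subgroup[OF sR gam_carrier[OF b(1)]])
  have "gam G 4 \<subset> R h" using R_mem[of h] h(2) by blast
  then have 1: "3 * card (gam G 4) \<le> card (R h)" by (rule card_proper_subgroup[OF fin o gam_subgroup sR])
  have "R h \<subset> adj (R h) b" using adj_sub[where N = "R h" and a = b] b(2) by blast
  then have 2: "3 * card (R h) \<le> card (adj (R h) b)" by (rule card_proper_subgroup[OF fin o sR sA])
  have "adj (R h) b \<subseteq> gam G 3" using b R_sub[OF h(1)] by (intro adj_least gam_subgroup)
  then show ?thesis using card_seteq[OF gam_fin, of "adj (R h) b" 3] 1 2 card34 by simp
qed

lemma gam3_sub_normal:
  assumes o: "order G = 3 ^ n" and h: "h \<in> carrier G" "\<lbrakk>h, s\<rbrakk> \<notin> gam G 4" and b: "b \<in> gam G 3" "b \<notin> R h"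
    and M: "M \<lhd> G" "\<lbrakk>h, s\<rbrakk> \<in> M" "b \<in> M"
  shows "gam G 3 \<subseteq> M"
proof -
  note K = set_mult_normal[OF M(1) gam_normal[of 4]]
  note sK = normal_imp_subgroup[OF K(1)]
  have "R h \<subseteq> M <#> gam G 4" unfolding R_def using M(2) K by (intro adj_least sK) auto
  then have "gam G 3 \<subseteq> M <#> gam G 4"
    unfolding gam3_eq_adj_R[OF o h b] using M(3) K by (intro adj_least sK) auto
  then show ?thesis using nakayama[OF M(1), of 3 c] nil by (simp add: Suc2)
qed

text \<open>Both [h,s] and h^(3^e) lie in the Frattini subgroup of \<open>H\<close>, and they are
  independent modulo gamma_4. So gamma_3 lies in it by \<open>nakayama\<close>, and \<open>H\<close>
  is generated over it by \<open>h\<close> and \<open>s\<close>.\<close>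

lemma rank_le2:
  assumes o: "order G = 3 ^ n" and H: "H \<lhd> G" "H = adj (gam G 2) h" and h: "h \<in> carrier G" "\<lbrakk>h, s\<rbrakk> \<notin> gam G 4"
    and uR: "h [^] ((3::nat) ^ e) \<notin> R h"
  shows "card H \<le> 9 * card (Frat H)"
proof -
  let ?M = "Frat H"
  have nM: "?M \<lhd> G" by (rule Frat_normal[OF H(1)])
  note sM = normal_imp_subgroup[OF nM]
  have sH: "subgroup H G" by (rule normal_imp_subgroup[OF H(1)])
  have hH: "h \<in> H" "s \<in> H" using adj_sub[where N = "gam G 2" and a = h] s_gam H(2) by blast+
  have e1: "3 ^ (e - 1) * 3 = (3::nat) ^ e" using e2 by (cases e) auto
  have "h [^] ((3::nat) ^ (e - 1)) \<in> H"
    using subgroup_int_pow_closed[OF sH hH(1), of "int (3 ^ (e-1))"] int_pow_int[of G h "3 ^ (e-1)"] by simp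
  then have "(h [^] ((3::nat) ^ (e - 1))) [^] (3::nat) \<in> ?M" by (rule Frat_cube)
  then have uM: "h [^] ((3::nat) ^ e) \<in> ?M" using h e1 by (simp add: nat_pow_pow)
  have g3: "gam G 3 \<subseteq> ?M"
    by (rule gam3_sub_normal[OF o h pow_e_gam3[OF h(1)] uR nM Frat_cm[OF hH] uM])
  have finM: "finite ?M" using fin subgroup.subset[OF sM] finite_subset by blast
  have sK: "subgroup (adj ?M s) G" by (rule adj_subgroup[OF sM]) simp
  have "adj (gam G 3) s \<subseteq> adj ?M s" using g3 by (intro mono_generate) blast
  then have g2: "gam G 2 \<subseteq> adj ?M s" using gam2_adj by blast
  have nK: "adj ?M s \<lhd> G" by (rule normal_above_derived[OF sK g2])
  have cK: "finite (adj ?M s)" "card (adj ?M s) \<le> 3 * card ?M"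
    using card_adj_le[OF nM finM, of s 3] Frat_cube[OF hH(2)] by auto
  have "adj (gam G 2) h \<subseteq> adj (adj ?M s) h" using insert_mono[OF g2] by (rule mono_generate)
  then have "H \<subseteq> adj (adj ?M s) h" by (rule ord_eq_le_trans[OF H(2)])
  moreover have "h [^] (3::nat) \<in> adj ?M s" using Frat_cube[OF hH(1)] adj_sub(1) by blast
  ultimately have "card H \<le> 3 * card (adj ?M s)"
    using card_adj_le[OF nK cK(1) h(1), of 3] card_mono[of "adj (adj ?M s) h" H] by simp
  then show ?thesis using cK by simp
qed

lemma pow_e_mod':
  assumes g: "g \<in> carrier G"
  shows "\<exists>i::int. \<exists>n \<in> adj (gam G 2) y. g = n \<otimes> x [^] i"
  using adj_mem_int[OF carrier_adj(2) x, of g] g carrier_adj(1) by blast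

text \<open>If 3 divided \<open>i\<close>, then h^(3^(e-1)) would lie in gamma_2 and <h>gamma_2
  would have index at least 9.\<close>

lemma cyc_gen_coprime:
  assumes h: "h \<in> carrier G" "h = n \<otimes> x [^] (i::int)" "n \<in> adj (gam G 2) y"
    and cH: "card (carrier G) = 3 * card (adj (gam G 2) h)"
  shows "\<not> 3 dvd i"
proof
  assume "3 dvd i"
  then obtain j where j: "i = 3 * j" by blast
  let ?m = "3 ^ (e - 1) :: nat"
  have nG: "n \<in> carrier G" "n [^] (3::nat) \<in> gam G 2" using adj_y_cube[OF h(3)] by auto
  have "gam G 2 #> h [^] ?m = gam G 2 #> (n [^] ?m \<otimes> (x [^] i) [^] ?m)"
    unfolding h(2) by (rule pow_mult_mod[OF gam_normal nG(1) _ gam2_all]) (use nG in auto)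
  moreover have "n [^] ?m \<in> gam G 2"
  proof -
    have m: "?m = 3 * 3 ^ (e - 2)" using e2 power_Suc[of "3::nat" "e - 2"] by (simp add: Suc_diff_le[symmetric] numeral_2_eq_2)
    have "(n [^] (3::nat)) [^] ((3::nat) ^ (e - 2)) \<in> gam G 2"
      using subgroup_int_pow_closed[OF gam_subgroup nG(2), of "int (3 ^ (e - 2))"] int_pow_int[of G _ "3 ^ (e-2)"] by simp
    then show ?thesis unfolding m using nG by (simp add: nat_pow_pow)
  qed
  moreover have "(x [^] i) [^] ?m \<in> gam G 2"
  proof -
    have "3 * int ?m = int (3 ^ e)" using e2 by (cases e) auto
    then have "i * int ?m = int (3 ^ e) * j" unfolding j by (metis mult.commute mult.left_commute)
    then have "(x [^] i) [^] ?m = u [^] j"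
      using int_pow_pow[OF x, of i "int ?m"] int_pow_pow[OF x, of "int (3 ^ e)" j]
        int_pow_int[of G "x [^] i" ?m] int_pow_int[of G x "3 ^ e"] by simp
    then show ?thesis using subgroup_int_pow_closed[OF gam_subgroup x_pow2] by simp
  qed
  ultimately have "h [^] ?m \<in> gam G 2"
    using coset_mem_iff[OF gam_normal _ _ _ order_refl gam_subgroup, of "h [^] ?m" "n [^] ?m \<otimes> (x [^] i) [^] ?m" 2] h(1) nG
      subgroup.m_closed[OF gam_subgroup[of 2], of "n [^] ?m" "(x [^] i) [^] ?m"] by simp
  then have "card (adj (gam G 2) h) \<le> ?m * card (gam G 2)"
    using card_adj_le(2)[OF gam_normal gam_fin h(1), of ?m 2] by simp
  then have "3 ^ (e + 1) * card (gam G 2) \<le> 3 * (?m * card (gam G 2))" using cH card_carrier by simp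
  also have "3 * (?m * card (gam G 2)) = 3 ^ e * card (gam G 2)" using e2 by (cases e) auto
  finally have "3 * (3 ^ e * card (gam G 2)) \<le> 3 ^ e * card (gam G 2)" by simp
  then show False using gam_card_pos[of 2] by simp
qed

text \<open>The \<open>x\<close>-exponent of \<open>h\<close> is prime to 3, so a Bezout relation
  with 3^e recovers \<open>x\<close> from \<open>h\<close>, \<open>y\<close> and gamma_2; the
  Frattini argument then discards gamma_2.\<close>

lemma change_generator:
  assumes h: "h \<in> carrier G" and cH: "card (carrier G) = 3 * card (adj (gam G 2) h)"
  shows "bicyc G e c h y"
proof -
  obtain i :: int and n where n: "n \<in> adj (gam G 2) y" "h = n \<otimes> x [^] i" using pow_e_mod'[OF h] by blast
  have nG: "n \<in> carrier G" using adj_y_cube[OF n(1)] by auto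
  have "Factorial_Ring.prime (3::int)" by simp
  then have "coprime 3 i" using cyc_gen_coprime[OF h n(2,1) cH] by (rule prime_imp_coprime)
  then have "gcd i (3 ^ e) = 1" by (simp add: coprime_iff_gcd_eq_1[symmetric] coprime_commute)
  then obtain a b where ab: "a * i + b * 3 ^ e = 1" using bezout_int[of i "3 ^ e"] by metis
  have hy: "generate G {h, y} = carrier G"
  proof (rule frattini[OF fin nil])
    show "subgroup (generate G {h, y}) G" using h by (intro generate_is_subgroup) auto
    fix S assume S: "subgroup S G" "generate G {h, y} \<subseteq> S" "gam G 2 \<subseteq> S"
    interpret S: subgroup S G by (rule S(1))
    have hS: "h \<in> S" "y \<in> S" using S(2) generate.incl[of _ "{h, y}" G] by auto
    have nS: "n \<in> S" using adj_least[OF S(1,3) hS(2)] n(1) by blast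
    have "x [^] i = inv n \<otimes> h" unfolding n(2) using nG by (simp add: word)
    then have xi: "x [^] i \<in> S" using nS hS by simp
    have "x = x [^] (a * i + b * 3 ^ e)" using ab by simp
    also have "\<dots> = x [^] (a * i) \<otimes> x [^] (b * 3 ^ e)" by (rule int_pow_mult[OF x])
    also have "x [^] (a * i) = (x [^] i) [^] a" using int_pow_pow[OF x, of i a] by (simp add: mult.commute)
    also have "x [^] (b * 3 ^ e) = u [^] b"
      using int_pow_pow[OF x, of "int (3 ^ e)" b] int_pow_int[of G x "3 ^ e"] by (simp add: mult.commute)
    finally have ex: "x = (x [^] i) [^] a \<otimes> u [^] b" .
    have "(x [^] i) [^] a \<otimes> u [^] b \<in> S"
      using subgroup_int_pow_closed[OF S(1) xi] subgroup_int_pow_closed[OF S(1), of u b] x_pow2 S(3) by blast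
    then have "x \<in> S" by (subst ex)
    then show "S = carrier G" using gen2_eq[OF gen S(1)] hS by blast
  qed
  have "h [^] ((3::nat) ^ e) \<in> gam G 2" using pow_e_gam3[OF h] gam32 by blast
  then show ?thesis
    by unfold_locales (use fin e2 c3 h hy y_pow2 nil card_carrier card24 card_step in auto)
qed

end

section \<open>The distinguished generator, and commutation with a generator along the lower central
  series\<close>

context bicyc
begin

lemma cyc_max_gen:
  assumes o: "order G = 3 ^ n" and H: "max_sub G H" "cyc_quot G H"
  shows "\<exists>h\<in>H. H = adj (gam G 2) h \<and> H = adj Phi h"
proof -
  obtain h where h: "h \<in> H" "H = adj (gam G 2) h"
    using H(2) unfolding cyc_quot_def cyc_mod_def gam2 by blast
  have "h \<notin> Phi"
  proof
    assume "h \<in> Phi"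
    then have "H \<subseteq> Phi" using h(2) adj_least[OF normal_imp_subgroup[OF Phi_normal] gam2_Phi] by blast
    then show False using max_sub_gen(3)[OF o H(1)] by blast
  qed
  then show ?thesis using h max_sub_gen(4)[OF o H(1) h(1)] by blast
qed

text \<open>Rank two of \<open>H1\<close> yields a 3^e-th power outside gamma_4. Modulo gamma_4 all
  such powers are powers of h^(3^e), so h^(3^e) is outside gamma_4 too. Rank three of
  \<open>H3\<close> forces it into \<open>R h\<close>.\<close>

lemma special_gen:
  assumes o: "order G = 3 ^ n" and H1: "max_sub G H1" "cyc_quot G H1" "rank3 (G\<lparr>carrier := H1\<rparr>) = 2"
    and H3: "max_sub G H3" "cyc_quot G H3" "rank3 (G\<lparr>carrier := H3\<rparr>) = 3"
  shows "\<exists>h\<in>carrier G. bicyc G e c h y \<and> H3 = adj (gam G 2) h \<and> h [^] ((3::nat) ^ e) \<notin> gam G 4 \<and>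
     h [^] ((3::nat) ^ e) \<in> adj (gam G 4) \<lbrakk>h, \<lbrakk>h, y\<rbrakk>\<rbrakk>"
proof -
  have s: "subgroup H1 G" "subgroup H3 G" using H1 H3 by (auto simp: max_sub_def)
  have i1: "card (carrier G) = 3 * card H1" "card (carrier G) = 3 * card H3"
    by (rule max_sub_index(2)[OF fin o nil H1(1)], rule max_sub_index(2)[OF fin o nil H3(1)])
  have F0: "card (Frat H) > 0" if "subgroup H G" for H
    using finite_subset[OF subgroup.subset[OF Frat_subgroup[OF that]] fin]
      subgroup.one_closed[OF Frat_subgroup[OF that]] card_gt_0_iff by blast
  obtain h1 where h1: "h1 \<in> H1" "H1 = adj (gam G 2) h1" "H1 = adj Phi h1" using cyc_max_gen[OF o H1(1,2)] by blast
  obtain h where h: "h \<in> H3" "H3 = adj (gam G 2) h" "H3 = adj Phi h" using cyc_max_gen[OF o H3(1,2)] by blast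
  have hG: "h1 \<in> carrier G" "h \<in> carrier G" using h h1 s subgroup.mem_carrier by metis+
  have r1: "card H1 = 9 * card (Frat H1)" and r3: "card H3 = 27 * card (Frat H3)"
    using H1(3) H3(3) unfolding rank3_eq[OF fin o s(1)] rank3_eq[OF fin o s(2)] by auto
  have "h1 [^] ((3::nat) ^ e) \<notin> R h1"
  proof
    assume "h1 [^] ((3::nat) ^ e) \<in> R h1"
    then have "27 * card (Frat H1) \<le> card H1"
      using rank_ge3[OF hG(1) h1(2) _ i1(1) s(1)] h1(3) by blast
    then show False using r1 F0[OF s(1)] by simp
  qed
  then have u1: "h1 [^] ((3::nat) ^ e) \<notin> gam G 4" using R_mem(1) by blast
  have nh: "\<lbrakk>h, s\<rbrakk> \<notin> gam G 4" by (rule cm_max_sub_gam4[OF H3(1) hG(2) h(3)])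
  have uR: "h [^] ((3::nat) ^ e) \<in> R h"
  proof (rule ccontr)
    assume "h [^] ((3::nat) ^ e) \<notin> R h"
    then have "card H3 \<le> 9 * card (Frat H3)"
      using rank_le2[OF o max_sub_gam2(1)[OF nil H3(1)] h(2) hG(2) nh] by blast
    then show False using r3 F0[OF s(2)] by simp
  qed
  have "card (carrier G) = 3 * card (adj (gam G 2) h)" using i1(2) h(2) by simp
  then have B: "bicyc G e c h y" by (rule change_generator[OF hG(2)])
  interpret B: bicyc G e c h y by (rule B)
  have u: "h [^] ((3::nat) ^ e) \<notin> gam G 4"
  proof
    assume a: "h [^] ((3::nat) ^ e) \<in> gam G 4"
    obtain i :: int where i: "gam G 4 #> h1 [^] ((3::nat) ^ e) = gam G 4 #> (h [^] ((3::nat) ^ e)) [^] i"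
      using B.pow_e_mod[OF hG(1)] by blast
    have "(h [^] ((3::nat) ^ e)) [^] i \<in> gam G 4" by (rule subgroup_int_pow_closed[OF gam_subgroup a])
    then have "h1 [^] ((3::nat) ^ e) \<in> gam G 4"
      using coset_mem_iff[OF gam_normal _ _ i order_refl gam_subgroup] hG by simp
    then show False using u1 by simp
  qed
  \<comment> \<open>\<open>R h\<close> is formed with the commutator \<open>s\<close> of the old
    pair, whereas the claim speaks of the new pair \<open>h\<close>, \<open>y\<close>.\<close>
  let ?M = "adj (gam G 4) \<lbrakk>h, \<lbrakk>h, y\<rbrakk>\<rbrakk>"
  have nM: "?M \<lhd> G" using B.R_normal[OF hG(2)] unfolding B.R_def .
  have M4: "gam G 4 \<subseteq> ?M" by (rule adj_sub)
  have "adj (gam G 3) \<lbrakk>h, y\<rbrakk> \<subseteq> Cent ?M h"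
  proof (rule adj_least[OF Cent_subgroup[OF nM hG(2)]])
    show "gam G 3 \<subseteq> Cent ?M h" using cm_gam'[OF _ hG(2), of _ 3] M4 gam_sub by (intro sub_CentI) (auto simp: Suc2)
    show "\<lbrakk>h, y\<rbrakk> \<in> Cent ?M h" using adj_sub(2)[of "\<lbrakk>h, \<lbrakk>h, y\<rbrakk>\<rbrakk>" "gam G 4"] hG(2) by (simp add: Cent_iff)
  qed
  then have "\<lbrakk>h, s\<rbrakk> \<in> ?M" using B.gam2_adj s_gam by (auto simp: Cent_iff)
  then have "R h \<subseteq> ?M" unfolding R_def by (intro adj_least normal_imp_subgroup[OF nM] M4)
  then show ?thesis using hG(2) B h(2) u uR by blast
qed

lemma gam3_sub_subgroup:
  assumes K: "subgroup K G" "gam G 4 \<subseteq> K" "z \<in> K" "t \<in> K"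
  shows "gam G 3 \<subseteq> K"
proof -
  have "subgroup (K \<inter> gam G 3) G" by (rule subgroups_Inter_pair[OF K(1) gam_subgroup])
  then have "K \<inter> gam G 3 \<lhd> G" by (rule normal_between[where k = 3]) (use K(2) gam43 in \<open>auto simp: Suc2\<close>)
  then have "gam G 3 \<subseteq> K \<inter> gam G 3" by (rule gam3_least) (use K gam43 t_gam z_gam in auto)
  then show ?thesis by blast
qed

lemma gam2_sub_subgroup:
  assumes K: "subgroup K G" "gam G 3 \<subseteq> K" "s \<in> K"
  shows "gam G 2 \<subseteq> K"
  using gam2_adj adj_least[OF K] by blast

text \<open>gamma_2/gamma_3 is cyclic, generated by \<open>s\<close>, which commutes with itself. So
  only commutators of gamma_2 with gamma_3 contribute, and these lie in gamma_5.\<close>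

lemma gam2_comm5: "a \<in> gam G 2 \<Longrightarrow> b \<in> gam G 2 \<Longrightarrow> \<lbrakk>a, b\<rbrakk> \<in> gam G 5"
proof -
  have A: "gam G 3 \<subseteq> Cent (gam G 5) a" if a: "a \<in> gam G 2" for a
  proof
    fix b assume b: "b \<in> gam G 3"
    have "\<lbrakk>b, a\<rbrakk> \<in> gam G 5" using cm_gam_gam2[OF b a] by (simp add: Suc2)
    then show "b \<in> Cent (gam G 5) a"
      using cm_swap[OF gam_subgroup _ gam_carrier[OF b] gam_carrier[OF a]] gam_carrier[OF b] by (simp add: Cent_iff)
  qed
  have "gam G 2 \<subseteq> Cent (gam G 5) s"
    by (intro gam2_sub_subgroup Cent_subgroup gam_normal A s_gam Cent_self gam_subgroup) simp_all
  then have "gam G 2 \<subseteq> Cent (gam G 5) a" if a: "a \<in> gam G 2" for a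
    using a A[OF a] gam_carrier[OF a] Cent_swap[OF gam_subgroup stzp(1)]
    by (intro gam2_sub_subgroup Cent_subgroup gam_normal) auto
  then show "a \<in> gam G 2 \<Longrightarrow> b \<in> gam G 2 \<Longrightarrow> \<lbrakk>a, b\<rbrakk> \<in> gam G 5"
    unfolding Cent_def by blast
qed

lemma conj_gam: "a \<in> gam G k \<Longrightarrow> g \<in> carrier G \<Longrightarrow> g \<otimes> a \<otimes> inv g \<in> gam G k"
  by (rule normal.inv_op_closed2[OF gam_normal])

lemma card_gam_le:
  assumes "4 \<le> k" "k \<le> c"
  shows "\<not> gam G k \<subseteq> gam G (Suc k)"
proof
  assume "gam G k \<subseteq> gam G (Suc k)"
  then have "card (gam G k) \<le> card (gam G (Suc k))" by (intro card_mono gam_fin)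
  then show False using card_step[OF assms] gam_card_pos[of "Suc k"] by simp
qed

lemma gam_gen:
  assumes o: "order G = 3 ^ n" and k: "4 \<le> k" "k \<le> c" and v: "v \<in> gam G k" "v \<notin> gam G (Suc k)"
  shows "gam G k = adj (gam G (Suc k)) v"
proof -
  have s: "subgroup (adj (gam G (Suc k)) v) G" by (rule adj_subgroup[OF gam_subgroup gam_carrier[OF v(1)]])
  have "gam G (Suc k) \<subset> adj (gam G (Suc k)) v" using adj_sub[where N = "gam G (Suc k)" and a = v] v(2) by blast
  then have "3 * card (gam G (Suc k)) \<le> card (adj (gam G (Suc k)) v)"
    by (rule card_proper_subgroup[OF fin o gam_subgroup s])
  then show ?thesis
    using card_seteq[OF gam_fin adj_normal_gam(2)[OF v(1)]] card_step[OF k] by simp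
qed

text \<open>On \<open>\<gamma>\<^sub>j/\<gamma>\<^sub>m\<close> the generators \<open>x\<close> and \<open>y\<close> act by commuting automorphisms.\<close>
lemma cmx_gam:
  assumes C: "\<And>a b. a \<in> gam G 2 \<Longrightarrow> b \<in> gam G j \<Longrightarrow> \<lbrakk>a, b\<rbrakk> \<in> gam G m" and j: "j \<ge> 3"
    and base: "\<And>a. a \<in> gam G j \<Longrightarrow> \<lbrakk>x, a\<rbrakk> \<in> gam G (j + 2)"
  shows "j \<le> k \<Longrightarrow> k + 2 \<le> m \<Longrightarrow> a \<in> gam G k \<Longrightarrow> \<lbrakk>x, a\<rbrakk> \<in> gam G (k + 2)"
proof (induct k arbitrary: a rule: dec_induct)
  case (step k)
  let ?N = "gam G (Suc (k + 2))" and ?K = "Cent (gam G (Suc (k + 2))) x \<inter> gam G (Suc k)"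
  have sK: "subgroup ?K G" by (intro subgroups_Inter_pair Cent_subgroup gam_normal gam_subgroup x)
  have K1: "gam G (Suc (Suc k)) \<subseteq> ?K"
  proof
    fix b assume b: "b \<in> gam G (Suc (Suc k))"
    show "b \<in> ?K" using cm_gam'[OF b x] gam_carrier[OF b] gam_Suc_sub[of "Suc k"] b by (auto simp: Cent_iff)
  qed
  have nK: "?K \<lhd> G" by (rule normal_between[OF sK K1]) blast
  have mN: "gam G m \<subseteq> ?N" using step by (intro gam_antimono) simp
  have k2: "gam G (Suc k) \<subseteq> gam G 2" "gam G (Suc k) \<subseteq> gam G j" "gam G k \<subseteq> gam G j"
    using step j by (auto intro!: gam_antimono)
  have "gam G (Suc k) \<subseteq> ?K"
  proof (rule gam_step2[OF gen x y, where B = "gam G k"])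
    show "gam G k \<subseteq> generate G (gam G k \<union> gam G (Suc k))" by (auto intro: generate.incl)
    fix b assume b: "b \<in> gam G k"
    have bG: "b \<in> carrier G" by (rule gam_carrier[OF b])
    have xb: "\<lbrakk>x, b\<rbrakk> \<in> gam G (Suc (Suc k))" using step.hyps(3)[OF _ b] step.prems by simp
    then show "\<lbrakk>b, x\<rbrakk> \<in> ?K" using K1 cm_swap[OF sK _ x bG] by blast
    have yb: "\<lbrakk>y, b\<rbrakk> \<in> gam G (Suc k)" by (rule cm_gam'[OF b y])
    have w: "y \<otimes> x \<otimes> b \<otimes> inv (y \<otimes> x) \<in> gam G k" by (rule conj_gam[OF b]) simp
    \<comment> \<open>Every element of gamma_(k+1) comes from some [y,b], since [x,b] is already
      deeper. Interchanging the two actions moves \<open>x\<close> inside, where the induction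
      hypothesis applies.\<close>
    have "?N #> \<lbrakk>x, \<lbrakk>y, b\<rbrakk>\<rbrakk> = ?N #> \<lbrakk>y, \<lbrakk>x, b\<rbrakk>\<rbrakk>"
    proof (rule cm_cm_commute[OF gam_normal x y bG])
      show "\<lbrakk>\<lbrakk>x, b\<rbrakk>, \<lbrakk>y, b\<rbrakk>\<rbrakk> \<in> ?N" using C[OF _ subsetD[OF k2(2) yb]] cm_gam'[OF b x] k2(1) mN by blast
      show "\<lbrakk>s, y \<otimes> x \<otimes> b \<otimes> inv (y \<otimes> x)\<rbrakk> \<in> ?N" using C[OF s_gam] w k2(3) mN by blast
    qed
    moreover have "\<lbrakk>y, \<lbrakk>x, b\<rbrakk>\<rbrakk> \<in> ?N" using cm_gam'[OF xb y] by simp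
    ultimately have "\<lbrakk>x, \<lbrakk>y, b\<rbrakk>\<rbrakk> \<in> ?N"
      using coset_mem_iff[OF gam_normal _ _ _ order_refl gam_subgroup, of "\<lbrakk>x, \<lbrakk>y, b\<rbrakk>\<rbrakk>" "\<lbrakk>y, \<lbrakk>x, b\<rbrakk>\<rbrakk>"] bG by simp
    then have "\<lbrakk>y, b\<rbrakk> \<in> ?K" using yb bG by (simp add: Cent_iff)
    then show "\<lbrakk>b, y\<rbrakk> \<in> ?K" using cm_swap[OF sK _ y bG] by blast
  next
    show "k \<ge> 1" using step j by simp
    show "gam G k \<subseteq> carrier G" by (rule gam_sub)
    show "?K \<lhd> G" "gam G (Suc (Suc k)) \<subseteq> ?K" by (fact nK K1)+
  qed
  then show ?case using step.prems by (auto simp: Cent_iff)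
qed (use base in simp)

text \<open>Outside gamma_(k+1) the element \<open>v\<close> would generate gamma_k over
  gamma_(k+1), so [x,v] and [y,v] would generate gamma_(k+1) over gamma_(k+2). That section is
  nontrivial because k + 1 <= c.\<close>

lemma cmy_inj:
  assumes o: "order G = 3 ^ n" and k: "4 \<le> k" "Suc k \<le> c" and v: "v \<in> gam G k" "\<lbrakk>y, v\<rbrakk> \<in> gam G (k + 2)"
    and cx: "\<lbrakk>x, v\<rbrakk> \<in> gam G (k + 2)"
  shows "v \<in> gam G (Suc k)"
proof (rule ccontr)
  assume n: "v \<notin> gam G (Suc k)"
  have vG: "v \<in> carrier G" by (rule gam_carrier[OF v(1)])
  have gk: "gam G k \<subseteq> generate G ({v} \<union> gam G (Suc k))"
    using gam_gen[OF o _ _ v(1) n] k by simp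
  have "\<lbrakk>v, x\<rbrakk> \<in> gam G (Suc (Suc k))" "\<lbrakk>v, y\<rbrakk> \<in> gam G (Suc (Suc k))"
    using cm_swap[OF gam_subgroup _ x vG] cm_swap[OF gam_subgroup _ y vG] v(2) cx by simp_all
  then have "gam G (Suc k) \<subseteq> gam G (Suc (Suc k))"
    by (intro gam_step2[OF gen x y _ gk _ gam_normal order_refl]) (use k vG in simp_all)
  then show False using card_gam_le[of "Suc k"] k by simp
qed

end

text \<open>The distinguished case: the third maximal subgroup \<open>\<langle>x\<rangle>\<gamma>\<^sub>2\<close> has rank three.\<close>
locale special = bicyc +
  assumes uR: "u \<in> R x" and u4: "u \<notin> gam G 4"
begin

text \<open>\<open>u\<close> is a nontrivial element of the group of order 3 generated by
  \<open>z\<close> modulo gamma_4, so the two can be exchanged. Thus \<open>z\<close> inherits from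
  \<open>u\<close> that it is nearly central.\<close>

lemma z_adj_u: "z \<in> adj (gam G 4) u"
  by (rule adj_exchange[OF gam_normal _ cube3[OF z_gam] uR[unfolded R_def] u4 adj_subgroup[OF gam_subgroup] adj_sub(1)])
    (simp_all add: adj_sub(2))

lemma cm_u: "g \<in> carrier G \<Longrightarrow> \<lbrakk>g, u\<rbrakk> \<in> gam G (e + 3)"
  using cm_pow_gam[OF x, of g e] e2 by simp

lemma cm_z: "g \<in> carrier G \<Longrightarrow> \<lbrakk>g, z\<rbrakk> \<in> gam G 5"
proof -
  assume g: "g \<in> carrier G"
  have "gam G (e + 3) \<subseteq> gam G 5" using e2 by (intro gam_antimono) simp
  then have "adj (gam G 4) u \<subseteq> Cent (gam G 5) g"
    using cm_gam'[OF _ g, of _ 4] cm_u[OF g] gam_sub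
    by (intro adj_least Cent_subgroup gam_normal g sub_CentI[OF _ order_refl]) (auto simp: Cent_iff Suc2)
  then show ?thesis using z_adj_u by (auto simp: Cent_iff)
qed

lemma cmx_t: "\<lbrakk>x, t\<rbrakk> \<in> gam G 5"
proof -
  have w: "y \<otimes> x \<otimes> s \<otimes> inv (y \<otimes> x) \<in> gam G 2" by (rule conj_gam[OF s_gam]) simp
  have "gam G 5 #> \<lbrakk>x, t\<rbrakk> = gam G 5 #> \<lbrakk>y, z\<rbrakk>"
    using gam2_comm5 t_gam z_gam gam32 s_gam w by (intro cm_cm_commute[OF gam_normal x y]) auto
  then show ?thesis
    using coset_mem_iff[OF gam_normal _ _ _ order_refl gam_subgroup, of "\<lbrakk>x, t\<rbrakk>" "\<lbrakk>y, z\<rbrakk>"] cm_z[OF y] by simp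
qed

lemma cmx3: "a \<in> gam G 3 \<Longrightarrow> \<lbrakk>x, a\<rbrakk> \<in> gam G 5"
proof -
  have "gam G 3 \<subseteq> Cent (gam G 5) x"
    using cm_gam'[OF _ x, of _ 4] cm_z[OF x] cmx_t gam_sub
    by (intro gam3_sub_subgroup Cent_subgroup gam_normal x sub_CentI[OF _ order_refl]) (auto simp: Cent_iff Suc2)
  then show "a \<in> gam G 3 \<Longrightarrow> \<lbrakk>x, a\<rbrakk> \<in> gam G 5" by (auto simp: Cent_iff)
qed

lemma gam4_adj_p: "gam G 4 \<subseteq> adj (gam G 5) p"
proof -
  have M: "adj (gam G 5) p \<lhd> G" using adj_normal_gam(1)[OF p_gam] by (simp add: Suc2)
  note sM = normal_imp_subgroup[OF M]
  have M5: "gam G 5 \<subseteq> adj (gam G 5) p" "p \<in> adj (gam G 5) p" by (rule adj_sub)+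
  have "gam G (Suc 3) \<subseteq> adj (gam G 5) p"
  proof (rule gam_step2[OF gen x y _ _ _ M, where B = "{z, t}"])
    show "gam G 3 \<subseteq> generate G ({z, t} \<union> gam G (Suc 3))"
      using gam_sub by (intro gam3_sub_subgroup generate_is_subgroup) (auto simp: Suc2 intro: generate.incl)
    show "\<lbrakk>b, x\<rbrakk> \<in> adj (gam G 5) p" if "b \<in> {z, t}" for b
      using that cm_swap[OF sM _ x] M5 cm_z[OF x] cmx_t by auto
    show "\<lbrakk>b, y\<rbrakk> \<in> adj (gam G 5) p" if "b \<in> {z, t}" for b
      using that cm_swap[OF sM _ y] M5 cm_z[OF y] by auto
  qed (use M5 in \<open>auto simp: Suc2\<close>)
  then show ?thesis by (simp add: Suc2)
qed

text \<open>Since [x,y^3] and t^3 lie in gamma_5, the formula \<open>s3t3p\<close> makes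
  \<open>p\<close> inverse to s^3 modulo gamma_5. So gamma_4 comes from cubes in gamma_2 and lies in
  the Frattini subgroup of every maximal subgroup; dividing by parts of it cannot change
  ranks.\<close>

lemma gam4_adj_s3: "gam G 4 \<subseteq> adj (gam G 5) (s [^] (3::nat))"
proof -
  let ?M = "adj (gam G 5) (s [^] (3::nat))"
  have sM: "subgroup ?M G" by (rule adj_subgroup[OF gam_subgroup]) simp
  have M5: "gam G 5 \<subseteq> ?M" "s [^] (3::nat) \<in> ?M" by (rule adj_sub)+
  have "\<lbrakk>x, y [^] (3::nat)\<rbrakk> \<in> gam G 5" by (rule cmx3[OF y3_gam3])
  then have 1: "s [^] (3::nat) \<otimes> t [^] (3::nat) \<otimes> p \<in> ?M" using s3t3p[OF order_refl gam_normal] M5 by blast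
  have "t [^] (3::nat) \<in> gam G 5" using cube2[of 3, OF _ t_gam] by simp
  then have 2: "s [^] (3::nat) \<otimes> t [^] (3::nat) \<in> ?M" using M5 subgroup.m_closed[OF sM] by blast
  let ?a = "s [^] (3::nat) \<otimes> t [^] (3::nat)"
  have "p = inv ?a \<otimes> (?a \<otimes> p)" by (rule inv_cancel_left(2)[symmetric]) auto
  then have "p \<in> ?M" using 1 2 subgroup.m_closed[OF sM] subgroup.m_inv_closed[OF sM] by metis
  then show ?thesis using gam4_adj_p adj_least[OF sM M5(1)] by blast
qed

lemma gam4_least:
  assumes M: "M \<lhd> G" "s [^] (3::nat) \<in> M"
  shows "gam G 4 \<subseteq> M"
proof (rule nakayama[OF M(1) _ _ nil])
  note K = set_mult_normal[OF M(1) gam_normal[of 5]]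
  have "adj (gam G 5) (s [^] (3::nat)) \<subseteq> M <#> gam G 5"
    using M(2) K by (intro adj_least normal_imp_subgroup[OF K(1)]) auto
  then show "gam G 4 \<subseteq> M <#> gam G (Suc 4)" using gam4_adj_s3 by (simp add: Suc2)
qed simp

lemma gam4_Frat:
  assumes "H \<lhd> G" "gam G 2 \<subseteq> H"
  shows "gam G 4 \<subseteq> Frat H"
  using assms s_gam by (intro gam4_least Frat_normal Frat_cube) auto

end

section \<open>The second derived subgroup\<close>

context group
begin

lemma coset_drop_right:
  assumes "M \<lhd> G" "m \<in> M" "a \<in> carrier G"
  shows "M #> (a \<otimes> m) = M #> a"
proof -
  interpret M: normal M G by fact
  have "a \<otimes> m = (a \<otimes> m \<otimes> inv a) \<otimes> a" using assms by (simp add: word)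
  then show ?thesis using coset_drop[OF assms(1) M.inv_op_closed2[OF assms(3,2)] assms(3)] by simp
qed

lemma coset_mult_eq:
  assumes "M \<lhd> G" "a \<in> carrier G" "b \<in> carrier G" "a' \<in> carrier G" "b' \<in> carrier G"
    "M #> a = M #> a'" "M #> b = M #> b'"
  shows "M #> (a \<otimes> b) = M #> (a' \<otimes> b')"
  using normal.rcos_sum[OF assms(1,2,3)] normal.rcos_sum[OF assms(1,4,5)] assms(6,7) by simp

lemma coset_cancel:
  assumes "M \<lhd> G" "a \<in> carrier G" "b \<in> carrier G" "M #> (a \<otimes> b) = M #> b"
  shows "a \<in> M"
proof -
  interpret M: normal M G by fact
  have "a \<otimes> b \<in> M #> b" using rcos_self[OF _ M.is_subgroup, of "a \<otimes> b"] assms by simp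
  then have "a \<otimes> b \<otimes> inv b \<in> M" by (rule M.rcos_module_imp[OF group_axioms assms(3)])
  then show ?thesis using assms by (simp add: m_assoc)
qed

lemma coset_cancel_left:
  assumes "M \<lhd> G" "a \<in> carrier G" "b \<in> carrier G" "M #> (b \<otimes> a) = M #> b"
  shows "a \<in> M"
proof -
  interpret M: normal M G by fact
  have "(b \<otimes> a \<otimes> inv b) \<otimes> b = b \<otimes> a" using assms by (simp add: word)
  then have c: "b \<otimes> a \<otimes> inv b \<in> M" using coset_cancel[OF assms(1) _ assms(3), of "b \<otimes> a \<otimes> inv b"] assms by simp
  have "inv b \<otimes> (b \<otimes> a \<otimes> inv b) \<otimes> b = a" using assms by (simp add: word)
  then show ?thesis using M.inv_op_closed1[OF assms(3) c] by simp
qed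

lemma conj_cm_distrib:
  "g \<in> carrier G \<Longrightarrow> a \<in> carrier G \<Longrightarrow> b \<in> carrier G \<Longrightarrow>
   g \<otimes> \<lbrakk>a, b\<rbrakk> \<otimes> inv g = \<lbrakk>g \<otimes> a \<otimes> inv g, g \<otimes> b \<otimes> inv g\<rbrakk>"
  by (simp add: cm_def word)

end

context special
begin

text \<open>Modulo gamma_5 the term gamma_4 is generated by s^3, and modulo gamma_6 the commutator
  [x,s^3] reduces to z^3, which is a power of u^3. This starts \<open>cmx_gam\<close> in groups not
  yet known to be metabelian.\<close>

lemma cmx4:
  assumes o: "order G = 3 ^ n" and e3: "e \<ge> 3" and c6: "c \<ge> 6" and a: "a \<in> gam G 4"
  shows "\<lbrakk>x, a\<rbrakk> \<in> gam G 6"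
proof -
  have u3: "u [^] (3::nat) \<in> gam G 5" using cube2[OF _ u_gam3] by simp
  have ue: "u [^] (3::nat) = x [^] ((3::nat) ^ (e + 1))" by (simp add: nat_pow_pow mult.commute)
  \<comment> \<open>Otherwise u^3 would generate gamma_5 modulo gamma_6. As it is central modulo
    gamma_7 (here \<open>e \<ge> 3\<close> enters), gamma_6 would equal gamma_7, against
    \<open>c \<ge> 6\<close>.\<close>
  have u36: "u [^] (3::nat) \<in> gam G 6"
  proof (rule ccontr)
    assume n: "u [^] (3::nat) \<notin> gam G 6"
    have "gam G 5 = adj (gam G (Suc 5)) (u [^] (3::nat))"
      by (rule gam_gen[OF o _ _ u3]) (use c6 n in \<open>auto simp: Suc2\<close>)
    then have g5: "gam G 5 \<subseteq> generate G ({u [^] (3::nat)} \<union> gam G (Suc 5))" by simp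
    have "\<lbrakk>u [^] (3::nat), g\<rbrakk> \<in> gam G (Suc (Suc 5))" if g: "g \<in> carrier G" for g
    proof -
      have "\<lbrakk>g, u [^] (3::nat)\<rbrakk> \<in> gam G (e + 1 + 3)" unfolding ue by (rule cm_pow_gam[OF x g]) simp
      then have "\<lbrakk>g, u [^] (3::nat)\<rbrakk> \<in> gam G (Suc (Suc 5))"
        using gam_antimono[of "Suc (Suc 5)" "e + 1 + 3"] e3 by auto
      then show ?thesis by (rule cm_swap[OF gam_subgroup _ g]) simp
    qed
    then have "gam G (Suc 5) \<subseteq> gam G (Suc (Suc 5))"
      by (intro gam_step[OF _ g5 _ gam_normal order_refl]) auto
    then show False using card_gam_le[of 6] c6 by (simp add: Suc2)
  qed
  have z3: "z [^] (3::nat) \<in> gam G 6"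
  proof -
    obtain k :: int and m where m: "m \<in> gam G 4" "z = m \<otimes> u [^] k"
      using adj_mem_int[OF gam_normal stzp(5) z_adj_u] by blast
    have mG: "m \<in> carrier G" by (rule gam_carrier[OF m(1)])
    have "u [^] k \<in> gam G 2" by (rule subgroup_int_pow_closed[OF gam_subgroup x_pow2])
    then have "\<lbrakk>m, u [^] k\<rbrakk> \<in> gam G 6" using cm_gam_gam2[OF m(1)] by (simp add: Suc2)
    then have "gam G 6 #> z [^] (3::nat) = gam G 6 #> (m [^] (3::nat) \<otimes> (u [^] k) [^] (3::nat))"
      unfolding m(2) by (intro pow_mult_mod gam_normal mG) auto
    moreover have "(u [^] k) [^] (3::nat) = (u [^] (3::nat)) [^] k"
      using int_pow_pow[OF stzp(5), of k 3] int_pow_pow[OF stzp(5), of 3 k] int_pow_int[of G "u [^] k" 3]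
        int_pow_int[of G u 3] by (simp add: mult.commute)
    moreover have "(u [^] (3::nat)) [^] k \<in> gam G 6" by (rule subgroup_int_pow_closed[OF gam_subgroup u36])
    moreover have "m [^] (3::nat) \<in> gam G 6" using cube2[OF _ m(1)] by simp
    ultimately show ?thesis
      using coset_mem_iff[OF gam_normal _ _ _ order_refl gam_subgroup, of "z [^] (3::nat)" "m [^] (3::nat) \<otimes> (u [^] k) [^] (3::nat)" 6]
        mG subgroup.m_closed[OF gam_subgroup] by simp
  qed
  have k: "\<lbrakk>s, z\<rbrakk> \<in> gam G 5" by (rule cm_z) simp
  have k2: "\<lbrakk>s, \<lbrakk>s, z\<rbrakk>\<rbrakk> \<in> gam G 6" "\<lbrakk>z, \<lbrakk>s, z\<rbrakk>\<rbrakk> \<in> gam G 6" using cm_gam'[OF k] by (simp_all add: Suc2)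
  have "\<lbrakk>x, s [^] (3::nat)\<rbrakk> \<in> gam G 6"
  proof -
    have "z [^] (3::nat) \<otimes> \<lbrakk>s, z\<rbrakk> [^] (3::nat) \<otimes> \<lbrakk>s, \<lbrakk>s, z\<rbrakk>\<rbrakk> \<in> gam G 6"
      using z3 k2 cube1[OF _ k] subgroup.m_closed[OF gam_subgroup] by (simp add: Suc2)
    moreover have "\<lbrakk>z, \<lbrakk>s, \<lbrakk>s, z\<rbrakk>\<rbrakk>\<rbrakk> \<in> gam G 6" "\<lbrakk>\<lbrakk>s, z\<rbrakk>, \<lbrakk>s, \<lbrakk>s, z\<rbrakk>\<rbrakk>\<rbrakk> \<in> gam G 6"
      using Cent_cm_right[OF gam_normal k2(1)] by simp_all
    ultimately show ?thesis using cm_cube_mod[OF gam_normal x stzp(1) refl refl refl k2(2)] by blast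
  qed
  moreover have "gam G 5 \<subseteq> Cent (gam G 6) x"
    using cm_gam'[OF _ x, of _ 5] gam_sub by (intro sub_CentI[OF _ order_refl]) (auto simp: Suc2)
  ultimately have "adj (gam G 5) (s [^] (3::nat)) \<subseteq> Cent (gam G 6) x"
    by (intro adj_least Cent_subgroup gam_normal x) (auto simp: Cent_iff)
  then show ?thesis using gam4_adj_s3 a by (auto simp: Cent_iff)
qed

text \<open>By \<open>cmy_inj\<close>, an element of gamma_m fixed by \<open>y\<close> modulo
  gamma_(m+2) lies in gamma_(m+1). The commutators [s,t] and [s,z] turn out to be fixed in this
  sense, while [z,t] is controlled through the action of \<open>x\<close>.\<close>

lemma gam2_comm_step:
  assumes o: "order G = 3 ^ n" and e3: "e \<ge> 3" and c6: "c \<ge> 6"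
    and A: "\<And>a b. a \<in> gam G 2 \<Longrightarrow> b \<in> gam G 2 \<Longrightarrow> \<lbrakk>a, b\<rbrakk> \<in> gam G m" and m: "5 \<le> m" "Suc m \<le> c"
    and a: "a \<in> gam G 2" and b: "b \<in> gam G 2"
  shows "\<lbrakk>a, b\<rbrakk> \<in> gam G (Suc m)"
proof -
  define N where "N = gam G (m + 2)"
  have nN: "N \<lhd> G" unfolding N_def by (rule gam_normal)
  interpret N: normal N G by (rule nN)
  note G2 = gam_carrier[of _ 2]
  have cN: "\<lbrakk>v, a\<rbrakk> \<in> N" "\<lbrakk>a, v\<rbrakk> \<in> N" if "v \<in> gam G m" "a \<in> gam G 2" for v a
    using cm_gam_gam2[OF that] cm_swap[OF gam_subgroup cm_gam_gam2[OF that]] that gam_carrier unfolding N_def by auto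
  \<comment> \<open>The elements of gamma_2 centralizing gamma_2 modulo \<open>N\<close>. This
    subgroup is normal and contains s^3, hence all of gamma_4, which leaves only the commutators
    among \<open>s\<close>, \<open>t\<close> and \<open>z\<close>.\<close>
  define K where "K = {a \<in> gam G 2. \<forall>b\<in>gam G 2. \<lbrakk>b, a\<rbrakk> \<in> N}"
  have KC: "K = gam G 2 \<inter> (\<Inter>b\<in>gam G 2. Cent N b)" unfolding K_def Cent_def using gam_sub by blast
  have sK: "subgroup K G" unfolding KC
    using s_gam by (intro subgroups_Inter_pair gam_subgroup subgroups_Inter) (auto intro!: Cent_subgroup nN G2)
  have nK: "K \<lhd> G"
  proof (rule normal_invI[OF sK])
    fix g h assume g: "g \<in> carrier G" and h: "h \<in> K"
    have hg: "h \<in> gam G 2" "h \<in> carrier G" using h G2 by (auto simp: K_def)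
    have "\<lbrakk>b, g \<otimes> h \<otimes> inv g\<rbrakk> \<in> N" if b: "b \<in> gam G 2" for b
    proof -
      let ?b = "inv g \<otimes> b \<otimes> g"
      have b2: "?b \<in> gam G 2" using conj_gam[OF b, of "inv g"] g by simp
      have "\<lbrakk>b, g \<otimes> h \<otimes> inv g\<rbrakk> = g \<otimes> \<lbrakk>?b, h\<rbrakk> \<otimes> inv g" using g hg G2[OF b] by (simp add: cm_def word)
      then show ?thesis using N.inv_op_closed2[OF g, of "\<lbrakk>?b, h\<rbrakk>"] h b2 by (simp add: K_def)
    qed
    then show "g \<otimes> h \<otimes> inv g \<in> K" using conj_gam[OF hg(1) g] by (simp add: K_def)
  qed
  have "\<lbrakk>b, s [^] (3::nat)\<rbrakk> \<in> N" if b: "b \<in> gam G 2" for b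
    using cm_cube_mod'[OF nN G2[OF b] stzp(1) cN(2)[OF A[OF b s_gam] s_gam]] cube2[OF _ A[OF b s_gam]] m
    unfolding N_def by simp
  then have "s [^] (3::nat) \<in> K" using s3_gam4 gam42 by (auto simp: K_def)
  then have g4K: "gam G 4 \<subseteq> K" by (rule gam4_least[OF nK])
  have kN: "\<lbrakk>b, k\<rbrakk> \<in> N" "\<lbrakk>k, b\<rbrakk> \<in> N" if "k \<in> gam G 4" "b \<in> gam G 2" for b k
    using g4K that cm_swap[OF N.is_subgroup, of b k] gam_carrier unfolding K_def by auto
  have cx: "\<lbrakk>x, v\<rbrakk> \<in> gam G (m + 2)" if "v \<in> gam G m" for v
    by (rule cmx_gam[where j = 4 and m = "m + 2" and k = m])
      (use kN cmx4[OF o e3 c6] m that in \<open>auto simp: N_def\<close>)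
  have inj: "v \<in> gam G (Suc m)" if "v \<in> gam G m" "\<lbrakk>y, v\<rbrakk> \<in> N" for v
    using cmy_inj[OF o _ m(2) that(1) _ cx[OF that(1)]] that m unfolding N_def by simp
  have mod2: "w \<in> gam G 2" if "w \<in> gam G m" for w using gam_antimono[of 2 m] m that by auto
  have Kr: "N #> \<lbrakk>d, k \<otimes> b\<rbrakk> = N #> \<lbrakk>d, b\<rbrakk>" if k: "k \<in> gam G 4" and b: "b \<in> gam G 2" and d: "d \<in> gam G 2" for k b d
  proof -
    have car: "k \<in> carrier G" "b \<in> carrier G" "d \<in> carrier G" using k b d gam_carrier by auto
    have "\<lbrakk>d, k \<otimes> b\<rbrakk> = \<lbrakk>d, k\<rbrakk> \<otimes> (\<lbrakk>k, \<lbrakk>d, b\<rbrakk>\<rbrakk> \<otimes> \<lbrakk>d, b\<rbrakk>)"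
      using cm_mult_right[OF car(3,1,2)] conj_cm[of "\<lbrakk>d, b\<rbrakk>" k] car by simp
    then show ?thesis
      using coset_drop[OF nN kN(1)[OF k d], of "\<lbrakk>k, \<lbrakk>d, b\<rbrakk>\<rbrakk> \<otimes> \<lbrakk>d, b\<rbrakk>"] coset_drop[OF nN kN(2)[OF k mod2[OF A[OF d b]]], of "\<lbrakk>d, b\<rbrakk>"] car
      by simp
  qed
  have B1: "N #> \<lbrakk>a \<otimes> b, d\<rbrakk> = N #> (\<lbrakk>b, d\<rbrakk> \<otimes> \<lbrakk>a, d\<rbrakk>)" if a: "a \<in> gam G 2" and b: "b \<in> gam G 2" and d: "d \<in> gam G 2" for a b d
  proof -
    have car: "a \<in> carrier G" "b \<in> carrier G" "d \<in> carrier G" using a b d gam_carrier by auto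
    have "\<lbrakk>a \<otimes> b, d\<rbrakk> = \<lbrakk>a, \<lbrakk>b, d\<rbrakk>\<rbrakk> \<otimes> (\<lbrakk>b, d\<rbrakk> \<otimes> \<lbrakk>a, d\<rbrakk>)"
      unfolding cm_mult_left[OF car] using conj_cm[of "\<lbrakk>b, d\<rbrakk>" a] car by (simp add: m_assoc[symmetric])
    then show ?thesis using coset_drop[OF nN cN(2)[OF A[OF b d] a], of "\<lbrakk>b, d\<rbrakk> \<otimes> \<lbrakk>a, d\<rbrakk>"] car by simp
  qed
  have t2: "t \<in> gam G 2" and z2: "z \<in> gam G 2" using t_gam z_gam gam32 by auto
  have g54: "gam G 5 \<subseteq> gam G 4" by (rule gam_antimono) simp
  have q: "\<lbrakk>y, z\<rbrakk> \<in> gam G 4" and r: "\<lbrakk>x, t\<rbrakk> \<in> gam G 4" using cm_z[OF y] cmx_t g54 by auto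
  \<comment> \<open>The conjugate of [s,b] by \<open>g\<close> is the commutator of [g,s]s and
    [g,b]b. Modulo \<open>N\<close> the factor [g,b] drops out, being in gamma_4, and the first
    argument is multiplicative.\<close>
  have cv: "N #> (\<lbrakk>g, \<lbrakk>s, b\<rbrakk>\<rbrakk> \<otimes> \<lbrakk>s, b\<rbrakk>) = N #> (\<lbrakk>s, b\<rbrakk> \<otimes> \<lbrakk>\<lbrakk>g, s\<rbrakk>, b\<rbrakk>)"
    if g: "g \<in> carrier G" and b: "b \<in> gam G 2" "\<lbrakk>g, b\<rbrakk> \<in> gam G 4" and gs: "\<lbrakk>g, s\<rbrakk> \<in> gam G 2" for g b
  proof -
    have bG: "b \<in> carrier G" by (rule G2[OF b(1)])
    have gs2: "\<lbrakk>g, s\<rbrakk> \<otimes> s \<in> gam G 2" using gs s_gam subgroup.m_closed[OF gam_subgroup] by blast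
    have "\<lbrakk>g, \<lbrakk>s, b\<rbrakk>\<rbrakk> \<otimes> \<lbrakk>s, b\<rbrakk> = \<lbrakk>\<lbrakk>g, s\<rbrakk> \<otimes> s, \<lbrakk>g, b\<rbrakk> \<otimes> b\<rbrakk>"
      using conj_cm[of "\<lbrakk>s, b\<rbrakk>" g] conj_cm_distrib[OF g stzp(1) bG] conj_cm[OF stzp(1) g] conj_cm[OF bG g] g bG by simp
    then show ?thesis using Kr[OF b(2,1) gs2] B1[OF gs s_gam b(1)] by simp
  qed
  \<comment> \<open>For g = y and b = t the extra term in \<open>cv\<close> is [t,t] = 1, so
    \<open>y\<close> fixes [s,t] modulo \<open>N\<close>.\<close>
  have v: "\<lbrakk>s, t\<rbrakk> \<in> gam G (Suc m)"
  proof (rule inj[OF A[OF s_gam t2]])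
    have "N #> (\<lbrakk>y, \<lbrakk>s, t\<rbrakk>\<rbrakk> \<otimes> \<lbrakk>s, t\<rbrakk>) = N #> \<lbrakk>s, t\<rbrakk>" using cv[OF y t2 p_gam t2] by simp
    then show "\<lbrakk>y, \<lbrakk>s, t\<rbrakk>\<rbrakk> \<in> N" by (rule coset_cancel[OF nN, rotated -1]) auto
  qed
  \<comment> \<open>As [s,t] is now one step deeper, \<open>x\<close> fixes it modulo
    \<open>N\<close>; comparison with \<open>cv\<close> for g = x leaves only [z,t].\<close>
  have zt: "\<lbrakk>z, t\<rbrakk> \<in> N"
  proof (rule coset_cancel_left[OF nN _ _ , of _ "\<lbrakk>s, t\<rbrakk>"])
    have "\<lbrakk>x, \<lbrakk>s, t\<rbrakk>\<rbrakk> \<in> N" using cm_gam'[OF v x] unfolding N_def by simp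
    then have "N #> \<lbrakk>s, t\<rbrakk> = N #> (\<lbrakk>x, \<lbrakk>s, t\<rbrakk>\<rbrakk> \<otimes> \<lbrakk>s, t\<rbrakk>)" using coset_drop[OF nN, of _ "\<lbrakk>s, t\<rbrakk>"] by simp
    then show "N #> (\<lbrakk>s, t\<rbrakk> \<otimes> \<lbrakk>z, t\<rbrakk>) = N #> \<lbrakk>s, t\<rbrakk>" using cv[OF x t2 r z2] by simp
  qed auto
  have tz: "\<lbrakk>t, z\<rbrakk> \<in> N" by (rule cm_swap[OF N.is_subgroup zt]) auto
  have sz: "\<lbrakk>s, z\<rbrakk> \<in> gam G (Suc m)"
  proof (rule inj[OF A[OF s_gam z2]])
    have "N #> (\<lbrakk>y, \<lbrakk>s, z\<rbrakk>\<rbrakk> \<otimes> \<lbrakk>s, z\<rbrakk>) = N #> \<lbrakk>s, z\<rbrakk>"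
      using cv[OF y z2 q t2] coset_drop_right[OF nN tz, of "\<lbrakk>s, z\<rbrakk>"] by simp
    then show "\<lbrakk>y, \<lbrakk>s, z\<rbrakk>\<rbrakk> \<in> N" by (rule coset_cancel[OF nN, rotated -1]) auto
  qed
  have NM: "N \<subseteq> gam G (Suc m)" unfolding N_def by (intro gam_antimono) simp
  have fin: "gam G 2 \<subseteq> Cent (gam G (Suc m)) a"
    if "a \<in> gam G 2" "\<lbrakk>a, s\<rbrakk> \<in> gam G (Suc m)" "\<lbrakk>a, t\<rbrakk> \<in> gam G (Suc m)" "\<lbrakk>a, z\<rbrakk> \<in> gam G (Suc m)" for a
  proof -
    have C: "subgroup (Cent (gam G (Suc m)) a) G" by (rule Cent_subgroup[OF gam_normal G2[OF that(1)]])
    have "gam G 4 \<subseteq> Cent (gam G (Suc m)) a" using kN(1)[OF _ that(1)] NM gam_sub by (rule sub_CentI)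
    then have "gam G 3 \<subseteq> Cent (gam G (Suc m)) a"
      using that by (intro gam3_sub_subgroup C) (simp_all add: Cent_iff)
    then show ?thesis using that by (intro gam2_sub_subgroup C) (simp_all add: Cent_iff)
  qed
  have one: "\<one> \<in> gam G (Suc m)" by (rule subgroup.one_closed[OF gam_subgroup])
  note sw = cm_swap[OF gam_subgroup]
  have S: "gam G 2 \<subseteq> Cent (gam G (Suc m)) s" using v sz one by (intro fin s_gam) simp_all
  have T: "gam G 2 \<subseteq> Cent (gam G (Suc m)) t" using sw[OF v] tz NM one by (intro fin t2) auto
  have Z: "gam G 2 \<subseteq> Cent (gam G (Suc m)) z" using sw[OF sz] zt NM one by (intro fin z2) auto
  have "\<lbrakk>s, a\<rbrakk> \<in> gam G (Suc m)" "\<lbrakk>t, a\<rbrakk> \<in> gam G (Suc m)" "\<lbrakk>z, a\<rbrakk> \<in> gam G (Suc m)"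
    using subsetD[OF S a] subsetD[OF T a] subsetD[OF Z a] by (simp_all add: Cent_iff)
  then have "gam G 2 \<subseteq> Cent (gam G (Suc m)) a" using sw[OF _ _ G2[OF a]] by (intro fin a) simp_all
  then show ?thesis using b by (auto simp: Cent_iff)
qed

text \<open>A commutator \<open>v = \<lbrakk>s, t\<rbrakk>\<close> of
  maximal depth would be centralized by \<open>y\<close> to a depth which contradicts the injectivity of
  \<open>v \<mapsto> \<lbrakk>y, v\<rbrakk>\<close>.\<close>
lemma gam2_comm_c:
  assumes o: "order G = 3 ^ n" and e3: "e \<ge> 3" and c5: "c \<ge> 5" and a: "a \<in> gam G 2" and b: "b \<in> gam G 2"
  shows "\<lbrakk>a, b\<rbrakk> \<in> gam G c"
proof -
  have "m \<le> c \<Longrightarrow> \<forall>a\<in>gam G 2. \<forall>b\<in>gam G 2. \<lbrakk>a, b\<rbrakk> \<in> gam G m" if "5 \<le> m" for m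
    using that
  proof (induct m rule: dec_induct)
    case base then show ?case using gam2_comm5 by blast
  next
    case (step m) then show ?case using gam2_comm_step[OF o e3, of m] by auto
  qed
  then show ?thesis using a b c5 by blast
qed

end

section \<open>Central elements of the derived subgroup of a metabelian group\<close>

context group
begin

definition act where "act g a = g \<otimes> a \<otimes> inv g"

lemma act_closed [simp]: "g \<in> carrier G \<Longrightarrow> a \<in> carrier G \<Longrightarrow> act g a \<in> carrier G"
  by (simp add: act_def)

lemma act_mult: "g \<in> carrier G \<Longrightarrow> a \<in> carrier G \<Longrightarrow> b \<in> carrier G \<Longrightarrow> act g (a \<otimes> b) = act g a \<otimes> act g b"
  by (simp add: act_def word)

lemma act_inv: "g \<in> carrier G \<Longrightarrow> a \<in> carrier G \<Longrightarrow> act g (inv a) = inv (act g a)"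
  by (simp add: act_def word)

lemma act_one [simp]: "g \<in> carrier G \<Longrightarrow> act g \<one> = \<one>"
  by (simp add: act_def)

end

text \<open>The setting in which gamma_2 is a module over the commutative group ring of G/gamma_2,
  generated by the single element [x,y].\<close>

locale metab2 = group G for G (structure) +
  fixes x y
  assumes x [simp]: "x \<in> carrier G" and y [simp]: "y \<in> carrier G"
    and gen: "generate G {x, y} = carrier G"
    and comm: "a \<in> gam G 2 \<Longrightarrow> b \<in> gam G 2 \<Longrightarrow> a \<otimes> b = b \<otimes> a"
begin

abbreviation A where "A \<equiv> gam G 2"

lemmas A_mult [simp] = subgroup.m_closed[OF gam_subgroup[of 2]]
lemmas A_inv [simp] = subgroup.m_inv_closed[OF gam_subgroup[of 2]]
lemmas A_one [simp] = subgroup.one_closed[OF gam_subgroup[of 2]]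
lemmas AG [simp] = gam_carrier[of _ 2]

lemma act_A [simp]: "g \<in> carrier G \<Longrightarrow> a \<in> A \<Longrightarrow> act g a \<in> A"
  unfolding act_def by (rule normal.inv_op_closed2[OF gam_normal])

lemma left_comm: "a \<in> A \<Longrightarrow> b \<in> A \<Longrightarrow> d \<in> A \<Longrightarrow> a \<otimes> (b \<otimes> d) = b \<otimes> (a \<otimes> d)"
  using comm[of a b] m_assoc[of a b d] m_assoc[of b a d] by simp

lemma act_commute:
  assumes g: "g \<in> carrier G" and h: "h \<in> carrier G" and a: "a \<in> A"
  shows "act g (act h a) = act h (act g a)"
proof -
  let ?b = "act h (act g a)" and ?c = "\<lbrakk>g, h\<rbrakk>"
  have c: "?c \<in> A" using cm_gam[of g 1 h] g h by (simp add: numeral_2_eq_2)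
  have b: "?b \<in> A" using g h a by simp
  have "act g (act h a) = ?c \<otimes> ?b \<otimes> inv ?c"
    using g h AG[OF a] by (simp add: act_def cm_def word)
  also have "\<dots> = ?b" using comm[OF c b] AG[OF c] AG[OF b] by (simp add: m_assoc)
  finally show ?thesis .
qed

definition endo where
  "endo K \<longleftrightarrow> (\<forall>a\<in>A. K a \<in> A) \<and> (\<forall>a\<in>A. \<forall>b\<in>A. K (a \<otimes> b) = K a \<otimes> K b) \<and>
     (\<forall>g\<in>carrier G. \<forall>a\<in>A. K (act g a) = act g (K a))"

lemma A_least:
  assumes S: "subgroup S G" "\<lbrakk>x, y\<rbrakk> \<in> S" and c: "\<And>g a. g \<in> carrier G \<Longrightarrow> a \<in> S \<Longrightarrow> act g a \<in> S"
  shows "A \<subseteq> S"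
  using S c by (intro gen2_gam2[OF gen] normal_invI) (auto simp: act_def)

text \<open>The values at [x,y] of all \<open>G\<close>-endomorphisms form a submodule containing
  [x,y], hence everything: over a commutative ring, multiplication by a scalar is an endomorphism of
  a cyclic module.\<close>

lemma endo_exists:
  assumes q: "q \<in> A"
  shows "\<exists>K. endo K \<and> K \<lbrakk>x, y\<rbrakk> = q"
proof -
  let ?s = "\<lbrakk>x, y\<rbrakk>"
  have s: "?s \<in> A" using cm_gam[of x 1 y] by (simp add: numeral_2_eq_2)
  define E where "E = {q \<in> A. \<exists>K. endo K \<and> K ?s = q}"
  have "A \<subseteq> E"
  proof (rule A_least)
    show "subgroup E G"
    proof (rule subgroupI)
      show "E \<subseteq> carrier G" by (auto simp: E_def)
      have "endo (\<lambda>a. \<one>)" by (auto simp: endo_def)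
      then show "E \<noteq> {}" unfolding E_def using A_one by blast
      fix b assume b: "b \<in> E"
      then obtain K where K: "endo K" "K ?s = b" by (auto simp: E_def)
      have "endo (\<lambda>a. inv (K a))"
        using K(1) comm unfolding endo_def by (auto simp: inv_mult_group act_inv)
      then show "inv b \<in> E" using K b unfolding E_def by auto
      fix d assume d: "d \<in> E"
      then obtain L where L: "endo L" "L ?s = d" by (auto simp: E_def)
      have "endo (\<lambda>a. K a \<otimes> L a)"
        using K(1) L(1) unfolding endo_def by (auto simp: act_mult m_assoc left_comm)
      then show "b \<otimes> d \<in> E" using K L b d unfolding E_def by auto
    qed
    have "endo (\<lambda>a. a)" by (auto simp: endo_def)
    then show "?s \<in> E" using s unfolding E_def by blast
    fix g b assume g: "g \<in> carrier G" and b: "b \<in> E"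
    then obtain K where K: "endo K" "K ?s = b" by (auto simp: E_def)
    have "endo (\<lambda>a. act g (K a))"
      using K(1) g unfolding endo_def by (auto simp: act_mult act_commute)
    then show "act g b \<in> E" using K b g unfolding E_def by auto
  qed
  then show ?thesis using q by (auto simp: E_def)
qed

text \<open>Let \<open>K\<close> be the \<open>G\<close>-endomorphism of \<open>\<gamma>\<^sub>2\<close> mapping \<open>\<lbrakk>x, y\<rbrakk>\<close> to \<open>y\<^sup>3\<close>. The norm map
  \<open>a \<mapsto> a \<cdot> a\<^sup>y \<cdot> a\<^sup>y\<^sup>y\<close> and \<open>a \<mapsto> \<lbrakk>x, K a\<rbrakk>\<close> agree at the generator \<open>\<lbrakk>x, y\<rbrakk>\<close>, hence everywhere, and on a
  central element they are \<open>a\<^sup>3\<close> and \<open>K \<lbrakk>x, a\<rbrakk> = \<one>\<close>.\<close>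
lemma central_cube:
  assumes q: "y [^] (3::nat) \<in> A" and v: "v \<in> A" and xv: "\<lbrakk>x, v\<rbrakk> = \<one>" and yv: "\<lbrakk>y, v\<rbrakk> = \<one>"
  shows "v [^] (3::nat) = \<one>"
proof -
  let ?s = "\<lbrakk>x, y\<rbrakk>"
  have s: "?s \<in> A" using cm_gam[of x 1 y] by (simp add: numeral_2_eq_2)
  obtain K where K: "endo K" "K ?s = y [^] (3::nat)" using endo_exists[OF q] by blast
  have KA [simp]: "K a \<in> A" if "a \<in> A" for a using K that by (auto simp: endo_def)
  have Km: "K (a \<otimes> b) = K a \<otimes> K b" if "a \<in> A" "b \<in> A" for a b using K that by (auto simp: endo_def)
  have Ka: "K (act g a) = act g (K a)" if "g \<in> carrier G" "a \<in> A" for g a using K that by (auto simp: endo_def)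
  have K1: "K \<one> = \<one>" using Km[of \<one> \<one>] KA[of \<one>] by (metis A_one AG l_one one_closed r_cancel_one)
  have Ki: "K (inv a) = inv (K a)" if "a \<in> A" for a
    using Km[of "inv a" a] K1 that by (intro inv_equality[symmetric]) auto
  define N where "N a = a \<otimes> act y a \<otimes> act y (act y a)" for a
  define F where "F a = act x (K a) \<otimes> inv (K a)" for a
  define S where "S = {a \<in> A. N a = F a}"
  have NA: "N a \<in> A" and XA: "F a \<in> A" if "a \<in> A" for a using that by (auto simp: N_def F_def)
  have Nm: "N (a \<otimes> b) = N a \<otimes> N b" and Xm: "F (a \<otimes> b) = F a \<otimes> F b" if "a \<in> A" "b \<in> A" for a b
    using that by (simp_all add: N_def F_def Km act_mult inv_mult_group m_assoc left_comm comm)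
  have Ng: "N (act g a) = act g (N a)" and Xg: "F (act g a) = act g (F a)" if "g \<in> carrier G" "a \<in> A" for g a
    using that act_commute[of y g] act_commute[of x g] by (simp_all add: N_def F_def Ka act_mult act_inv)
  have "A \<subseteq> S"
  proof (rule A_least)
    show "subgroup S G"
    proof (rule subgroupI)
      show "S \<subseteq> carrier G" by (auto simp: S_def)
      have "\<one> \<in> S" by (simp add: S_def N_def F_def K1)
      then show "S \<noteq> {}" by blast
      fix a assume a: "a \<in> S"
      have aA: "a \<in> A" using a by (simp add: S_def)
      have "N \<one> = \<one>" "F \<one> = \<one>" by (simp_all add: N_def F_def K1)
      then have "N (inv a) = inv (N a)" "F (inv a) = inv (F a)"
        using Nm[of "inv a" a] Xm[of "inv a" a] aA NA[OF aA] XA[OF aA] NA[of "inv a"] XA[of "inv a"]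
        by (auto intro!: inv_equality[symmetric])
      then show "inv a \<in> S" using a by (simp add: S_def)
      fix b assume "b \<in> S" then show "a \<otimes> b \<in> S" using a Nm Xm by (simp add: S_def)
    qed
    show "?s \<in> S"
    proof -
      \<comment> \<open>The conjugates of [x,y] by 1, y and y^2 telescope to [x,y^3].\<close>
      have "N ?s = act x (y [^] (3::nat)) \<otimes> inv (y [^] (3::nat))"
        unfolding N_def act_def cm_def pow3[OF y] by (simp add: word)
      then show ?thesis using s by (simp add: S_def F_def K)
    qed
    fix g a assume "g \<in> carrier G" "a \<in> S"
    then show "act g a \<in> S" using Ng Xg by (simp add: S_def)
  qed
  then have "N v = F v" using v by (auto simp: S_def)
  have fixv: "act x v = v" "act y v = v" using conj_cm[OF AG[OF v]] xv yv AG[OF v] by (simp_all add: act_def)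
  have "N v = v [^] (3::nat)" using fixv AG[OF v] by (simp add: N_def pow3)
  moreover have "F v = \<one>" using Ka[OF x v] fixv KA[OF v] by (simp add: F_def)
  ultimately show ?thesis using \<open>N v = F v\<close> by simp
qed

lemma cm_y_hom: "a \<in> A \<Longrightarrow> b \<in> A \<Longrightarrow> g \<in> carrier G \<Longrightarrow> \<lbrakk>g, a \<otimes> b\<rbrakk> = \<lbrakk>g, a\<rbrakk> \<otimes> \<lbrakk>g, b\<rbrakk>"
proof -
  assume a: "a \<in> A" and b: "b \<in> A" and g: "g \<in> carrier G"
  have gb: "\<lbrakk>g, b\<rbrakk> \<in> A" using cm_gam'[OF b g] gam_antimono[of 2 "Suc 2"] by auto
  have "\<lbrakk>g, a \<otimes> b\<rbrakk> = \<lbrakk>g, a\<rbrakk> \<otimes> (a \<otimes> \<lbrakk>g, b\<rbrakk> \<otimes> inv a)" using a b g by (simp add: cm_mult_right)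
  then show ?thesis using comm[OF a gb] AG[OF a] AG[OF gb] by (simp add: m_assoc)
qed

end

locale special_metab = special +
  assumes gam2_comm1: "a \<in> gam G 2 \<Longrightarrow> b \<in> gam G 2 \<Longrightarrow> \<lbrakk>a, b\<rbrakk> = \<one>"
begin

sublocale metab2
  by unfold_locales (use gen gam2_comm1 cm_eq_one_iff gam_carrier in auto)

lemma cmx_metab: "k \<ge> 3 \<Longrightarrow> a \<in> gam G k \<Longrightarrow> \<lbrakk>x, a\<rbrakk> \<in> gam G (k + 2)"
proof (rule cmx_gam[where j = 3 and m = "k + 2"])
  fix a b assume "a \<in> gam G 2" "b \<in> gam G 3"
  then have "\<lbrakk>a, b\<rbrakk> = \<one>" using gam2_comm1 gam32 by blast
  then show "\<lbrakk>a, b\<rbrakk> \<in> gam G (k + 2)" using subgroup.one_closed[OF gam_subgroup] by simp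
qed (use cmx3 in auto)

text \<open>Repeated use of \<open>cmy_inj\<close> pushes \<open>v\<close> down one term at a time
  until the last nontrivial one.\<close>

lemma cmy_kernel:
  assumes o: "order G = 3 ^ n" and c4: "c \<ge> 4" and v: "v \<in> gam G 4" "\<lbrakk>y, v\<rbrakk> = \<one>"
  shows "v \<in> gam G c"
proof -
  have "k \<le> c \<Longrightarrow> v \<in> gam G k" if "4 \<le> k" for k
    using that
  proof (induct k rule: dec_induct)
    case (step k)
    then have vk: "v \<in> gam G k" by simp
    show ?case
      by (rule cmy_inj[OF o _ _ vk _ cmx_metab[OF _ vk]])
        (use step v subgroup.one_closed[OF gam_subgroup] in auto)
  qed (use v in simp)
  then show ?thesis using c4 by simp
qed

text \<open>Working upwards from the end of the series, [x,gamma_j] lies in gamma_(j+2), which is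
  already in the image. So commutation with \<open>y\<close> alone produces all of
  gamma_(j+1).\<close>

lemma cmy_surj:
  assumes k: "k \<ge> 3" and b: "b \<in> gam G (Suc k)"
  shows "\<exists>a\<in>gam G k. b = \<lbrakk>y, a\<rbrakk>"
proof -
  have main: "gam G (Suc j) \<subseteq> (\<lambda>a. \<lbrakk>y, a\<rbrakk>) ` gam G j" if "3 \<le> j" "j \<le> max 3 c" for j
    using that(2,1)
  proof (induct j rule: inc_induct)
    case base
    have "gam G (Suc (max 3 c)) = {\<one>}" using nil c3 by (simp add: max_def)
    moreover have "\<one> = \<lbrakk>y, \<one>\<rbrakk>" by simp
    moreover have "\<one> \<in> gam G (max 3 c)" by (rule subgroup.one_closed[OF gam_subgroup])
    ultimately show ?case by (metis empty_subsetI imageI insert_subset)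
  next
    case (step j)
    let ?I = "(\<lambda>a. \<lbrakk>y, a\<rbrakk>) ` gam G j"
    have j2: "gam G j \<subseteq> A" using step by (intro gam_antimono) simp
    have sI: "subgroup ?I G"
    proof (rule subgroupI)
      show "?I \<subseteq> carrier G" using gam_carrier by auto
      show "?I \<noteq> {}" using subgroup.one_closed[OF gam_subgroup] by blast
      fix i assume "i \<in> ?I"
      then obtain a where a: "a \<in> gam G j" "i = \<lbrakk>y, a\<rbrakk>" by blast
      have aA: "a \<in> A" using a j2 by blast
      have "\<lbrakk>y, inv a\<rbrakk> \<otimes> \<lbrakk>y, a\<rbrakk> = \<one>" using cm_y_hom[of "inv a" a y] aA by simp
      then have "inv i = \<lbrakk>y, inv a\<rbrakk>" using a aA by (intro inv_equality) auto
      then show "inv i \<in> ?I" using subgroup.m_inv_closed[OF gam_subgroup a(1)] by blast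
      fix i' assume "i' \<in> ?I"
      then obtain a' where a': "a' \<in> gam G j" "i' = \<lbrakk>y, a'\<rbrakk>" by blast
      have "i \<otimes> i' = \<lbrakk>y, a \<otimes> a'\<rbrakk>" using cm_y_hom[of a a' y] subsetD[OF j2 a(1)] subsetD[OF j2 a'(1)] a(2) a'(2) by simp
      then show "i \<otimes> i' \<in> ?I" using subgroup.m_closed[OF gam_subgroup a(1) a'(1)] by blast
    qed
    have I2: "gam G (Suc (Suc j)) \<subseteq> ?I" using step gam_Suc_sub[of j] by auto
    have "?I \<subseteq> gam G (Suc j)" using cm_gam'[OF _ y] by blast
    then have nI: "?I \<lhd> G" by (rule normal_between[OF sI I2])
    show ?case
    proof (rule gam_step2[OF gen x y, where B = "gam G j"])
      show "gam G j \<subseteq> generate G (gam G j \<union> gam G (Suc j))" by (auto intro: generate.incl)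
      show "?I \<lhd> G" "gam G (Suc (Suc j)) \<subseteq> ?I" by (fact nI I2)+
      show "1 \<le> j" using step by simp
      show "gam G j \<subseteq> carrier G" by (rule gam_sub)
    next
      fix b assume b: "b \<in> gam G j"
      have bG: "b \<in> carrier G" by (rule gam_carrier[OF b])
      have "\<lbrakk>x, b\<rbrakk> \<in> gam G (Suc (Suc j))" using cmx_metab[OF _ b] step by simp
      then show "\<lbrakk>b, x\<rbrakk> \<in> ?I" using cm_swap[OF sI _ x bG] I2 by blast
      show "\<lbrakk>b, y\<rbrakk> \<in> ?I" using cm_swap[OF sI _ y bG] b by blast
    qed
  qed
  show ?thesis
  proof (cases "k \<le> max 3 c")
    case True then show ?thesis using main[OF k] b by blast
  next
    case False
    then have "gam G (Suc k) \<subseteq> gam G (Suc c)" by (intro gam_antimono) simp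
    then have "b = \<lbrakk>y, \<one>\<rbrakk>" using b nil by auto
    then show ?thesis using subgroup.one_closed[OF gam_subgroup] by blast
  qed
qed

text \<open>By \<open>cmy_surj\<close> some g in gamma_(e+2) has [y,g] = [y,u], so z' = u g^(-1)
  commutes with \<open>y\<close>. The actions of \<open>x\<close> and \<open>y\<close> commute, so
  [x,z'] is fixed by \<open>y\<close> as well, and so is the cube of z'. Both lie in gamma_4, and
  \<open>cmy_kernel\<close> sends them to gamma_c.\<close>

lemma central_correction:
  assumes o: "order G = 3 ^ n" and c4: "c \<ge> 4"
  obtains g z' where "g \<in> gam G (e + 2)" "z' = u \<otimes> inv g" "z' \<in> gam G 3" "z' \<notin> gam G 4"
    "\<And>h. h \<in> carrier G \<Longrightarrow> \<lbrakk>h, z'\<rbrakk> \<in> gam G c" "z' [^] (3::nat) \<in> gam G c"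
proof -
  have "\<lbrakk>y, u\<rbrakk> \<in> gam G (Suc (e + 2))" using cm_u[OF y] by (simp add: eval_nat_numeral)
  then obtain g where g: "g \<in> gam G (e + 2)" "\<lbrakk>y, u\<rbrakk> = \<lbrakk>y, g\<rbrakk>" using cmy_surj[of "e + 2" "\<lbrakk>y, u\<rbrakk>"] e2 by auto
  have ge: "gam G (e + 2) \<subseteq> gam G 4" using e2 by (intro gam_antimono) simp
  have g4: "g \<in> gam G 4" using g ge by blast
  have gA: "g \<in> A" "u \<in> A" using g4 gam42 x_pow2 by auto
  have gG: "g \<in> carrier G" using gA by simp
  let ?z = "u \<otimes> inv g"
  have zA: "?z \<in> A" using gA by simp
  have z3: "?z \<in> gam G 3"
    using u_gam3 g4 gam43 subgroup.m_closed[OF gam_subgroup] subgroup.m_inv_closed[OF gam_subgroup] by blast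
  have z4: "?z \<notin> gam G 4" using mult_mem_cancel[OF gam_subgroup _ subgroup.m_inv_closed[OF gam_subgroup g4], of u] u4 by simp
  have "\<lbrakk>y, inv g\<rbrakk> = inv \<lbrakk>y, g\<rbrakk>"
    using cm_y_hom[of "inv g" g y] gA by (intro inv_equality[symmetric]) auto
  then have yz: "\<lbrakk>y, ?z\<rbrakk> = \<one>" using cm_y_hom[of u "inv g" y] gA g by simp
  have "\<lbrakk>x, ?z\<rbrakk> \<in> gam G c"
  proof (rule cmy_kernel[OF o c4])
    have "\<lbrakk>x, ?z\<rbrakk> \<in> gam G (3 + 2)" by (rule cmx_metab[OF _ z3]) simp
    then show "\<lbrakk>x, ?z\<rbrakk> \<in> gam G 4" using gam_antimono[of 4 "3 + 2"] by auto
    have ey: "act y ?z = ?z" using conj_cm[of ?z y] yz gG by (simp add: act_def)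
    have e: "\<lbrakk>x, ?z\<rbrakk> = act x ?z \<otimes> inv ?z" by (simp add: cm_def act_def)
    have "act y \<lbrakk>x, ?z\<rbrakk> = act y (act x ?z) \<otimes> inv (act y ?z)"
      unfolding e using zA act_A[OF x zA] by (simp add: act_mult act_inv del: act_A)
    also have "\<dots> = \<lbrakk>x, ?z\<rbrakk>" unfolding act_commute[OF y x zA] ey e ..
    finally have "act y \<lbrakk>x, ?z\<rbrakk> \<otimes> inv \<lbrakk>x, ?z\<rbrakk> = \<one>" using gG by simp
    then show "\<lbrakk>y, \<lbrakk>x, ?z\<rbrakk>\<rbrakk> = \<one>" using gG by (simp add: cm_def[of G y] act_def)
  qed
  moreover have "\<lbrakk>y, ?z\<rbrakk> \<in> gam G c" using yz subgroup.one_closed[OF gam_subgroup] by simp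
  ultimately have cz: "\<lbrakk>h, ?z\<rbrakk> \<in> gam G c" if h: "h \<in> carrier G" for h
  proof -
    have zG: "?z \<in> carrier G" using zA by simp
    have "\<lbrakk>?z, x\<rbrakk> \<in> gam G c" "\<lbrakk>?z, y\<rbrakk> \<in> gam G c"
      using \<open>\<lbrakk>x, ?z\<rbrakk> \<in> gam G c\<close> \<open>\<lbrakk>y, ?z\<rbrakk> \<in> gam G c\<close> cm_swap[OF gam_subgroup _ _ zG] by auto
    then have "\<lbrakk>?z, h\<rbrakk> \<in> gam G c" by (intro gen2_Cent[OF gen gam_normal zG h] x y)
    then show ?thesis by (rule cm_swap[OF gam_subgroup _ zG h])
  qed
  have "?z [^] (3::nat) \<in> gam G c"
  proof (rule cmy_kernel[OF o c4])
    show "?z [^] (3::nat) \<in> gam G 4" by (rule cube3[OF z3])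
    have zG: "?z \<in> carrier G" using zA by simp
    have zz: "?z \<otimes> ?z \<in> A" using zA by simp
    have "\<lbrakk>y, ?z \<otimes> ?z \<otimes> ?z\<rbrakk> = \<one>"
      unfolding cm_y_hom[OF zz zA y] cm_y_hom[OF zA zA y] yz by simp
    then show "\<lbrakk>y, ?z [^] (3::nat)\<rbrakk> = \<one>" unfolding pow3[OF zG] .
  qed
  then show ?thesis using that[OF g(1) refl z3 z4 cz] by blast
qed

end

section \<open>The lower exponent-\<open>3\<close> central series\<close>

context group
begin

lemma pser_normal: "pser G n \<lhd> G"
proof (induct n)
  case 0 show ?case by (simp add: normal_self)
next
  case (Suc n)
  interpret M: normal "pser G n" G by (rule Suc)
  show ?case unfolding pser.simps
  proof (rule normal_generateI)
    show "{x [^] (3::nat) |x. x \<in> pser G n} \<union> comm_set G (pser G n) (carrier G) \<subseteq> carrier G"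
      by (auto simp: comm_set_def)
    fix h g assume h: "h \<in> {x [^] (3::nat) |x. x \<in> pser G n} \<union> comm_set G (pser G n) (carrier G)"
      and g: "g \<in> carrier G"
    then consider a where "a \<in> pser G n" "h = a [^] (3::nat)" | a b where "a \<in> pser G n" "b \<in> carrier G" "h = \<lbrakk>a, b\<rbrakk>"
      unfolding comm_set_def cm_def by blast
    then show "g \<otimes> h \<otimes> inv g \<in> {x [^] (3::nat) |x. x \<in> pser G n} \<union> comm_set G (pser G n) (carrier G)"
    proof cases
      case 1
      then have "g \<otimes> h \<otimes> inv g = (g \<otimes> a \<otimes> inv g) [^] (3::nat)" using g by (simp add: pow3 word)
      then show ?thesis using M.inv_op_closed2[OF g 1(1)] by blast
    next
      case 2
      then have "g \<otimes> h \<otimes> inv g = \<lbrakk>g \<otimes> a \<otimes> inv g, g \<otimes> b \<otimes> inv g\<rbrakk>"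
        using conj_cm_distrib[OF g M.mem_carrier[OF 2(1)] 2(2)] by simp
      moreover have "g \<otimes> b \<otimes> inv g \<in> carrier G" using g 2 by simp
      ultimately show ?thesis using M.inv_op_closed2[OF g 2(1)] unfolding comm_set_def cm_def by blast
    qed
  qed
qed

lemma pser_Suc_mem:
  "a \<in> pser G n \<Longrightarrow> a [^] (3::nat) \<in> pser G (Suc n)"
  "a \<in> pser G n \<Longrightarrow> g \<in> carrier G \<Longrightarrow> \<lbrakk>a, g\<rbrakk> \<in> pser G (Suc n)"
  unfolding pser.simps comm_set_def cm_def by (intro generate.incl; blast)+

lemma pser_least:
  assumes "subgroup M G" "\<And>a. a \<in> pser G n \<Longrightarrow> a [^] (3::nat) \<in> M"
    "\<And>a g. a \<in> pser G n \<Longrightarrow> g \<in> carrier G \<Longrightarrow> \<lbrakk>a, g\<rbrakk> \<in> M"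
  shows "pser G (Suc n) \<subseteq> M"
  unfolding pser.simps
  by (rule generate_subgroup_incl[OF _ assms(1)]) (use assms(2,3) in \<open>auto simp: comm_set_def cm_def\<close>)

declare pser.simps(2) [simp del]

lemma pser_Suc_sub: "pser G (Suc n) \<subseteq> pser G n"
proof (rule pser_least)
  note s = normal_imp_subgroup[OF pser_normal[of n]]
  show "subgroup (pser G n) G" by (rule s)
  fix a assume a: "a \<in> pser G n"
  have aG: "a \<in> carrier G" by (rule subgroup.mem_carrier[OF s a])
  show "a [^] (3::nat) \<in> pser G n" using a aG subgroup.m_closed[OF s] by (simp add: pow3)
  fix g assume g: "g \<in> carrier G"
  show "\<lbrakk>a, g\<rbrakk> \<in> pser G n" by (rule cm_swap[OF s Cent_cm_right[OF pser_normal a g] g aG])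
qed

lemma pclass_eq:
  assumes "pser G (Suc m) = {\<one>}" "pser G m \<noteq> {\<one>}"
  shows "pclass G = Suc m"
  unfolding pclass_def
proof (rule Least_equality)
  fix k assume k: "pser G k = {\<one>}"
  show "Suc m \<le> k"
  proof (rule ccontr)
    assume "\<not> Suc m \<le> k"
    then have "pser G m \<subseteq> pser G k" using lift_Suc_antimono_le[of "pser G" k m] pser_Suc_sub by simp
    then show False using k assms(2) subgroup.one_closed[OF normal_imp_subgroup[OF pser_normal[of m]]] by auto
  qed
qed (fact assms(1))

lemma adj_normal_central:
  assumes N: "N \<lhd> G" and a: "a \<in> carrier G" "\<And>g. g \<in> carrier G \<Longrightarrow> \<lbrakk>g, a\<rbrakk> \<in> N"
  shows "adj N a \<lhd> G"
proof -
  interpret N: normal N G by fact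
  have s: "subgroup (adj N a) G" by (rule adj_subgroup[OF N.is_subgroup a(1)])
  show ?thesis
  proof (rule normal_invI[OF s])
    fix g h assume g: "g \<in> carrier G" and h: "h \<in> adj N a"
    have "adj N a \<subseteq> Cent N g"
      using sub_Cent[OF N g] a g by (intro adj_least Cent_subgroup N) (auto simp: Cent_iff)
    then have "h \<in> Cent N g" using h by blast
    then have "\<lbrakk>g, h\<rbrakk> \<in> adj N a" "h \<in> carrier G" using subsetD[OF adj_sub(1)] by (auto simp: Cent_iff)
    then show "g \<otimes> h \<otimes> inv g \<in> adj N a" using conj_cm[of h g] g h subgroup.m_closed[OF s] by simp
  qed
qed

lemma adj_one: "subgroup N G \<Longrightarrow> a \<in> N \<Longrightarrow> adj N a = N"
  using adj_least[of N N a] adj_sub(1)[of N a] by blast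

end

context bicyc
begin

lemma x_pow_Suc: "(x [^] ((3::nat) ^ k)) [^] (3::nat) = x [^] ((3::nat) ^ Suc k)"
  by (simp add: nat_pow_pow mult.commute)

text \<open>Commutators with x^(3^k) lie in gamma_(k+3) and cubes of gamma_(k+1) in gamma_(k+2). So
  passing to the next term deepens the lower central part by one and cubes the power of
  \<open>x\<close>, with nothing new arising.\<close>

lemma pser_eq: "k \<ge> 1 \<Longrightarrow> pser G k = adj (gam G (Suc k)) (x [^] ((3::nat) ^ k))"
proof (induct k rule: nat_induct_at_least)
  case base
  show ?case
  proof
    have "pser G (Suc 0) \<subseteq> Phi"
    proof (rule pser_least[OF normal_imp_subgroup[OF Phi_normal]])
      show "a [^] (3::nat) \<in> Phi" if "a \<in> pser G 0" for a using cube_Phi that by simp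
      show "\<lbrakk>a, g\<rbrakk> \<in> Phi" if "a \<in> pser G 0" "g \<in> carrier G" for a g using gam2_all gam2_Phi that by auto
    qed
    then show "pser G 1 \<subseteq> adj (gam G (Suc 1)) (x [^] ((3::nat) ^ 1))" by (simp add: Phi_def Suc2)
    have "gam G (Suc 1) \<subseteq> pser G (Suc 0)"
      by (rule gam_least[OF _ normal_imp_subgroup[OF pser_normal]]) (auto intro!: pser_Suc_mem(2))
    then show "adj (gam G (Suc 1)) (x [^] ((3::nat) ^ 1)) \<subseteq> pser G 1"
      using pser_Suc_mem(1)[of x 0] by (intro adj_least normal_imp_subgroup[OF pser_normal]) auto
  qed
next
  case (Suc k)
  let ?a = "x [^] ((3::nat) ^ k)" and ?b = "x [^] ((3::nat) ^ Suc k)" and ?M = "gam G (Suc (Suc k))"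
  have mem: "?a \<in> pser G k" "gam G (Suc k) \<subseteq> pser G k" unfolding Suc by (rule adj_sub)+
  have sM: "subgroup (adj ?M ?b) G" by (rule adj_subgroup[OF gam_subgroup]) simp
  have ac: "\<lbrakk>h, ?a\<rbrakk> \<in> ?M" if "h \<in> carrier G" for h
    using cm_pow_gam[OF x that Suc(1)] gam_antimono[of "Suc (Suc k)" "k + 3"] by auto
  show ?case
  proof
    show "pser G (Suc k) \<subseteq> adj ?M ?b"
    proof (rule pser_least[OF sM])
      fix g assume g: "g \<in> pser G k"
      obtain i :: int and m where m: "m \<in> gam G (Suc k)" "g = m \<otimes> ?a [^] i"
        using adj_mem_int[OF gam_normal, of ?a g "Suc k"] g Suc(2) by auto
      have mG: "m \<in> carrier G" by (rule gam_carrier[OF m(1)])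
      have "?M #> g [^] (3::nat) = ?M #> (m [^] (3::nat) \<otimes> (?a [^] i) [^] (3::nat))"
        unfolding m(2) using cm_gam[OF m(1)] by (intro pow_mult_mod gam_normal mG) auto
      moreover have "(?a [^] i) [^] (3::nat) = ?b [^] i"
        using int_pow_pow[of ?a i 3] int_pow_pow[of ?a 3 i] int_pow_int[of G "?a [^] i" 3] int_pow_int[of G ?a 3]
          x_pow_Suc[of k] by (simp add: mult.commute)
      moreover have "?b [^] i \<in> adj ?M ?b" by (rule subgroup_int_pow_closed[OF sM adj_sub(2)])
      moreover have "m [^] (3::nat) \<in> adj ?M ?b" using cube1[OF _ m(1)] Suc(1) adj_sub(1) by auto
      ultimately show "g [^] (3::nat) \<in> adj ?M ?b"
        using coset_mem_iff[OF gam_normal _ _ _ adj_sub(1) sM, of "g [^] (3::nat)" "m [^] (3::nat) \<otimes> (?a [^] i) [^] (3::nat)"]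
          mG m(2) subgroup.m_closed[OF sM] by simp
      fix h assume h: "h \<in> carrier G"
      have "adj (gam G (Suc k)) ?a \<subseteq> Cent ?M h"
        using cm_gam'[OF _ h] ac[OF h] gam_sub
        by (intro adj_least Cent_subgroup gam_normal h sub_CentI[OF _ order_refl]) (auto simp: Cent_iff)
      then have "g \<in> Cent ?M h" using g Suc(2) by blast
      then have "\<lbrakk>g, h\<rbrakk> \<in> ?M" using cm_swap[OF gam_subgroup _ h] by (simp add: Cent_iff)
      then show "\<lbrakk>g, h\<rbrakk> \<in> adj ?M ?b" using adj_sub(1) by blast
    qed
    have "?M \<subseteq> pser G (Suc k)"
      using mem(2) by (intro gam_least normal_imp_subgroup[OF pser_normal] pser_Suc_mem(2)) auto
    then show "adj ?M ?b \<subseteq> pser G (Suc k)"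
      using pser_Suc_mem(1)[OF mem(1)] unfolding x_pow_Suc by (intro adj_least normal_imp_subgroup[OF pser_normal])
  qed
qed

end

context special_metab
begin

lemma gam_big: "k > c \<Longrightarrow> gam G k = {\<one>}"
  using gam_antimono[of "Suc c" k] nil subgroup.one_closed[OF gam_subgroup[of k]] by auto

text \<open>For such \<open>k\<close> the power x^(3^k) is a power of \<open>u\<close>, hence in
  gamma_2, and its commutators lie in gamma_(k+3) = 1. It is therefore a central element to which
  \<open>central_cube\<close> applies.\<close>

lemma x_pow_one:
  assumes "k \<ge> e" "k + 2 \<ge> c"
  shows "x [^] ((3::nat) ^ Suc k) = \<one>"
proof -
  let ?a = "x [^] ((3::nat) ^ k)"
  have "(3::nat) ^ e * 3 ^ (k - e) = 3 ^ k" using assms by (simp add: power_add[symmetric])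
  then have "?a = u [^] ((3::nat) ^ (k - e))" by (simp add: nat_pow_pow)
  then have aA: "?a \<in> A" 
    using subgroup_int_pow_closed[OF gam_subgroup x_pow2, of "int (3 ^ (k - e))"] int_pow_int[of G u "3 ^ (k-e)"] by simp
  have "\<lbrakk>h, ?a\<rbrakk> = \<one>" if "h \<in> carrier G" for h
    using cm_pow_gam[OF x that, of k] gam_big[of "k + 3"] assms e2 by simp
  then have "?a [^] (3::nat) = \<one>" using central_cube[OF y_pow2 aA] by simp
  then show ?thesis unfolding x_pow_Suc .
qed

lemma gam_c_card: "c \<ge> 4 \<Longrightarrow> card (gam G c) = 3"
  using card_step[of c] nil by simp

text \<open>Here u^3 = 1, so the exponent class is e + 1 whatever \<open>c\<close> is. The last term
  has order 3 |gamma_(e+1)| once \<open>u\<close> lies outside gamma_(e+1), which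
  \<open>e \<ge> 3\<close> ensures; the second factor is 1 for c <= e and 3 for c = e + 1.\<close>

lemma pser_small:
  assumes o: "order G = 3 ^ n" and c: "c \<le> e + 1"
  shows "pser G e = adj (gam G (Suc e)) u" "pclass G = Suc e"
    "c \<le> e \<Longrightarrow> card (pser G e) = 3" "e \<ge> 3 \<Longrightarrow> c = e + 1 \<Longrightarrow> card (pser G e) = 9"
proof -
  show pe: "pser G e = adj (gam G (Suc e)) u" using pser_eq[of e] e2 by simp
  have u3: "x [^] ((3::nat) ^ Suc e) = \<one>" using x_pow_one[of e] c by simp
  have "pser G (Suc e) = adj (gam G (Suc (Suc e))) \<one>" using pser_eq[of "Suc e"] unfolding u3 by simp
  then have p1: "pser G (Suc e) = {\<one>}" using gam_big[of "Suc (Suc e)"] c by (simp add: generate_one)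
  have u1: "u \<noteq> \<one>" using u4 subgroup.one_closed[OF gam_subgroup] by metis
  have uP: "u \<in> pser G e" unfolding pe by (rule adj_sub)
  then show "pclass G = Suc e" using u1 by (intro pclass_eq p1) auto
  have uc: "u \<notin> gam G (Suc e)" if "e \<ge> 3" using u4 gam_antimono[of 4 "Suc e"] that by auto
  have le: "card (pser G e) \<le> 3 * card (gam G (Suc e))"
    unfolding pe using card_adj_le(2)[OF gam_normal gam_fin, of u 3 "Suc e"] u3 x_pow_Suc[of e]
      subgroup.one_closed[OF gam_subgroup] by simp
  have e3: "e \<ge> 3" if "c \<le> e" using c3 that by auto
  have ge: "3 * card (gam G (Suc e)) \<le> card (pser G e)" if "u \<notin> gam G (Suc e)"
    using that adj_sub[where N = "gam G (Suc e)" and a = u] normal_imp_subgroup[OF pser_normal[of e]] unfolding pe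
    by (intro card_proper_subgroup[OF fin o gam_subgroup]) auto
  show "card (pser G e) = 3" if "c \<le> e" using le ge uc e3 that gam_big[of "Suc e"] by simp
  show "card (pser G e) = 9" if "e \<ge> 3" "c = e + 1" using le ge uc gam_c_card that by simp
qed

lemma pser_large:
  assumes c: "c \<ge> e + 2"
  shows "pser G (c - 1) = gam G c" "pclass G = c" "card (pser G (c - 1)) = 3"
proof -
  have c1: "Suc (c - 1) = c" "c - 1 \<ge> 1" "Suc (c - 2) = c - 1" using c by auto
  \<comment> \<open>c - 2 is the least exponent allowed by \<open>x_pow_one\<close>, and c >= e + 2
    makes it at least e.\<close>
  have "x [^] ((3::nat) ^ Suc (c - 2)) = \<one>" using c by (intro x_pow_one) auto
  then have x1: "x [^] ((3::nat) ^ (c - 1)) = \<one>" unfolding c1 .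
  show p: "pser G (c - 1) = gam G c"
    using pser_eq[OF c1(2)] adj_one[OF gam_subgroup subgroup.one_closed[OF gam_subgroup], of c] unfolding x1 c1 by simp
  show k: "card (pser G (c - 1)) = 3" using gam_c_card c e2 unfolding p by simp
  have x2: "x [^] ((3::nat) ^ c) = \<one>" using x_pow_Suc[of "c - 1"] x1 c1 by simp
  have "pser G c = adj (gam G (Suc c)) \<one>" using pser_eq[of c] c unfolding x2 by simp
  then have "pser G c = {\<one>}" unfolding nil by (simp add: generate_one)
  then have "pclass G = Suc (c - 1)" using k c1 by (intro pclass_eq) auto
  then show "pclass G = c" using c1 by simp
qed

end

section \<open>Transport along epimorphisms\<close>

text \<open>Quotients, iterated quotients and isomorphisms are all handled as epimorphisms with a
  known kernel, which avoids calculating with cosets of cosets.\<close>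

locale epi = group_hom +
  assumes surj: "h ` carrier G = carrier H"
begin

abbreviation ker where "ker \<equiv> kernel G H h"

lemma ker_iff: "a \<in> ker \<longleftrightarrow> a \<in> carrier G \<and> h a = \<one>\<^bsub>H\<^esub>"
  by (auto simp: kernel_def)

lemma cubes_img:
  assumes S: "S \<subseteq> carrier G"
  shows "{a [^]\<^bsub>H\<^esub> (3::nat) | a. a \<in> h ` S} = h ` {a [^] (3::nat) | a. a \<in> S}"
proof -
  have "{a [^]\<^bsub>H\<^esub> (3::nat) | a. a \<in> h ` S} = (\<lambda>a. h a [^]\<^bsub>H\<^esub> (3::nat)) ` S" by blast
  also have "\<dots> = (\<lambda>a. h (a [^] (3::nat))) ` S"
    by (rule image_cong[OF refl], rule hom_nat_pow[symmetric]) (rule subsetD[OF S])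
  finally show ?thesis by blast
qed

lemma comm_set_img:
  assumes "A \<subseteq> carrier G" "B \<subseteq> carrier G"
  shows "comm_set H (h ` A) (h ` B) = h ` comm_set G A B"
proof -
  have c: "cm H (h a) (h b) = h (cm G a b)" if "a \<in> A" "b \<in> B" for a b
    by (rule hom_cm[symmetric]) (use assms that in auto)
  have "comm_set H (h ` A) (h ` B) = {cm H (h a) (h b) | a b. a \<in> A \<and> b \<in> B}"
    unfolding comm_set_def cm_def by blast
  also have "\<dots> = {h (cm G a b) | a b. a \<in> A \<and> b \<in> B}" using c by metis
  also have "\<dots> = h ` comm_set G A B" unfolding comm_set_def cm_def by blast
  finally show ?thesis .
qed

lemma comm_set_carrier: "A \<subseteq> carrier G \<Longrightarrow> comm_set G A (carrier G) \<subseteq> carrier G"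
  by (auto simp: comm_set_def)

lemma gam_img: "gam H n = h ` gam G n"
proof (induct n)
  case 0 show ?case using surj by simp
next
  case (Suc n)
  show ?case
  proof (cases "n = 0")
    case True then show ?thesis using surj by simp
  next
    case False
    then have n: "n \<ge> 1" by simp
    show ?thesis unfolding H.gam_Suc[OF n] G.gam_Suc[OF n] Suc surj[symmetric] comm_set_img[OF G.gam_sub order_refl]
      by (rule generate_img) (rule comm_set_carrier[OF G.gam_sub])
  qed
qed

lemma derived_carrier: "derived H (carrier H) = h ` derived G (carrier G)"
  using gam_img[of 2] unfolding G.gam2 H.gam2 .

lemma pser_img: "pser H n = h ` pser G n"
proof (induct n)
  case 0 show ?case using surj by simp
next
  case (Suc n)
  have P: "pser G n \<subseteq> carrier G" using subgroup.subset[OF normal_imp_subgroup[OF G.pser_normal]] .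
  have "{x [^]\<^bsub>H\<^esub> (3::nat) |x. x \<in> h ` pser G n} = h ` {x [^] (3::nat) |x. x \<in> pser G n}"
    by (rule cubes_img[OF P])
  then have "{x [^]\<^bsub>H\<^esub> (3::nat) |x. x \<in> pser H n} \<union> comm_set H (pser H n) (carrier H) =
      h ` ({x [^] (3::nat) |x. x \<in> pser G n} \<union> comm_set G (pser G n) (carrier G))"
    unfolding Suc surj[symmetric] comm_set_img[OF P order_refl] by blast
  moreover have "{x [^] (3::nat) |x. x \<in> pser G n} \<subseteq> carrier G" using P by auto
  ultimately show ?case unfolding pser.simps(2)
    using generate_img[OF Un_least[OF _ comm_set_carrier[OF P]]] by simp
qed

lemma img_subset_iff:
  assumes S: "subgroup S G" "S' \<subseteq> carrier G" and k: "ker \<subseteq> S"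
  shows "h ` S' \<subseteq> h ` S \<longleftrightarrow> S' \<subseteq> S"
proof
  assume a: "h ` S' \<subseteq> h ` S"
  show "S' \<subseteq> S"
  proof
    fix b assume b: "b \<in> S'"
    then obtain d where d: "d \<in> S" "h b = h d" using a by blast
    have G: "b \<in> carrier G" "d \<in> carrier G" using S b d subgroup.mem_carrier[OF S(1)] by auto
    then have "b \<otimes> inv d \<in> ker" using d by (simp add: ker_iff)
    then have "b \<otimes> inv d \<otimes> d \<in> S" using k d subgroup.m_closed[OF S(1)] by blast
    then show "b \<in> S" using G by (simp add: G.m_assoc)
  qed
qed blast

lemma img_eq_iff:
  assumes "subgroup S G" "subgroup S' G" "ker \<subseteq> S" "ker \<subseteq> S'"
  shows "h ` S' = h ` S \<longleftrightarrow> S' = S"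
  using img_subset_iff[OF assms(1) subgroup.subset[OF assms(2)] assms(3)]
    img_subset_iff[OF assms(2) subgroup.subset[OF assms(1)] assms(4)] by auto

lemma mem_img_iff:
  assumes "subgroup S G" "ker \<subseteq> S" "a \<in> carrier G"
  shows "h a \<in> h ` S \<longleftrightarrow> a \<in> S"
  using img_subset_iff[OF assms(1) _ assms(2), of "{a}"] assms(3) by auto

lemma card_img:
  assumes S: "subgroup S G"
  shows "card S = card (h ` S) * card (S \<inter> ker)"
proof -
  interpret S: group "G\<lparr>carrier := S\<rparr>" by (rule G.subgroup_imp_group[OF S])
  have sh: "subgroup (h ` S) H" by (rule subgroup_img_is_subgroup[OF S])
  interpret T: group "H\<lparr>carrier := h ` S\<rparr>" by (rule H.subgroup_imp_group[OF sh])
  have SG: "S \<subseteq> carrier G" by (rule subgroup.subset[OF S])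
  interpret r: group_hom "G\<lparr>carrier := S\<rparr>" "H\<lparr>carrier := h ` S\<rparr>" h
    by unfold_locales (use SG in \<open>auto simp: hom_def subset_iff\<close>)
  have k: "kernel (G\<lparr>carrier := S\<rparr>) (H\<lparr>carrier := h ` S\<rparr>) h = S \<inter> ker"
    using SG by (auto simp: kernel_def)
  have "bij_betw (\<lambda>Y. the_elem (h ` Y)) (carrier (G\<lparr>carrier := S\<rparr> Mod (S \<inter> ker))) (h ` S)"
    using r.FactGroup_iso_set unfolding k iso_def by simp
  then have "card (rcosets\<^bsub>G\<lparr>carrier := S\<rparr>\<^esub> (S \<inter> ker)) = card (h ` S)"
    using bij_betw_same_card unfolding FactGroup_def by fastforce
  then show ?thesis using S.lagrange[of "S \<inter> ker"] r.subgroup_kernel unfolding k order_def by simp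
qed

lemma order_img: "order G = order H * card ker"
  using card_img[OF G.subgroup_self] surj subgroup.subset[OF subgroup_kernel]
  by (simp add: order_def Int_absorb1)

lemma is_3group_img:
  assumes "is_3group G"
  shows "is_3group H"
proof -
  obtain n where n: "order G = 3 ^ n" and f: "finite (carrier G)" using assms by (auto simp: is_3group_def)
  have "order H dvd 3 ^ n" using order_img n by (metis dvd_triv_left)
  then have "\<exists>m. order H = 3 ^ m" using divides_primepow_nat[of 3 "order H" n] by auto
  moreover have "finite (carrier H)" using f surj by (metis finite_imageI)
  ultimately show ?thesis by (simp add: is_3group_def H.is_group)
qed

lemma max_sub_img:
  assumes M: "max_sub G M" and k: "ker \<subseteq> M"
  shows "max_sub H (h ` M)"
proof -
  have s: "subgroup M G" "M \<noteq> carrier G" using M by (auto simp: max_sub_def)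
  have "h ` M \<noteq> carrier H"
    using img_eq_iff[OF s(1) G.subgroup_self k subgroup.subset[OF subgroup_kernel]] s(2) surj by simp
  moreover have "K = h ` M \<or> K = carrier H" if K: "subgroup K H" "h ` M \<subseteq> K" for K
  proof -
    let ?L = "{a \<in> carrier G. h a \<in> K}"
    interpret K: subgroup K H by (rule K(1))
    have sL: "subgroup ?L G"
    proof (rule G.subgroupI)
      have "\<one> \<in> ?L" using K.one_closed by simp
      then show "?L \<noteq> {}" by blast
    qed auto
    have "M \<subseteq> ?L" using K(2) subgroup.mem_carrier[OF s(1)] by auto
    then have "?L = M \<or> ?L = carrier G" using M sL unfolding max_sub_def by blast
    moreover have "h ` ?L = K" using surj subgroup.subset[OF K(1)] by auto
    ultimately show ?thesis using surj by auto
  qed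
  ultimately show ?thesis using subgroup_img_is_subgroup[OF s(1)] by (auto simp: max_sub_def)
qed

lemma cyc_mod_img: 
  assumes "A \<subseteq> carrier G" "B \<subseteq> carrier G" "cyc_mod G A B"
  shows "cyc_mod H (h ` A) (h ` B)"
proof -
  obtain a where a: "a \<in> A" "A = generate G (insert a B)" using assms(3) by (auto simp: cyc_mod_def)
  have "h ` A = generate H (insert (h a) (h ` B))" using generate_img[of "insert a B"] a assms by auto
  then show ?thesis using a(1) by (auto simp: cyc_mod_def)
qed

lemma bicyc_mod_img: 
  assumes "A \<subseteq> carrier G" "B \<subseteq> carrier G" "bicyc_mod G A B"
  shows "bicyc_mod H (h ` A) (h ` B)"
proof -
  obtain a b where a: "a \<in> A" "b \<in> A" "A = generate G ({a, b} \<union> B)" using assms(3) by (auto simp: bicyc_mod_def)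
  have "h ` ({a, b} \<union> B) = {h a, h b} \<union> h ` B" by auto
  then have "h ` A = generate H ({h a, h b} \<union> h ` B)" using generate_img[of "{a, b} \<union> B"] a assms by auto
  then show ?thesis using a(1,2) unfolding bicyc_mod_def by blast
qed

lemma cyc_quot_img:
  assumes S: "subgroup S G" and k: "ker \<subseteq> derived G (carrier G)" "derived G (carrier G) \<subseteq> S"
  shows "cyc_quot H (h ` S) \<longleftrightarrow> cyc_quot G S"
proof
  let ?D = "derived G (carrier G)"
  have sD: "subgroup ?D G" using G.derived_is_subgroup[OF order_refl] .
  assume "cyc_quot G S"
  then show "cyc_quot H (h ` S)"
    unfolding cyc_quot_def derived_carrier using S sD by (intro cyc_mod_img subgroup.subset)
next
  let ?D = "derived G (carrier G)"
  have sD: "subgroup ?D G" using G.derived_is_subgroup[OF order_refl] .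
  assume "cyc_quot H (h ` S)"
  then obtain a where a: "a \<in> S" "h ` S = generate H (insert (h a) (h ` ?D))"
    unfolding cyc_quot_def cyc_mod_def derived_carrier by auto
  have aG: "a \<in> carrier G" by (rule subgroup.mem_carrier[OF S a(1)])
  have "h ` S = h ` generate G (insert a ?D)"
    using generate_img[of "insert a ?D"] a(2) aG subgroup.subset[OF sD] by auto
  moreover have "subgroup (generate G (insert a ?D)) G" by (rule G.adj_subgroup[OF sD aG])
  moreover have "ker \<subseteq> generate G (insert a ?D)" using k(1) G.adj_sub(1) by blast
  moreover have "ker \<subseteq> S" using k by blast
  ultimately have "S = generate G (insert a ?D)" using img_eq_iff[OF _ S] by blast
  then show "cyc_quot G S" using a(1) unfolding cyc_quot_def cyc_mod_def by blast
qed

lemma Frat_img: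
  assumes S: "subgroup S G"
  shows "H.Frat (h ` S) = h ` G.Frat S"
proof -
  have SG: "S \<subseteq> carrier G" by (rule subgroup.subset[OF S])
  have "{a [^]\<^bsub>H\<^esub> (3::nat) | a. a \<in> h ` S} = h ` {a [^] (3::nat) | a. a \<in> S}"
    by (rule cubes_img[OF SG])
  then have "{a [^]\<^bsub>H\<^esub> (3::nat) | a. a \<in> h ` S} \<union> derived H (h ` S) = h ` ({a [^] (3::nat) | a. a \<in> S} \<union> derived G S)"
    using derived_img[OF SG] by blast
  then show ?thesis unfolding H.Frat_def G.Frat_def
    using generate_img[OF subset_trans[OF G.Frat_gen_sub[OF S] SG]] by simp
qed

lemma rank3_img:
  assumes G3: "is_3group G" and S: "subgroup S G" and k: "ker \<subseteq> G.Frat S"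
  shows "rank3 (H\<lparr>carrier := h ` S\<rparr>) = rank3 (G\<lparr>carrier := S\<rparr>)"
proof -
  obtain n where n: "order G = 3 ^ n" and f: "finite (carrier G)" using G3 by (auto simp: is_3group_def)
  obtain m where m: "order H = 3 ^ m" and f': "finite (carrier H)" using is_3group_img[OF G3] by (auto simp: is_3group_def)
  have kS: "ker \<subseteq> S" using k G.Frat_sub[OF S] by blast
  define d where "d = rank3 (G\<lparr>carrier := S\<rparr>)"
  have "card S = 3 ^ d * card (G.Frat S)" by (rule iffD1[OF G.rank3_eq[OF f n S] d_def[symmetric]])
  then have "card (h ` S) * card ker = 3 ^ d * (card (h ` G.Frat S) * card ker)"
    using card_img[OF S] card_img[OF G.Frat_subgroup[OF S]] k kS by (simp add: Int_absorb1)
  moreover have "card ker > 0"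
    using finite_subset[OF subgroup.subset[OF subgroup_kernel] f] subgroup.one_closed[OF subgroup_kernel] card_gt_0_iff by blast
  ultimately have "card (h ` S) = 3 ^ d * card (H.Frat (h ` S))" unfolding Frat_img[OF S] by simp
  then show ?thesis using H.rank3_eq[OF f' m subgroup_img_is_subgroup[OF S]] d_def by simp
qed

lemma is_CF_img: "is_CF G \<Longrightarrow> is_CF H"
  unfolding is_CF_def gam_img using cyc_mod_img[OF G.gam_sub G.gam_sub] by blast

lemma is_BCF_img: "is_BCF G \<Longrightarrow> is_BCF H"
  unfolding is_BCF_def gam_img using bicyc_mod_img[OF G.gam_sub G.gam_sub] by blast

lemma Mod_iso: "G Mod ker \<cong> H"
  by (rule FactGroup_iso[OF surj])

lemma epi_Mod:
  assumes N: "N \<lhd> H"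
  shows "epi G (H Mod N) (\<lambda>a. N #>\<^bsub>H\<^esub> h a)" "kernel G (H Mod N) (\<lambda>a. N #>\<^bsub>H\<^esub> h a) = {a \<in> carrier G. h a \<in> N}"
proof -
  interpret N: normal N H by fact
  interpret Q: group_hom H "H Mod N" "\<lambda>a. N #>\<^bsub>H\<^esub> a" by (rule N.mod_hom)
  show "epi G (H Mod N) (\<lambda>a. N #>\<^bsub>H\<^esub> h a)"
  proof (intro epi.intro group_hom.intro epi_axioms.intro group_hom_axioms.intro)
    show "(\<lambda>a. N #>\<^bsub>H\<^esub> h a) ` carrier G = carrier (H Mod N)"
      using surj unfolding carrier_FactGroup by (metis image_image)
    show "(\<lambda>a. N #>\<^bsub>H\<^esub> h a) \<in> hom G (H Mod N)"
    proof (rule homI)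
      fix a assume a: "a \<in> carrier G"
      show "N #>\<^bsub>H\<^esub> h a \<in> carrier (H Mod N)" by (rule Q.hom_closed[OF hom_closed[OF a]])
      fix b assume b: "b \<in> carrier G"
      show "N #>\<^bsub>H\<^esub> h (a \<otimes> b) = (N #>\<^bsub>H\<^esub> h a) \<otimes>\<^bsub>H Mod N\<^esub> (N #>\<^bsub>H\<^esub> h b)"
        unfolding hom_mult[OF a b] by (rule Q.hom_mult[OF hom_closed[OF a] hom_closed[OF b]])
    qed
  qed (rule G.is_group N.factorgroup_is_group)+
  show "kernel G (H Mod N) (\<lambda>a. N #>\<^bsub>H\<^esub> h a) = {a \<in> carrier G. h a \<in> N}"
    unfolding kernel_def using N.mod_one_iff[OF hom_closed] by blast
qed

lemma abel_type_img:
  assumes k: "ker \<subseteq> gam G 2" and a: "abel_type e G"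
  shows "abel_type e H"
proof -
  interpret E: epi G "H Mod gam H 2" "\<lambda>a. gam H 2 #>\<^bsub>H\<^esub> h a" by (rule epi_Mod[OF H.gam_normal])
  have "E.ker = gam G 2"
  proof -
    have "E.ker = {a \<in> carrier G. h a \<in> gam H 2}" by (rule epi_Mod(2)[OF H.gam_normal])
    also have "\<dots> = {a \<in> carrier G. a \<in> gam G 2}"
      unfolding gam_img[of 2] using mem_img_iff[OF G.gam_subgroup k] by blast
    finally show ?thesis using G.gam_carrier[of _ 2] by blast
  qed
  then have i: "G Mod gam G 2 \<cong> H Mod gam H 2" using E.Mod_iso by simp
  have "group (G Mod gam G 2)" by (rule normal.factorgroup_is_group[OF G.gam_normal])
  then have "H Mod gam H 2 \<cong> G Mod gam G 2" using i by (rule group.iso_sym)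
  then show ?thesis using a unfolding abel_type_def G.gam2[symmetric] H.gam2[symmetric] by (rule iso_trans)
qed

lemma rank_dist_img:
  assumes G3: "is_3group G" and nil: "gam G (Suc c) = {\<one>}" and k2: "ker \<subseteq> gam G 2"
    and k: "\<And>M. max_sub G M \<Longrightarrow> ker \<subseteq> G.Frat M" and r: "rank_dist_2233 G"
  shows "rank_dist_2233 H"
proof -
  obtain H1 H2 H3 H4 where H: "distinct [H1, H2, H3]" "\<forall>H\<in>{H1, H2, H3}. max_sub G H \<and> cyc_quot G H"
      "max_sub G H4" "\<not> cyc_quot G H4"
      "rank3 (G\<lparr>carrier := H1\<rparr>) = 2" "rank3 (G\<lparr>carrier := H2\<rparr>) = 2"
      "rank3 (G\<lparr>carrier := H3\<rparr>) = 3" "rank3 (G\<lparr>carrier := H4\<rparr>) = 3"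
    using r unfolding rank_dist_2233_def by blast
  have m: "subgroup M G" "gam G 2 \<subseteq> M" "ker \<subseteq> M" if "max_sub G M" for M
    using that G.max_sub_gam2[OF nil that] k2 by (auto simp: max_sub_def)
  have mx: "max_sub H (h ` M)" if "max_sub G M" for M using max_sub_img[OF that m(3)[OF that]] .
  have rk: "rank3 (H\<lparr>carrier := h ` M\<rparr>) = rank3 (G\<lparr>carrier := M\<rparr>)" if "max_sub G M" for M
    using rank3_img[OF G3 m(1)[OF that] k[OF that]] .
  have cy: "cyc_quot H (h ` M) \<longleftrightarrow> cyc_quot G M" if "max_sub G M" for M
    using cyc_quot_img[OF m(1)[OF that]] k2 m(2)[OF that] unfolding G.gam2 by blast
  have eq: "h ` M = h ` M' \<longleftrightarrow> M = M'" if "max_sub G M" "max_sub G M'" for M M'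
    by (rule img_eq_iff[OF m(1)[OF that(2)] m(1)[OF that(1)] m(3)[OF that(2)] m(3)[OF that(1)]])
  have M: "max_sub G H1" "max_sub G H2" "max_sub G H3" using H(2) by simp_all
  have c: "cyc_quot G H1" "cyc_quot G H2" "cyc_quot G H3" using H(2) by simp_all
  have d: "distinct [h ` H1, h ` H2, h ` H3]"
    using H(1) eq[OF M(1,2)] eq[OF M(1,3)] eq[OF M(2,3)] by simp
  have a: "\<forall>K\<in>{h ` H1, h ` H2, h ` H3}. max_sub H K \<and> cyc_quot H K"
    using c mx[OF M(1)] mx[OF M(2)] mx[OF M(3)] unfolding cy[OF M(1), symmetric] cy[OF M(2), symmetric] cy[OF M(3), symmetric] by simp
  have n: "\<not> cyc_quot H (h ` H4)" using H(4) cy[OF H(3)] by simp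
  show ?thesis unfolding rank_dist_2233_def
    by (rule exI[of _ "h ` H1"], rule exI[of _ "h ` H2"], rule exI[of _ "h ` H3"], rule exI[of _ "h ` H4"], intro conjI)
      (use d a n mx[OF H(3)] H(5-8) rk[OF M(1)] rk[OF M(2)] rk[OF M(3)] rk[OF H(3)] in \<open>(assumption | simp only:)+\<close>)
qed

end

section \<open>Class, order and isomorphism of quotients\<close>

lemma log3_order_eq: "order G = 3 ^ n \<Longrightarrow> log3_order G = n"
  unfolding log3_order_def by (rule the_equality) auto

lemma (in group) nil_class_eq:
  assumes "gam G (Suc c) = {\<one>}" "c = 0 \<or> gam G c \<noteq> {\<one>}"
  shows "nil_class G = c"
  unfolding nil_class_def
proof (rule Least_equality)
  fix d assume d: "gam G (Suc d) = {\<one>}"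
  show "c \<le> d"
  proof (rule ccontr)
    assume "\<not> c \<le> d"
    then have "gam G c \<subseteq> {\<one>}" "c \<noteq> 0" using d gam_antimono[of "Suc d" c] by auto
    then show False using assms(2) subgroup.one_closed[OF gam_subgroup[of c]] by auto
  qed
qed (fact assms(1))

lemma epi_iso:
  assumes "group G" "group H" "f \<in> iso G H"
  shows "epi G H f" "kernel G H f = {\<one>\<^bsub>G\<^esub>}"
  using assms iso_kernel_image[OF assms(1,2)]
  by (auto intro!: epi.intro group_hom.intro group_hom_axioms.intro epi_axioms.intro)

text \<open>Both groups are the quotient of \<open>G\<close> by the common kernel. This is how
  quotients reached along different routes are identified.\<close>

lemma epi_same_kernel_iso:
  assumes "epi G H f" "epi G K g" "kernel G H f = kernel G K g"
  shows "H \<cong> K"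
proof -
  interpret F: epi G H f by fact
  interpret K: epi G K g by fact
  have "H \<cong> G Mod F.ker" by (rule group.iso_sym[OF _ F.Mod_iso]) (rule normal.factorgroup_is_group[OF F.normal_kernel])
  then show ?thesis using K.Mod_iso unfolding assms(3)[symmetric] by (rule iso_trans)
qed

lemma (in normal) epi_canonical: "epi G (G Mod H) (\<lambda>a. H #> a)" "kernel G (G Mod H) (\<lambda>a. H #> a) = H"
proof -
  show "epi G (G Mod H) (\<lambda>a. H #> a)"
    by (intro epi.intro mod_hom epi_axioms.intro) (simp add: carrier_FactGroup)
  show "kernel G (G Mod H) (\<lambda>a. H #> a) = H"
    unfolding kernel_def using mod_one_iff mem_carrier by blast
qed

section \<open>The Artin transfer to a subgroup of index three\<close>

locale index3 = normal H G for H and G (structure) +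
  assumes cubes: "a \<in> carrier G \<Longrightarrow> a [^] (3::nat) \<in> H"
    and gen1: "q \<in> carrier G \<Longrightarrow> q \<notin> H \<Longrightarrow> carrier G = generate G (insert q H)"
begin

lemma H_coset_iff: "a \<in> carrier G \<Longrightarrow> b \<in> carrier G \<Longrightarrow> H #> a = H #> b \<longleftrightarrow> a \<in> H #> b"
  using repr_independence[OF _ _ is_subgroup, of a b] rcos_self[OF _ is_subgroup, of a] by auto

lemma cosets_cover:
  assumes "q \<in> carrier G" "q \<notin> H" "g \<in> carrier G"
  shows "\<exists>k<3. H #> g = H #> q [^] (k::nat)"
proof -
  have "g \<in> generate G (insert q H)" using gen1[OF assms(1,2)] assms(3) by (rule subst)
  then obtain k where k: "k < 3" "g \<in> H #> q [^] (k::nat)"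
    using adj_mem[OF normal_axioms assms(1) cubes[OF assms(1)]] by auto
  then show ?thesis using H_coset_iff[OF assms(3), of "q [^] k"] assms(1) by auto
qed

lemma cosets_distinct:
  assumes q: "q \<in> carrier G" "q \<notin> H"
  shows "H #> \<one> \<noteq> H #> q" "H #> \<one> \<noteq> H #> q \<otimes> q" "H #> q \<noteq> H #> q \<otimes> q"
proof -
  have H1: "H #> \<one> = H" using coset_mult_one subset by blast
  show "H #> \<one> \<noteq> H #> q" unfolding H1 using q rcos_self[OF _ is_subgroup, of q] by auto
  show "H #> q \<noteq> H #> q \<otimes> q"
    using q H_coset_iff[of "q \<otimes> q" q] coset_cancel[OF normal_axioms, of q q] by auto
  show "H #> \<one> \<noteq> H #> q \<otimes> q"
  proof
    assume "H #> \<one> = H #> q \<otimes> q"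
    then have "q \<otimes> q \<in> H" unfolding H1 using rcos_self[OF _ is_subgroup, of "q \<otimes> q"] q by auto
    then have "inv (q \<otimes> q) \<otimes> q [^] (3::nat) \<in> H" using cubes[OF q(1)] by blast
    then show False using q by (simp add: pow3 word)
  qed
qed

lemma transversal_exists:
  assumes q: "q \<in> carrier G" "q \<notin> H"
  shows "transversal G H {\<one>, q, q \<otimes> q}"
  unfolding transversal_def
proof (intro conjI ballI)
  fix g assume g: "g \<in> carrier G"
  obtain k :: nat where k: "k < 3" "H #> g = H #> q [^] k" using cosets_cover[OF q g] by blast
  note d = cosets_distinct[OF q]
  from k(1) consider "k = 0" | "k = 1" | "k = 2" by linarith
  then show "\<exists>!t. t \<in> {\<one>, q, q \<otimes> q} \<and> H #> g = H #> t"
  proof cases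
    case 1 with k d show ?thesis by (intro ex1I[of _ \<one>]) auto
  next
    case 2 with k d q show ?thesis by (intro ex1I[of _ q]) auto
  next
    case 3 with k d q show ?thesis by (intro ex1I[of _ "q \<otimes> q"]) (auto simp: numeral_2_eq_2)
  qed
qed (use q in auto)

text \<open>\<open>transfer\<close> picks its transversal by \<open>SOME\<close>, so the calculation
  has to hold for an arbitrary one; each meets the three cosets in \<open>H\<close>-multiples of 1,
  q and q^2.\<close>

lemma transversal_cases:
  assumes T: "transversal G H T" and q: "q \<in> carrier G" "q \<notin> H"
  obtains h0 h1 h2 where "h0 \<in> H" "h1 \<in> H" "h2 \<in> H"
    "T = {h0, h1 \<otimes> q, h2 \<otimes> (q \<otimes> q)}" "h0 \<noteq> h1 \<otimes> q" "h0 \<noteq> h2 \<otimes> (q \<otimes> q)" "h1 \<otimes> q \<noteq> h2 \<otimes> (q \<otimes> q)"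
    "\<And>a. a \<in> H \<Longrightarrow> coset_rep G H T a = h0" "\<And>a. a \<in> H \<Longrightarrow> coset_rep G H T (a \<otimes> q) = h1 \<otimes> q"
    "\<And>a. a \<in> H \<Longrightarrow> coset_rep G H T (a \<otimes> (q \<otimes> q)) = h2 \<otimes> (q \<otimes> q)"
proof -
  have TG: "T \<subseteq> carrier G" using T by (simp add: transversal_def)
  have ex: "\<exists>!t. t \<in> T \<and> H #> g = H #> t" if "g \<in> carrier G" for g using T that by (simp add: transversal_def)
  have pick: "\<exists>h\<in>H. h \<otimes> b \<in> T \<and> H #> b = H #> (h \<otimes> b)" if b: "b \<in> carrier G" for b
  proof -
    obtain t where t: "t \<in> T" "H #> b = H #> t" using ex[OF b] by blast
    then have "t \<in> H #> b" using rcos_self[OF _ is_subgroup, of t] TG by auto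
    then show ?thesis using t by (auto simp: r_coset_def)
  qed
  have qq: "q \<otimes> q \<in> carrier G" using q by simp
  obtain h0 where h0: "h0 \<in> H" "h0 \<otimes> \<one> \<in> T" "H #> \<one> = H #> (h0 \<otimes> \<one>)" using pick[OF one_closed] by blast
  obtain h1 where h1: "h1 \<in> H" "h1 \<otimes> q \<in> T" "H #> q = H #> (h1 \<otimes> q)" using pick[OF q(1)] by blast
  obtain h2 where h2: "h2 \<in> H" "h2 \<otimes> (q \<otimes> q) \<in> T" "H #> q \<otimes> q = H #> (h2 \<otimes> (q \<otimes> q))" using pick[OF qq] by blast
  have h01: "h0 \<otimes> \<one> = h0" using h0 by simp
  have un: "t = t'" if "t \<in> T" "t' \<in> T" "H #> t = H #> t'" for t t'
    using ex[of t] that TG by blast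
  have sub: "t \<in> {h0, h1 \<otimes> q, h2 \<otimes> (q \<otimes> q)}" if t: "t \<in> T" for t
  proof -
    obtain k :: nat where k: "k < 3" "H #> t = H #> q [^] k" using cosets_cover[OF q, of t] t TG by blast
    then consider "k = 0" | "k = 1" | "k = 2" by linarith
    then show ?thesis
    proof cases
      case 1 with k h0 h01 t un[of t h0] show ?thesis by simp
    next
      case 2 with k h1 q t un[of t "h1 \<otimes> q"] show ?thesis by simp
    next
      case 3 with k h2 q t un[of t "h2 \<otimes> (q \<otimes> q)"] show ?thesis by (simp add: numeral_2_eq_2)
    qed
  qed
  have rep: "coset_rep G H T (a \<otimes> b) = h \<otimes> b"
    if "a \<in> H" "b \<in> carrier G" "h \<otimes> b \<in> T" "H #> b = H #> (h \<otimes> b)" for a b h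
    unfolding coset_rep_def
  proof (rule the_equality)
    have "H #> (a \<otimes> b) = H #> b" using coset_drop[OF normal_axioms that(1,2)] .
    then show "h \<otimes> b \<in> T \<and> H #> a \<otimes> b = H #> (h \<otimes> b)" using that by simp
    then show "t = h \<otimes> b" if "t \<in> T \<and> H #> a \<otimes> b = H #> t" for t using un that by simp
  qed
  note d = cosets_distinct[OF q]
  show ?thesis
  proof (rule that[OF h0(1) h1(1) h2(1)])
    show "T = {h0, h1 \<otimes> q, h2 \<otimes> (q \<otimes> q)}" using sub h0 h01 h1 h2 by auto
    show "h0 \<noteq> h1 \<otimes> q" "h0 \<noteq> h2 \<otimes> (q \<otimes> q)" "h1 \<otimes> q \<noteq> h2 \<otimes> (q \<otimes> q)"
      using d h0(3) h1(3) h2(3) h01 by auto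
    show "coset_rep G H T a = h0" if "a \<in> H" for a using rep[OF that one_closed h0(2,3)] h01 that by simp
    show "coset_rep G H T (a \<otimes> q) = h1 \<otimes> q" if "a \<in> H" for a by (rule rep[OF that q(1) h1(2,3)])
    show "coset_rep G H T (a \<otimes> (q \<otimes> q)) = h2 \<otimes> (q \<otimes> q)" if "a \<in> H" for a by (rule rep[OF that qq h2(2,3)])
  qed
qed

text \<open>In the abelian group H/H' the factors h0, h1, h2 of the transversal cancel. An element
  outside \<open>H\<close> permutes the cosets cyclically, leaving its cube; an element inside fixes
  each coset, leaving a product of conjugates.\<close>

lemma transfer_kernel_iff:
  assumes g: "g \<in> carrier G"
  shows "g \<notin> H \<Longrightarrow> g \<in> transfer_kernel G H \<longleftrightarrow> g [^] (3::nat) \<in> derived G H"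
    and "g \<in> H \<Longrightarrow> r \<in> carrier G \<Longrightarrow> r \<notin> H \<Longrightarrow>
      g \<in> transfer_kernel G H \<longleftrightarrow> g \<otimes> (r \<otimes> g \<otimes> inv r) \<otimes> (r \<otimes> r \<otimes> g \<otimes> inv (r \<otimes> r)) \<in> derived G H"
proof -
  define K where "K = G\<lparr>carrier := H\<rparr>"
  define D where "D = derived G H"
  define Q where "Q = K Mod D"
  define pp where "pp a = D #>\<^bsub>K\<^esub> a" for a
  have DK: "derived K H = D" unfolding K_def D_def using derived_consistent[OF order_refl is_subgroup] .
  have Kc: "carrier K = H" by (simp add: K_def)
  have Km: "monoid.mult K = monoid.mult G" by (simp add: K_def)
  have gK: "group K" unfolding K_def by (rule subgroup_is_group[OF is_group])
  interpret K: group K by (rule gK)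
  have nD: "D \<lhd> K" using K.derived_self_is_normal unfolding Kc DK .
  interpret D: normal D K by (rule nD)
  interpret Q: comm_group Q using K.derived_quot_is_comm_group unfolding Kc DK Q_def .
  interpret P: group_hom K Q pp unfolding Q_def pp_def by (rule D.mod_hom)
  have Qone: "\<one>\<^bsub>Q\<^esub> = D" by (simp add: Q_def)
  have pc: "pp a \<in> carrier Q" if "a \<in> H" for a using P.hom_closed that Kc by simp
  have pm: "pp (a \<otimes> b) = pp a \<otimes>\<^bsub>Q\<^esub> pp b" if "a \<in> H" "b \<in> H" for a b using P.hom_mult that Kc Km by simp
  have pinv: "pp (inv a) = inv\<^bsub>Q\<^esub> pp a" if "a \<in> H" for a
    using P.hom_inv[of a] m_inv_consistent[OF is_subgroup that] that Kc unfolding K_def by simp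
  have pD: "pp a = D \<longleftrightarrow> a \<in> D" if "a \<in> H" for a
    using D.mod_one_iff[of a] that Kc unfolding pp_def by simp
  define T where "T = (SOME T. transversal G H T)"
  have T: "transversal G H T" if "q \<in> carrier G" "q \<notin> H" for q
    unfolding T_def using transversal_exists[OF that] by (rule someI)
  have tr: "transfer G H a = finprod Q (\<lambda>t. pp (t \<otimes> a \<otimes> inv (coset_rep G H T (t \<otimes> a)))) T" for a
    unfolding transfer_def Let_def T_def[symmetric] K_def[symmetric] DK Q_def[symmetric] pp_def ..
  have fin3: "finprod Q f {a, b, d} = f a \<otimes>\<^bsub>Q\<^esub> (f b \<otimes>\<^bsub>Q\<^esub> f d)"
    if "a \<noteq> b" "a \<noteq> d" "b \<noteq> d" "f a \<in> carrier Q" "f b \<in> carrier Q" "f d \<in> carrier Q" for f and a b d :: 'a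
    using that by (simp add: Q.finprod_insert)
  have ker: "g \<in> transfer_kernel G H \<longleftrightarrow> transfer G H g = D"
    using g unfolding transfer_kernel_def K_def[symmetric] DK by simp
  {
    assume gH: "g \<notin> H"
    obtain h0 h1 h2 where h: "h0 \<in> H" "h1 \<in> H" "h2 \<in> H"
      and Te: "T = {h0, h1 \<otimes> g, h2 \<otimes> (g \<otimes> g)}" and d: "h0 \<noteq> h1 \<otimes> g" "h0 \<noteq> h2 \<otimes> (g \<otimes> g)" "h1 \<otimes> g \<noteq> h2 \<otimes> (g \<otimes> g)"
      and r: "\<And>a. a \<in> H \<Longrightarrow> coset_rep G H T a = h0" "\<And>a. a \<in> H \<Longrightarrow> coset_rep G H T (a \<otimes> g) = h1 \<otimes> g"
      "\<And>a. a \<in> H \<Longrightarrow> coset_rep G H T (a \<otimes> (g \<otimes> g)) = h2 \<otimes> (g \<otimes> g)"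
      using transversal_cases[OF T[OF g gH] g gH] by blast
    have hG: "h0 \<in> carrier G" "h1 \<in> carrier G" "h2 \<in> carrier G" using h by auto
    have g3: "g [^] (3::nat) \<in> H" "g \<otimes> (g \<otimes> g) = g [^] (3::nat)" using cubes[OF g] g by (simp_all add: pow3 m_assoc)
    let ?f = "\<lambda>t. pp (t \<otimes> g \<otimes> inv (coset_rep G H T (t \<otimes> g)))"
    have "h0 \<otimes> g \<otimes> inv (h1 \<otimes> g) = h0 \<otimes> inv h1" using hG g by (simp add: word)
    then have f0: "?f h0 = pp h0 \<otimes>\<^bsub>Q\<^esub> inv\<^bsub>Q\<^esub> pp h1" using r(2)[OF h(1)] h pm pinv by simp
    have "h1 \<otimes> g \<otimes> g = h1 \<otimes> (g \<otimes> g)" "h1 \<otimes> (g \<otimes> g) \<otimes> inv (h2 \<otimes> (g \<otimes> g)) = h1 \<otimes> inv h2" using hG g by (simp_all add: word)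
    then have f1: "?f (h1 \<otimes> g) = pp h1 \<otimes>\<^bsub>Q\<^esub> inv\<^bsub>Q\<^esub> pp h2" using r(3)[OF h(2)] h pm pinv by simp
    have "h2 \<otimes> (g \<otimes> g) \<otimes> g = h2 \<otimes> g [^] (3::nat)" using hG g by (simp add: word pow3)
    then have f2: "?f (h2 \<otimes> (g \<otimes> g)) = pp h2 \<otimes>\<^bsub>Q\<^esub> pp (g [^] (3::nat)) \<otimes>\<^bsub>Q\<^esub> inv\<^bsub>Q\<^esub> pp h0"
      using r(1)[of "h2 \<otimes> g [^] (3::nat)"] h g3 pm pinv by simp
    have c: "pp h0 \<in> carrier Q" "pp h1 \<in> carrier Q" "pp h2 \<in> carrier Q" "pp (g [^] (3::nat)) \<in> carrier Q" using pc h g3 by auto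
    have "transfer G H g = ?f h0 \<otimes>\<^bsub>Q\<^esub> (?f (h1 \<otimes> g) \<otimes>\<^bsub>Q\<^esub> ?f (h2 \<otimes> (g \<otimes> g)))"
      unfolding tr by (subst (2) Te, rule fin3[OF d]) (use f0 f1 f2 c in auto)
    also have "\<dots> = pp (g [^] (3::nat))"
    proof -
      have e: "A \<otimes>\<^bsub>Q\<^esub> inv\<^bsub>Q\<^esub> B \<otimes>\<^bsub>Q\<^esub> (B \<otimes>\<^bsub>Q\<^esub> inv\<^bsub>Q\<^esub> C \<otimes>\<^bsub>Q\<^esub> (C \<otimes>\<^bsub>Q\<^esub> E \<otimes>\<^bsub>Q\<^esub> inv\<^bsub>Q\<^esub> A)) = E"
        if "A \<in> carrier Q" "B \<in> carrier Q" "C \<in> carrier Q" "E \<in> carrier Q" for A B C E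
        using that Q.m_comm[of E "inv\<^bsub>Q\<^esub> A"] by (simp add: Q.word)
      show ?thesis unfolding f0 f1 f2 by (rule e[OF c])
    qed
    finally show "g \<in> transfer_kernel G H \<longleftrightarrow> g [^] (3::nat) \<in> derived G H"
      using ker pD[OF g3(1)] unfolding D_def by simp
  }
  {
    assume gH: "g \<in> H" and rr: "r \<in> carrier G" "r \<notin> H"
    obtain h0 h1 h2 where h: "h0 \<in> H" "h1 \<in> H" "h2 \<in> H"
      and Te: "T = {h0, h1 \<otimes> r, h2 \<otimes> (r \<otimes> r)}" and d: "h0 \<noteq> h1 \<otimes> r" "h0 \<noteq> h2 \<otimes> (r \<otimes> r)" "h1 \<otimes> r \<noteq> h2 \<otimes> (r \<otimes> r)"
      and r: "\<And>a. a \<in> H \<Longrightarrow> coset_rep G H T a = h0" "\<And>a. a \<in> H \<Longrightarrow> coset_rep G H T (a \<otimes> r) = h1 \<otimes> r"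
      "\<And>a. a \<in> H \<Longrightarrow> coset_rep G H T (a \<otimes> (r \<otimes> r)) = h2 \<otimes> (r \<otimes> r)"
      using transversal_cases[OF T[OF rr] rr] by blast
    have hG: "h0 \<in> carrier G" "h1 \<in> carrier G" "h2 \<in> carrier G" using h by auto
    let ?f = "\<lambda>t. pp (t \<otimes> g \<otimes> inv (coset_rep G H T (t \<otimes> g)))"
    let ?g1 = "r \<otimes> g \<otimes> inv r" and ?g2 = "r \<otimes> r \<otimes> g \<otimes> inv (r \<otimes> r)"
    have g12: "?g1 \<in> H" "?g2 \<in> H" using inv_op_closed2[OF rr(1) gH] inv_op_closed2[OF _ gH, of "r \<otimes> r"] rr by auto
    \<comment> \<open>Conjugation by elements of \<open>H\<close> is invisible in H/H', so the
      choice of representatives has no influence.\<close>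
    have cj: "pp (a \<otimes> b \<otimes> inv a) = pp b" if "a \<in> H" "b \<in> H" for a b
      using that pm pinv pc[OF that(1)] pc[OF that(2)] Q.m_comm[of "pp a" "pp b"] by (simp add: Q.m_assoc)
    have f0: "?f h0 = pp g" using r(1)[of "h0 \<otimes> g"] h gH cj by simp
    have "h1 \<otimes> r \<otimes> g = (h1 \<otimes> ?g1) \<otimes> r" "(h1 \<otimes> ?g1) \<otimes> r \<otimes> inv (h1 \<otimes> r) = h1 \<otimes> ?g1 \<otimes> inv h1"
      using hG rr g by (simp_all add: word)
    then have f1: "?f (h1 \<otimes> r) = pp ?g1" using r(2)[of "h1 \<otimes> ?g1"] h g12 cj[OF h(2) g12(1)] by simp
    have "h2 \<otimes> (r \<otimes> r) \<otimes> g = (h2 \<otimes> ?g2) \<otimes> (r \<otimes> r)"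
       "(h2 \<otimes> ?g2) \<otimes> (r \<otimes> r) \<otimes> inv (h2 \<otimes> (r \<otimes> r)) = h2 \<otimes> ?g2 \<otimes> inv h2"
      using hG rr g by (simp_all add: word)
    then have f2: "?f (h2 \<otimes> (r \<otimes> r)) = pp ?g2" using r(3)[of "h2 \<otimes> ?g2"] h g12 cj[OF h(3) g12(2)] by simp
    have "transfer G H g = ?f h0 \<otimes>\<^bsub>Q\<^esub> (?f (h1 \<otimes> r) \<otimes>\<^bsub>Q\<^esub> ?f (h2 \<otimes> (r \<otimes> r)))"
      unfolding tr by (subst (2) Te, rule fin3[OF d]) (use f0 f1 f2 pc gH g12 in auto)
    also have "\<dots> = pp (g \<otimes> ?g1 \<otimes> ?g2)"
      unfolding f0 f1 f2 using pm gH g12 pc by (simp add: Q.m_assoc)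
    finally show "g \<in> transfer_kernel G H \<longleftrightarrow> g \<otimes> ?g1 \<otimes> ?g2 \<in> derived G H"
      using ker pD[of "g \<otimes> ?g1 \<otimes> ?g2"] gH g12 unfolding D_def by simp
  }
qed

end

lemma (in group) max_sub_index3:
  assumes "finite (carrier G)" "order G = 3 ^ n" "gam G (Suc c) = {\<one>}" "max_sub G H"
  shows "index3 H G"
  using max_sub_gam2(1)[OF assms(3,4)] max_sub_index(1)[OF assms] max_sub_adj[OF assms(4)]
  by (simp add: index3_def index3_axioms_def)

section \<open>Finite \<open>3\<close>-groups are nilpotent\<close>

text \<open>Conjugacy classes have 3-power size. If 1 were the only fixed point, their sum 3^n would
  be 1 modulo 3.\<close>

lemma (in group) center_nontrivial:
  assumes o: "order G = 3 ^ n" and n: "carrier G \<noteq> {\<one>}" and fin: "finite (carrier G)"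
  shows "\<exists>a\<in>carrier G. a \<noteq> \<one> \<and> (\<forall>g\<in>carrier G. g \<otimes> a \<otimes> inv g = a)"
proof (rule ccontr)
  assume no: "\<not> ?thesis"
  define f where "f = (\<lambda>g. \<lambda>h \<in> carrier G. g \<otimes> h \<otimes> (inv g))"
  interpret act: group_action G "carrier G" f unfolding f_def by (rule action_by_conjugation)
  let ?O = "orbits G (carrier G) f"
  have "?O \<subseteq> Pow (carrier G)" using act.orbits_coverture by blast
  then have finO: "finite ?O" using fin by (meson finite_Pow_iff finite_subset)
  have o1: "orbit G f \<one> = {\<one>}" unfolding orbit_def f_def by (auto intro!: exI[of _ "\<one>"])
  have d: "3 dvd card A" if A: "A \<in> ?O" "A \<noteq> {\<one>}" for A
  proof -
    obtain a where a: "a \<in> carrier G" "A = orbit G f a" using A(1) by (auto simp: orbits_def)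
    have "card A dvd 3 ^ n" using act.orbit_stabilizer_theorem[OF a(1)] a(2) o by (metis dvd_triv_left)
    then obtain k where k: "card A = 3 ^ k" using divides_primepow_nat[of 3 "card A" n] by auto
    have aA: "a \<in> A" using act.orbit_refl[OF a(1)] a(2) by simp
    have "a \<noteq> \<one>" using a A(2) o1 by auto
    then obtain g where g: "g \<in> carrier G" "g \<otimes> a \<otimes> inv g \<noteq> a" using no a(1) by blast
    have "g \<otimes> a \<otimes> inv g \<in> A" unfolding a(2) orbit_def f_def using g(1) a(1) by auto
    then have "card A \<noteq> 1" using aA g(2) by (metis card_1_singletonE singletonD)
    then show ?thesis using k by (cases k) auto
  qed
  have "(\<Sum>A\<in>?O. \<Sum>x\<in>A. 1) = (\<Sum>x\<in>carrier G. 1::nat)" by (rule act.disjoint_sum[OF fin])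
  then have "(\<Sum>A\<in>?O. card A) = 3 ^ n" using o by (simp add: order_def)
  moreover have "{\<one>} \<in> ?O" unfolding orbits_def using o1 by blast
  ultimately have s: "3 ^ n = 1 + (\<Sum>A\<in>?O - {{\<one>}}. card A)" using sum.remove[OF finO, of "{\<one>}" card] by simp
  have "3 dvd (\<Sum>A\<in>?O - {{\<one>}}. card A)" using d by (intro dvd_sum) auto
  moreover have "n \<noteq> 0"
  proof
    assume "n = 0"
    then have "card (carrier G) = 1" using o by (simp add: order_def)
    then show False using n one_closed by (metis card_1_singletonE singletonD)
  qed
  then have "(3::nat) dvd 3 ^ n" by (simp add: dvd_power)
  ultimately have "(3::nat) dvd 1" unfolding s using dvd_add_left_iff by blast
  then show False by simp
qed

lemma (in group) center_mod_nontrivial: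
  assumes o: "order G = 3 ^ n" and fin: "finite (carrier G)" and M: "M \<lhd> G" "M \<noteq> carrier G"
  shows "\<exists>a\<in>carrier G. a \<notin> M \<and> (\<forall>g\<in>carrier G. \<lbrakk>g, a\<rbrakk> \<in> M)"
proof -
  interpret M: normal M G by (rule M(1))
  interpret E: epi G "G Mod M" "\<lambda>a. M #> a" by (rule M.epi_canonical)
  have k: "E.ker = M" by (rule M.epi_canonical)
  have "is_3group G" using o fin is_group by (auto simp: is_3group_def)
  then obtain m where m: "order (G Mod M) = 3 ^ m" "finite (carrier (G Mod M))"
    using E.is_3group_img by (auto simp: is_3group_def)
  have "carrier (G Mod M) \<noteq> {\<one>\<^bsub>G Mod M\<^esub>}"
  proof
    assume "carrier (G Mod M) = {\<one>\<^bsub>G Mod M\<^esub>}"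
    then have "M #> g = \<one>\<^bsub>G Mod M\<^esub>" if "g \<in> carrier G" for g using E.hom_closed[OF that] by blast
    then have "g \<in> M" if "g \<in> carrier G" for g using M.mod_one_iff[OF that] that by blast
    then have "carrier G \<subseteq> M" by blast
    then show False using M(2) M.subset by blast
  qed
  from E.H.center_nontrivial[OF m(1) this m(2)]
  obtain q where q: "q \<in> carrier (G Mod M)" "q \<noteq> \<one>\<^bsub>G Mod M\<^esub>"
    "\<forall>g\<in>carrier (G Mod M). g \<otimes>\<^bsub>G Mod M\<^esub> q \<otimes>\<^bsub>G Mod M\<^esub> inv\<^bsub>G Mod M\<^esub> g = q" by blast
  then obtain a where a: "a \<in> carrier G" "q = M #> a" unfolding E.surj[symmetric] by blast
  have "a \<notin> M" using q(2) M.mod_one_iff[OF a(1)] a(2) by blast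
  moreover have "\<lbrakk>g, a\<rbrakk> \<in> M" if g: "g \<in> carrier G" for g
  proof -
    have "M #> (g \<otimes> a \<otimes> inv g) = (M #> g) \<otimes>\<^bsub>G Mod M\<^esub> (M #> a) \<otimes>\<^bsub>G Mod M\<^esub> inv\<^bsub>G Mod M\<^esub> (M #> g)"
      by (simp only: E.hom_mult E.hom_inv m_closed inv_closed g a(1))
    also have "\<dots> = M #> a" using q(3) E.hom_closed[OF g] unfolding a(2) by blast
    finally have "M #> (g \<otimes> a \<otimes> inv g) = M #> a" .
    then have "M #> (\<lbrakk>g, a\<rbrakk> \<otimes> a) = M #> a" using conj_cm[OF a(1) g] by simp
    then show ?thesis using coset_cancel[OF M(1) _ a(1)] g a(1) by blast
  qed
  ultimately show ?thesis using a(1) by blast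
qed

text \<open>Any proper normal \<open>M\<close> can be enlarged by an element central modulo
  \<open>M\<close>; if the larger subgroup contains a term of the lower central series, then
  \<open>M\<close> contains the next one. This gives the \<open>LEAST\<close> in
  \<open>nil_class\<close> its meaning.\<close>

lemma (in group) three_group_nilpotent:
  assumes o: "order G = 3 ^ n" and fin: "finite (carrier G)"
  shows "\<exists>c. gam G (Suc c) = {\<one>}"
proof -
  have "\<exists>c. gam G (Suc c) \<subseteq> M" if "M \<lhd> G" for M
    using that
  proof (induct "card (carrier G) - card M" arbitrary: M rule: less_induct)
    case less
    show ?case
    proof (cases "M = carrier G")
      case True then show ?thesis by (intro exI[of _ 0]) simp
    next
      case False
      obtain a where a: "a \<in> carrier G" "a \<notin> M" "\<And>g. g \<in> carrier G \<Longrightarrow> \<lbrakk>g, a\<rbrakk> \<in> M"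
        using center_mod_nontrivial[OF o fin less(2) False] by blast
      have n: "adj M a \<lhd> G" by (rule adj_normal_central[OF less(2) a(1,3)])
      have "adj M a \<subseteq> carrier G" using normal_imp_subgroup[OF n] subgroup.subset by blast
      then have "finite (adj M a)" "card (adj M a) \<le> card (carrier G)"
        using fin finite_subset card_mono by blast+
      moreover have "M \<subset> adj M a" using adj_sub[where N = M and a = a] a(2) by blast
      ultimately have "card (carrier G) - card (adj M a) < card (carrier G) - card M"
        using psubset_card_mono[of "adj M a" M] by linarith
      then obtain c where c: "gam G (Suc c) \<subseteq> adj M a" using less(1)[OF _ n] by blast
      have "gam G (Suc (Suc c)) \<subseteq> M"
      proof (rule gam_least[OF _ normal_imp_subgroup[OF less(2)]])
        fix b g assume b: "b \<in> gam G (Suc c)" and g: "g \<in> carrier G"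
        have "adj M a \<subseteq> Cent M g"
          using sub_Cent[OF less(2) g] a(1,3) g by (intro adj_least Cent_subgroup less(2)) (auto simp: Cent_iff)
        then have "b \<in> Cent M g" using b c by blast
        then show "\<lbrakk>b, g\<rbrakk> \<in> M" using cm_swap[OF normal_imp_subgroup[OF less(2)] _ g] by (simp add: Cent_iff)
      qed simp
      then show ?thesis by blast
    qed
  qed
  from this[OF one_is_normal] obtain c where "gam G (Suc c) \<subseteq> {\<one>}" by blast
  then show ?thesis using subgroup.one_closed[OF gam_subgroup[of "Suc c"]] by blast
qed

lemma (in group) nil_class_nil:
  assumes "order G = 3 ^ n" "finite (carrier G)"
  shows "gam G (Suc (nil_class G)) = {\<one>}"
  unfolding nil_class_def using three_group_nilpotent[OF assms] by (rule LeastI_ex)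

lemma (in group) gam_below_class:
  assumes o: "order G = 3 ^ n" "finite (carrier G)" and k: "1 \<le> k" "k \<le> nil_class G"
  shows "\<not> gam G k \<subseteq> gam G (Suc k)"
proof
  assume a: "gam G k \<subseteq> gam G (Suc k)"
  have "gam G k \<subseteq> gam G (Suc (nil_class G))" using k by (intro gam_stab[OF _ a]) auto
  then have "gam G k = {\<one>}" using nil_class_nil[OF o] subgroup.one_closed[OF gam_subgroup[of k]] by auto
  then have "nil_class G \<le> k - 1" unfolding nil_class_def using k by (intro Least_le) simp
  then show False using k by simp
qed

lemma (in epi) nil_class_quot:
  assumes o: "order G = 3 ^ n" "finite (carrier G)" and ker: "ker = gam G (Suc m)" and m: "m \<le> nil_class G" "m \<ge> 1"
  shows "nil_class H = m"
proof (rule H.nil_class_eq)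
  have one: "h ` gam G (Suc m) = {\<one>\<^bsub>H\<^esub>}"
    using ker subgroup.one_closed[OF G.gam_subgroup[of "Suc m"]] by (auto simp: kernel_def set_eq_iff image_iff) metis
  show "gam H (Suc m) = {\<one>\<^bsub>H\<^esub>}" unfolding gam_img one ..
  have "gam H m \<noteq> {\<one>\<^bsub>H\<^esub>}"
  proof
    assume "gam H m = {\<one>\<^bsub>H\<^esub>}"
    then have "h ` gam G m \<subseteq> h ` gam G (Suc m)" unfolding gam_img one by simp
    then have "gam G m \<subseteq> gam G (Suc m)"
      using img_subset_iff[OF G.gam_subgroup G.gam_sub] ker by blast
    then show False using G.gam_below_class[OF o m(2,1)] by simp
  qed
  then show "m = 0 \<or> gam H m \<noteq> {\<one>\<^bsub>H\<^esub>}" ..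
qed

lemma (in group) Mod_epi: "epi G (G Mod gam G k) (\<lambda>a. gam G k #> a)" "kernel G (G Mod gam G k) (\<lambda>a. gam G k #> a) = gam G k"
  by (rule normal.epi_canonical[OF gam_normal])+

section \<open>Structure of the vertices of the trees\<close>

text \<open>Lifts of the two standard generators of the abelianization generate \<open>G\<close>
  modulo gamma_2, hence generate \<open>G\<close> by the Frattini argument.\<close>

lemma abel_type_gens:
  fixes G (structure)
  assumes "is_3group G" and a: "abel_type e G" and e: "e \<ge> 1"
  shows "card (carrier G) = 3 ^ (e + 1) * card (gam G 2)"
    "\<exists>x\<in>carrier G. \<exists>y\<in>carrier G. generate G {x, y} = carrier G \<and> x [^] ((3::nat) ^ e) \<in> gam G 2 \<and> y [^] (3::nat) \<in> gam G 2"
proof -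
  obtain n where o: "order G = 3 ^ n" "finite (carrier G)" and g: "group G" using assms(1) by (auto simp: is_3group_def)
  interpret group G by (rule g)
  interpret N: normal "gam G 2" G by (rule gam_normal)
  interpret E: epi G "G Mod gam G 2" "\<lambda>a. gam G 2 #> a" by (rule Mod_epi)
  let ?Z = "integer_mod_group (3 ^ e) \<times>\<times> integer_mod_group 3"
  have gZ: "group ?Z" by (simp add: DirProd_group)
  have "G Mod gam G 2 \<cong> ?Z" using a unfolding abel_type_def gam2 .
  then have "?Z \<cong> G Mod gam G 2" by (rule group.iso_sym[OF E.H.is_group])
  then obtain f where f: "f \<in> iso ?Z (G Mod gam G 2)" by (auto simp: is_iso_def)
  interpret F: epi ?Z "G Mod gam G 2" f by (rule epi_iso[OF gZ E.H.is_group f])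
  have cZ: "carrier ?Z = {0..<3 ^ e} \<times> {0..<3}" by (simp add: carrier_integer_mod_group)
  have "card (carrier (G Mod gam G 2)) = card (carrier ?Z)" using f bij_betw_same_card[of f] by (simp add: iso_def)
  then have "order (G Mod gam G 2) = 3 ^ (e + 1)" unfolding cZ order_def by (simp add: nat_power_eq)
  then show "card (carrier G) = 3 ^ (e + 1) * card (gam G 2)"
    using E.order_img Mod_epi(2)[of 2] by (simp add: order_def)
  have m: "(1::int, 0::int) \<in> carrier ?Z" "(0::int, 1::int) \<in> carrier ?Z" unfolding cZ using e by (auto simp: self_le_power)
  obtain x where x: "x \<in> carrier G" "f (1, 0) = gam G 2 #> x" using F.hom_closed[OF m(1)] unfolding E.surj[symmetric] by blast
  obtain y where y: "y \<in> carrier G" "f (0, 1) = gam G 2 #> y" using F.hom_closed[OF m(2)] unfolding E.surj[symmetric] by blast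
  have p1: "(1, 0) [^]\<^bsub>?Z\<^esub> (k::nat) = (int k mod 3 ^ e, 0)" for k
    by (induct k) (auto simp: DirProd_def mod_simps add.commute)
  have p2: "(0, 1) [^]\<^bsub>?Z\<^esub> (k::nat) = (0, int k mod 3)" for k
    by (induct k) (auto simp: DirProd_def mod_simps add.commute)
  have "gam G 2 #> (x [^] ((3::nat) ^ e)) = f ((1, 0) [^]\<^bsub>?Z\<^esub> ((3::nat) ^ e))"
    using E.hom_nat_pow[OF x(1)] F.hom_nat_pow[OF m(1)] x(2) by simp
  also have "\<dots> = \<one>\<^bsub>G Mod gam G 2\<^esub>" unfolding p1 using F.hom_one by simp
  finally have xp: "x [^] ((3::nat) ^ e) \<in> gam G 2" using N.mod_one_iff x(1) by simp
  have "gam G 2 #> (y [^] (3::nat)) = f ((0, 1) [^]\<^bsub>?Z\<^esub> (3::nat))"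
    using E.hom_nat_pow[OF y(1)] F.hom_nat_pow[OF m(2)] y(2) by simp
  also have "\<dots> = \<one>\<^bsub>G Mod gam G 2\<^esub>" unfolding p2 using F.hom_one by simp
  finally have yp: "y [^] (3::nat) \<in> gam G 2" using N.mod_one_iff y(1) by simp
  have "generate G {x, y} = carrier G"
  proof (rule frattini[OF o(2) nil_class_nil[OF o]])
    show "subgroup (generate G {x, y}) G" using x y by (intro generate_is_subgroup) auto
    fix S assume S: "subgroup S G" "generate G {x, y} \<subseteq> S" "gam G 2 \<subseteq> S"
    have xyS: "x \<in> S" "y \<in> S" using S(2) generate.incl[of _ "{x, y}" G] by auto
    have "g \<in> S" if g: "g \<in> carrier G" for g
    proof -
      obtain ab where ab: "ab \<in> carrier ?Z" "gam G 2 #> g = f ab" using E.hom_closed[OF g] unfolding F.surj[symmetric] by blast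
      obtain a b where abe: "ab = (a, b)" "0 \<le> a" "a < 3 ^ e" "0 \<le> b" "b < 3" using ab(1) unfolding cZ by auto
      have "ab = (1, 0) [^]\<^bsub>?Z\<^esub> (nat a) \<otimes>\<^bsub>?Z\<^esub> (0, 1) [^]\<^bsub>?Z\<^esub> (nat b)"
        unfolding p1 p2 using abe by (simp add: DirProd_def)
      then have "f ab = f ((1, 0) [^]\<^bsub>?Z\<^esub> (nat a)) \<otimes>\<^bsub>G Mod gam G 2\<^esub> f ((0, 1) [^]\<^bsub>?Z\<^esub> (nat b))"
        using F.hom_mult[of "(1, 0) [^]\<^bsub>?Z\<^esub> (nat a)" "(0, 1) [^]\<^bsub>?Z\<^esub> (nat b)"] monoid.nat_pow_closed[OF group.is_monoid[OF gZ]] m by simp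
      also have "\<dots> = gam G 2 #> (x [^] nat a \<otimes> y [^] nat b)"
        unfolding F.hom_nat_pow[OF m(1)] F.hom_nat_pow[OF m(2)] x(2) y(2)
        by (simp only: E.hom_nat_pow E.hom_mult nat_pow_closed x(1) y(1))
      finally have "gam G 2 #> g = gam G 2 #> (x [^] nat a \<otimes> y [^] nat b)" using ab(2) by simp
      moreover have "x [^] nat a \<otimes> y [^] nat b \<in> S"
        using xyS subgroup.m_closed[OF S(1)] subgroup_int_pow_closed[OF S(1), of x "int (nat a)"] subgroup_int_pow_closed[OF S(1), of y "int (nat b)"]
          int_pow_int[of G x "nat a"] int_pow_int[of G y "nat b"] by metis
      ultimately show ?thesis using coset_mem_iff[OF gam_normal g _ _ S(3,1)] x y by blast
    qed
    then show "S = carrier G" using subgroup.subset[OF S(1)] by blast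
  qed
  then show "\<exists>x\<in>carrier G. \<exists>y\<in>carrier G. generate G {x, y} = carrier G \<and> x [^] ((3::nat) ^ e) \<in> gam G 2 \<and> y [^] (3::nat) \<in> gam G 2"
    using x(1) y(1) xp yp by blast
qed

lemma fam_3group: "fam b e G \<Longrightarrow> is_3group G"
  by (simp add: fam_def)

lemma fam_order:
  assumes "fam b e G" "e \<ge> 2"
  shows "order G = 3 ^ (e + (if b then 1 else 0) + nil_class G)"
proof -
  obtain n where n: "order G = 3 ^ n" using assms by (auto simp: fam_def is_3group_def)
  have "n - nil_class G = e + (if b then 1 else 0)"
    using assms(1) log3_order_eq[OF n] by (cases b) (auto simp: fam_def coclass_def)
  \<comment> \<open>The coclass is a truncated difference; being positive, it is a genuine
    one.\<close>
  then have "n = e + (if b then 1 else 0) + nil_class G" using assms(2) by simp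
  then show ?thesis using n by simp
qed

context epi
begin

lemma Mod_kernel:
  assumes S: "subgroup S G" "ker \<subseteq> S" and n: "h ` S \<lhd> H"
  shows "epi G (H Mod h ` S) (\<lambda>a. h ` S #>\<^bsub>H\<^esub> h a)" "kernel G (H Mod h ` S) (\<lambda>a. h ` S #>\<^bsub>H\<^esub> h a) = S"
proof -
  show "epi G (H Mod h ` S) (\<lambda>a. h ` S #>\<^bsub>H\<^esub> h a)" by (rule epi_Mod(1)[OF n])
  have "kernel G (H Mod h ` S) (\<lambda>a. h ` S #>\<^bsub>H\<^esub> h a) = {a \<in> carrier G. h a \<in> h ` S}" by (rule epi_Mod(2)[OF n])
  also have "\<dots> = {a \<in> carrier G. a \<in> S}" using mem_img_iff[OF S] by blast
  also have "\<dots> = S" using subgroup.subset[OF S(1)] by blast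
  finally show "kernel G (H Mod h ` S) (\<lambda>a. h ` S #>\<^bsub>H\<^esub> h a) = S" .
qed

lemma Mod_gam_kernel:
  assumes S: "subgroup S G" "ker \<subseteq> S" and n: "h ` S = gam H k"
  shows "epi G (H Mod gam H k) (\<lambda>a. gam H k #>\<^bsub>H\<^esub> h a)" "kernel G (H Mod gam H k) (\<lambda>a. gam H k #>\<^bsub>H\<^esub> h a) = S"
  using Mod_kernel[OF S] H.gam_normal[of k] unfolding n by auto

lemma Mod_gam_iso: "ker \<subseteq> gam G k \<Longrightarrow> G Mod gam G k \<cong> H Mod gam H k"
  using epi_same_kernel_iso[OF G.Mod_epi(1) Mod_gam_kernel(1)[OF G.gam_subgroup _ gam_img[symmetric]]]
    Mod_gam_kernel(2)[OF G.gam_subgroup _ gam_img[symmetric]] G.Mod_epi(2) by auto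

end

lemma iso_group_obtain:
  assumes "group G" "group H" "G \<cong> H"
  obtains f where "epi G H f" "kernel G H f = {\<one>\<^bsub>G\<^esub>}"
  using assms epi_iso[of G H] by (auto simp: is_iso_def)

lemma nil_class_iso:
  assumes "group G" "group H" "G \<cong> H"
  shows "nil_class G = nil_class H"
proof -
  obtain f where f: "epi G H f" "kernel G H f = {\<one>\<^bsub>G\<^esub>}" by (rule iso_group_obtain[OF assms])
  interpret E: epi G H f by (rule f(1))
  have "gam G (Suc c) = {\<one>\<^bsub>G\<^esub>} \<longleftrightarrow> gam H (Suc c) = {\<one>\<^bsub>H\<^esub>}" for c
  proof -
    have "gam H (Suc c) = {\<one>\<^bsub>H\<^esub>} \<longleftrightarrow> f ` gam G (Suc c) = f ` {\<one>\<^bsub>G\<^esub>}" unfolding E.gam_img by simp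
    also have "\<dots> \<longleftrightarrow> gam G (Suc c) = {\<one>\<^bsub>G\<^esub>}"
      by (rule E.img_eq_iff[OF E.G.triv_subgroup E.G.gam_subgroup])
        (use f(2) subgroup.one_closed[OF E.G.gam_subgroup] in auto)
    finally show ?thesis by simp
  qed
  then show ?thesis unfolding nil_class_def by simp
qed

lemma fam_iso:
  assumes F: "fam b e G" and H: "group H" "G \<cong> H"
  shows "fam b e H"
proof -
  have G3: "is_3group G" by (rule fam_3group[OF F])
  obtain n where o: "order G = 3 ^ n" "finite (carrier G)" and G: "group G" using G3 by (auto simp: is_3group_def)
  obtain f where f: "epi G H f" "kernel G H f = {\<one>\<^bsub>G\<^esub>}" by (rule iso_group_obtain[OF G H])
  interpret E: epi G H f by (rule f(1))
  have s: "subgroup S G \<Longrightarrow> E.ker \<subseteq> S" for S unfolding f(2) using subgroup.one_closed[of S G] by blast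
  have "card E.ker = 1" unfolding f(2) by simp
  then have "order H = order G" using E.order_img by simp
  then have "coclass H = coclass G" using nil_class_iso[OF G H] by (simp add: coclass_def log3_order_def)
  moreover have "rank_dist_2233 H"
    using F s E.G.Frat_subgroup
    by (intro E.rank_dist_img[OF G3 E.G.nil_class_nil[OF o]] s E.G.gam_subgroup) (auto simp: fam_def max_sub_def)
  moreover have "abel_type e H" using F by (intro E.abel_type_img s E.G.gam_subgroup) (simp add: fam_def)
  ultimately show ?thesis
    using F E.is_3group_img[OF G3] E.is_CF_img E.is_BCF_img by (auto simp: fam_def)
qed

lemma in_tree_iso:
  assumes T: "in_tree b e G" and H: "group H" "G \<cong> H"
  shows "in_tree b e H"
proof -
  have G: "group G" using T by (auto simp: in_tree_def fam_def is_3group_def)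
  obtain f where f: "epi G H f" "kernel G H f = {\<one>\<^bsub>G\<^esub>}" by (rule iso_group_obtain[OF G H])
  interpret E: epi G H f by (rule f(1))
  have c: "nil_class H = nil_class G" using nil_class_iso[OF G H] by simp
  have "fam b e (H Mod gam H k)" if "4 \<le> k" "k \<le> nil_class G" for k
  proof (rule fam_iso)
    show "fam b e (G Mod gam G k)" using T that by (simp add: in_tree_def)
    show "group (H Mod gam H k)" by (rule normal.factorgroup_is_group[OF E.H.gam_normal])
    show "G Mod gam G k \<cong> H Mod gam H k"
      by (rule E.Mod_gam_iso) (use f(2) subgroup.one_closed[OF E.G.gam_subgroup] in auto)
  qed
  then show ?thesis using T fam_iso[OF _ H] by (simp add: in_tree_def c)
qed

lemma tree_facts:
  assumes T: "in_tree b e G" and e: "e \<ge> 2"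
  shows "group G" "finite (carrier G)" "is_3group G" "order G = 3 ^ (e + (if b then 1 else 0) + nil_class G)" "nil_class G \<ge> 3"
    "gam G (Suc (nil_class G)) = {\<one>\<^bsub>G\<^esub>}"
proof -
  have F: "fam b e G" using T by (simp add: in_tree_def)
  show "is_3group G" by (rule fam_3group[OF F])
  then show g: "group G" and f: "finite (carrier G)" by (auto simp: is_3group_def)
  show o: "order G = 3 ^ (e + (if b then 1 else 0) + nil_class G)" by (rule fam_order[OF F e])
  show "nil_class G \<ge> 3" using T by (simp add: in_tree_def)
  show "gam G (Suc (nil_class G)) = {\<one>\<^bsub>G\<^esub>}" by (rule group.nil_class_nil[OF g o f])
qed

lemma quot_class:
  fixes G (structure)
  assumes T: "in_tree b e G" and e: "e \<ge> 2" and m: "1 \<le> m" "m \<le> nil_class G"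
  shows "nil_class (G Mod gam G (Suc m)) = m"
proof -
  note f = tree_facts[OF T e]
  interpret group G by (rule f(1))
  interpret E: epi G "G Mod gam G (Suc m)" "\<lambda>a. gam G (Suc m) #> a" by (rule Mod_epi)
  show ?thesis by (rule E.nil_class_quot[OF f(4,2) Mod_epi(2) m(2,1)])
qed

text \<open>All ancestors have the same coclass, so their orders are determined by their classes;
  comparison with the order of \<open>G\<close> gives that of gamma_k. Ancestors have class at least
  3, whence k >= 4.\<close>

lemma tree_card_gam:
  fixes G (structure)
  assumes T: "in_tree b e G" and e: "e \<ge> 2" and k: "4 \<le> k" "k \<le> Suc (nil_class G)"
  shows "card (gam G k) = 3 ^ (Suc (nil_class G) - k)"
proof (cases "k = Suc (nil_class G)")
  case True then show ?thesis using tree_facts(6)[OF T e] by simp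
next
  case False
  note f = tree_facts[OF T e]
  interpret group G by (rule f(1))
  let ?d = "e + (if b then 1 else 0)"
  interpret E: epi G "G Mod gam G k" "\<lambda>a. gam G k #> a" by (rule Mod_epi)
  have F: "fam b e (G Mod gam G k)" using T k False by (simp add: in_tree_def)
  have "nil_class (G Mod gam G k) = k - 1" using quot_class[OF T e, of "k - 1"] k by simp
  then have "order (G Mod gam G k) = 3 ^ (?d + (k - 1))" using fam_order[OF F e] by simp
  then have "3 ^ (?d + nil_class G) = 3 ^ (?d + (k - 1)) * card (gam G k)"
    using E.order_img f(4) Mod_epi(2) by simp
  moreover have "?d + nil_class G = ?d + (k - 1) + (Suc (nil_class G) - k)" using k by simp
  then have "(3::nat) ^ (?d + nil_class G) = 3 ^ (?d + (k - 1)) * 3 ^ (Suc (nil_class G) - k)" by (metis power_add)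
  ultimately show ?thesis by simp
qed

lemma in_tree_quot:
  fixes G (structure)
  assumes T: "in_tree b e G" and e: "e \<ge> 2" and m: "3 \<le> m" "m \<le> nil_class G"
  shows "in_tree b e (G Mod gam G (Suc m))"
proof -
  note f = tree_facts[OF T e]
  interpret group G by (rule f(1))
  let ?Q = "G Mod gam G (Suc m)"
  interpret E: epi G ?Q "\<lambda>a. gam G (Suc m) #> a" by (rule Mod_epi)
  have ker: "E.ker = gam G (Suc m)" by (rule Mod_epi(2))
  show ?thesis
  proof (cases "m = nil_class G")
    case True
    have "E.ker = {\<one>}" using ker f(6) True by simp
    then have "(\<lambda>a. gam G (Suc m) #> a) \<in> iso G ?Q"
      using iso_kernel_image[OF f(1) E.H.is_group] E.homh E.surj by blast
    then have "G \<cong> ?Q" by (auto simp: is_iso_def)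
    then show ?thesis by (rule in_tree_iso[OF T E.H.is_group])
  next
    case False
    have c: "nil_class ?Q = m" using quot_class[OF T e] m by simp
    have "fam b e ?Q" using T m False by (simp add: in_tree_def)
    moreover have "fam b e (?Q Mod gam ?Q k)" if k: "4 \<le> k" "k \<le> m" for k
    proof (rule fam_iso)
      show "fam b e (G Mod gam G k)" using T k m by (simp add: in_tree_def)
      show "group (?Q Mod gam ?Q k)" by (rule normal.factorgroup_is_group[OF E.H.gam_normal])
      show "G Mod gam G k \<cong> ?Q Mod gam ?Q k"
        by (rule E.Mod_gam_iso) (use ker gam_antimono[of k "Suc m"] k in auto)
    qed
    ultimately show ?thesis using m by (simp add: in_tree_def c)
  qed
qed

text \<open>The ancestor of class 3 determines |gamma_4| and the abelianization determines
  |gamma_2|, which yields the factor 27 in \<open>bicyc\<close>; \<open>special_gen\<close> then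
  adapts \<open>x\<close>. That <x>gamma_2 is maximal with cyclic quotient is recorded for the
  discussion of type d.10.\<close>

lemma special_exists:
  fixes G (structure)
  assumes T: "in_tree True e G" and e: "e \<ge> 2"
  shows "\<exists>x y. special G e (nil_class G) x y \<and> max_sub G (generate G (insert x (gam G 2)))
     \<and> cyc_quot G (generate G (insert x (gam G 2)))"
proof -
  note f = tree_facts[OF T e]
  have F: "fam True e G" using T by (simp add: in_tree_def)
  interpret group G by (rule f(1))
  have ab: "abel_type e G" using F by (simp add: fam_def)
  have e1: "e \<ge> 1" using e by simp
  note ag = abel_type_gens[OF f(3) ab e1]
  obtain x y where xy: "x \<in> carrier G" "y \<in> carrier G" "generate G {x, y} = carrier G"
    "x [^] ((3::nat) ^ e) \<in> gam G 2" "y [^] (3::nat) \<in> gam G 2" using ag(2) by blast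
  let ?c = "nil_class G"
  have c4: "card (gam G 4) = 3 ^ (?c - 3)" using tree_card_gam[OF T e, of 4] f(5) by simp
  have "3 ^ (e + 1) * card (gam G 2) = 3 ^ (e + 1 + ?c)" using ag(1) f(4) by (simp add: order_def)
  then have c2: "card (gam G 2) = 3 ^ ?c" by (simp add: power_add)
  have "3 ^ (3 + (?c - 3)) = (3::nat) ^ ?c" using le_add_diff_inverse[OF f(5)] by (rule arg_cong)
  then have c24: "card (gam G 2) = 27 * card (gam G 4)" unfolding c2 c4 power_add by simp
  have cs: "card (gam G k) = 3 * card (gam G (Suc k))" if "4 \<le> k" "k \<le> ?c" for k
    using tree_card_gam[OF T e, of k] tree_card_gam[OF T e, of "Suc k"] that by (simp add: Suc_diff_le)
  interpret B: bicyc G e ?c x y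
    by unfold_locales (use f e xy ag(1) c24 cs in auto)
  obtain H1 H2 H3 H4 where H: "\<forall>H\<in>{H1, H2, H3}. max_sub G H \<and> cyc_quot G H"
      "rank3 (G\<lparr>carrier := H1\<rparr>) = 2" "rank3 (G\<lparr>carrier := H3\<rparr>) = 3"
    using F unfolding fam_def rank_dist_2233_def by blast
  obtain h where h: "h \<in> carrier G" "bicyc G e ?c h y" "H3 = adj (gam G 2) h"
    "h [^] ((3::nat) ^ e) \<notin> gam G 4" "h [^] ((3::nat) ^ e) \<in> adj (gam G 4) \<lbrakk>h, \<lbrakk>h, y\<rbrakk>\<rbrakk>"
    using B.special_gen[OF f(4), of H1 H3] H by blast
  interpret C: bicyc G e ?c h y by (rule h(2))
  have "special G e ?c h y"
    by unfold_locales (use h C.R_def in auto)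
  then show ?thesis using H(1) h(3) by blast
qed

lemma cyc_mod_card:
  fixes G (structure)
  assumes G: "is_3group G" and A: "subgroup A G" and B: "B \<lhd> G" "B \<subseteq> A" and c: "card A = 3 * card B \<or> A = B"
  shows "cyc_mod G A B"
proof -
  obtain n where o: "order G = 3 ^ n" and fin: "finite (carrier G)" and g: "group G" using G by (auto simp: is_3group_def)
  interpret group G by (rule g)
  have sB: "subgroup B G" by (rule normal_imp_subgroup[OF B(1)])
  show ?thesis
  proof (cases "A = B")
    case True
    then have "A = generate G (insert \<one> B)" using adj_one[OF sB subgroup.one_closed[OF sB]] by simp
    then show ?thesis unfolding cyc_mod_def using subgroup.one_closed[OF A] by blast
  next
    case False
    then obtain a where a: "a \<in> A" "a \<notin> B" using B(2) by blast
    have aG: "a \<in> carrier G" by (rule subgroup.mem_carrier[OF A a(1)])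
    have sub: "adj B a \<subseteq> A" by (rule adj_least[OF A B(2) a(1)])
    have "B \<subset> adj B a" using adj_sub[where N = B and a = a] a(2) by blast
    then have "3 * card B \<le> card (adj B a)" by (rule card_proper_subgroup[OF fin o sB adj_subgroup[OF sB aG]])
    then have "adj B a = A" using c False card_seteq[OF finite_subset[OF subgroup.subset[OF A] fin] sub] by simp
    then show ?thesis unfolding cyc_mod_def using a(1) by blast
  qed
qed

section \<open>From BCF vertices to CF vertices\<close>

context special
begin

lemma adj_int_gam4:
  assumes z: "z' \<in> gam G 3" "z' \<notin> gam G 4" "z' [^] (3::nat) \<in> gam G k" and k: "k \<ge> 4" and c: "\<forall>g\<in>carrier G. \<lbrakk>g, z'\<rbrakk> \<in> gam G k"
  shows "adj (gam G k) z' \<inter> gam G 4 = gam G k" "adj (gam G k) z' \<subseteq> gam G 3"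
    "order G = 3 ^ n \<Longrightarrow> card (adj (gam G k) z') = 3 * card (gam G k)" "adj (gam G k) z' \<lhd> G"
proof -
  have k4: "gam G k \<subseteq> gam G 4" using k by (rule gam_antimono)
  have zG: "z' \<in> carrier G" by (rule gam_carrier[OF z(1)])
  show "adj (gam G k) z' \<inter> gam G 4 = gam G k"
  proof
    show "adj (gam G k) z' \<inter> gam G 4 \<subseteq> gam G k"
    proof
      fix b assume b: "b \<in> adj (gam G k) z' \<inter> gam G 4"
      show "b \<in> gam G k"
      proof (rule ccontr)
        assume n: "b \<notin> gam G k"
        have "z' \<in> gam G 4" using adj_exchange[OF gam_normal zG z(3) _ n gam_subgroup k4] b by blast
        then show False using z(2) by simp
      qed
    qed
    show "gam G k \<subseteq> adj (gam G k) z' \<inter> gam G 4" using k4 adj_sub(1)[of "gam G k" z'] by blast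
  qed
  show "adj (gam G k) z' \<subseteq> gam G 3" using k4 gam43 z(1) by (intro adj_least gam_subgroup) auto
  show "adj (gam G k) z' \<lhd> G" by (rule adj_normal_central[OF gam_normal zG]) (use c in blast)
  assume o: "order G = 3 ^ n"
  have "gam G k \<subset> adj (gam G k) z'" using adj_sub[where N = "gam G k" and a = z'] z(2) k4 by blast
  then have "3 * card (gam G k) \<le> card (adj (gam G k) z')"
    by (rule card_proper_subgroup[OF fin o gam_subgroup adj_subgroup[OF gam_subgroup zG]])
  then show "card (adj (gam G k) z') = 3 * card (gam G k)"
    using card_adj_le(2)[OF gam_normal gam_fin zG z(3)] by simp
qed

text \<open>By \<open>adj_int_gam4\<close> the kernel meets gamma_4 only in gamma_k. So it removes
  one factor 3 from gamma_3/gamma_4 and leaves the other sections above gamma_k intact, which lowers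
  the coclass by one. Ranks persist because the kernel lies in all Frattini subgroups. The parameter
  \<open>k\<close> lets ancestors be treated as further instances.\<close>

lemma CF_quot_fam:
  assumes T: "in_tree True e G" and c: "c = nil_class G" and k: "4 \<le> k" "k \<le> Suc c"
    and z: "z' \<in> gam G 3" "z' \<notin> gam G 4" "z' [^] (3::nat) \<in> gam G k" "\<forall>g\<in>carrier G. \<lbrakk>g, z'\<rbrakk> \<in> gam G k"
    and F: "\<forall>M. max_sub G M \<longrightarrow> z' \<in> Frat M"
    and E: "epi G Q f" "kernel G Q f = adj (gam G k) z'"
  shows "fam False e Q" "nil_class Q = k - 1"
proof -
  interpret E: epi G Q f by (rule E(1))
  note tf = tree_facts[OF T e2]
  note adjz = adj_int_gam4[OF z(1-3) k(1) z(4)]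
  let ?K = "adj (gam G k) z'"
  have FG: "fam True e G" using T by (simp add: in_tree_def)
  have cK: "card ?K = 3 * card (gam G k)" by (rule adjz(3)[OF tf(4)])
  have kpos: "card (gam G k) > 0" by (rule gam_card_pos)
  have k4: "gam G k \<subseteq> gam G 4" using k by (intro gam_antimono)
  have Q3: "is_3group Q" by (rule E.is_3group_img[OF tf(3)])
  have Kn: "?K \<inter> gam G j = gam G k" if "4 \<le> j" "j \<le> k" for j
    using adjz(1) gam_antimono[OF that(1)] gam_antimono[OF that(2)] adj_sub(1)[of "gam G k" z'] by blast
  have card4: "card (gam G j) = card (gam Q j) * card (gam G k)" if "4 \<le> j" "j \<le> k" for j
    using E.card_img[OF gam_subgroup, of j] Kn[OF that] unfolding E.gam_img E(2) by (simp add: Int_commute)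
  have card3: "card (gam G j) = card (gam Q j) * (3 * card (gam G k))" if "j \<le> 3" for j
    using E.card_img[OF gam_subgroup, of j] adjz(2) gam_antimono[OF that] cK unfolding E.gam_img E(2)
    by (simp add: Int_absorb1 subset_trans)
  have triv: "gam Q j = {\<one>\<^bsub>Q\<^esub>}" if "k \<le> j" for j
  proof -
    have "f a = \<one>\<^bsub>Q\<^esub>" if "a \<in> gam G j" for a
    proof -
      have "a \<in> kernel G Q f" unfolding E(2) using that gam_antimono[OF \<open>k \<le> j\<close>] adj_sub(1) by blast
      then show ?thesis by (simp add: kernel_def)
    qed
    then show ?thesis using subgroup.one_closed[OF E.H.gam_subgroup[of j]] unfolding E.gam_img by auto
  qed
  have r4: "card (gam Q j) = 3 * card (gam Q (Suc j))" if "4 \<le> j" "j < k" for j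
  proof -
    have "card (gam Q j) * card (gam G k) = 3 * (card (gam Q (Suc j)) * card (gam G k))"
      using card4[of j] card4[of "Suc j"] card_step[of j] that k by linarith
    then show ?thesis using kpos by simp
  qed
  have r3: "card (gam Q 3) = 3 * card (gam Q 4)"
  proof -
    have "card (gam Q 3) * (3 * card (gam G k)) = 9 * (card (gam Q 4) * card (gam G k))"
      using card3[of 3] card4[of 4] card34 k by linarith
    then show ?thesis using kpos by simp
  qed
  have r2: "card (gam Q 2) = 3 * card (gam Q 3)"
  proof -
    have "card (gam Q 2) * (3 * card (gam G k)) = 3 * (card (gam Q 3) * (3 * card (gam G k)))"
      using card3[of 2] card3[of 3] card23 by linarith
    then show ?thesis using kpos by simp
  qed
  have r: "card (gam Q j) = 3 * card (gam Q (Suc j)) \<or> gam Q j = gam Q (Suc j)" if j2: "j \<ge> 2" for j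
  proof -
    consider "j = 2" | "j = 3" | "4 \<le> j" "j < k" | "k \<le> j" using j2 by linarith
    then show ?thesis
      by cases (use r2 r3 r4 triv[of j] triv[of "Suc j"] in \<open>auto simp: Suc2\<close>)
  qed
  have "is_CF Q" unfolding is_CF_def
    using r E.H.gam_Suc_sub by (intro allI impI cyc_mod_card[OF Q3] E.H.gam_subgroup E.H.gam_normal)
  moreover have "gam Q (k - 1) \<noteq> {\<one>\<^bsub>Q\<^esub>}"
  proof
    assume "gam Q (k - 1) = {\<one>\<^bsub>Q\<^esub>}"
    moreover have "card (gam Q (k - 1)) = 3 * card (gam Q k)"
      using r3 r4[of "k - 1"] k by (cases "k = 4") auto
    ultimately show False using triv[of k] by simp
  qed
  then show nc: "nil_class Q = k - 1" using triv[of k] k by (intro E.H.nil_class_eq) auto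
  moreover have "coclass Q = e"
  proof -
    have g: "card (gam G k) = 3 ^ (Suc c - k)" using tree_card_gam[OF T e2] k c by simp
    have "3 ^ (e + 1 + c) = order Q * (3 * 3 ^ (Suc c - k))"
      using E.order_img tf(4) unfolding E(2) cK g c[symmetric] by simp
    moreover have "e + 1 + c = (e + (k - 1)) + Suc (Suc c - k)" using k by simp
    then have "(3::nat) ^ (e + 1 + c) = 3 ^ (e + (k - 1)) * 3 ^ Suc (Suc c - k)" by (metis power_add)
    ultimately have "order Q = 3 ^ (e + (k - 1))" by simp
    then show ?thesis using nc log3_order_eq[of Q "e + (k - 1)"] by (simp add: coclass_def)
  qed
  moreover have K2: "kernel G Q f \<subseteq> gam G 2" using adjz(2) gam32 unfolding E(2) by blast
  then have "abel_type e Q" using FG by (intro E.abel_type_img) (simp_all add: fam_def)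
  moreover have "rank_dist_2233 Q"
  proof (rule E.rank_dist_img[OF tf(3) tf(6) K2])
    fix M assume M: "max_sub G M"
    then have sM: "subgroup M G" by (simp add: max_sub_def)
    have "gam G 4 \<subseteq> Frat M" by (rule gam4_Frat[OF max_sub_gam2[OF nil M]])
    then show "kernel G Q f \<subseteq> Frat M" unfolding E(2) using k4 F M by (intro adj_least Frat_subgroup sM) auto
  qed (use FG in \<open>simp add: fam_def\<close>)
  ultimately show "fam False e Q" using Q3 by (simp add: fam_def)
qed

text \<open>The ancestors of \<open>Q\<close> are the quotients of \<open>G\<close> by <z'>gamma_j,
  so \<open>CF_quot_fam\<close> applies to each with \<open>j\<close> in place of
  \<open>k\<close>.\<close>

lemma CF_quot_tree:
  assumes T: "in_tree True e G" and c: "c = nil_class G" and k: "4 \<le> k" "k \<le> Suc c"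
    and z: "z' \<in> gam G 3" "z' \<notin> gam G 4" "z' [^] (3::nat) \<in> gam G k" "\<forall>g\<in>carrier G. \<lbrakk>g, z'\<rbrakk> \<in> gam G k"
    and F: "\<forall>M. max_sub G M \<longrightarrow> z' \<in> Frat M"
    and E: "epi G Q f" "kernel G Q f = adj (gam G k) z'"
  shows "in_tree False e Q" "nil_class Q = k - 1"
proof -
  interpret E: epi G Q f by (rule E(1))
  note fq = CF_quot_fam[OF T c]
  have zG: "z' \<in> carrier G" by (rule gam_carrier[OF z(1)])
  show nc: "nil_class Q = k - 1" by (rule fq(2)[OF k z F E])
  have "fam False e (Q Mod gam Q j)" if j: "4 \<le> j" "j \<le> k - 1" for j
  proof -
    let ?S = "adj (gam G j) z'"
    have jk: "gam G k \<subseteq> gam G j" using j by (intro gam_antimono) simp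
    have sS: "subgroup ?S G" by (rule adj_subgroup[OF gam_subgroup zG])
    have kS: "kernel G Q f \<subseteq> ?S" unfolding E(2) by (rule mono_generate) (use jk in blast)
    have "f z' = \<one>\<^bsub>Q\<^esub>" using adj_sub(2)[of z' "gam G k"] unfolding E(2)[symmetric] by (simp add: kernel_def)
    moreover have "f ` ?S = generate Q (f ` insert z' (gam G j))"
      by (rule E.generate_img[symmetric]) (use zG gam_sub in auto)
    ultimately have "f ` ?S = generate Q (insert \<one>\<^bsub>Q\<^esub> (gam Q j))" unfolding E.gam_img by simp
    then have fS: "f ` ?S = gam Q j"
      using E.H.adj_one[OF E.H.gam_subgroup subgroup.one_closed[OF E.H.gam_subgroup]] by simp
    show ?thesis
      by (rule fq(1)[OF _ _ z(1,2) _ _ F E.Mod_gam_kernel[OF sS kS fS]]) (use j k z(3,4) jk in auto)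
  qed
  then show "in_tree False e Q"
    using fq(1)[OF k z F E] k unfolding in_tree_def nc by auto
qed

end

section \<open>Mainline vertices\<close>

text \<open>\<open>has_desc_all\<close> lets descendants range over groups on the natural numbers,
  so quotients, whose elements are cosets, have to be transported.\<close>

lemma nat_copy:
  fixes G (structure)
  assumes "group G" "finite (carrier G)"
  obtains D :: "nat monoid" where "group D" "G \<cong> D"
proof -
  interpret group G by fact
  obtain f :: "'a \<Rightarrow> nat" and n where f: "f ` carrier G = {i. i < n}" "inj_on f (carrier G)"
    using finite_imp_inj_to_nat_seg[OF assms(2)] by blast
  let ?g = "inv_into (carrier G) f"
  define D :: "nat monoid" where "D = \<lparr>carrier = f ` carrier G, monoid.mult = (\<lambda>a b. f (?g a \<otimes> ?g b)), one = f \<one>\<rparr>"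
  have g: "?g (f a) = a" if "a \<in> carrier G" for a using f(2) that by simp
  have gD: "group D"
  proof (rule groupI)
    show "\<exists>y\<in>carrier D. y \<otimes>\<^bsub>D\<^esub> a = \<one>\<^bsub>D\<^esub>" if aD: "a \<in> carrier D" for a
    proof -
      obtain b where b: "b \<in> carrier G" "a = f b" using aD by (auto simp: D_def)
      show ?thesis by (rule bexI[of _ "f (inv b)"]) (use b g in \<open>auto simp: D_def\<close>)
    qed
  qed (auto simp: D_def g m_assoc)
  have "f \<in> iso G D"
    using f(2) g by (auto simp: iso_def hom_def bij_betw_def D_def)
  then have "G \<cong> D" by (auto simp: is_iso_def)
  then show ?thesis using that gD by blast
qed

lemma CF_mainline_iso:
  assumes "CF_mainline e G" "group H" "G \<cong> H"
  shows "CF_mainline e H"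
proof -
  have T: "in_tree False e G" and D: "has_desc_all False e G" using assms(1) by (auto simp: CF_mainline_def)
  have g: "group G" using T by (auto simp: in_tree_def fam_def is_3group_def)
  have H: "H \<cong> G" by (rule group.iso_sym[OF g assms(3)])
  have "has_desc_all False e H"
    using D iso_trans[OF H] unfolding has_desc_all_def nil_class_iso[OF g assms(2,3)] by blast
  then show ?thesis using in_tree_iso[OF T assms(2,3)] by (simp add: CF_mainline_def)
qed

lemma special_metab_exists:
  fixes G (structure)
  assumes T: "in_tree True e G" and e: "e \<ge> 2" and c: "\<forall>a\<in>gam G 2. \<forall>b\<in>gam G 2. cm G a b = \<one>"
  shows "\<exists>x y. special_metab G e (nil_class G) x y \<and> max_sub G (generate G (insert x (gam G 2)))
    \<and> cyc_quot G (generate G (insert x (gam G 2)))"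
proof -
  obtain x y where xy: "special G e (nil_class G) x y" "max_sub G (generate G (insert x (gam G 2)))"
     "cyc_quot G (generate G (insert x (gam G 2)))"
    using special_exists[OF T e] by blast
  then have "special_metab G e (nil_class G) x y"
    using c by (auto simp: special_metab_def special_metab_axioms_def)
  then show ?thesis using xy by blast
qed

lemma (in group) metabelian_comm:
  assumes "metabelian G"
  shows "\<forall>a\<in>gam G 2. \<forall>b\<in>gam G 2. \<lbrakk>a, b\<rbrakk> = \<one>"
proof -
  have "\<lbrakk>a, b\<rbrakk> \<in> derived G (gam G 2)" if "a \<in> gam G 2" "b \<in> gam G 2" for a b
    unfolding derived_def cm_def using that by (intro generate.incl) blast
  then show ?thesis using assms unfolding metabelian_def gam2[symmetric] by auto
qed

lemma (in epi) comm_img: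
  assumes "\<And>a b. a \<in> gam G 2 \<Longrightarrow> b \<in> gam G 2 \<Longrightarrow> cm G a b \<in> ker"
  shows "\<forall>a\<in>gam H 2. \<forall>b\<in>gam H 2. cm H a b = \<one>\<^bsub>H\<^esub>"
proof (intro ballI)
  fix a b assume "a \<in> gam H 2" "b \<in> gam H 2"
  then obtain a' b' where ab: "a' \<in> gam G 2" "b' \<in> gam G 2" "a = h a'" "b = h b'" unfolding gam_img by blast
  then show "cm H a b = \<one>\<^bsub>H\<^esub>"
    using assms[OF ab(1,2)] hom_cm[OF G.gam_carrier[OF ab(1)] G.gam_carrier[OF ab(2)]] ker_iff by simp
qed

lemma (in epi) adj_ker_img:
  assumes z: "z \<in> ker"
  shows "h ` generate G (insert z (gam G j)) = gam H j"
proof -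
  have zG: "z \<in> carrier G" "h z = \<one>\<^bsub>H\<^esub>" using z by (auto simp: ker_iff)
  have "h ` generate G (insert z (gam G j)) = generate H (h ` insert z (gam G j))"
    by (rule generate_img[symmetric]) (use zG G.gam_sub in auto)
  then show ?thesis
    using zG H.adj_one[OF H.gam_subgroup subgroup.one_closed[OF H.gam_subgroup], of j] gam_img[of j] by simp
qed

context bicyc
begin

text \<open>Epimorphisms map the exponent series onto the exponent series, and P_e(G) is
  <u>gamma_(e+1), which is contained in <u>gamma_k.\<close>

lemma pser_quot:
  assumes E: "epi G B f" "kernel G B f = gam G k" and k: "k \<le> Suc e"
  shows "epi G (B Mod pser B e) (\<lambda>a. pser B e #>\<^bsub>B\<^esub> f a)" "kernel G (B Mod pser B e) (\<lambda>a. pser B e #>\<^bsub>B\<^esub> f a) = adj (gam G k) u"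
proof -
  interpret E: epi G B f by (rule E(1))
  let ?S = "adj (gam G k) u"
  have sS: "subgroup ?S G" by (rule adj_subgroup[OF gam_subgroup]) simp
  have pe: "pser G e = adj (gam G (Suc e)) u" using pser_eq[of e] e2 by simp
  have 1: "pser G e \<subseteq> ?S" unfolding pe using gam_antimono[OF k] by (intro mono_generate) blast
  have "f ` ?S = generate B (f ` insert u (gam G k))"
    by (rule E.generate_img[symmetric]) (use gam_sub in auto)
  also have "\<dots> \<subseteq> pser B e"
  proof (rule E.H.generate_subgroup_incl[OF _ normal_imp_subgroup[OF E.H.pser_normal]])
    have "f a = \<one>\<^bsub>B\<^esub>" if "a \<in> gam G k" for a using that unfolding E(2)[symmetric] by (simp add: kernel_def)
    moreover have "\<one>\<^bsub>B\<^esub> \<in> pser B e" by (rule subgroup.one_closed[OF normal_imp_subgroup[OF E.H.pser_normal]])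
    moreover have "f u \<in> pser B e" unfolding E.pser_img pe using adj_sub(2) by blast
    ultimately show "f ` insert u (gam G k) \<subseteq> pser B e" by auto
  qed
  finally have "f ` ?S = pser B e" using 1 unfolding E.pser_img by blast
  then show "epi G (B Mod pser B e) (\<lambda>a. pser B e #>\<^bsub>B\<^esub> f a)" "kernel G (B Mod pser B e) (\<lambda>a. pser B e #>\<^bsub>B\<^esub> f a) = adj (gam G k) u"
    using E.Mod_kernel[OF sS] E.H.pser_normal[of e] adj_sub(1) unfolding E(2) by auto
qed

text \<open>\<open>u\<close> is the cube of x^(3^(e-1)), which is a power of x^3 since
  \<open>e \<ge> 2\<close> and therefore lies in every maximal subgroup.\<close>

lemma u_Frat:
  assumes o: "order G = 3 ^ n" and M: "max_sub G M"
  shows "u \<in> Frat M"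
proof -
  have sM: "subgroup M G" using M by (simp add: max_sub_def)
  have e1: "(3::nat) ^ (e - 1) = 3 * 3 ^ (e - 2)"
    using e2 power_Suc[of "3::nat" "e - 2"] by (simp add: Suc_diff_le[symmetric] numeral_2_eq_2)
  have "x [^] (3::nat) \<in> M" by (rule max_sub_index(1)[OF fin o nil M x])
  then have "(x [^] (3::nat)) [^] ((3::nat) ^ (e - 2)) \<in> M"
    using subgroup_int_pow_closed[OF sM, of "x [^] (3::nat)" "int (3 ^ (e - 2))"] int_pow_int[of G "x [^] (3::nat)" "3 ^ (e-2)"] by simp
  then have "x [^] ((3::nat) ^ (e - 1)) \<in> M" unfolding e1 by (simp add: nat_pow_pow)
  then have "(x [^] ((3::nat) ^ (e - 1))) [^] (3::nat) \<in> Frat M" by (rule Frat_cube)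
  then show ?thesis using x_pow_Suc[of "e - 1"] e2 by simp
qed

end

context special_metab
begin

lemma u_quot_tree:
  assumes T: "in_tree True e G" and c: "c = nil_class G" and k: "4 \<le> k" "k \<le> Suc c" "k \<le> Suc e" "c \<le> Suc e"
    and E: "epi G Q f" "kernel G Q f = adj (gam G k) u"
  shows "in_tree False e Q" "nil_class Q = k - 1"
proof -
  have "x [^] ((3::nat) ^ Suc e) = \<one>" by (rule x_pow_one) (use k in auto)
  then have u3: "u [^] (3::nat) \<in> gam G k" unfolding x_pow_Suc using subgroup.one_closed[OF gam_subgroup] by simp
  have uc: "\<forall>g\<in>carrier G. \<lbrakk>g, u\<rbrakk> \<in> gam G k" using cm_u gam_antimono[of k "e + 3"] k by auto
  have F: "\<forall>M. max_sub G M \<longrightarrow> u \<in> Frat M" using u_Frat[OF tree_facts(4)[OF T e2]] by blast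
  show "in_tree False e Q" "nil_class Q = k - 1"
    using CF_quot_tree[OF T c k(1,2) u_gam3 u4 u3 uc F E] by auto
qed

end

text \<open>One of the two extra classes of \<open>D\<close> is lost by dividing out the last term,
  which contains the second derived subgroup by \<open>gam2_comm_c\<close>. The other is lost by
  dividing out gamma_(C+1), modulo which the corrected element is central.\<close>

lemma tree_desc_CF:
  fixes B (structure) and D :: "nat monoid"
  assumes B: "in_tree True e B" "nil_class B \<le> e" and e3: "e \<ge> 3"
    and D: "in_tree True e D" "nil_class D = C + 2" "nil_class B \<le> C" "B \<cong> D Mod gam D (Suc (nil_class B))"
  shows "\<exists>D' :: nat monoid. in_tree False e D' \<and> nil_class D' = C \<and>
    B Mod pser B e \<cong> D' Mod gam D' (Suc (nil_class B))"
proof -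
  have e2: "e \<ge> 2" using e3 by simp
  define c where "c = nil_class B"
  have c: "3 \<le> c" "c \<le> e" "c \<le> C" using B D tree_facts(5)[OF B(1) e2] by (auto simp: c_def)
  note tB = tree_facts[OF B(1) e2] and tD = tree_facts[OF D(1) e2]
  interpret D: group D by (rule tD(1))
  let ?D1 = "D Mod gam D (Suc (C + 1))"
  interpret E1: epi D ?D1 "\<lambda>a. gam D (Suc (C + 1)) #>\<^bsub>D\<^esub> a" by (rule D.Mod_epi)
  have k1: "E1.ker = gam D (Suc (C + 1))" by (rule D.Mod_epi)
  have T1: "in_tree True e ?D1" and c1: "nil_class ?D1 = C + 1"
    using in_tree_quot[OF D(1) e2, of "C + 1"] quot_class[OF D(1) e2, of "C + 1"] c D(2) by auto
  have comm1: "\<forall>a\<in>gam ?D1 2. \<forall>b\<in>gam ?D1 2. cm ?D1 a b = \<one>\<^bsub>?D1\<^esub>"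
  proof (rule E1.comm_img)
    fix a b assume ab: "a \<in> gam D 2" "b \<in> gam D 2"
    obtain x y where "special D e (nil_class D) x y" using special_exists[OF D(1) e2] by blast
    then interpret S: special D e "nil_class D" x y .
    have "cm D a b \<in> gam D (nil_class D)" by (rule S.gam2_comm_c[OF tD(4) e3 _ ab]) (use D(2) c in simp)
    then show "cm D a b \<in> E1.ker" unfolding k1 D(2) by simp
  qed
  note t1 = tree_facts[OF T1 e2]
  obtain x y where "special_metab ?D1 e (nil_class ?D1) x y" using special_metab_exists[OF T1 e2 comm1] by blast
  then interpret S: special_metab ?D1 e "C + 1" x y unfolding c1 .
  obtain g z' where z: "g \<in> gam ?D1 (e + 2)" "z' = S.u \<otimes>\<^bsub>?D1\<^esub> inv\<^bsub>?D1\<^esub> g" "z' \<in> gam ?D1 3" "z' \<notin> gam ?D1 4"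
    "\<And>h. h \<in> carrier ?D1 \<Longrightarrow> cm ?D1 h z' \<in> gam ?D1 (C + 1)" "z' [^]\<^bsub>?D1\<^esub> (3::nat) \<in> gam ?D1 (C + 1)"
    using S.central_correction[OF t1(4)] c by auto
  have gG: "g \<in> carrier ?D1" and zG: "z' \<in> carrier ?D1" using z E1.H.gam_carrier by auto
  have g4: "g \<in> gam ?D1 4" using z(1) E1.H.gam_antimono[of 4 "e + 2"] e3 by auto
  have F: "\<forall>M. max_sub ?D1 M \<longrightarrow> z' \<in> E1.H.Frat M"
  proof (intro allI impI)
    fix M assume M: "max_sub ?D1 M"
    then have sF: "subgroup (E1.H.Frat M) ?D1" by (intro E1.H.Frat_subgroup) (simp add: max_sub_def)
    have "g \<in> E1.H.Frat M" using S.gam4_Frat[OF E1.H.max_sub_gam2[OF S.nil M]] g4 by blast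
    then show "z' \<in> E1.H.Frat M"
      unfolding z(2) using S.u_Frat[OF t1(4) M] subgroup.m_closed[OF sF] subgroup.m_inv_closed[OF sF] by blast
  qed
  let ?K = "E1.H.adj (gam ?D1 (C + 1)) z'"
  have zc: "\<forall>h\<in>carrier ?D1. cm ?D1 h z' \<in> gam ?D1 (C + 1)" using z(5) by blast
  have nK: "?K \<lhd> ?D1" by (rule E1.H.adj_normal_central[OF E1.H.gam_normal zG z(5)])
  let ?Q = "?D1 Mod ?K"
  interpret K: normal ?K ?D1 by (rule nK)
  interpret E2: epi ?D1 ?Q "\<lambda>a. ?K #>\<^bsub>?D1\<^esub> a" by (rule K.epi_canonical)
  have k2: "E2.ker = ?K" by (rule K.epi_canonical)
  have k4: "4 \<le> C + 1" "C + 1 \<le> Suc (C + 1)" using c by auto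
  have TQ: "in_tree False e ?Q" and cQ: "nil_class ?Q = C"
    using S.CF_quot_tree[OF T1 c1[symmetric] k4 z(3,4,6) zc F E2.epi_axioms k2] by auto
  have fQ: "finite (carrier ?Q)" by (rule tree_facts(2)[OF TQ e2])
  obtain D' :: "nat monoid" where D': "group D'" "?Q \<cong> D'" using nat_copy[OF E2.H.is_group fQ] by blast
  obtain f where f: "epi ?Q D' f" "kernel ?Q D' f = {\<one>\<^bsub>?Q\<^esub>}" by (rule iso_group_obtain[OF E2.H.is_group D'])
  have i1: "?Q Mod gam ?Q (Suc c) \<cong> D' Mod gam D' (Suc c)"
    by (rule epi.Mod_gam_iso[OF f(1)]) (use f(2) subgroup.one_closed[OF E2.H.gam_subgroup] in auto)
  let ?N = "gam ?D1 (Suc c)"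
  \<comment> \<open>The correction \<open>g\<close> lies in gamma_(e+2), hence in gamma_(c+1) as c
    <= e. At the level of \<open>B\<close> it is invisible.\<close>
  have eqS: "E1.H.adj ?N z' = E1.H.adj ?N S.u"
  proof -
    have sz: "subgroup (E1.H.adj ?N z') ?D1" and su: "subgroup (E1.H.adj ?N S.u) ?D1"
      by (intro E1.H.adj_subgroup E1.H.gam_subgroup zG S.stzp)+
    have gN: "g \<in> ?N" using z(1) E1.H.gam_antimono[of "Suc c" "e + 2"] c by auto
    have "S.u = z' \<otimes>\<^bsub>?D1\<^esub> g" 
      unfolding z(2) E1.H.m_assoc[OF S.stzp(5) E1.H.inv_closed[OF gG] gG] E1.H.l_inv[OF gG] E1.H.r_one[OF S.stzp(5)] ..
    then have "S.u \<in> E1.H.adj ?N z'"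
      using subgroup.m_closed[OF sz E1.H.adj_sub(2), of g] gN E1.H.adj_sub(1) by auto
    moreover have "z' \<in> E1.H.adj ?N S.u"
      unfolding z(2) using subgroup.m_closed[OF su E1.H.adj_sub(2), of "inv\<^bsub>?D1\<^esub> g"] subgroup.m_inv_closed[OF su, of g] gN E1.H.adj_sub(1) by blast
    ultimately show ?thesis
      using E1.H.adj_least[OF sz E1.H.adj_sub(1)] E1.H.adj_least[OF su E1.H.adj_sub(1)] by blast
  qed
  have sS: "subgroup (E1.H.adj ?N z') ?D1" by (rule E1.H.adj_subgroup[OF E1.H.gam_subgroup zG])
  have zK: "z' \<in> E2.ker" unfolding k2 by (rule E1.H.adj_sub)
  have "gam ?D1 (C + 1) \<subseteq> ?N" using c by (intro E1.H.gam_antimono) simp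
  then have kS: "E2.ker \<subseteq> E1.H.adj ?N z'" unfolding k2 by (intro E1.H.mono_generate) blast
  note a = E2.Mod_gam_kernel[OF sS kS E2.adj_ker_img[OF zK]]
  have "?D1 Mod gam ?D1 (Suc c) \<cong> B"
  proof -
    have "D Mod gam D (Suc c) \<cong> ?D1 Mod gam ?D1 (Suc c)"
      by (rule E1.Mod_gam_iso) (use k1 D.gam_antimono[of "Suc c" "Suc (C + 1)"] c in auto)
    then have "B \<cong> ?D1 Mod gam ?D1 (Suc c)" using D(4) unfolding c_def[symmetric] by (rule iso_trans[rotated])
    then show ?thesis by (rule group.iso_sym[OF tB(1)])
  qed
  then obtain \<phi> where phi: "epi (?D1 Mod ?N) B \<phi>" "kernel (?D1 Mod ?N) B \<phi> = {\<one>\<^bsub>?D1 Mod ?N\<^esub>}"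
    using iso_group_obtain[OF normal.factorgroup_is_group[OF E1.H.gam_normal] tB(1)] by blast
  interpret P: epi "?D1 Mod ?N" B \<phi> by (rule phi(1))
  interpret N: epi ?D1 "?D1 Mod ?N" "\<lambda>a. ?N #>\<^bsub>?D1\<^esub> a" by (rule E1.H.Mod_epi)
  have kN: "N.ker = ?N" by (rule E1.H.Mod_epi)
  have comp: "epi ?D1 B (\<lambda>a. \<phi> (?N #>\<^bsub>?D1\<^esub> a))"
  proof (intro epi.intro group_hom.intro group_hom_axioms.intro epi_axioms.intro)
    show "(\<lambda>a. \<phi> (?N #>\<^bsub>?D1\<^esub> a)) \<in> hom ?D1 B"
      by (rule homI) (simp_all only: P.hom_closed N.hom_closed N.hom_mult P.hom_mult)
    show "(\<lambda>a. \<phi> (?N #>\<^bsub>?D1\<^esub> a)) ` carrier ?D1 = carrier B"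
      unfolding P.surj[symmetric] N.surj[symmetric] by (simp add: image_image)
  qed (rule E1.H.is_group tB(1))+
  have kcomp: "kernel ?D1 B (\<lambda>a. \<phi> (?N #>\<^bsub>?D1\<^esub> a)) = ?N"
  proof -
    have "\<phi> (?N #>\<^bsub>?D1\<^esub> a) = \<one>\<^bsub>B\<^esub> \<longleftrightarrow> a \<in> ?N" if a: "a \<in> carrier ?D1" for a
    proof -
      have "\<phi> (?N #>\<^bsub>?D1\<^esub> a) = \<one>\<^bsub>B\<^esub> \<longleftrightarrow> ?N #>\<^bsub>?D1\<^esub> a = \<one>\<^bsub>?D1 Mod ?N\<^esub>"
        using phi(2) P.ker_iff[of "?N #>\<^bsub>?D1\<^esub> a"] N.hom_closed[OF a] by (metis singleton_iff)
      also have "\<dots> \<longleftrightarrow> a \<in> ?N" using kN N.ker_iff[of a] a by blast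
      finally show ?thesis .
    qed
    then show ?thesis unfolding kernel_def using E1.H.gam_carrier[of _ "Suc c"] by blast
  qed
  have "Suc c \<le> Suc e" using c by simp
  note b = S.pser_quot[OF comp kcomp this]
  have "B Mod pser B e \<cong> ?Q Mod gam ?Q (Suc c)"
    by (rule epi_same_kernel_iso[OF b(1) a(1)]) (simp only: a(2) b(2) eqS)
  then have "B Mod pser B e \<cong> D' Mod gam D' (Suc c)" using i1 by (rule iso_trans)
  moreover have "in_tree False e D'" by (rule in_tree_iso[OF TQ D'])
  moreover have "nil_class D' = C" using nil_class_iso[OF E2.H.is_group D'] cQ by simp
  ultimately show ?thesis unfolding c_def by blast
qed

text \<open>Descendants of \<open>B\<close> of class C + 2 give descendants of the quotient of class
  C, so unbounded descent is inherited.\<close>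

lemma CF_mainline_pser_quot:
  fixes B (structure)
  assumes B: "in_tree True e B" "nil_class B \<le> e" "has_desc_all True e B" and e3: "e \<ge> 3"
    and comm: "\<forall>a\<in>gam B 2. \<forall>b\<in>gam B 2. cm B a b = \<one>"
  shows "CF_mainline e (B Mod pser B e)"
proof -
  have e2: "e \<ge> 2" using e3 by simp
  define c where "c = nil_class B"
  note tB = tree_facts[OF B(1) e2]
  interpret group B by (rule tB(1))
  obtain x y where "special_metab B e (nil_class B) x y" using special_metab_exists[OF B(1) e2 comm] by blast
  then interpret S: special_metab B e c x y unfolding c_def .
  interpret N: normal "pser B e" B by (rule pser_normal)
  have "pser B e = adj (gam B (Suc e)) S.u" using S.pser_eq[of e] e2 by simp
  then have pe: "pser B e = adj (gam B (Suc c)) S.u"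
    using S.gam_big[of "Suc e"] S.gam_big[of "Suc c"] B(2) c_def by simp
  have k: "4 \<le> Suc c" "Suc c \<le> Suc c" "Suc c \<le> Suc e" "c \<le> Suc e" using S.c3 B(2) c_def by auto
  have E: "epi B (B Mod pser B e) (\<lambda>a. pser B e #> a)" "kernel B (B Mod pser B e) (\<lambda>a. pser B e #> a) = adj (gam B (Suc c)) S.u"
    using N.epi_canonical pe by auto
  have T: "in_tree False e (B Mod pser B e)" and n: "nil_class (B Mod pser B e) = c"
    using S.u_quot_tree[OF B(1) c_def k E] by auto
  have "has_desc_all False e (B Mod pser B e)"
    unfolding has_desc_all_def n
  proof (intro allI impI)
    fix C assume C: "c \<le> C"
    then obtain D :: "nat monoid" where D: "in_tree True e D" "nil_class D = C + 2" "B \<cong> D Mod gam D (Suc (nil_class B))"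
      using B(3) unfolding has_desc_all_def c_def by (meson trans_le_add1)
    show "\<exists>D :: nat monoid. in_tree False e D \<and> nil_class D = C \<and> B Mod pser B e \<cong> D Mod gam D (Suc c)"
      using tree_desc_CF[OF B(1,2) e3 D(1,2) _ D(3)] C unfolding c_def by blast
  qed
  then show ?thesis using T by (simp add: CF_mainline_def)
qed

section \<open>Transfer kernel types of quotients\<close>

context group
begin

text \<open>The transfer of \<open>g\<close> to a subgroup \<open>M\<close> of index three with transversal \<open>\<one>, r, r\<^sup>2\<close>.\<close>
definition tval where
  "tval M r g = (if g \<in> M then g \<otimes> (r \<otimes> g \<otimes> inv r) \<otimes> (r \<otimes> r \<otimes> g \<otimes> inv (r \<otimes> r)) else g [^] (3::nat))"

lemma tval_closed [simp]: "r \<in> carrier G \<Longrightarrow> g \<in> carrier G \<Longrightarrow> tval M r g \<in> carrier G"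
  by (simp add: tval_def)

lemma transfer_kernel_tval:
  assumes "index3 M G" "g \<in> carrier G" "r \<in> carrier G" "r \<notin> M"
  shows "g \<in> transfer_kernel G M \<longleftrightarrow> tval M r g \<in> derived G M"
  using index3.transfer_kernel_iff[OF assms(1,2)] assms(3,4) by (simp add: tval_def)

lemma transfer_kernel_carrier: "transfer_kernel G M \<subseteq> carrier G"
  by (auto simp: transfer_kernel_def)

lemma gens_span_sub: "A \<subseteq> carrier G \<Longrightarrow> A \<union> derived G (carrier G) \<subseteq> carrier G"
  using derived_in_carrier[OF order_refl] by blast

lemma tval_central:
  assumes g: "g \<in> carrier G" and r: "r \<in> carrier G" and v: "v \<in> carrier G"
    and c: "\<And>a. a \<in> carrier G \<Longrightarrow> v \<otimes> a = a \<otimes> v" and m: "g \<otimes> v \<in> M \<longleftrightarrow> g \<in> M"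
  shows "tval M r (g \<otimes> v) = tval M r g \<otimes> (v \<otimes> v \<otimes> v)"
proof -
  have cl: "v \<otimes> (a \<otimes> b) = a \<otimes> (v \<otimes> b)" if "a \<in> carrier G" "b \<in> carrier G" for a b
    using c[OF that(1)] that v by (simp add: m_assoc[symmetric])
  note k = c[OF g] c[OF r] c[OF inv_closed[OF r]] cl[OF g] cl[OF r] cl[OF inv_closed[OF r]]
  show ?thesis using g r v unfolding tval_def m pow3[OF g] pow3[OF m_closed[OF g v]]
    by (simp add: m_assoc inv_mult_group k)
qed

lemma tval_gam2:
  assumes g: "g \<in> carrier G" and r: "r \<in> carrier G"
  shows "tval M r g \<in> gam G 2 \<longleftrightarrow> g [^] (3::nat) \<in> gam G 2"
proof -
  have c: "gam G 2 #> (q \<otimes> g \<otimes> inv q) = gam G 2 #> g" if q: "q \<in> carrier G" for q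
    using coset_drop[OF gam_normal cm_gam[of q 1 g] g] conj_cm[OF g q] q g by (simp add: numeral_2_eq_2)
  have "gam G 2 #> (g \<otimes> (r \<otimes> g \<otimes> inv r) \<otimes> (r \<otimes> r \<otimes> g \<otimes> inv (r \<otimes> r))) = gam G 2 #> (g \<otimes> g \<otimes> g)"
    by (intro coset_mult_eq gam_normal c refl) (use g r in auto)
  then have "gam G 2 #> tval M r g = gam G 2 #> g [^] (3::nat)"
    using g by (simp add: tval_def pow3)
  then show ?thesis using coset_mem_iff[OF gam_normal _ _ _ order_refl gam_subgroup, of "tval M r g" "g [^] (3::nat)" 2] g r by simp
qed

end

text \<open>A value of \<open>kval\<close> names the first candidate that matches, so it also says
  that earlier candidates differ. These inequalities are what permits recomputing the value in a
  quotient.\<close>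

lemma first_match:
  fixes K :: 'c and v :: nat
  assumes "v = (if K = a then 0 else if K = b then 1 else if K = c then 2 else if K = d then 3 else if K = f then 4 else 5)"
  shows "v = 0 \<longleftrightarrow> K = a" "v = 1 \<Longrightarrow> K = b \<and> b \<noteq> a" "v = 2 \<Longrightarrow> K = c \<and> c \<noteq> a \<and> c \<noteq> b"
    "v = 3 \<Longrightarrow> K = d" "v = 4 \<Longrightarrow> K = f \<and> f \<noteq> a \<and> f \<noteq> b \<and> f \<noteq> c \<and> f \<noteq> d"
proof -
  consider "K = a" "v = 0" | "K \<noteq> a" "K = b" "v = 1" | "K \<noteq> a" "K \<noteq> b" "K = c" "v = 2"
    | "K \<noteq> a" "K \<noteq> b" "K \<noteq> c" "K = d" "v = 3" | "K \<noteq> a" "K \<noteq> b" "K \<noteq> c" "K \<noteq> d" "K = f" "v = 4"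
    | "K \<noteq> a" "v = 5"
    using assms by presburger
  note c = this
  show "v = 0 \<longleftrightarrow> K = a" by (cases rule: c; simp)
  show "K = b \<and> b \<noteq> a" if "v = 1" using that by (cases rule: c; simp)
  show "K = c \<and> c \<noteq> a \<and> c \<noteq> b" if "v = 2" using that by (cases rule: c; simp)
  show "K = d" if "v = 3" using that by (cases rule: c; simp)
  show "K = f \<and> f \<noteq> a \<and> f \<noteq> b \<and> f \<noteq> c \<and> f \<noteq> d" if "v = 4" using that by (cases rule: c; simp)
qed

lemma kval_cases:
  fixes G (structure)
  defines "S \<equiv> \<lambda>A. generate G (A \<union> derived G (carrier G))"
  shows "kval e G x y M = 0 \<longleftrightarrow> transfer_kernel G M = S {x [^] ((3::nat) ^ (e - 1)), y}"
    "kval e G x y M = 1 \<Longrightarrow> transfer_kernel G M = S {y} \<and> S {y} \<noteq> S {x [^] ((3::nat) ^ (e - 1)), y}"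
    "kval e G x y M = 2 \<Longrightarrow> transfer_kernel G M = S {x [^] ((3::nat) ^ (e - 1)) \<otimes> y} \<and>
       S {x [^] ((3::nat) ^ (e - 1)) \<otimes> y} \<noteq> S {x [^] ((3::nat) ^ (e - 1)), y} \<and>
       S {x [^] ((3::nat) ^ (e - 1)) \<otimes> y} \<noteq> S {y}"
    "kval e G x y M = 3 \<Longrightarrow> transfer_kernel G M = S {x [^] ((3::nat) ^ (e - 1)) \<otimes> x [^] ((3::nat) ^ (e - 1)) \<otimes> y}"
    "kval e G x y M = 4 \<Longrightarrow> transfer_kernel G M = S {x [^] ((3::nat) ^ (e - 1))} \<and>
       S {x [^] ((3::nat) ^ (e - 1))} \<noteq> S {x [^] ((3::nat) ^ (e - 1)), y} \<and>
       S {x [^] ((3::nat) ^ (e - 1))} \<noteq> S {y} \<and> S {x [^] ((3::nat) ^ (e - 1))} \<noteq> S {x [^] ((3::nat) ^ (e - 1)) \<otimes> y} \<and>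
       S {x [^] ((3::nat) ^ (e - 1))} \<noteq> S {x [^] ((3::nat) ^ (e - 1)) \<otimes> x [^] ((3::nat) ^ (e - 1)) \<otimes> y}"
  unfolding S_def by (fact first_match[OF kval_def[unfolded Let_def]])+

context epi
begin

lemma span_img:
  assumes A: "A \<subseteq> carrier G"
  shows "generate H (h ` A \<union> derived H (carrier H)) = h ` generate G (A \<union> derived G (carrier G))"
  unfolding derived_carrier image_Un[symmetric] by (rule generate_img[OF G.gens_span_sub[OF A]])

lemma kval_img:
  assumes K: "transfer_kernel H (h ` M) = h ` K" "subgroup K G" "ker \<subseteq> K" and D: "ker \<subseteq> derived G (carrier G)"
    and x: "x \<in> carrier G" and y: "y \<in> carrier G"
  shows "kval e H (h x) (h y) (h ` M) =
    (let D = derived G (carrier G); w = x [^] ((3::nat) ^ (e - 1)); S = (\<lambda>A. generate G (A \<union> D)) in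
      if K = S {w, y} then 0 else if K = S {y} then 1 else if K = S {w \<otimes> y} then 2
      else if K = S {w \<otimes> w \<otimes> y} then 3 else if K = S {w} then 4 else 5)"
proof -
  define w where "w = x [^] ((3::nat) ^ (e - 1))"
  let ?D = "derived G (carrier G)"
  have wG: "w \<in> carrier G" and hw: "h x [^]\<^bsub>H\<^esub> ((3::nat) ^ (e - 1)) = h w" using x by (simp_all add: w_def hom_nat_pow)
  have eq: "h ` K = generate H (h ` A \<union> derived H (carrier H)) \<longleftrightarrow> K = generate G (A \<union> ?D)" if A: "A \<subseteq> carrier G" for A
    unfolding span_img[OF A]
    by (rule img_eq_iff[OF G.generate_is_subgroup[OF G.gens_span_sub[OF A]] K(2) _ K(3)])
      (use D generate.incl[of _ "A \<union> ?D" G] in auto)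
  have im: "{h w, h y} = h ` {w, y}" "{h y} = h ` {y}" "{h w \<otimes>\<^bsub>H\<^esub> h y} = h ` {w \<otimes> y}"
    "{h w \<otimes>\<^bsub>H\<^esub> h w \<otimes>\<^bsub>H\<^esub> h y} = h ` {w \<otimes> w \<otimes> y}" "{h w} = h ` {w}"
    using wG y by simp_all
  have s: "{w, y} \<subseteq> carrier G" "{y} \<subseteq> carrier G" "{w \<otimes> y} \<subseteq> carrier G" "{w \<otimes> w \<otimes> y} \<subseteq> carrier G" "{w} \<subseteq> carrier G"
    using wG y by simp_all
  note q = s[THEN eq, folded im]
  show ?thesis unfolding kval_def Let_def hw K(1) w_def[symmetric] q ..
qed

lemma tval_img:
  assumes M: "subgroup M G" "ker \<subseteq> M" and g: "g \<in> carrier G" and r: "r \<in> carrier G"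
  shows "H.tval (h ` M) (h r) (h g) = h (G.tval M r g)"
  using mem_img_iff[OF M g] g r by (simp add: H.tval_def G.tval_def hom_nat_pow)

lemma transfer_kernel_img:
  assumes G3: "is_3group G" and nil: "gam G (Suc c) = {\<one>}" and M: "max_sub G M" and k: "ker \<subseteq> M"
    and r: "r \<in> carrier G" "r \<notin> M" and g: "g \<in> carrier G"
  shows "h g \<in> transfer_kernel H (h ` M) \<longleftrightarrow> h (G.tval M r g) \<in> h ` derived G M"
proof -
  have sM: "subgroup M G" using M by (simp add: max_sub_def)
  obtain n where n: "order H = 3 ^ n" "finite (carrier H)" using is_3group_img[OF G3] by (auto simp: is_3group_def)
  have "gam H (Suc c) = {\<one>\<^bsub>H\<^esub>}" unfolding gam_img nil by simp
  then have i: "index3 (h ` M) H" by (rule H.max_sub_index3[OF n(2,1) _ max_sub_img[OF M k]])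
  have "h r \<notin> h ` M" using mem_img_iff[OF sM k r(1)] r(2) by simp
  then show ?thesis
    using H.transfer_kernel_tval[OF i, of "h g" "h r"] tval_img[OF sM k g r(1)] derived_img[OF subgroup.subset[OF sM]] g r(1) by simp
qed

lemma gens_ok_img:
  assumes g: "gens_ok e G x y"
  shows "gens_ok e H (h x) (h y)"
proof -
  have xy: "x \<in> carrier G" "y \<in> carrier G" "generate G {x, y} = carrier G" using g by (auto simp: gens_ok_def)
  have D: "h a \<in> derived H (carrier H)" if "a \<in> derived G (carrier G)" for a unfolding derived_carrier using that by blast
  have "generate H {h x, h y} = carrier H" using generate_img[of "{x, y}"] xy surj by simp
  moreover have "(h x [^]\<^bsub>H\<^esub> ((3::nat) ^ (e - 1))) [^]\<^bsub>H\<^esub> (3::nat) = h ((x [^] ((3::nat) ^ (e - 1))) [^] (3::nat))"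
    "h y [^]\<^bsub>H\<^esub> (3::nat) = h (y [^] (3::nat))" using xy by (simp_all add: hom_nat_pow)
  ultimately show ?thesis using D g xy by (simp add: gens_ok_def)
qed

lemma has_tkt_img:
  assumes nil: "gam G (Suc c) = {\<one>}" and k2: "ker \<subseteq> gam G 2"
    and g: "gens_ok e G x y" and H: "distinct [H1, H2, H3]" "\<forall>H\<in>{H1, H2, H3}. max_sub G H \<and> cyc_quot G H"
      "max_sub G H4" "\<not> cyc_quot G H4"
    and v: "kval e H (h x) (h y) (h ` H1) = k1" "kval e H (h x) (h y) (h ` H2) = k2'"
      "kval e H (h x) (h y) (h ` H3) = k3" "kval e H (h x) (h y) (h ` H4) = k4"
  shows "has_tkt e H k1 k2' k3 k4"
proof -
  have m: "subgroup M G" "gam G 2 \<subseteq> M" "ker \<subseteq> M" if "max_sub G M" for M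
    using that G.max_sub_gam2[OF nil that] k2 by (auto simp: max_sub_def)
  have mx: "max_sub H (h ` M)" if "max_sub G M" for M using max_sub_img[OF that m(3)[OF that]] .
  have cy: "cyc_quot H (h ` M) \<longleftrightarrow> cyc_quot G M" if "max_sub G M" for M
    using cyc_quot_img[OF m(1)[OF that]] k2 m(2)[OF that] unfolding G.gam2 by blast
  have eq: "h ` M = h ` M' \<longleftrightarrow> M = M'" if "max_sub G M" "max_sub G M'" for M M'
    by (rule img_eq_iff[OF m(1)[OF that(2)] m(1)[OF that(1)] m(3)[OF that(2)] m(3)[OF that(1)]])
  have M: "max_sub G H1" "max_sub G H2" "max_sub G H3" using H(2) by simp_all
  have d: "distinct [h ` H1, h ` H2, h ` H3]"
    using H(1) eq[OF M(1,2)] eq[OF M(1,3)] eq[OF M(2,3)] by simp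
  have c: "cyc_quot H (h ` H1)" "cyc_quot H (h ` H2)" "cyc_quot H (h ` H3)"
    using cy[OF M(1)] cy[OF M(2)] cy[OF M(3)] H(2) by blast+
  have a: "\<forall>K\<in>{h ` H1, h ` H2, h ` H3}. max_sub H K \<and> cyc_quot H K"
    using c mx[OF M(1)] mx[OF M(2)] mx[OF M(3)] by simp
  have n: "\<not> cyc_quot H (h ` H4)" using H(4) cy[OF H(3)] by simp
  show ?thesis unfolding has_tkt_def
    by (rule exI[of _ "h x"], rule exI[of _ "h y"], rule conjI[OF gens_ok_img[OF g]],
      rule exI[of _ "h ` H1"], rule exI[of _ "h ` H2"], rule exI[of _ "h ` H3"], rule exI[of _ "h ` H4"], intro conjI)
      (fact d a n v mx[OF H(3)])+
qed

end

section \<open>Transfer kernels after factoring out the cube of \<open>w\<close>\<close>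

lemma (in group) central_shift_subgroup:
  assumes T: "subgroup T G" and w: "w \<in> carrier G" "\<And>g. g \<in> carrier G \<Longrightarrow> w \<otimes> g = g \<otimes> w"
  shows "subgroup {g \<in> carrier G. \<exists>j::int. g \<otimes> w [^] j \<in> T} G"
proof (rule subgroupI)
  interpret T: subgroup T G by fact
  have cw: "w [^] j \<otimes> g = g \<otimes> w [^] j" if g: "g \<in> carrier G" for g and j :: int
  proof -
    have "w \<in> Cent {\<one>} g" using w g cm_eq_one_iff[OF g w(1)] by (simp add: Cent_iff)
    then have "w [^] j \<in> Cent {\<one>} g" by (intro subgroup_int_pow_closed Cent_subgroup one_is_normal g)
    then show ?thesis using cm_eq_one_iff[OF g, of "w [^] j"] w(1) by (simp add: Cent_iff)
  qed
  show "{g \<in> carrier G. \<exists>j::int. g \<otimes> w [^] j \<in> T} \<subseteq> carrier G" by blast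
  have "\<one> \<otimes> w [^] (0::int) \<in> T" by simp
  then show "{g \<in> carrier G. \<exists>j::int. g \<otimes> w [^] j \<in> T} \<noteq> {}" by blast
  fix a assume "a \<in> {g \<in> carrier G. \<exists>j::int. g \<otimes> w [^] j \<in> T}"
  then obtain j :: int where a: "a \<in> carrier G" "a \<otimes> w [^] j \<in> T" by blast
  have "inv (a \<otimes> w [^] j) = inv a \<otimes> w [^] (- j)"
    using a(1) w(1) cw[of "inv a" "- j"] by (simp add: inv_mult_group int_pow_neg)
  then show "inv a \<in> {g \<in> carrier G. \<exists>j::int. g \<otimes> w [^] j \<in> T}" using T.m_inv_closed[OF a(2)] a(1) by (auto intro!: exI[of _ "- j"])
  fix b assume "b \<in> {g \<in> carrier G. \<exists>j::int. g \<otimes> w [^] j \<in> T}"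
  then obtain l :: int where b: "b \<in> carrier G" "b \<otimes> w [^] l \<in> T" by blast
  have "a \<otimes> w [^] j \<otimes> (b \<otimes> w [^] l) = a \<otimes> b \<otimes> w [^] (j + l)"
    using a(1) b(1) w(1) cw[of b j] by (simp add: int_pow_mult m_assoc) (simp add: m_assoc[symmetric])
  then have "a \<otimes> b \<otimes> w [^] (j + l) \<in> T" using T.m_closed[OF a(2) b(2)] by simp
  then show "a \<otimes> b \<in> {g \<in> carrier G. \<exists>j::int. g \<otimes> w [^] j \<in> T}" using a(1) b(1) by blast
qed

context bicyc
begin

text \<open>\<open>has_tkt\<close> brings its own generators, which need not be adapted to the
  subgroup of rank three; the general results must still be available for them.\<close>

lemma gens_ok_bicyc:
  assumes g: "gens_ok e G x' y'"
  shows "bicyc G e c x' y'"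
proof -
  have p: "(x' [^] ((3::nat) ^ (e - 1))) [^] (3::nat) \<in> gam G 2" and x': "x' \<in> carrier G"
    using g by (auto simp: gens_ok_def gam2)
  have "(3::nat) ^ (e - 1) * 3 = 3 ^ e" using e2 by (cases e) auto
  then have "x' [^] ((3::nat) ^ e) \<in> gam G 2" using p x' by (simp add: nat_pow_pow)
  then show ?thesis
    by unfold_locales
      (use g fin e2 c3 nil card_carrier card24 card_step in \<open>auto simp: gens_ok_def gam2\<close>)
qed

abbreviation w where "w \<equiv> x [^] ((3::nat) ^ (e - 1))"

lemma w_cube: "w [^] (3::nat) = u"
  using x_pow_Suc[of "e - 1"] e2 by simp

lemma w_max: 
  assumes o: "order G = 3 ^ n" and M: "max_sub G M"
  shows "w \<in> M"
proof -
  have sM: "subgroup M G" using M by (simp add: max_sub_def)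
  have e1: "(3::nat) ^ (e - 1) = 3 * 3 ^ (e - 2)"
    using e2 power_Suc[of "3::nat" "e - 2"] by (simp add: Suc_diff_le[symmetric] numeral_2_eq_2)
  have "x [^] (3::nat) \<in> M" by (rule max_sub_index(1)[OF fin o nil M x])
  then have "(x [^] (3::nat)) [^] ((3::nat) ^ (e - 2)) \<in> M"
    using subgroup_int_pow_closed[OF sM, of "x [^] (3::nat)" "int (3 ^ (e - 2))"] int_pow_int[of G "x [^] (3::nat)" "3 ^ (e-2)"] by simp
  then show ?thesis unfolding e1 by (simp add: nat_pow_pow)
qed

lemma cm_w: "g \<in> carrier G \<Longrightarrow> \<lbrakk>g, w\<rbrakk> \<in> gam G (e + 2)"
  using cm_pow_gam[OF x, of g "e - 1"] e2 by simp

text \<open>If \<open>w\<close> is central, then the transfer maps \<open>w\<close> to \<open>w\<^sup>3\<close>. So factoring out \<open>w\<^sup>3\<close> enlarges every transfer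
  kernel precisely by \<open>w\<close>.\<close>
lemma kval_quot_w:
  assumes G3: "is_3group G" and M: "max_sub G M" and ce: "c \<le> e"
    and E: "epi G Q f" "kernel G Q f = adj {\<one>} u"
  shows "kval e G x y M \<in> {0, 1, 2, 3} \<Longrightarrow> kval e Q (f x) (f y) (f ` M) = 0"
    "kval e G x y M = 4 \<Longrightarrow> kval e Q (f x) (f y) (f ` M) = 4"
proof -
  interpret E: epi G Q f by (rule E(1))
  obtain n where o: "order G = 3 ^ n" using G3 by (auto simp: is_3group_def)
  have sM: "subgroup M G" using M by (simp add: max_sub_def)
  have wM: "w \<in> M" by (rule w_max[OF o M])
  have wG: "w \<in> carrier G" by simp
  let ?D = "derived G (carrier G)" and ?K = "transfer_kernel G M"
  let ?S = "\<lambda>A. generate G (A \<union> ?D)"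
  have "gam G (e + 2) = {\<one>}"
    using gam_antimono[of "Suc c" "e + 2"] ce nil subgroup.one_closed[OF gam_subgroup[of "e + 2"]] by auto
  then have wc: "w \<otimes> g = g \<otimes> w" if "g \<in> carrier G" for g using cm_w[OF that] cm_eq_one_iff[OF that wG] by simp
  have cw: "w [^] j \<otimes> g = g \<otimes> w [^] j" if g: "g \<in> carrier G" for g and j :: int
  proof -
    have "w \<in> Cent {\<one>} g" using wc[OF g] cm_eq_one_iff[OF g wG] by (simp add: Cent_iff)
    then have "w [^] j \<in> Cent {\<one>} g" by (intro subgroup_int_pow_closed Cent_subgroup one_is_normal g)
    then show ?thesis using cm_eq_one_iff[OF g, of "w [^] j"] by (simp add: Cent_iff)
  qed
  have uj: "u [^] j = w [^] (3 * j)" for j :: int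
    using int_pow_pow[OF wG, of 3 j] int_pow_int[of G w 3] w_cube by simp
  have kD: "E.ker \<subseteq> ?D"
    unfolding E(2) gam2[symmetric] using x_pow2 subgroup.one_closed[OF gam_subgroup] by (intro adj_least gam_subgroup) auto
  have DM: "?D \<subseteq> M" using max_sub_gam2(2)[OF nil M] unfolding gam2 .
  have kM: "E.ker \<subseteq> M" using kD DM by blast
  obtain r where r: "r \<in> carrier G" "r \<notin> M" using M subgroup.subset[OF sM] by (auto simp: max_sub_def)
  have i3: "index3 M G" by (rule max_sub_index3[OF fin o nil M])
  have tv: "tval M r (g \<otimes> w [^] j) = tval M r g \<otimes> w [^] (3 * j)" if g: "g \<in> carrier G" for g and j :: int
  proof -
    let ?v = "w [^] j"
    have v: "?v \<in> carrier G" "?v \<in> M" using subgroup_int_pow_closed[OF sM wM] by auto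
    have v3: "w [^] (3 * j) = ?v \<otimes> ?v \<otimes> ?v"
      using int_pow_pow[OF wG, of j 3] int_pow_int[of G ?v 3] v(1) by (simp add: pow3 mult.commute)
    have m: "g \<otimes> ?v \<in> M \<longleftrightarrow> g \<in> M" by (rule mult_mem_cancel[OF sM g v(2)])
    show ?thesis using tval_central[OF g r(1) v(1) cw m] unfolding v3 .
  qed
  \<comment> \<open>Multiplying g by w^j multiplies its transfer by w^(3j) = u^j, and these are the
    elements of the kernel of \<open>f\<close>. So the new transfer kernel pulls back to the old one
    times <w>.\<close>
  have KQ: "f g \<in> transfer_kernel Q (f ` M) \<longleftrightarrow> (\<exists>j::int. g \<otimes> w [^] j \<in> ?K)" if g: "g \<in> carrier G" for g
  proof -
    let ?v = "tval M r g"
    have vG: "?v \<in> carrier G" using g r by simp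
    have "f g \<in> transfer_kernel Q (f ` M) \<longleftrightarrow> f ?v \<in> f ` derived G M"
      by (rule E.transfer_kernel_img[OF G3 nil M kM r g])
    also have "\<dots> \<longleftrightarrow> (\<exists>j::int. ?v \<otimes> w [^] (3 * j) \<in> derived G M)"
    proof
      assume "f ?v \<in> f ` derived G M"
      then obtain d where d: "d \<in> derived G M" "f ?v = f d" by auto
      have dG: "d \<in> carrier G" using d(1) derived_in_carrier[OF subgroup.subset[OF sM]] by blast
      have "inv ?v \<otimes> d \<in> E.ker" using d(2) vG dG by (simp add: E.ker_iff)
      then obtain j :: int where j: "inv ?v \<otimes> d = u [^] j"
        unfolding E(2) using adj_mem_int[OF one_is_normal stzp(5)] by fastforce
      have "?v \<otimes> (inv ?v \<otimes> d) = d" using vG dG by (simp add: inv_cancel_left)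
      then have "?v \<otimes> w [^] (3 * j) = d" unfolding j uj .
      then show "\<exists>j::int. ?v \<otimes> w [^] (3 * j) \<in> derived G M" using d(1) by auto
    next
      assume "\<exists>j::int. ?v \<otimes> w [^] (3 * j) \<in> derived G M"
      then obtain j :: int where j: "?v \<otimes> u [^] j \<in> derived G M" unfolding uj[symmetric] by blast
      have "u [^] j \<in> E.ker" unfolding E(2) by (intro subgroup_int_pow_closed adj_subgroup triv_subgroup adj_sub) simp
      then have "f (?v \<otimes> u [^] j) = f ?v" using vG by (simp add: E.ker_iff)
      then show "f ?v \<in> f ` derived G M" using j by (metis imageI)
    qed
    also have "\<dots> \<longleftrightarrow> (\<exists>j::int. g \<otimes> w [^] j \<in> ?K)"
      using transfer_kernel_tval[OF i3 _ r] tv[OF g] g by simp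
    finally show ?thesis .
  qed
  let ?K' = "{g \<in> carrier G. \<exists>j::int. g \<otimes> w [^] j \<in> ?K}"
  have KQ': "transfer_kernel Q (f ` M) = f ` ?K'"
  proof
    show "transfer_kernel Q (f ` M) \<subseteq> f ` ?K'"
    proof
      fix q assume q: "q \<in> transfer_kernel Q (f ` M)"
      then have "q \<in> carrier Q" using E.H.transfer_kernel_carrier by blast
      then obtain g where "g \<in> carrier G" "q = f g" unfolding E.surj[symmetric] by blast
      then show "q \<in> f ` ?K'" using KQ q by auto
    qed
    show "f ` ?K' \<subseteq> transfer_kernel Q (f ` M)" using KQ by auto
  qed
  have fw: "f x [^]\<^bsub>Q\<^esub> ((3::nat) ^ (e - 1)) = f w" by (simp add: E.hom_nat_pow)
  have SQ: "generate Q (f ` B \<union> derived Q (carrier Q)) = f ` ?S B" if "B \<subseteq> carrier G" for B by (rule E.span_img[OF that])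
  have sS: "subgroup (?S B) G" if "B \<subseteq> carrier G" for B by (rule generate_is_subgroup[OF gens_span_sub[OF that]])
  have inS: "B \<subseteq> ?S B" "?D \<subseteq> ?S B" for B using generate.incl[of _ "B \<union> ?D" G] by blast+
  have kS: "E.ker \<subseteq> ?S B" for B using kD inS(2) by blast
  have leS: "?S B \<subseteq> T" if "subgroup T G" "B \<subseteq> T" "?D \<subseteq> T" for B T
    using that by (intro generate_subgroup_incl) auto
  \<comment> \<open>The enlarged kernel always contains w and G' and, if B lies in <w,y>G', stays
    inside that subgroup. So containing y decides equality.\<close>
  have full: "?K' = ?S {w, y}" if B: "?K = ?S B" "B \<subseteq> ?S {w, y}" and yK: "y \<in> ?K'" for B
  proof -
    have BG: "B \<subseteq> carrier G" using B(2) subgroup.subset[OF sS[of "{w, y}"]] by auto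
    have s2: "subgroup (?S {w, y}) G" by (rule sS) auto
    interpret s2: subgroup "?S {w, y}" G by (rule s2)
    have wS: "w \<in> ?S {w, y}" using inS(1)[of "{w, y}"] by blast
    have sK: "subgroup ?K' G" unfolding B(1) by (rule central_shift_subgroup[OF sS[OF BG] wG wc])
    have "?K' \<subseteq> ?S {w, y}"
    proof
      fix g assume "g \<in> ?K'"
      then obtain j :: int where g: "g \<in> carrier G" "g \<otimes> w [^] j \<in> ?S B" unfolding B(1) by blast
      then have "g \<otimes> w [^] j \<in> ?S {w, y}" using leS[OF s2 B(2) inS(2)] by blast
      then show "g \<in> ?S {w, y}" using mult_mem_cancel[OF s2 g(1) subgroup_int_pow_closed[OF s2 wS]] by blast
    qed
    moreover have "w \<in> ?K'"
    proof -
      have "w \<otimes> w [^] (-1::int) = \<one>" using int_pow_neg[OF wG, of 1] by simp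
      then have "w \<otimes> w [^] (-1::int) \<in> ?K" using subgroup.one_closed[OF sS[OF BG]] B(1) by simp
      then show ?thesis using wG by blast
    qed
    moreover have "?D \<subseteq> ?K'"
    proof
      fix d assume d: "d \<in> ?D"
      have dG: "d \<in> carrier G" using d derived_in_carrier[OF order_refl] by blast
      then have "d \<otimes> w [^] (0::int) \<in> ?K" using d inS(2)[of B] B(1) by auto
      then show "d \<in> ?K'" using dG by blast
    qed
    ultimately show ?thesis using leS[OF sK, of "{w, y}"] yK by blast
  qed
  have zero: "kval e Q (f x) (f y) (f ` M) = 0" if "?K' = ?S {w, y}"
    unfolding kval_cases(1) fw KQ' that using SQ[of "{w, y}"] by simp
  have s2: "subgroup (?S {w, y}) G" by (rule sS) auto
  have wyS: "w \<in> ?S {w, y}" "y \<in> ?S {w, y}" using inS(1)[of "{w, y}"] by blast+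
  have wyS': "w \<otimes> y \<in> ?S {w, y}" "w \<otimes> w \<otimes> y \<in> ?S {w, y}" using wyS subgroup.m_closed[OF s2] by blast+
  show "kval e Q (f x) (f y) (f ` M) = 0" if "kval e G x y M \<in> {0, 1, 2, 3}"
  proof (rule zero)
    define v where "v = kval e G x y M"
    have "v \<in> {0, 1, 2, 3}" using that unfolding v_def .
    then consider "v = 0" | "v = 1" | "v = 2" | "v = 3" by auto
    then show "?K' = ?S {w, y}"
    proof cases
      case 1
      have K: "?K = ?S {w, y}" using 1 v_def kval_cases(1)[of e G x y M] by simp
      have "y \<otimes> w [^] (0::int) \<in> ?K" using K wyS(2) by simp
      then have "y \<in> ?K'" using y by blast
      then show ?thesis using wyS by (intro full[OF K]) auto
    next
      case 2
      have K: "?K = ?S {y}" by (rule kval_cases(2)[OF 2[unfolded v_def], THEN conjunct1])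
      have "y \<otimes> w [^] (0::int) \<in> ?K" using K inS(1)[of "{y}"] by simp
      then have "y \<in> ?K'" using y by blast
      then show ?thesis using wyS by (intro full[OF K]) auto
    next
      case 3
      have K: "?K = ?S {w \<otimes> y}" by (rule kval_cases(3)[OF 3[unfolded v_def], THEN conjunct1])
      \<comment> \<open>For a kernel generated over G' by w^(j-1)y the witness exponent is j -
        1.\<close>
      have "y \<otimes> w [^] (1::int) \<in> ?K" using K inS(1)[of "{w \<otimes> y}"] wc[OF y] int_pow_1[OF wG] by simp
      then have "y \<in> ?K'" using y by blast
      then show ?thesis using wyS'(1) by (intro full[OF K]) auto
    next
      case 4
      have K: "?K = ?S {w \<otimes> w \<otimes> y}" by (rule kval_cases(4)[OF 4[unfolded v_def]])
      have "w [^] (2::int) = w \<otimes> w" using int_pow_int[of G w 2] by (simp add: numeral_2_eq_2)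
      then have "y \<otimes> w [^] (2::int) = w \<otimes> w \<otimes> y" using cw[OF y, of 2] by simp
      then have "y \<otimes> w [^] (2::int) \<in> ?K" using K inS(1)[of "{w \<otimes> w \<otimes> y}"] by simp
      then have "y \<in> ?K'" using y by blast
      then show ?thesis using wyS'(2) by (intro full[OF K]) auto
    qed
  qed
  assume k4: "kval e G x y M = 4"
  have K: "?K = ?S {w}" using kval_cases(5)[OF k4] by blast
  have n: "?S {w} \<noteq> ?S {w, y}" "?S {w} \<noteq> ?S {y}" "?S {w} \<noteq> ?S {w \<otimes> y}" "?S {w} \<noteq> ?S {w \<otimes> w \<otimes> y}"
    using kval_cases(5)[OF k4] by blast+
  have s1: "subgroup (?S {w}) G" by (rule sS) auto
  have wS: "w \<in> ?S {w}" using inS(1)[of "{w}"] by blast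
  have "?K' = ?S {w}"
  proof
    show "?K' \<subseteq> ?S {w}" unfolding K using mult_mem_cancel[OF s1 _ subgroup_int_pow_closed[OF s1 wS]] by blast
    show "?S {w} \<subseteq> ?K'"
    proof
      fix g assume g: "g \<in> ?S {w}"
      have "g \<in> carrier G" by (rule subgroup.mem_carrier[OF s1 g])
      moreover from this have "g \<otimes> w [^] (0::int) \<in> ?K" using g K by simp
      ultimately show "g \<in> ?K'" by blast
    qed
  qed
  then have KQ4: "transfer_kernel Q (f ` M) = f ` ?S {w}" using KQ' by simp
  show "kval e Q (f x) (f y) (f ` M) = 4"
    unfolding E.kval_img[OF KQ4 s1 kS kD x y] Let_def using n by simp
qed

end

context bicyc
begin

text \<open>Write g = n x^i with n^3 in gamma_2; then x^(3i) lies in gamma_2. Since x has order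
  exactly 3^e modulo gamma_2, the exponent i is a multiple of 3^(e-1).\<close>

lemma cube_gam2_span:
  assumes g: "g \<in> carrier G" "g [^] (3::nat) \<in> gam G 2"
  shows "g \<in> generate G ({w, y} \<union> derived G (carrier G))"
proof -
  let ?S = "generate G ({w, y} \<union> gam G 2)"
  have sS: "subgroup ?S G" by (rule generate_is_subgroup) (use gam_sub in auto)
  have iS: "w \<in> ?S" "y \<in> ?S" "gam G 2 \<subseteq> ?S" by (auto intro: generate.incl)
  obtain i :: int and n where n: "n \<in> adj (gam G 2) y" "g = n \<otimes> x [^] i" using pow_e_mod'[OF g(1)] by blast
  have nG: "n \<in> carrier G" "n [^] (3::nat) \<in> gam G 2" using adj_y_cube[OF n(1)] by auto
  have "gam G 2 #> g [^] (3::nat) = gam G 2 #> (n [^] (3::nat) \<otimes> (x [^] i) [^] (3::nat))"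
    unfolding n(2) by (rule pow_mult_mod[OF gam_normal nG(1) _ gam2_all]) (use nG in auto)
  then have "n [^] (3::nat) \<otimes> (x [^] i) [^] (3::nat) \<in> gam G 2"
    using coset_mem_iff[OF gam_normal _ _ _ order_refl gam_subgroup, of "g [^] (3::nat)" "n [^] (3::nat) \<otimes> (x [^] i) [^] (3::nat)" 2] g nG by simp
  moreover have "inv (n [^] (3::nat)) \<otimes> (n [^] (3::nat) \<otimes> (x [^] i) [^] (3::nat)) = (x [^] i) [^] (3::nat)"
    using nG by (simp add: m_assoc[symmetric])
  ultimately have "(x [^] i) [^] (3::nat) \<in> gam G 2"
    using subgroup.m_closed[OF gam_subgroup subgroup.m_inv_closed[OF gam_subgroup nG(2)]] by metis
  then have xi: "x [^] (3 * i) \<in> gam G 2"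
    using int_pow_pow[OF x, of i 3] int_pow_int[of G "x [^] i" 3] by (simp add: mult.commute)
  have wn: "w \<notin> gam G 2"
  proof
    assume a: "w \<in> gam G 2"
    have sY: "subgroup (adj (gam G 2) y) G" by (rule adj_subgroup[OF gam_subgroup y])
    have fY: "finite (adj (gam G 2) y)" using fin subgroup.subset[OF sY] finite_subset by blast
    have "w \<in> adj (gam G 2) y" using a adj_sub(1) by blast
    then have "card (carrier G) \<le> 3 ^ (e - 1) * card (adj (gam G 2) y)"
      using card_adj_le(2)[OF carrier_adj(2) fY x, of "3 ^ (e - 1)"] carrier_adj(1) by simp
    also have "\<dots> \<le> 3 ^ (e - 1) * (3 * card (gam G 2))"
      using card_adj_le(2)[OF gam_normal gam_fin y y_pow2] by simp
    also have "\<dots> = 3 ^ e * card (gam G 2)" using e2 by (cases e) auto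
    finally show False using card_carrier gam_card_pos[of 2] by simp
  qed
  have "int (3 ^ (e - 1)) dvd i"
  proof -
    have "gcd (3 * i) (3 ^ e) dvd (3::int) ^ e" by simp
    then obtain k where k: "k \<le> e" "gcd (3 * i) (3 ^ e) = (3::int) ^ k"
      by (rule divides_primepow[rotated]) simp_all
    \<comment> \<open>If the greatest common divisor were a smaller power of 3, Bezout would express
      \<open>w\<close> through x^(3i) and \<open>u\<close>, both in gamma_2.\<close>
    have "k = e"
    proof (rule ccontr)
      assume "k \<noteq> e"
      then have "(3::int) ^ k dvd 3 ^ (e - 1)" using k(1) by (intro le_imp_power_dvd) auto
      then obtain d where d: "(3::int) ^ (e - 1) = 3 ^ k * d" by blast
      obtain a b where ab: "a * (3 * i) + b * 3 ^ e = gcd (3 * i) (3 ^ e)" using bezout_int by metis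
      have e1: "int (3 ^ (e - 1)) = (3 * i) * (a * d) + int (3 ^ e) * (b * d)"
        using d ab[symmetric] unfolding k(2) by (simp add: algebra_simps)
      have "w = x [^] int (3 ^ (e - 1))" using int_pow_int[of G x "3 ^ (e - 1)"] by simp
      also have "\<dots> = x [^] ((3 * i) * (a * d)) \<otimes> x [^] (int (3 ^ e) * (b * d))" unfolding e1 by (rule int_pow_mult[OF x])
      also have "\<dots> = (x [^] (3 * i)) [^] (a * d) \<otimes> u [^] (b * d)"
        using int_pow_pow[OF x, of "3 * i" "a * d"] int_pow_pow[OF x, of "int (3 ^ e)" "b * d"] int_pow_int[of G x "3 ^ e"] by simp
      also have "\<dots> \<in> gam G 2"
        by (intro subgroup.m_closed[OF gam_subgroup] subgroup_int_pow_closed[OF gam_subgroup] xi x_pow2)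
      finally show False using wn by simp
    qed
    then have "(3::int) ^ e dvd 3 * i" using k(2) by (metis gcd_dvd1)
    moreover have "(3::int) ^ e = 3 * 3 ^ (e - 1)" using e2 by (cases e) auto
    ultimately show ?thesis by simp
  qed
  then obtain d where d: "i = int (3 ^ (e - 1)) * d" by blast
  have "x [^] i = w [^] d"
    using int_pow_pow[OF x, of "int (3 ^ (e - 1))" d] int_pow_int[of G x "3 ^ (e - 1)"] unfolding d by simp
  then have "x [^] i \<in> ?S" using subgroup_int_pow_closed[OF sS iS(1)] by simp
  moreover have "n \<in> ?S" using n(1) adj_least[OF sS iS(3,2)] by blast
  ultimately show ?thesis unfolding n(2) gam2[symmetric] by (intro subgroup.m_closed[OF sS])
qed

end

section \<open>Type d.10 passes to the parent\<close>

context special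
begin

text \<open>If \<open>u\<close> is in \<open>R h\<close>, then [h,s] is a power of \<open>u\<close>
  modulo gamma_4, hence in \<open>R x\<close>. So both maximal subgroups lie in the centralizer of
  \<open>s\<close> modulo \<open>R x\<close>; it misses \<open>y\<close>, and by maximality both
  equal it.\<close>

lemma R_max_sub_u:
  assumes o: "order G = 3 ^ n" and Hs: "max_sub G (adj (gam G 2) x)" and M: "max_sub G M"
    and h: "h \<in> carrier G" "M = adj Phi h" and uh: "u \<in> R h"
  shows "M = adj (gam G 2) x"
proof -
  note sR = normal_imp_subgroup[OF R_normal[OF x]]
  have "\<lbrakk>h, s\<rbrakk> \<in> R x"
    by (rule adj_exchange[OF gam_normal _ cube3[OF cm3[OF h(1)]] uh[unfolded R_def] u4 sR R_mem(1) uR]) (use h in simp)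
  then have sh: "\<lbrakk>s, h\<rbrakk> \<in> R x" by (rule cm_swap[OF sR]) (use h in simp_all)
  have sx: "\<lbrakk>s, x\<rbrakk> \<in> R x" by (rule cm_swap[OF sR R_mem(2)]) simp_all
  let ?C = "Cent (R x) s"
  have sC: "subgroup ?C G" by (rule Cent_subgroup[OF R_normal[OF x]]) simp
  have g2: "gam G 2 \<subseteq> ?C" using gam2_comm[OF s_gam] R_mem(1) gam_sub by (rule sub_CentI)
  have "x \<in> ?C" using sx by (simp add: Cent_iff)
  then have 1: "adj (gam G 2) x \<subseteq> ?C" by (rule adj_least[OF sC g2])
  have "x [^] (3::nat) \<in> ?C" unfolding Cent_iff using cm_cube_gam4[OF x, of s] R_mem(1)[of x] nat_pow_closed[OF x] stzp(1) by blast
  then have "Phi \<subseteq> ?C" by (rule Phi_least[OF sC g2])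
  then have 2: "M \<subseteq> ?C" unfolding h(2) using sh h(1) by (intro adj_least sC) (auto simp: Cent_iff)
  have "y \<notin> ?C"
  proof
    assume "y \<in> ?C"
    then have "\<lbrakk>s, y\<rbrakk> \<in> R x" unfolding Cent_iff by (rule conjunct2)
    then have "t \<in> R x" by (rule cm_swap[OF sR]) simp_all
    then show False using x_y_indep(1) by simp
  qed
  then have cC: "?C \<noteq> carrier G" using y by metis
  have "?C = K" if K: "max_sub G K" "K \<subseteq> ?C" for K
  proof -
    have "?C = K \<or> ?C = carrier G" using K sC by (simp only: max_sub_def)
    then show ?thesis using cC by metis
  qed
  from this[OF Hs 1] this[OF M 2] show ?thesis by simp
qed

text \<open>Now \<open>u\<close> and [h,s] generate gamma_3 modulo gamma_4. As \<open>u\<close> is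
  central modulo gamma_5 and [h,s] lies in the normal subgroup M', gamma_4 lies in M' gamma_5, and
  \<open>nakayama\<close> removes gamma_5.\<close>

lemma gam4_derived_max_sub:
  assumes o: "order G = 3 ^ n" and M: "max_sub G M" and h: "h \<in> M" "M = adj Phi h" and uh: "u \<notin> R h"
  shows "gam G 4 \<subseteq> derived G M"
proof -
  have sM: "subgroup M G" using M by (simp add: max_sub_def)
  have nM: "M \<lhd> G" and gM: "gam G 2 \<subseteq> M" using max_sub_gam2[OF nil M] by auto
  have hG: "h \<in> carrier G" by (rule subgroup.mem_carrier[OF sM h(1)])
  have nD: "derived G M \<lhd> G" by (rule derived_is_normal[OF nM])
  note sD = normal_imp_subgroup[OF nD]
  let ?b = "\<lbrakk>h, s\<rbrakk>"
  have bD: "?b \<in> derived G M" 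
    unfolding derived_def by (rule generate.incl) (use h(1) subsetD[OF gM s_gam] in \<open>unfold cm_def[of G h s], blast\<close>)
  have bG: "?b \<in> carrier G" using hG by simp
  note P = set_mult_normal[OF nD gam_normal[of 5]]
  have sG: "subgroup (generate G ({u, ?b} \<union> gam G 4)) G" by (rule generate_is_subgroup) (use gam_sub bG in auto)
  have "adj (R h) u \<subseteq> generate G ({u, ?b} \<union> gam G 4)"
    unfolding R_def by (intro adj_least sG) (auto intro: generate.incl)
  then have g3: "gam G 3 \<subseteq> generate G ({u, ?b} \<union> gam G (Suc 3))"
    using gam3_eq_adj_R[OF o hG cm_max_sub_gam4[OF M hG h(2)] u_gam3 uh] by (simp add: Suc2)
  have "gam G (Suc 3) \<subseteq> derived G M <#> gam G 5"
  proof (rule gam_step[OF _ g3 _ P(1)])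
    show "{u, ?b} \<subseteq> carrier G" using bG by simp
    show "gam G (Suc (Suc 3)) \<subseteq> derived G M <#> gam G 5" using P(3) by (simp add: Suc2)
    fix b g assume b: "b \<in> {u, ?b}" and g: "g \<in> carrier G"
    have "\<lbrakk>u, g\<rbrakk> \<in> gam G 5"
      using cm_swap[OF gam_subgroup cm_u[OF g] g] gam_antimono[of 5 "e + 3"] e2 by auto
    moreover have "\<lbrakk>?b, g\<rbrakk> \<in> derived G M"
      using subgroup.m_closed[OF sD bD normal.inv_op_closed2[OF nD g subgroup.m_inv_closed[OF sD bD]]] g bG
      by (simp add: cm_def m_assoc)
    ultimately show "\<lbrakk>b, g\<rbrakk> \<in> derived G M <#> gam G 5" using b P(2,3) by blast
  qed simp
  then have "gam G 4 \<subseteq> derived G M <#> gam G (Suc 4)" by (simp add: Suc2)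
  then show ?thesis by (intro nakayama[OF nD _ _ nil]) auto
qed

text \<open>The transfer maps \<open>w\<close> to \<open>w\<^sup>3\<close> modulo \<open>\<gamma>\<^sub>4\<close>, and \<open>w\<^sup>3\<close> generates \<open>\<langle>u\<rangle>\<close> modulo \<open>\<gamma>\<^sub>4\<close>.\<close>
lemma w_transfer_kernel:
  assumes o: "order G = 3 ^ n" and Hs: "max_sub G (adj (gam G 2) x)" and M: "max_sub G M"
    and B: "bicyc G e c x' y'" and w: "x' [^] ((3::nat) ^ (e - 1)) \<in> transfer_kernel G M"
  shows "M = adj (gam G 2) x"
proof -
  interpret B: bicyc G e c x' y' by (rule B)
  have sM: "subgroup M G" using M by (simp add: max_sub_def)
  obtain h where h: "h \<in> M" "M = adj Phi h" using max_sub_gen[OF o M] by blast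
  have hG: "h \<in> carrier G" by (rule subgroup.mem_carrier[OF sM h(1)])
  note sR = normal_imp_subgroup[OF R_normal[OF hG]]
  obtain r where r: "r \<in> carrier G" "r \<notin> M" using M subgroup.subset[OF sM] by (auto simp: max_sub_def)
  have wM: "B.w \<in> M" by (rule B.w_max[OF o M])
  have "gam G 4 #> (q \<otimes> B.w \<otimes> inv q) = gam G 4 #> B.w" if q: "q \<in> carrier G" for q
  proof -
    have "\<lbrakk>q, B.w\<rbrakk> \<in> gam G 4" using B.cm_w[OF q] gam_antimono[of 4 "e + 2"] e2 by auto
    then show ?thesis using coset_drop[OF gam_normal, of _ 4 B.w] conj_cm[of B.w q] q by simp
  qed
  then have "gam G 4 #> (B.w \<otimes> (r \<otimes> B.w \<otimes> inv r) \<otimes> (r \<otimes> r \<otimes> B.w \<otimes> inv (r \<otimes> r))) = gam G 4 #> (B.w \<otimes> B.w \<otimes> B.w)"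
    by (intro coset_mult_eq gam_normal refl) (use r in auto)
  then have c: "gam G 4 #> tval M r B.w = gam G 4 #> B.u"
    using wM pow3[of B.w] B.w_cube by (simp add: tval_def)
  have "tval M r B.w \<in> derived G M"
    using transfer_kernel_tval[OF max_sub_index3[OF fin o nil M] _ r] w by simp
  then have "tval M r B.w \<in> R h" using derived_max_sub'[OF hG] h(2) by blast
  then have u': "B.u \<in> R h" using coset_mem_iff[OF gam_normal _ _ c R_mem(1) sR] r by simp
  obtain i :: int where i: "gam G 4 #> u = gam G 4 #> B.u [^] i" using B.pow_e_mod[OF x] by blast
  have "u \<in> R h"
    using coset_mem_iff[OF gam_normal _ _ i R_mem(1) sR] subgroup_int_pow_closed[OF sR u'] by simp
  then show ?thesis by (rule R_max_sub_u[OF o Hs M hG h(2)])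
qed

text \<open>The kernel gamma_c lies in M' for every maximal subgroup other than <x>gamma_2, so those
  transfer kernels are preserved. The value 0 belongs to <x>gamma_2 by
  \<open>w_transfer_kernel\<close>; its kernel is already the full 3-torsion of G/G' and cannot
  grow.\<close>

lemma has_tkt_quot_gam_c:
  assumes G3: "is_3group G" and c4: "c \<ge> 4"
    and Hs: "max_sub G (adj (gam G 2) x)" "cyc_quot G (adj (gam G 2) x)"
    and T: "has_tkt e G 1 1 0 2" and E: "epi G Q f" "kernel G Q f = gam G c"
  shows "has_tkt e Q 1 1 0 2"
proof -
  interpret E: epi G Q f by (rule E(1))
  obtain n where o: "order G = 3 ^ n" using G3 by (auto simp: is_3group_def)
  obtain x' y' H1 H2 H3 H4 where g: "gens_ok e G x' y'" and d: "distinct [H1, H2, H3]"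
    and H: "\<forall>H\<in>{H1, H2, H3}. max_sub G H \<and> cyc_quot G H" "max_sub G H4" "\<not> cyc_quot G H4"
    and v: "kval e G x' y' H1 = 1" "kval e G x' y' H2 = 1" "kval e G x' y' H3 = 0" "kval e G x' y' H4 = 2"
    using T unfolding has_tkt_def by blast
  have B: "bicyc G e c x' y'" by (rule gens_ok_bicyc[OF g])
  interpret B: bicyc G e c x' y' by (rule B)
  let ?D = "derived G (carrier G)"
  let ?S = "\<lambda>A. generate G (A \<union> ?D)"
  have sS: "subgroup (?S A) G" if "A \<subseteq> carrier G" for A by (rule generate_is_subgroup[OF gens_span_sub[OF that]])
  have inS: "A \<subseteq> ?S A" "?D \<subseteq> ?S A" for A using generate.incl[of _ "A \<union> ?D" G] by blast+
  have k4: "E.ker \<subseteq> gam G 4" unfolding E(2) by (rule gam_antimono[OF c4])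
  have k2: "E.ker \<subseteq> gam G 2" and kD: "E.ker \<subseteq> ?D" using k4 gam42 unfolding gam2[symmetric] by blast+
  have kS: "E.ker \<subseteq> ?S A" for A using kD inS(2) by blast
  have mx: "max_sub G H1" "max_sub G H2" "max_sub G H3" using H(1) by simp_all
  have K3: "transfer_kernel G H3 = ?S {B.w, y'}" using v(3) unfolding kval_cases(1) .
  have "B.w \<in> transfer_kernel G H3" unfolding K3 using inS(1)[of "{B.w, y'}"] by blast
  then have H3: "H3 = adj (gam G 2) x" by (rule w_transfer_kernel[OF o Hs(1) mx(3) B])
  have TK: "f g \<in> transfer_kernel Q (f ` M) \<longleftrightarrow> f (tval M r g) \<in> f ` derived G M"
    and TK': "g \<in> transfer_kernel G M \<longleftrightarrow> tval M r g \<in> derived G M"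
    if M: "max_sub G M" and g: "g \<in> carrier G" and r: "r \<in> carrier G" "r \<notin> M" for M g r
  proof -
    have kM: "E.ker \<subseteq> M" using max_sub_gam2(2)[OF nil M] k2 by blast
    show "f g \<in> transfer_kernel Q (f ` M) \<longleftrightarrow> f (tval M r g) \<in> f ` derived G M"
      by (rule E.transfer_kernel_img[OF G3 nil M kM r g])
    show "g \<in> transfer_kernel G M \<longleftrightarrow> tval M r g \<in> derived G M"
      by (rule transfer_kernel_tval[OF max_sub_index3[OF fin o nil M] g r])
  qed
  have outside: "\<exists>r\<in>carrier G. r \<notin> M" if "max_sub G M" for M
    using that subgroup.subset[of M G] by (auto simp: max_sub_def)
  have imgI: "transfer_kernel Q (f ` M) = f ` K" if "K \<subseteq> carrier G"
    "\<And>g. g \<in> carrier G \<Longrightarrow> f g \<in> transfer_kernel Q (f ` M) \<longleftrightarrow> g \<in> K" for K M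
  proof
    show "f ` K \<subseteq> transfer_kernel Q (f ` M)" using that by blast
    show "transfer_kernel Q (f ` M) \<subseteq> f ` K"
    proof
      fix q assume q: "q \<in> transfer_kernel Q (f ` M)"
      then have "q \<in> carrier Q" using E.H.transfer_kernel_carrier by blast
      then obtain g where "g \<in> carrier G" "q = f g" unfolding E.surj[symmetric] by blast
      then show "q \<in> f ` K" using that(2) q by auto
    qed
  qed
  have TKQ: "transfer_kernel Q (f ` M) = f ` transfer_kernel G M" if M: "max_sub G M" "M \<noteq> H3" for M
  proof (rule imgI[OF transfer_kernel_carrier])
    fix g assume g: "g \<in> carrier G"
    obtain r where r: "r \<in> carrier G" "r \<notin> M" using outside[OF M(1)] by blast
    have sM: "subgroup M G" using M by (simp add: max_sub_def)
    obtain h where h: "h \<in> M" "M = adj Phi h" using max_sub_gen[OF o M(1)] by blast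
    have hG: "h \<in> carrier G" by (rule subgroup.mem_carrier[OF sM h(1)])
    have "u \<notin> R h" using R_max_sub_u[OF o Hs(1) M(1) hG h(2)] M(2) H3 by blast
    then have "E.ker \<subseteq> derived G M" using gam4_derived_max_sub[OF o M(1) h] k4 by blast
    then have "f (tval M r g) \<in> f ` derived G M \<longleftrightarrow> tval M r g \<in> derived G M"
      by (intro E.mem_img_iff derived_is_subgroup subgroup.subset[OF sM]) (use r g in auto)
    then show "f g \<in> transfer_kernel Q (f ` M) \<longleftrightarrow> g \<in> transfer_kernel G M"
      using TK[OF M(1) g r] TK'[OF M(1) g r] by simp
  qed
  have wy: "{B.w, y'} \<subseteq> carrier G" "{y'} \<subseteq> carrier G" "{B.w \<otimes> y'} \<subseteq> carrier G" by auto
  have one: "kval e Q (f x') (f y') (f ` M) = 1" if M: "max_sub G M" "M \<noteq> H3" and k: "kval e G x' y' M = 1" for M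
  proof -
    have K: "transfer_kernel Q (f ` M) = f ` ?S {y'}" "?S {y'} \<noteq> ?S {B.w, y'}"
      using TKQ[OF M] kval_cases(2)[OF k] by auto
    show ?thesis unfolding E.kval_img[OF K(1) sS[OF wy(2)] kS kD B.x B.y] Let_def using K(2) by simp
  qed
  have two: "kval e Q (f x') (f y') (f ` M) = 2" if M: "max_sub G M" "M \<noteq> H3" and k: "kval e G x' y' M = 2" for M
  proof -
    have K: "transfer_kernel Q (f ` M) = f ` ?S {B.w \<otimes> y'}" "?S {B.w \<otimes> y'} \<noteq> ?S {B.w, y'}" "?S {B.w \<otimes> y'} \<noteq> ?S {y'}"
      using TKQ[OF M] kval_cases(3)[OF k] by auto
    show ?thesis unfolding E.kval_img[OF K(1) sS[OF wy(3)] kS kD B.x B.y] Let_def using K(2,3) by simp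
  qed
  have three: "kval e Q (f x') (f y') (f ` H3) = 0"
  proof -
    obtain r where r: "r \<in> carrier G" "r \<notin> H3" using outside[OF mx(3)] by blast
    have sH: "subgroup H3 G" using mx(3) by (simp add: max_sub_def)
    have D3: "derived G H3 \<subseteq> gam G 2" unfolding gam2 by (rule mono_derived[OF subgroup.subset[OF sH]])
    have K: "transfer_kernel Q (f ` H3) = f ` ?S {B.w, y'}"
    proof (rule imgI)
      show "?S {B.w, y'} \<subseteq> carrier G" by (rule subgroup.subset[OF sS[OF wy(1)]])
      fix g assume g: "g \<in> carrier G"
      have tG: "tval H3 r g \<in> carrier G" using g r by simp
      show "f g \<in> transfer_kernel Q (f ` H3) \<longleftrightarrow> g \<in> ?S {B.w, y'}"
      proof
        assume "f g \<in> transfer_kernel Q (f ` H3)"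
        then have "f (tval H3 r g) \<in> f ` gam G 2" using TK[OF mx(3) g r] D3 by blast
        then have "tval H3 r g \<in> gam G 2" using E.mem_img_iff[OF gam_subgroup k2 tG] by simp
        then have "g [^] (3::nat) \<in> gam G 2" using tval_gam2[OF g r(1)] by simp
        then show "g \<in> ?S {B.w, y'}" by (rule B.cube_gam2_span[OF g])
      next
        assume "g \<in> ?S {B.w, y'}"
        then show "f g \<in> transfer_kernel Q (f ` H3)" using TK[OF mx(3) g r] TK'[OF mx(3) g r] K3 by blast
      qed
    qed
    show ?thesis unfolding E.kval_img[OF K sS[OF wy(1)] kS kD B.x B.y] Let_def by simp
  qed
  have ne: "H1 \<noteq> H3" "H2 \<noteq> H3" "H4 \<noteq> H3" using d H by auto
  show ?thesis
    by (rule E.has_tkt_img[OF nil k2 g d H one[OF mx(1) ne(1) v(1)] one[OF mx(2) ne(2) v(2)] three two[OF H(2) ne(3) v(4)]])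
qed

end

section \<open>The last terms of the lower central and the lower exponent-\<open>3\<close> series\<close>

lemma Mod_gam_cong:
  assumes "group G" "group H" "G \<cong> H"
  shows "G Mod gam G k \<cong> H Mod gam H k"
proof -
  obtain f where f: "epi G H f" "kernel G H f = {\<one>\<^bsub>G\<^esub>}" by (rule iso_group_obtain[OF assms])
  interpret epi G H f by (rule f(1))
  show ?thesis by (rule Mod_gam_iso) (use f(2) subgroup.one_closed[OF G.gam_subgroup] in auto)
qed

text \<open>Descendants of \<open>G\<close> are descendants of its parent, and the type is inherited
  by \<open>has_tkt_quot_gam_c\<close>.\<close>

lemma BCF_mainline_quot:
  fixes G (structure)
  assumes B: "BCF_mainline e G" and e: "e \<ge> 2" and c: "nil_class G \<ge> 4"
  shows "BCF_mainline e (G Mod gam G (nil_class G))"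
proof -
  have T: "in_tree True e G" and D: "has_desc_all True e G" and K: "has_tkt e G 1 1 0 2"
    using B by (auto simp: BCF_mainline_def)
  note t = tree_facts[OF T e]
  interpret group G by (rule t(1))
  obtain m where m: "nil_class G = Suc m" "m \<ge> 3" using c by (cases "nil_class G") auto
  define Q where "Q = G Mod gam G (Suc m)"
  interpret E: epi G Q "\<lambda>a. gam G (Suc m) #> a" unfolding Q_def by (rule Mod_epi)
  have kE: "E.ker = gam G (Suc m)" unfolding Q_def by (rule Mod_epi)
  have TQ: "in_tree True e Q" and cQ: "nil_class Q = m"
    unfolding Q_def using in_tree_quot[OF T e, of m] quot_class[OF T e, of m] m by auto
  have "has_desc_all True e Q" unfolding has_desc_all_def cQ
  proof (intro allI impI)
    fix C assume C: "m \<le> C"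
    show "\<exists>D :: nat monoid. in_tree True e D \<and> nil_class D = C \<and> Q \<cong> D Mod gam D (Suc m)"
    proof (cases "C = m")
      case True
      \<comment> \<open>Descendants of \<open>G\<close> start at class m + 1, so class m is
        witnessed by a copy of \<open>Q\<close> itself.\<close>
      obtain D :: "nat monoid" where D': "group D" "Q \<cong> D" by (rule nat_copy[OF E.H.is_group tree_facts(2)[OF TQ e]])
      have "Q \<cong> Q Mod gam Q (Suc m)" using E.Mod_gam_iso[of "Suc m"] kE unfolding Q_def by simp
      then have "Q \<cong> D Mod gam D (Suc m)" using Mod_gam_cong[OF E.H.is_group D'] by (rule iso_trans)
      then show ?thesis using in_tree_iso[OF TQ D'] nil_class_iso[OF E.H.is_group D'] cQ True by auto
    next
      case False
      then have "Suc m \<le> C" using C by simp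
      then obtain D :: "nat monoid" where D': "in_tree True e D" "nil_class D = C" "G \<cong> D Mod gam D (Suc (Suc m))"
        using D unfolding has_desc_all_def m(1) by blast
      interpret D: group D by (rule tree_facts(1)[OF D'(1) e])
      interpret F: epi D "D Mod gam D (Suc (Suc m))" "\<lambda>a. gam D (Suc (Suc m)) #>\<^bsub>D\<^esub> a" by (rule D.Mod_epi)
      let ?M = "D Mod gam D (Suc (Suc m))"
      have "D Mod gam D (Suc m) \<cong> ?M Mod gam ?M (Suc m)"
        by (rule F.Mod_gam_iso) (use D.Mod_epi(2)[of "Suc (Suc m)"] D.gam_Suc_sub[of "Suc m"] in simp)
      then have "?M Mod gam ?M (Suc m) \<cong> D Mod gam D (Suc m)"
        by (rule group.iso_sym[OF normal.factorgroup_is_group[OF D.gam_normal]])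
      then have "Q \<cong> D Mod gam D (Suc m)"
        unfolding Q_def using Mod_gam_cong[OF is_group F.H.is_group D'(3), of "Suc m"] by (rule iso_trans[rotated])
      then show ?thesis using D' by blast
    qed
  qed
  moreover have "has_tkt e Q 1 1 0 2"
  proof -
    obtain x y where xy: "special G e (nil_class G) x y" "max_sub G (generate G (insert x (gam G 2)))"
      "cyc_quot G (generate G (insert x (gam G 2)))" using special_exists[OF T e] by blast
    interpret S: special G e "nil_class G" x y by (rule xy(1))
    show ?thesis by (rule S.has_tkt_quot_gam_c[OF t(3) c xy(2,3) K E.epi_axioms]) (simp only: kE m(1))
  qed
  ultimately show ?thesis using TQ unfolding BCF_mainline_def Q_def m(1) by blast
qed

context bicyc
begin

text \<open>The exponent series is independent of generators, so \<open>pser_eq\<close> may be read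
  with the pair from \<open>has_tkt\<close>: P_e(G) is generated by the cube of that pair's own
  \<open>w\<close>, and \<open>kval_quot_w\<close> applies.\<close>

lemma has_tkt_quot_pser:
  assumes G3: "is_3group G" and ce: "c \<le> e" and T: "has_tkt e G k1 k2 k3 k4" and k: "{k1, k2, k3, k4} \<subseteq> {0, 1, 2, 3, 4}"
  shows "has_tkt e (G Mod pser G e) (if k1 = 4 then 4 else 0) (if k2 = 4 then 4 else 0)
    (if k3 = 4 then 4 else 0) (if k4 = 4 then 4 else 0)"
proof -
  obtain x' y' H1 H2 H3 H4 where g: "gens_ok e G x' y'" and d: "distinct [H1, H2, H3]"
    and H: "\<forall>H\<in>{H1, H2, H3}. max_sub G H \<and> cyc_quot G H" "max_sub G H4" "\<not> cyc_quot G H4"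
    and v: "kval e G x' y' H1 = k1" "kval e G x' y' H2 = k2" "kval e G x' y' H3 = k3" "kval e G x' y' H4 = k4"
    using T unfolding has_tkt_def by blast
  interpret B: bicyc G e c x' y' by (rule gens_ok_bicyc[OF g])
  interpret N: normal "pser G e" G by (rule pser_normal)
  have g1: "gam G (Suc e) = {\<one>}"
    using gam_antimono[of "Suc c" "Suc e"] ce nil subgroup.one_closed[OF gam_subgroup[of "Suc e"]] by auto
  have pe: "pser G e = adj {\<one>} B.u" using B.pser_eq[of e] e2 unfolding g1 by simp
  note E = N.epi_canonical
  have E': "kernel G (G Mod pser G e) (\<lambda>a. pser G e #> a) = adj {\<one>} B.u" using E(2) pe by simp
  interpret E: epi G "G Mod pser G e" "\<lambda>a. pser G e #> a" by (rule E(1))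
  have k2: "E.ker \<subseteq> gam G 2"
    unfolding E' using B.x_pow2 subgroup.one_closed[OF gam_subgroup[of 2]] by (intro adj_least gam_subgroup) auto
  have q: "kval e (G Mod pser G e) (pser G e #> x') (pser G e #> y') ((\<lambda>a. pser G e #> a) ` M) =
      (if k = 4 then 4 else 0)" if M: "max_sub G M" and v: "kval e G x' y' M = k" and k: "k \<in> {0, 1, 2, 3, 4}" for M k
  proof (cases "k = 4")
    case True
    then show ?thesis using B.kval_quot_w(2)[OF G3 M ce E(1) E'] v True by simp
  next
    case False
    then have "kval e G x' y' M \<in> {0, 1, 2, 3}" using v k by auto
    from B.kval_quot_w(1)[OF G3 M ce E(1) E' this] show ?thesis using False by simp
  qed
  have mx: "max_sub G H1" "max_sub G H2" "max_sub G H3" using H(1) by simp_all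
  have kk: "k1 \<in> {0, 1, 2, 3, 4}" "k2 \<in> {0, 1, 2, 3, 4}" "k3 \<in> {0, 1, 2, 3, 4}" "k4 \<in> {0, 1, 2, 3, 4}" using k by blast+
  show ?thesis
    by (rule E.has_tkt_img[OF nil k2 g d H q[OF mx(1) v(1) kk(1)] q[OF mx(2) v(2) kk(2)] q[OF mx(3) v(3) kk(3)] q[OF H(2) v(4) kk(4)]])
qed

end

theorem theorem3:
  fixes V :: "('a,'b) monoid_scheme" and e i :: nat
  assumes "e \<ge> 2" and "i \<ge> 1"
    and "is_3group V" and "metabelian V" and "nil_class V = i + 2"
    and "BCF_mainline e V \<or>
         (i \<ge> 2 \<and> in_tree True e V \<and> \<not> BCF_mainline e V \<and>
          BCF_mainline e (V Mod gam V (nil_class V)))"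
  shows "(e \<ge> 3 \<and> i \<le> e - 2 \<longrightarrow>
           step_size V 1 \<and> CF_depth_le1 e (pparent V) \<and> nil_class (pparent V) = i + 2 \<and>
           (has_tkt e V 1 1 0 2 \<longrightarrow> has_tkt e (pparent V) 0 0 0 0) \<and>
           (has_tkt e V 1 1 1 2 \<longrightarrow> has_tkt e (pparent V) 0 0 0 0) \<and>
           (has_tkt e V 1 1 4 2 \<longrightarrow> has_tkt e (pparent V) 0 0 4 0) \<and>
           (has_tkt e V 1 1 2 2 \<longrightarrow> has_tkt e (pparent V) 0 0 0 0) \<and>
           (has_tkt e V 1 1 3 2 \<longrightarrow> has_tkt e (pparent V) 0 0 0 0))
       \<and> (e \<ge> 3 \<and> i = e - 1 \<longrightarrow>
           step_size V 2 \<and> CF_mainline e (pparent V) \<and> nil_class (pparent V) = i + 1)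
       \<and> (i \<ge> e \<longrightarrow>
           step_size V 1 \<and> BCF_mainline e (pparent V) \<and> nil_class (pparent V) = i + 1)"
proof -
  define c where "c = nil_class V"
  have ci: "c = i + 2" using assms(5) by (simp add: c_def)
  have e2: "e \<ge> 2" by (rule assms(1))
  have T: "in_tree True e V" using assms(6) by (auto simp: BCF_mainline_def)
  note t = tree_facts[OF T e2]
  interpret V: group V by (rule t(1))
  have comm: "\<forall>a\<in>gam V 2. \<forall>b\<in>gam V 2. cm V a b = \<one>\<^bsub>V\<^esub>" by (rule V.metabelian_comm[OF assms(4)])
  obtain x y where "special_metab V e (nil_class V) x y" using special_metab_exists[OF T e2 comm] by blast
  then interpret S: special_metab V e c x y unfolding c_def .
  define B where "B = V Mod gam V c"
  interpret E: epi V B "\<lambda>a. gam V c #>\<^bsub>V\<^esub> a" unfolding B_def by (rule V.Mod_epi)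
  have kE: "E.ker = gam V c" unfolding B_def by (rule V.Mod_epi)
  \<comment> \<open>For i >= 2 the parent has class at least 3 and is still a vertex of the tree. In
    the second and third parts this bound on i follows from those on e.\<close>
  have mB: "BCF_mainline e B" and cB: "nil_class B = i + 1" if "i \<ge> 2"
  proof -
    show "BCF_mainline e B"
      using assms(6) BCF_mainline_quot[of e V] e2 that ci unfolding B_def c_def by auto
    show "nil_class B = i + 1"
      using quot_class[OF T e2, of "i + 1"] that ci unfolding B_def c_def by simp
  qed
  have commB: "\<forall>a\<in>gam B 2. \<forall>b\<in>gam B 2. cm B a b = \<one>\<^bsub>B\<^esub>"
    by (rule E.comm_img) (use comm kE subgroup.one_closed[OF V.gam_subgroup[of c]] in simp)
  have CFB: "CF_mainline e (B Mod pser B e)" if "i \<ge> 2" "i + 1 \<le> e" "e \<ge> 3"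
    using CF_mainline_pser_quot[of e B] mB[OF that(1)] cB[OF that(1)] that commB by (simp add: BCF_mainline_def)
  interpret N: normal "pser V e" V by (rule V.pser_normal)
  have part1: "step_size V 1 \<and> CF_depth_le1 e (pparent V) \<and> nil_class (pparent V) = i + 2 \<and>
      (\<forall>k1 k2 k3 k4. has_tkt e V k1 k2 k3 k4 \<and> {k1, k2, k3, k4} \<subseteq> {0, 1, 2, 3, 4} \<longrightarrow>
        has_tkt e (pparent V) (if k1 = 4 then 4 else 0) (if k2 = 4 then 4 else 0) (if k3 = 4 then 4 else 0) (if k4 = 4 then 4 else 0))"
    if e3: "e \<ge> 3" and ie: "i \<le> e - 2"
  proof -
    have ce: "c \<le> e" using e3 ie ci by simp
    note p = S.pser_small[OF t(4)]
    have pe: "pser V e = V.adj (gam V (Suc c)) S.u" and pc: "pclass V = Suc e" and cd: "card (pser V e) = 3"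
      using p(1,2,3) ce S.gam_big[of "Suc e"] S.gam_big[of "Suc c"] by auto
    have pp: "pparent V = V Mod pser V e" by (simp add: pparent_def pc)
    define P where "P = V Mod pser V e"
    have EP: "epi V P (\<lambda>a. pser V e #>\<^bsub>V\<^esub> a)" "kernel V P (\<lambda>a. pser V e #>\<^bsub>V\<^esub> a) = V.adj (gam V (Suc c)) S.u"
      unfolding P_def using N.epi_canonical pe by auto
    interpret EP: epi V P "\<lambda>a. pser V e #>\<^bsub>V\<^esub> a" by (rule EP(1))
    have k: "4 \<le> Suc c" "Suc c \<le> Suc c" "Suc c \<le> Suc e" "c \<le> Suc e" using ce ci assms(2) by auto
    note q = S.u_quot_tree[OF T c_def k EP]
    have nP: "nil_class P = c" using q(2) by simp
    have "CF_mainline e P \<or> CF_mainline e (P Mod gam P (nil_class P))"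
    proof (cases "BCF_mainline e V")
      case True
      then show ?thesis
        using CF_mainline_pser_quot[OF T _ _ e3 comm] ce unfolding P_def c_def by (auto simp: BCF_mainline_def)
    next
      case False
      then have i2: "i \<ge> 2" using assms(6) by blast
      have cs: "c \<le> Suc e" using ce by simp
      let ?S = "V.adj (gam V c) S.u"
      have sS: "subgroup ?S V" by (rule V.adj_subgroup[OF V.gam_subgroup S.stzp(5)])
      have "gam V (Suc c) \<subseteq> gam V c" by (rule V.gam_antimono) simp
      then have kS: "EP.ker \<subseteq> ?S" unfolding EP(2) by (intro V.mono_generate) blast
      have uK: "S.u \<in> EP.ker" unfolding EP(2) by (rule V.adj_sub)
      note a = EP.Mod_gam_kernel[OF sS kS EP.adj_ker_img[OF uK]]
      note b = S.pser_quot[OF E.epi_axioms kE cs]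
      \<comment> \<open>Both sides are V modulo <u>gamma_c. So the CF parent of P is obtained from
        the BCF parent B, which is on the mainline because V is offside of depth one.\<close>
      have "B Mod pser B e \<cong> P Mod gam P c"
        by (rule epi_same_kernel_iso[OF b(1) a(1)]) (simp only: a(2) b(2))
      moreover have "group (P Mod gam P c)" by (rule normal.factorgroup_is_group[OF EP.H.gam_normal])
      moreover have "i + 1 \<le> e" using ie e3 by simp
      ultimately show ?thesis
        unfolding nP using CF_mainline_iso[OF CFB[OF i2 _ e3]] by blast
    qed
    then have "CF_depth_le1 e P" using q(1) by (simp add: CF_depth_le1_def)
    moreover have "step_size V 1" using cd by (simp add: step_size_def pc)
    ultimately show ?thesis
      using S.has_tkt_quot_pser[OF t(3) ce] nP ci unfolding pp P_def by blast
  qed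
  have part2: "step_size V 2 \<and> CF_mainline e (pparent V) \<and> nil_class (pparent V) = i + 1"
    if e3: "e \<ge> 3" and ie: "i = e - 1"
  proof -
    have ce: "c = Suc e" and i2: "i \<ge> 2" using e3 ie ci by auto
    note p = S.pser_small[OF t(4)]
    have pe: "pser V e = V.adj (gam V c) S.u" and pc: "pclass V = Suc e" and cd: "card (pser V e) = 9"
      using p(1,2,4) ce e3 by auto
    have pp: "pparent V = V Mod pser V e" by (simp add: pparent_def pc)
    have EP: "epi V (V Mod pser V e) (\<lambda>a. pser V e #>\<^bsub>V\<^esub> a)"
      "kernel V (V Mod pser V e) (\<lambda>a. pser V e #>\<^bsub>V\<^esub> a) = V.adj (gam V c) S.u"
      using N.epi_canonical pe by auto
    have k: "4 \<le> c" "c \<le> Suc c" "c \<le> Suc e" "c \<le> Suc e" using ce e3 by auto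
    note b = S.pser_quot[OF E.epi_axioms kE k(3)]
    \<comment> \<open>Here the last exponent term of V contains gamma_c, so the p-parent of V is
      also the p-parent-like quotient of the mainline vertex B.\<close>
    have "B Mod pser B e \<cong> V Mod pser V e"
      by (rule epi_same_kernel_iso[OF b(1) EP(1)]) (simp only: b(2) EP(2))
    then have "CF_mainline e (V Mod pser V e)"
      using CF_mainline_iso[OF CFB N.factorgroup_is_group] i2 ie e3 by auto
    moreover have "step_size V 2" using cd by (simp add: step_size_def pc)
    ultimately show ?thesis
      using S.u_quot_tree(2)[OF T c_def k EP] ci unfolding pp by simp
  qed
  have part3: "step_size V 1 \<and> BCF_mainline e (pparent V) \<and> nil_class (pparent V) = i + 1" if ie: "i \<ge> e"
  proof -
    have i2: "i \<ge> 2" and ce: "c \<ge> e + 2" using ie e2 ci by auto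
    note p = S.pser_large[OF ce]
    \<comment> \<open>In this range the last terms of the exponent series and of the lower central
      series coincide, so the p-parent is the parent in the BCF tree.\<close>
    have "pparent V = B" unfolding pparent_def p(1,2) B_def ..
    moreover have "step_size V 1" using p ce by (simp add: step_size_def)
    ultimately show ?thesis using mB[OF i2] cB[OF i2] by simp
  qed
  have "has_tkt e (pparent V) 0 0 (if k = 4 then 4 else 0) 0"
    if "e \<ge> 3" "i \<le> e - 2" "has_tkt e V 1 1 k 2" "k \<in> {0, 1, 2, 3, 4}" for k
  proof -
    have "{1, 1, k, 2} \<subseteq> {0, 1, 2, 3, 4}" using that(4) by blast
    then show ?thesis using part1[OF that(1,2)] that(3) by fastforce
  qed
  \<comment> \<open>The values 0, 1, 4, 2, 3 are the third components of the types d.10, B.2, D.10,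
    C.4, D.5.\<close>
  from this[of 0] this[of 1] this[of 2] this[of 3] this[of 4] show ?thesis
    using part1 part2 part3 by simp
qed

end
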